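(* Let $m\ge3$, let $\Omega_j\subset\mathbb{R}^{n_j}$, $j=1,\dots,m$, be bounded Lipschitz domains, and let $f\in H^{k+\max\{n_1,\dots,n_m\}}(\Omega_1\times\dots\times\Omega_m)$ for some fixed $k>0$. Then there is a constant $C>0$, which may depend on $f$, $k$ and the domains but not on $\varepsilon$, such that for every $0<\varepsilon<1$ the following holds. Let $$r_j=\big\lceil\varepsilon^{-(n_1+\dots+n_j)/k}\big\rceil,\qquad j=1,\dots,m-1.$$ Then the over-all truncation error of the tensor train decomposition $f^{\mathrm{TT}}_{r_1,\dots,r_{m-1}}$ of $f$ with these truncation ranks satisfies $$\|f-f^{\mathrm{TT}}_{r_1,\dots,r_{m-1}}\|_{L^2(\Omega_1\times\dots\times\Omega_m)}\le C\sqrt{m}\,\varepsilon.$$ The storage cost for $f^{\mathrm{TT}}_{r_1,\dots,r_{m-1}}$, given by $r_1+\sum_{j=2}^{m-1}r_{j-1}r_j$, is equal, up to the rounding of the ranks (i.e. up to constants independent of $\varepsilon$), to $$\varepsilon^{-n_1/k}+\varepsilon^{-(2n_1+n_2)/k}+\dots+\varepsilon^{-(2n_1+\dots+2n_{m-2}+n_{m-1})/k},$$ and hence is bounded by $\mathcal{O}\big(\varepsilon^{-(2m-1)\max\{n_1,\dots,n_{m-1}\}/k}\big)$.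
   Context: All functions are real-valued; $H^s$ denotes the standard (isotropic) Sobolev space of order $s\ge0$. The (truncated, continuous) tensor train decomposition of $f\in L^2(\Omega_1\times\dots\times\Omega_m)$ with ranks $r_1,\dots,r_{m-1}$ is computed successively by (vector-valued) singular value decompositions. Put $r_0=1$ and $\boldsymbol{g}_1=f$. For $j=1,\dots,m-1$, given $\boldsymbol{g}_j=[g_j(\alpha_{j-1},\boldsymbol{x}_j,\dots,\boldsymbol{x}_m)]_{\alpha_{j-1}=1}^{r_{j-1}}\in[L^2(\Omega_j\times\dots\times\Omega_m)]^{r_{j-1}}$, take the singular value decomposition separating $(\alpha_{j-1},\boldsymbol{x}_j)\in\{1,\dots,r_{j-1}\}\times\Omega_j$ from $(\boldsymbol{x}_{j+1},\dots,\boldsymbol{x}_m)\in\Omega_{j+1}\times\dots\times\Omega_m$, $$g_j(\alpha_{j-1},\boldsymbol{x}_j,\dots,\boldsymbol{x}_m)=\sum_{\alpha_j=1}^\infty\sqrt{\lambda_j(\alpha_j)}\,\varphi_j(\alpha_{j-1},\boldsymbol{x}_j,\alpha_j)\,\psi_j(\alpha_j,\boldsymbol{x}_{j+1},\dots,\boldsymbol{x}_m),$$ with $\lambda_j(1)\ge\lambda_j(2)\ge\dots\ge0$, where $\{[\varphi_j(\alpha_{j-1},\cdot,\alpha_j)]_{\alpha_{j-1}=1}^{r_{j-1}}\}_{\alpha_j}$ is orthonormal in $[L^2(\Omega_j)]^{r_{j-1}}$ (with norm $\|\boldsymbol{w}\|^2=\sum_\alpha\|w(\alpha)\|_{L^2}^2$)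 and $\{\psi_j(\alpha_j,\cdot)\}_{\alpha_j}$ is orthonormal in $L^2(\Omega_{j+1}\times\dots\times\Omega_m)$. Truncate it after $r_j$ terms and set $$\boldsymbol{g}_{j+1}=\big[\sqrt{\lambda_j(\alpha_j)}\,\psi_j(\alpha_j,\boldsymbol{x}_{j+1},\dots,\boldsymbol{x}_m)\big]_{\alpha_j=1}^{r_j}.$$ Finally set $\varphi_m(\alpha_{m-1},\boldsymbol{x}_m)=\sqrt{\lambda_{m-1}(\alpha_{m-1})}\,\psi_{m-1}(\alpha_{m-1},\boldsymbol{x}_m)$. Then, writing $\varphi_1(\alpha_1,\boldsymbol{x}_1)$ for $\varphi_1(1,\boldsymbol{x}_1,\alpha_1)$, $$f^{\mathrm{TT}}_{r_1,\dots,r_{m-1}}(\boldsymbol{x}_1,\dots,\boldsymbol{x}_m)=\sum_{\alpha_1=1}^{r_1}\cdots\sum_{\alpha_{m-1}=1}^{r_{m-1}}\varphi_1(\alpha_1,\boldsymbol{x}_1)\varphi_2(\alpha_1,\boldsymbol{x}_2,\alpha_2)\cdots\varphi_{m-1}(\alpha_{m-2},\boldsymbol{x}_{m-1},\alpha_{m-1})\varphi_m(\alpha_{m-1},\boldsymbol{x}_m).$$ The storage cost of $f^{\mathrm{TT}}_{r_1,\dots,r_{m-1}}$ is by definition $r_1+\sum_{j=2}^{m-1}r_{j-1}r_j$. The dimensions $n_1,\dots,n_m$ need not be ordered. *)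

theory Defs
  imports "HOL-Analysis.Analysis"
begin

text \<open>
  Since the dimensions \<open>n\<^sub>1, \<dots>, n\<^sub>m\<close> and their number vary, Euclidean space over a finite index
  set \<open>I\<close> is the set of extensional functions \<open>PiE I (\<lambda>_. UNIV)\<close>, with topology
  \<open>powertop_real I\<close> and Lebesgue measure \<open>PiM I (\<lambda>_. lborel)\<close>.
\<close>

definition euclid_dist :: "'i set \<Rightarrow> ('i \<Rightarrow> real) \<Rightarrow> ('i \<Rightarrow> real) \<Rightarrow> real" where
  "euclid_dist I x y = L2_set (\<lambda>i. x i - y i) I"

definition dom_measure :: "'i set \<Rightarrow> ('i \<Rightarrow> real) set \<Rightarrow> ('i \<Rightarrow> real) measure" where
  "dom_measure I U = restrict_space (PiM I (\<lambda>_. lborel)) U"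


section \<open>Bounded Lipschitz domains\<close>

text \<open>
  Near each boundary point \<open>p\<close> the domain is the strict epigraph, in the direction of some unit
  vector \<open>v\<close>, of a Lipschitz function \<open>\<gamma>\<close> on the hyperplane orthogonal to \<open>v\<close>.
\<close>

definition dot_on :: "'i set \<Rightarrow> ('i \<Rightarrow> real) \<Rightarrow> ('i \<Rightarrow> real) \<Rightarrow> real" where
  "dot_on I x y = (\<Sum>i\<in>I. x i * y i)"

definition orth_hyperplane :: "'i set \<Rightarrow> ('i \<Rightarrow> real) \<Rightarrow> ('i \<Rightarrow> real) set" where
  "orth_hyperplane I v = {a \<in> PiE I (\<lambda>_. UNIV). dot_on I a v = 0}"

definition orth_proj :: "'i set \<Rightarrow> ('i \<Rightarrow> real) \<Rightarrow> ('i \<Rightarrow> real) \<Rightarrow> ('i \<Rightarrow> real)" where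
  "orth_proj I v x = (\<lambda>i\<in>I. x i - dot_on I x v * v i)"

definition bounded_lipschitz_domain :: "'i set \<Rightarrow> ('i \<Rightarrow> real) set \<Rightarrow> bool" where
  "bounded_lipschitz_domain I \<Omega> \<longleftrightarrow>
     \<Omega> \<noteq> {} \<and> openin (powertop_real I) \<Omega> \<and> connectedin (powertop_real I) \<Omega> \<and>
     (\<exists>B. \<forall>x\<in>\<Omega>. L2_set x I \<le> B) \<and>
     (\<forall>p \<in> (powertop_real I) frontier_of \<Omega>.
        \<exists>v\<in>PiE I (\<lambda>_. UNIV). \<exists>\<gamma> L \<delta>. L2_set v I = 1 \<and> 0 \<le> L \<and> 0 < \<delta> \<and>
          (\<forall>a\<in>orth_hyperplane I v. \<forall>b\<in>orth_hyperplane I v.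
             \<bar>\<gamma> a - \<gamma> b\<bar> \<le> L * euclid_dist I a b) \<and>
          (\<forall>x\<in>PiE I (\<lambda>_. UNIV). euclid_dist I x p < \<delta> \<longrightarrow>
             (x \<in> \<Omega> \<longleftrightarrow> \<gamma> (orth_proj I v x) < dot_on I x v)))"


section \<open>Square integrable functions and Sobolev spaces\<close>

definition L2 :: "'a measure \<Rightarrow> ('a \<Rightarrow> real) set" where
  "L2 M = {u \<in> borel_measurable M. integrable M (\<lambda>x. (u x)\<^sup>2)}"

definition L2_norm :: "'a measure \<Rightarrow> ('a \<Rightarrow> real) \<Rightarrow> real" where
  "L2_norm M u = sqrt (\<integral>x. (u x)\<^sup>2 \<partial>M)"

text \<open>
  Higher partial derivatives \<open>\<partial>\<^bsub>i\<^sub>1\<^esub> \<dots> \<partial>\<^bsub>i\<^sub>p\<^esub>\<close> are indexed by the list \<open>[i\<^sub>1, \<dots>, i\<^sub>p]\<close> instead of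
  a multi-index; the order is the length of the list.
\<close>

definition partial :: "'i \<Rightarrow> (('i \<Rightarrow> real) \<Rightarrow> real) \<Rightarrow> ('i \<Rightarrow> real) \<Rightarrow> real" where
  "partial i u x = deriv (\<lambda>t. u (x(i := t))) (x i)"

primrec partials :: "'i list \<Rightarrow> (('i \<Rightarrow> real) \<Rightarrow> real) \<Rightarrow> ('i \<Rightarrow> real) \<Rightarrow> real" where
  "partials [] u = u"
| "partials (i # is) u = partial i (partials is u)"

definition smooth_on_space :: "'i set \<Rightarrow> (('i \<Rightarrow> real) \<Rightarrow> real) \<Rightarrow> bool" where
  "smooth_on_space I u \<longleftrightarrow>
     (\<forall>is\<in>lists I. continuous_map (powertop_real I) euclideanreal (partials is u) \<and>
        (\<forall>i\<in>I. \<forall>x\<in>PiE I (\<lambda>_. UNIV).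
           (\<lambda>t. partials is u (x(i := t))) field_differentiable (at (x i))))"

definition test_function :: "'i set \<Rightarrow> ('i \<Rightarrow> real) set \<Rightarrow> (('i \<Rightarrow> real) \<Rightarrow> real) \<Rightarrow> bool" where
  "test_function I U \<eta> \<longleftrightarrow> smooth_on_space I \<eta> \<and>
     (\<exists>K. compactin (powertop_real I) K \<and> K \<subseteq> U \<and> (\<forall>x\<in>PiE I (\<lambda>_. UNIV) - K. \<eta> x = 0))"

definition weak_derivative ::
    "'i set \<Rightarrow> ('i \<Rightarrow> real) set \<Rightarrow> 'i list \<Rightarrow> (('i \<Rightarrow> real) \<Rightarrow> real) \<Rightarrow> (('i \<Rightarrow> real) \<Rightarrow> real) \<Rightarrow> bool" where
  "weak_derivative I U is u w \<longleftrightarrow>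
     (\<forall>\<eta>. test_function I U \<eta> \<longrightarrow>
        (\<integral>x. u x * partials is \<eta> x \<partial>dom_measure I U)
          = (-1) ^ length is * (\<integral>x. w x * \<eta> x \<partial>dom_measure I U))"

text \<open>The square of the Sobolev-Slobodeckij seminorm of order \<open>0 < \<sigma> < 1\<close>.\<close>

definition slobodeckij_sq ::
    "'i set \<Rightarrow> ('i \<Rightarrow> real) set \<Rightarrow> real \<Rightarrow> (('i \<Rightarrow> real) \<Rightarrow> real) \<Rightarrow> ennreal" where
  "slobodeckij_sq I U \<sigma> w =
     (\<integral>\<^sup>+x. (\<integral>\<^sup>+y. ennreal ((w x - w y)\<^sup>2 / euclid_dist I x y powr (real (card I) + 2 * \<sigma>))
        \<partial>dom_measure I U) \<partial>dom_measure I U)"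

text \<open>
  \<open>H\<^sup>s(U)\<close> for real \<open>s \<ge> 0\<close>: square integrable weak derivatives up to order \<open>\<lfloor>s\<rfloor>\<close>, those of order
  \<open>\<lfloor>s\<rfloor>\<close> having finite Slobodeckij seminorm of order \<open>frac s\<close> if \<open>s\<close> is not an integer.
\<close>

definition sobolev :: "'i set \<Rightarrow> real \<Rightarrow> ('i \<Rightarrow> real) set \<Rightarrow> (('i \<Rightarrow> real) \<Rightarrow> real) set" where
  "sobolev I s U = {u \<in> L2 (dom_measure I U).
     \<exists>D. (\<forall>is\<in>lists I. length is \<le> nat \<lfloor>s\<rfloor> \<longrightarrow>
              D is \<in> L2 (dom_measure I U) \<and> weak_derivative I U is u (D is)) \<and>
         (s \<notin> \<int> \<longrightarrow> (\<forall>is\<in>lists I. length is = nat \<lfloor>s\<rfloor> \<longrightarrow>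
              slobodeckij_sq I U (frac s) (D is) < \<infinity>))}"


section \<open>Product domains\<close>

text \<open>
  A point of \<open>\<Omega>\<^sub>1 \<times> \<dots> \<times> \<Omega>\<^sub>m\<close> is \<open>x \<in> PiE {1..m} \<Omega>\<close>, where \<open>x j \<in> \<Omega> j\<close> is itself a function on
  \<open>{..<n j}\<close>. To speak of derivatives, \<open>\<real>\<^bsup>n\<^sub>1 + \<dots> + n\<^sub>m\<^esup>\<close> has as coordinates the pairs \<open>(j, i)\<close>
  with \<open>i < n j\<close>, and \<open>blocks\<close> splits a point of it into its \<open>m\<close> components.
\<close>

definition coords :: "nat \<Rightarrow> (nat \<Rightarrow> nat) \<Rightarrow> (nat \<times> nat) set" where
  "coords m n = (SIGMA j:{1..m}. {..<n j})"

definition blocks :: "nat \<Rightarrow> (nat \<Rightarrow> nat) \<Rightarrow> (nat \<times> nat \<Rightarrow> real) \<Rightarrow> nat \<Rightarrow> nat \<Rightarrow> real" where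
  "blocks m n y = (\<lambda>j\<in>{1..m}. \<lambda>i\<in>{..<n j}. y (j, i))"

definition flat_product ::
    "nat \<Rightarrow> (nat \<Rightarrow> nat) \<Rightarrow> (nat \<Rightarrow> (nat \<Rightarrow> real) set) \<Rightarrow> (nat \<times> nat \<Rightarrow> real) set" where
  "flat_product m n \<Omega> = {y \<in> PiE (coords m n) (\<lambda>_. UNIV). blocks m n y \<in> PiE {1..m} \<Omega>}"

definition sobolev_product ::
    "nat \<Rightarrow> (nat \<Rightarrow> nat) \<Rightarrow> (nat \<Rightarrow> (nat \<Rightarrow> real) set) \<Rightarrow> real \<Rightarrow> ((nat \<Rightarrow> nat \<Rightarrow> real) \<Rightarrow> real) set" where
  "sobolev_product m n \<Omega> s =
     {f. (\<lambda>y. f (blocks m n y)) \<in> sobolev (coords m n) s (flat_product m n \<Omega>)}"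


section \<open>Continuous tensor train decomposition\<close>

text \<open>
  Here \<open>M j\<close> is the measure space in the \<open>j\<close>-th variable. All rank indices start at \<open>1\<close>.

  \<open>is_svd M m j R g lam \<phi> \<psi>\<close>: the singular value decomposition of \<open>g(\<alpha>, x\<^sub>j, \<dots>, x\<^sub>m)\<close>,
  \<open>\<alpha> = 1, \<dots>, R\<close>, separating \<open>(\<alpha>, x\<^sub>j)\<close> from \<open>(x\<^bsub>j+1\<^esub>, \<dots>, x\<^sub>m)\<close>; the series converges in the
  vector-valued \<open>L\<^sup>2\<close>.
\<close>

definition is_svd ::
    "(nat \<Rightarrow> 'a measure) \<Rightarrow> nat \<Rightarrow> nat \<Rightarrow> nat \<Rightarrow> (nat \<Rightarrow> (nat \<Rightarrow> 'a) \<Rightarrow> real) \<Rightarrow>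
     (nat \<Rightarrow> real) \<Rightarrow> (nat \<Rightarrow> 'a \<Rightarrow> nat \<Rightarrow> real) \<Rightarrow> (nat \<Rightarrow> (nat \<Rightarrow> 'a) \<Rightarrow> real) \<Rightarrow> bool" where
  "is_svd M m j R g lam \<phi> \<psi> \<longleftrightarrow>
     (\<forall>\<beta>\<ge>1. 0 \<le> lam \<beta> \<and> lam (Suc \<beta>) \<le> lam \<beta>) \<and>
     (\<forall>\<beta>\<ge>1. \<forall>\<alpha>\<in>{1..R}. (\<lambda>y. \<phi> \<alpha> y \<beta>) \<in> L2 (M j)) \<and>
     (\<forall>\<beta>\<ge>1. \<forall>\<beta>'\<ge>1. (\<Sum>\<alpha>=1..R. \<integral>y. \<phi> \<alpha> y \<beta> * \<phi> \<alpha> y \<beta>' \<partial>M j) = (if \<beta> = \<beta>' then 1 else 0)) \<and>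
     (\<forall>\<beta>\<ge>1. \<psi> \<beta> \<in> L2 (PiM {Suc j..m} M)) \<and>
     (\<forall>\<beta>\<ge>1. \<forall>\<beta>'\<ge>1. (\<integral>z. \<psi> \<beta> z * \<psi> \<beta>' z \<partial>PiM {Suc j..m} M) = (if \<beta> = \<beta>' then 1 else 0)) \<and>
     (\<lambda>N. \<Sum>\<alpha>=1..R. (L2_norm (PiM {j..m} M) (\<lambda>x. g \<alpha> x -
            (\<Sum>\<beta>=1..N. sqrt (lam \<beta>) * \<phi> \<alpha> (x j) \<beta> * \<psi> \<beta> (restrict x {Suc j..m}))))\<^sup>2)
       \<longlonglongrightarrow> 0"

text \<open>
  The data of a run of the successive decomposition of \<open>f\<close> with ranks \<open>r\<close>, where \<open>r 0 = 1\<close>.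
  Singular value decompositions are not unique, hence a relation rather than a function.
\<close>

definition tt_svd ::
    "(nat \<Rightarrow> 'a measure) \<Rightarrow> nat \<Rightarrow> (nat \<Rightarrow> nat) \<Rightarrow> ((nat \<Rightarrow> 'a) \<Rightarrow> real) \<Rightarrow>
     (nat \<Rightarrow> nat \<Rightarrow> (nat \<Rightarrow> 'a) \<Rightarrow> real) \<Rightarrow> (nat \<Rightarrow> nat \<Rightarrow> real) \<Rightarrow>
     (nat \<Rightarrow> nat \<Rightarrow> 'a \<Rightarrow> nat \<Rightarrow> real) \<Rightarrow> (nat \<Rightarrow> nat \<Rightarrow> (nat \<Rightarrow> 'a) \<Rightarrow> real) \<Rightarrow> bool" where
  "tt_svd M m r f g lam \<phi> \<psi> \<longleftrightarrow>
     r 0 = 1 \<and> g 1 1 = f \<and>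
     (\<forall>j\<in>{1..m-1}.
        is_svd M m j (r (j - 1)) (g j) (lam j) (\<phi> j) (\<psi> j) \<and>
        (\<forall>\<alpha>\<in>{1..r j}. g (Suc j) \<alpha> = (\<lambda>z. sqrt (lam j \<alpha>) * \<psi> j \<alpha> z)))"

definition tt_approx ::
    "nat \<Rightarrow> (nat \<Rightarrow> nat) \<Rightarrow> (nat \<Rightarrow> nat \<Rightarrow> real) \<Rightarrow>
     (nat \<Rightarrow> nat \<Rightarrow> 'a \<Rightarrow> nat \<Rightarrow> real) \<Rightarrow> (nat \<Rightarrow> nat \<Rightarrow> (nat \<Rightarrow> 'a) \<Rightarrow> real) \<Rightarrow>
     (nat \<Rightarrow> 'a) \<Rightarrow> real" where
  "tt_approx m r lam \<phi> \<psi> x =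
     (\<Sum>\<alpha>\<in>PiE {1..m-1} (\<lambda>j. {1..r j}).
        \<phi> 1 1 (x 1) (\<alpha> 1) *
        (\<Prod>j=2..m-1. \<phi> j (\<alpha> (j - 1)) (x j) (\<alpha> j)) *
        (sqrt (lam (m-1) (\<alpha> (m-1))) * \<psi> (m-1) (\<alpha> (m-1)) (restrict x {m})))"

definition tt_storage :: "nat \<Rightarrow> (nat \<Rightarrow> nat) \<Rightarrow> nat" where
  "tt_storage m r = r 1 + (\<Sum>j=2..m-1. r (j - 1) * r j)"

text \<open>The empty sum makes the value at \<open>j = 0\<close> equal to \<open>1\<close>, as required of \<open>r\<^sub>0\<close>.\<close>

definition tt_rank :: "(nat \<Rightarrow> nat) \<Rightarrow> real \<Rightarrow> real \<Rightarrow> nat \<Rightarrow> nat" where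
  "tt_rank n k \<epsilon> j = nat \<lceil>\<epsilon> powr (- real (\<Sum>i=1..j. n i) / k)\<rceil>"

end

theory Submission
  imports Defs "HOL-Computational_Algebra.Polynomial"
begin

text \<open>
  The contraction of the first \<open>j\<close> cores is an orthonormal
  system. Composing with it turns a truncated singular value decomposition of the coefficient
  functions into a truncated singular value decomposition of the current approximation of \<open>f\<close>, read
  as a function of \<open>(x\<^sub>1, \<dots>, x\<^sub>j)\<close> and \<open>(x\<^bsub>j+1\<^esub>, \<dots>, x\<^sub>m)\<close>. By the theorem of Eckart and Young, the \<open>j\<close>-th
  truncation error is at most the distance of that approximation from any function of rank \<open>r\<^sub>j\<close>, hence
  at most the error accumulated so far plus the distance of \<open>f\<close> itself from such functions. The
  accumulated error therefore at most doubles in every step, up to the best approximation error of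
  \<open>f\<close> at this step (\<open>tt_quasi_optimal\<close>). The resulting factor \<open>2\<^sup>m\<close> does not depend on \<open>\<epsilon>\<close> and is
  absorbed by the constant.

  The smoothness \<open>k + max n\<close> provides weak
  derivatives up to order \<open>p = \<lceil>k\<rceil>\<close>. Let \<open>d = n\<^sub>1 + \<dots> + n\<^sub>j\<close> and divide the first \<open>j\<close> domains into
  \<open>O(h\<^bsup>-d\<^esup>)\<close> cells of size \<open>h\<close>. On each of them, the Taylor polynomial of degree below \<open>p\<close> in the
  variables \<open>(x\<^sub>1, \<dots>, x\<^sub>j)\<close> is a sum of a fixed number of products of a function of these variables and
  a function of the others, and it is \<open>O(h\<^sup>p)\<close> away from \<open>f\<close> in mean square (\<open>global_low_rank\<close>). For
  \<open>h\<close> proportional to \<open>\<epsilon>\<^bsup>1/k\<^esup>\<close> the number of terms is at most \<open>r\<^sub>j\<close>, and \<open>h\<^sup>p\<close> is \<open>O(\<epsilon>)\<close>.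

  Weak derivatives have no point values, so \<open>f\<close> is
  mollified first; since the rank bound does not involve the mollification parameter, that parameter
  may be as small as needed. Bounded Lipschitz domains have a uniform interior cone property, which is
  stable under products. Shifting the kernel along the axis of the cone keeps its support inside the
  domain. The centre of the Taylor polynomial of a cell is likewise
  taken from the cone above the cell, which makes all segments from the centre to the cell
  admissible; averaging over a box of possible centres selects one for which the mean square of
  the remainder over the cell is controlled.
\<close>

section \<open>Smooth bump functions\<close>

definition smooth1 :: "(real \<Rightarrow> real) \<Rightarrow> bool" where
  "smooth1 b \<longleftrightarrow> (\<forall>a s. ((deriv ^^ a) b has_real_derivative (deriv ^^ Suc a) b s) (at s))"

lemma smooth1D: "smooth1 b \<Longrightarrow> ((deriv ^^ a) b has_real_derivative (deriv ^^ Suc a) b s) (at s)"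
  by (auto simp: smooth1_def)

lemma smooth1_continuous: "smooth1 b \<Longrightarrow> continuous_on UNIV ((deriv ^^ a) b)"
  by (meson DERIV_isCont continuous_at_imp_continuous_on smooth1D)

lemma smooth1_measurable: "smooth1 b \<Longrightarrow> (deriv ^^ a) b \<in> borel_measurable borel"
  by (intro borel_measurable_continuous_onI smooth1_continuous)

text \<open>The derivatives of \<open>f\<close> of all orders lie in \<open>S\<close>.\<close>

lemma smooth1_coinduct:
  assumes "f \<in> S" and S: "\<And>f. f \<in> S \<Longrightarrow> \<exists>f'\<in>S. \<forall>s. (f has_real_derivative f' s) (at s)"
  shows "smooth1 f"
proof -
  have "(deriv ^^ a) f \<in> S" for a
  proof (induction a)
    case (Suc a)
    then obtain f' where f': "f' \<in> S" "\<And>s. ((deriv ^^ a) f has_real_derivative f' s) (at s)"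
      using S by blast
    then have "(deriv ^^ Suc a) f = f'" by (auto simp: fun_eq_iff intro!: DERIV_imp_deriv)
    then show ?case using f' by simp
  qed (use assms in auto)
  then have "\<exists>f'\<in>S. \<forall>s. ((deriv ^^ a) f has_real_derivative f' s) (at s)" for a using S by blast
  then have "\<exists>f'. \<forall>s. ((deriv ^^ a) f has_real_derivative f' s) (at s)" for a by blast
  then show ?thesis unfolding smooth1_def
    by (metis DERIV_imp_deriv comp_apply funpow.simps(2))
qed

lemma deriv_pow_zero_outside:
  fixes b :: "real \<Rightarrow> real"
  assumes "open A" "\<And>s. s \<in> A \<Longrightarrow> b s = 0" "s \<in> A"
  shows "(deriv ^^ a) b s = 0"
  using assms(3)
proof (induction a arbitrary: s)
  case (Suc a)
  have "((deriv ^^ a) b has_real_derivative 0) (at s)"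
    by (rule has_field_derivative_transform_within_open[where f = "\<lambda>_. 0" and S = A])
       (use Suc assms in auto)
  then show ?case by (auto intro: DERIV_imp_deriv)
qed (use assms in auto)

text \<open>
  Functions that vanish to infinite order at \<open>0\<close>. Allowing all polynomials \<open>q\<close> makes the family
  closed under differentiation.
\<close>

definition flat :: "real poly \<Rightarrow> real \<Rightarrow> real" where
  "flat q s = (if s \<le> 0 then 0 else poly q (1 / s) * exp (- (1 / s)))"

lemma poly_over_exp_tendsto_0: "((\<lambda>y. poly q y * exp (- y)) \<longlongrightarrow> (0::real)) at_top"
proof -
  have "((\<lambda>y. \<Sum>i\<le>degree q. coeff q i * (y ^ i / exp y)) \<longlongrightarrow> (\<Sum>i\<le>degree q. coeff q i * 0)) at_top"
    by (intro tendsto_intros tendsto_power_div_exp_0)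
  then show ?thesis
    by (simp add: poly_altdef sum_distrib_right sum_divide_distrib exp_minus field_simps)
qed

lemma flat_has_derivative:
  "(flat q has_real_derivative flat ([:0, 0, 1:] * (q - pderiv q)) s) (at s)"
proof -
  consider "s < 0" | "s = 0" | "s > 0" by linarith
  then show ?thesis
  proof cases
    case 1
    have "(flat q has_real_derivative 0) (at s)"
      by (rule has_field_derivative_transform_within_open[where f = "\<lambda>_. 0" and S = "{..<0}"])
         (use 1 in \<open>auto simp: flat_def\<close>)
    then show ?thesis using 1 by (simp add: flat_def)
  next
    case 3
    have d: "((\<lambda>s. 1 / s) has_real_derivative - (1 / s\<^sup>2)) (at s)"
      using 3 by (auto intro!: derivative_eq_intros simp: power2_eq_square)
    have p: "((\<lambda>s. poly q (1 / s)) has_real_derivative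
               poly (pderiv q) (1 / s) * - (1 / s\<^sup>2)) (at s)"
      by (rule DERIV_chain'[OF d poly_DERIV])
    have e: "((\<lambda>s. exp (- (1 / s))) has_real_derivative exp (- (1 / s)) * (1 / s\<^sup>2)) (at s)"
      using DERIV_chain'[OF DERIV_minus[OF d] DERIV_exp] by simp
    have "((\<lambda>s. poly q (1 / s) * exp (- (1 / s))) has_real_derivative
             flat ([:0, 0, 1:] * (q - pderiv q)) s) (at s)"
      using DERIV_mult[OF p e] 3
      by (simp add: flat_def algebra_simps power2_eq_square)
    then show ?thesis
      by (rule has_field_derivative_transform_within_open[where S = "{0<..}"])
          (use 3 in \<open>auto simp: flat_def\<close>)
  next
    case 2
    have "((\<lambda>y. poly ([:0, 1:] * q) y * exp (- y)) \<longlongrightarrow> 0) at_top"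
      by (rule poly_over_exp_tendsto_0)
    then have "((\<lambda>h. poly ([:0, 1:] * q) (inverse h) * exp (- inverse h)) \<longlongrightarrow> 0) (at_right 0)"
      by (rule filterlim_compose[OF _ filterlim_inverse_at_top_right])
    then have r: "((\<lambda>h. (flat q (0 + h) - flat q 0) / h) \<longlongrightarrow> 0) (at_right 0)"
      by (rule Lim_transform_eventually)
         (auto simp: eventually_at_filter flat_def inverse_eq_divide field_simps)
    have l: "((\<lambda>h. (flat q (0 + h) - flat q 0) / h) \<longlongrightarrow> 0) (at_left 0)"
      by (rule Lim_transform_eventually[OF tendsto_const])
         (auto simp: eventually_at_filter flat_def)
    have "((\<lambda>h. (flat q (0 + h) - flat q 0) / h) \<longlongrightarrow> 0) (at 0)"
      using l r by (simp add: filterlim_at_split)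
    then show ?thesis using 2 by (simp add: DERIV_def flat_def)
  qed
qed

text \<open>The least algebra that contains the flat functions in affine arguments.\<close>

inductive_set bump_algebra :: "(real \<Rightarrow> real) set" where
  flat: "(\<lambda>s. flat q (c + d * s)) \<in> bump_algebra"
| const: "(\<lambda>_. c) \<in> bump_algebra"
| add: "f \<in> bump_algebra \<Longrightarrow> g \<in> bump_algebra \<Longrightarrow> (\<lambda>s. f s + g s) \<in> bump_algebra"
| mult: "f \<in> bump_algebra \<Longrightarrow> g \<in> bump_algebra \<Longrightarrow> (\<lambda>s. f s * g s) \<in> bump_algebra"

text \<open>The derivative of every generator of the algebra is again in the algebra.\<close>

lemma bump_algebra_smooth1:
  assumes "f \<in> bump_algebra" shows "smooth1 f"
  using assms
proof (rule smooth1_coinduct)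
  fix f :: "real \<Rightarrow> real" assume "f \<in> bump_algebra"
  then show "\<exists>f'\<in>bump_algebra. \<forall>s. (f has_real_derivative f' s) (at s)"
  proof induction
    case (flat q c d)
    have "((\<lambda>s. flat q (c + d * s)) has_real_derivative
             flat ([:0, 0, 1:] * (q - pderiv q)) (c + d * s) * d) (at s)" for s
      by (rule DERIV_chain'[OF _ flat_has_derivative]) (auto intro!: derivative_eq_intros)
    then show ?case
      by (intro bexI[where x = "\<lambda>s. flat ([:0, 0, 1:] * (q - pderiv q)) (c + d * s) * d"])
         (auto intro!: bump_algebra.intros)
  next
    case (const c)
    show ?case by (intro bexI[where x = "\<lambda>_. 0"]) (auto intro!: bump_algebra.intros)
  next
    case (add f g)
    then obtain f' g' where "f' \<in> bump_algebra" "g' \<in> bump_algebra"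
      "\<And>s. (f has_real_derivative f' s) (at s)" "\<And>s. (g has_real_derivative g' s) (at s)" by blast
    then show ?case
      by (intro bexI[where x = "\<lambda>s. f' s + g' s"])
         (auto intro!: bump_algebra.intros derivative_intros)
  next
    case (mult f g)
    then obtain f' g' where *: "f' \<in> bump_algebra" "g' \<in> bump_algebra"
      "\<And>s. (f has_real_derivative f' s) (at s)" "\<And>s. (g has_real_derivative g' s) (at s)" by blast
    have "((\<lambda>s. f s * g s) has_real_derivative f' s * g s + g' s * f s) (at s)" for s
      by (rule DERIV_mult) (auto intro: *)
    then show ?case
      by (intro bexI[where x = "\<lambda>s. f' s * g s + g' s * f s"])
         (use mult * in \<open>auto intro!: bump_algebra.intros\<close>)
  qed
qed

definition bump :: "real \<Rightarrow> real \<Rightarrow> (real \<Rightarrow> real) \<Rightarrow> bool" where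
  "bump c d b \<longleftrightarrow> smooth1 b \<and> (\<forall>s. 0 \<le> b s) \<and> (\<forall>s. d < \<bar>s - c\<bar> \<longrightarrow> b s = 0) \<and>
     (\<integral>\<^sup>+s. ennreal (b s) \<partial>lborel) = 1"

text \<open>
  The product of a flat function that vanishes left of \<open>c - d\<close> and one that vanishes right of
  \<open>c + d\<close>, divided by its integral.
\<close>

lemma bump_exists:
  assumes "d > 0" shows "\<exists>b. bump c d b"
proof -
  define b0 where "b0 s = flat 1 (d - c + 1 * s) * flat 1 (c + d + (-1) * s)" for s
  have S: "b0 \<in> bump_algebra" unfolding b0_def [abs_def] by (intro bump_algebra.intros)
  have cont: "continuous_on A b0" for A
    using smooth1_continuous[OF bump_algebra_smooth1[OF S], of 0] continuous_on_subset by auto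
  have nn: "b0 s \<ge> 0" for s by (auto simp: b0_def flat_def)
  have out: "b0 s = 0" if "d < \<bar>s - c\<bar>" for s using that by (auto simp: b0_def flat_def)
  have pos: "b0 s > 0" if "c - d < s" "s < c + d" for s using that by (auto simp: b0_def flat_def)
  have set_eq: "(\<lambda>s. indicator {c-d..c+d} s *\<^sub>R b0 s) = b0"
  proof
    show "indicator {c-d..c+d} s *\<^sub>R b0 s = b0 s" for s
      using out[of s] by (cases "s \<in> {c-d..c+d}") (auto simp: abs_real_def split: if_splits)
  qed
  have int: "integrable lborel b0"
    using borel_integrable_compact[OF compact_Icc cont, of "c-d" "c+d"] set_eq by simp
  define Z where "Z = (\<integral>s. b0 s \<partial>lborel)"
  have "Z \<noteq> 0"
  proof
    assume "Z = 0"
    then have "AE s in lborel. b0 s = 0"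
      using integral_nonneg_eq_0_iff_AE[OF int] nn by (auto simp: Z_def)
    then have "AE s in lborel. s \<notin> {c-d<..<c+d}" using pos by (auto elim!: eventually_mono simp: order.strict_iff_order)
    then have "emeasure lborel {c-d<..<c+d} = 0"
      by (subst (asm) AE_iff_measurable[OF _ refl]) (auto simp: greaterThanLessThan_def greaterThan_def lessThan_def Int_def)
    then show False using assms by simp
  qed
  then have Z: "Z > 0" using Bochner_Integration.integral_nonneg[of lborel b0] nn by (simp add: Z_def order.strict_iff_order)
  have "bump c d (\<lambda>s. b0 s * (1 / Z))"
    unfolding bump_def
  proof (intro conjI)
    show "smooth1 (\<lambda>s. b0 s * (1 / Z))"
      by (intro bump_algebra_smooth1 bump_algebra.intros S)
    have "(\<integral>\<^sup>+s. ennreal (b0 s * (1 / Z)) \<partial>lborel) = ennreal (\<integral>s. b0 s * (1 / Z) \<partial>lborel)"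
      by (rule nn_integral_eq_integral) (use int nn Z in auto)
    also have "\<dots> = 1" using Z by (simp add: Z_def)
    finally show "(\<integral>\<^sup>+s. ennreal (b0 s * (1 / Z)) \<partial>lborel) = 1" .
  qed (use nn Z out in auto)
  then show ?thesis by blast
qed

lemma bump_deriv_zero: "bump c d b \<Longrightarrow> d < \<bar>s - c\<bar> \<Longrightarrow> (deriv ^^ a) b s = 0"
  by (rule deriv_pow_zero_outside[of "{s. d < \<bar>s - c\<bar>}"])
     (auto simp: bump_def intro!: open_Collect_less continuous_intros)

lemma bump_deriv_bounded:
  assumes "bump c d b" shows "\<exists>B. \<forall>s. \<bar>(deriv ^^ a) b s\<bar> \<le> B"
proof -
  have "bounded ((deriv ^^ a) b ` {c-d..c+d})"
    using assms smooth1_continuous continuous_on_subset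
    by (intro compact_imp_bounded compact_continuous_image) (auto simp: bump_def, blast)
  then obtain B where B: "\<And>s. s \<in> {c-d..c+d} \<Longrightarrow> \<bar>(deriv ^^ a) b s\<bar> \<le> B"
    unfolding bounded_iff by (metis imageI real_norm_def)
  have "\<bar>(deriv ^^ a) b s\<bar> \<le> max B 0" for s
  proof (cases "s \<in> {c-d..c+d}")
    case False
    then have "d < \<bar>s - c\<bar>" by (auto simp: abs_real_def)
    then show ?thesis using bump_deriv_zero[OF assms, of s a] by simp
  qed (use B[of s] in auto)
  then show ?thesis by blast
qed

section \<open>Lebesgue measure on a space of extensional functions\<close>

abbreviation leb :: "'i set \<Rightarrow> ('i \<Rightarrow> real) measure" where
  "leb I \<equiv> PiM I (\<lambda>_. lborel)"

lemma leb_sigma_finite: "finite I \<Longrightarrow> sigma_finite_measure (leb I)"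
proof -
  interpret product_sigma_finite "\<lambda>_. lborel :: real measure" by standard
  show "finite I \<Longrightarrow> ?thesis" by (rule sigma_finite)
qed

lemma space_leb: "space (leb I) = PiE I (\<lambda>_. UNIV)"
  by (simp add: space_PiM)

text \<open>
  The pushforward of the measure under the affine map, rescaled, agrees with it on boxes, and
  boxes determine a product measure.
\<close>

lemma nn_integral_leb_affine:
  fixes a :: "'i \<Rightarrow> real"
  assumes I: "finite I" and c: "c > 0" and f[measurable]: "f \<in> borel_measurable (leb I)"
  shows "(\<integral>\<^sup>+x. f x \<partial>leb I) = ennreal (c ^ card I) * (\<integral>\<^sup>+x. f (\<lambda>i\<in>I. a i + c * x i) \<partial>leb I)"
proof -
  interpret product_sigma_finite "\<lambda>_. lborel :: real measure" by standard
  define T where "T x = (\<lambda>i\<in>I. a i + c * x i)" for x :: "'i \<Rightarrow> real"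
  have T[measurable]: "T \<in> leb I \<rightarrow>\<^sub>M leb I" unfolding T_def by measurable
  let ?P = "density (distr (leb I) (leb I) T) (\<lambda>_. ennreal (c ^ card I))"
  have "?P = leb I"
  proof (rule PiM_eqI[OF I])
    fix A :: "'i \<Rightarrow> real set" assume A: "\<And>i. i \<in> I \<Longrightarrow> A i \<in> sets lborel"
    have [measurable]: "PiE I A \<in> sets (leb I)" using I A by (intro sets_PiM_I_finite) auto
    have "T -` PiE I A \<inter> space (leb I) = PiE I (\<lambda>i. (\<lambda>s. a i + c * s) -` A i)"
      by (auto simp: T_def space_PiM PiE_iff)
    then have "emeasure ?P (PiE I A)
        = ennreal (c ^ card I) * emeasure (leb I) (PiE I (\<lambda>i. (\<lambda>s. a i + c * s) -` A i))"
      by (simp add: emeasure_density nn_integral_cmult emeasure_distr)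
    also have "\<dots> = ennreal (c ^ card I) * (\<Prod>i\<in>I. emeasure lborel ((\<lambda>s. a i + c * s) -` A i))"
    proof -
      have "(\<lambda>s. a i + c * s) -` A i \<in> sets lborel" if "i \<in> I" for i
        using measurable_sets[of "\<lambda>s. a i + c * s" lborel lborel "A i"] A[OF that] by auto
      then show ?thesis using I by (simp add: emeasure_PiM)
    qed
    also have "\<dots> = (\<Prod>i\<in>I. ennreal c * emeasure lborel ((\<lambda>s. a i + c * s) -` A i))"
      using c by (simp add: prod.distrib ennreal_power)
    also have "\<dots> = (\<Prod>i\<in>I. emeasure lborel (A i))"
    proof (rule prod.cong[OF refl])
      fix i assume i: "i \<in> I"
      have [measurable]: "A i \<in> sets borel" using A[OF i] by simp
      have "(\<integral>\<^sup>+s. indicator (A i) s \<partial>lborel)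
          = ennreal \<bar>c\<bar> * (\<integral>\<^sup>+s. indicator (A i) (a i + c * s) \<partial>lborel)"
        using c by (intro nn_integral_real_affine) auto
      also have "(\<integral>\<^sup>+s. indicator (A i) (a i + c * s) \<partial>lborel)
          = (\<integral>\<^sup>+s. indicator ((\<lambda>s. a i + c * s) -` A i) s \<partial>lborel)"
        by (intro nn_integral_cong) (auto split: split_indicator)
      finally show "ennreal c * emeasure lborel ((\<lambda>s. a i + c * s) -` A i) = emeasure lborel (A i)"
        using measurable_sets[of "\<lambda>s. a i + c * s" lborel lborel "A i"] c by simp
    qed
    finally show "emeasure ?P (PiE I A) = (\<Prod>i\<in>I. emeasure lborel (A i))" .
  qed simp
  then have "(\<integral>\<^sup>+x. f x \<partial>leb I) = (\<integral>\<^sup>+x. f x \<partial>?P)" by simp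
  also have "\<dots> = ennreal (c ^ card I) * (\<integral>\<^sup>+x. f (T x) \<partial>leb I)"
    by (simp add: nn_integral_density nn_integral_distr nn_integral_cmult)
  finally show ?thesis by (simp add: T_def)
qed

lemma nn_integral_leb_translate:
  assumes "finite I" "f \<in> borel_measurable (leb I)"
  shows "(\<integral>\<^sup>+x. f (\<lambda>i\<in>I. x i + a i) \<partial>leb I) = (\<integral>\<^sup>+x. f x \<partial>leb I)"
  using nn_integral_leb_affine[OF assms(1) zero_less_one assms(2), of a]
  by (simp add: add.commute)

section \<open>Tensor products as test functions\<close>

definition tens :: "'i set \<Rightarrow> ('i \<Rightarrow> real \<Rightarrow> real) \<Rightarrow> ('i \<Rightarrow> real) \<Rightarrow> real" where
  "tens I F x = (\<Prod>i\<in>I. F i (x i))"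

text \<open>The tensor product of the derivatives of orders given by the multi-index of \<open>is\<close>.\<close>

definition dtens :: "'i set \<Rightarrow> ('i \<Rightarrow> real \<Rightarrow> real) \<Rightarrow> 'i list \<Rightarrow> ('i \<Rightarrow> real) \<Rightarrow> real" where
  "dtens I F is = tens I (\<lambda>i. (deriv ^^ count_list is i) (F i))"

text \<open>
  The arguments move along a curve, so that the rule applies to partial derivatives as well as to
  derivatives along a segment.
\<close>

lemma tens_has_derivative:
  assumes I: "finite I" and F: "\<And>i. i \<in> I \<Longrightarrow> smooth1 (F i)"
    and y: "\<And>i. i \<in> I \<Longrightarrow> ((\<lambda>t. y t i) has_real_derivative w i) (at t)"
  shows "((\<lambda>t. dtens I F is (y t)) has_real_derivative
           (\<Sum>j\<in>I. w j * dtens I F (j # is) (y t))) (at t)"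
proof -
  have "((\<lambda>t. \<Prod>i\<in>I. (deriv ^^ count_list is i) (F i) (y t i)) has_real_derivative
      (\<Sum>j\<in>I. ((deriv ^^ Suc (count_list is j)) (F j) (y t j) * w j)
         * (\<Prod>i\<in>I - {j}. (deriv ^^ count_list is i) (F i) (y t i)))) (at t)"
    using y F by (intro has_field_derivative_prod DERIV_chain'[OF y] smooth1D)
  also have "(\<Sum>j\<in>I. ((deriv ^^ Suc (count_list is j)) (F j) (y t j) * w j)
         * (\<Prod>i\<in>I - {j}. (deriv ^^ count_list is i) (F i) (y t i)))
      = (\<Sum>j\<in>I. w j * dtens I F (j # is) (y t))"
  proof (rule sum.cong[OF refl])
    fix j assume j: "j \<in> I"
    have "dtens I F (j # is) (y t) = (deriv ^^ Suc (count_list is j)) (F j) (y t j)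
        * (\<Prod>i\<in>I - {j}. (deriv ^^ count_list (j # is) i) (F i) (y t i))"
      unfolding dtens_def tens_def using I j by (subst prod.remove[of I j]) auto
    also have "(\<Prod>i\<in>I - {j}. (deriv ^^ count_list (j # is) i) (F i) (y t i))
        = (\<Prod>i\<in>I - {j}. (deriv ^^ count_list is i) (F i) (y t i))"
      by (intro prod.cong) auto
    finally show "((deriv ^^ Suc (count_list is j)) (F j) (y t j) * w j)
         * (\<Prod>i\<in>I - {j}. (deriv ^^ count_list is i) (F i) (y t i)) = w j * dtens I F (j # is) (y t)"
      by simp
  qed
  finally show ?thesis by (simp add: dtens_def tens_def)
qed

lemma tens_partial_derivative:
  assumes I: "finite I" and F: "\<And>i. i \<in> I \<Longrightarrow> smooth1 (F i)" and j: "j \<in> I"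
  shows "((\<lambda>t. dtens I F is (x(j := t))) has_real_derivative dtens I F (j # is) x) (at (x j))"
proof -
  have "((\<lambda>t. dtens I F is (x(j := t))) has_real_derivative
      (\<Sum>l\<in>I. (if l = j then 1 else 0) * dtens I F (l # is) (x(j := x j)))) (at (x j))"
    by (rule tens_has_derivative[OF I F]) (auto intro!: derivative_eq_intros)
  then show ?thesis using I j by (simp add: if_distrib[of "\<lambda>c. c * _"] sum.delta cong: if_cong)
qed

lemma partials_tens:
  assumes "finite I" "\<And>i. i \<in> I \<Longrightarrow> smooth1 (F i)" "is \<in> lists I"
  shows "partials is (tens I F) = dtens I F is"
  using assms(3)
proof (induction "is")
  case Nil
  show ?case by (simp add: dtens_def)
next
  case (Cons j "is")
  then show ?case
    by (auto simp: partial_def fun_eq_iff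
        intro!: DERIV_imp_deriv tens_partial_derivative[OF assms(1,2)])
qed

lemma tens_smooth:
  assumes I: "finite I" and F: "\<And>i. i \<in> I \<Longrightarrow> smooth1 (F i)"
  shows "smooth_on_space I (tens I F)"
  unfolding smooth_on_space_def
proof (intro ballI conjI)
  fix "is" assume "is": "is \<in> lists I"
  have p: "partials is (tens I F) = dtens I F is"
    by (rule partials_tens[OF I F "is"])
  have "continuous_map (powertop_real I) euclideanreal
      (\<lambda>x. \<Prod>i\<in>I. (deriv ^^ count_list is i) (F i) (x i))"
  proof (rule continuous_map_prod[OF I])
    fix i assume i: "i \<in> I"
    have "continuous_map euclideanreal euclideanreal ((deriv ^^ count_list is i) (F i))"
      using smooth1_continuous[OF F[OF i]] by simp
    then have "continuous_map (powertop_real I) euclideanreal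
        ((deriv ^^ count_list is i) (F i) \<circ> (\<lambda>x. x i))"
      by (rule continuous_map_compose[rotated]) (rule continuous_map_product_projection[OF i])
    then show "continuous_map (powertop_real I) euclideanreal
        (\<lambda>x. (deriv ^^ count_list is i) (F i) (x i))"
      by (simp only: o_def)
  qed
  then show "continuous_map (powertop_real I) euclideanreal (partials is (tens I F))"
    unfolding p by (simp only: dtens_def tens_def [abs_def])
  show "(\<lambda>t. partials is (tens I F) (x(i := t))) field_differentiable at (x i)"
    if "i \<in> I" for i x
    unfolding p field_differentiable_def using tens_partial_derivative[of I F, OF I F that] by blast
qed

lemma tens_test_function:
  assumes I: "finite I" and F: "\<And>i. i \<in> I \<Longrightarrow> smooth1 (F i)"
    and supp: "\<And>i s. i \<in> I \<Longrightarrow> s \<notin> {l i..u i} \<Longrightarrow> F i s = 0"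
    and U: "PiE I (\<lambda>i. {l i..u i}) \<subseteq> U"
  shows "test_function I U (tens I F)"
  unfolding test_function_def
proof (intro conjI exI[where x = "PiE I (\<lambda>i. {l i..u i})"])
  show "compactin (powertop_real I) (PiE I (\<lambda>i. {l i..u i}))"
    by (simp add: compactin_PiE)
  show "\<forall>x\<in>PiE I (\<lambda>_. UNIV) - PiE I (\<lambda>i. {l i..u i}). tens I F x = 0"
    using supp I by (fastforce simp: tens_def PiE_iff extensional_def)
qed (use U tens_smooth[OF I F] in auto)

section \<open>Mollification\<close>

text \<open>
  The Cauchy--Schwarz inequality for \<open>\<bar>f\<bar> * sqrt \<rho>\<close> and \<open>sqrt \<rho>\<close>. If \<open>f * \<rho>\<close> is not integrable,
  the left-hand side is \<open>0\<close> by convention.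
\<close>

lemma jensen_weighted:
  fixes f :: "'a \<Rightarrow> real"
  assumes [measurable]: "f \<in> borel_measurable M" "\<rho> \<in> borel_measurable M"
    and nn: "\<And>x. 0 \<le> \<rho> x" and one: "(\<integral>\<^sup>+x. ennreal (\<rho> x) \<partial>M) \<le> 1"
  shows "ennreal ((\<integral>x. f x * \<rho> x \<partial>M)\<^sup>2) \<le> (\<integral>\<^sup>+x. ennreal ((f x)\<^sup>2) * ennreal (\<rho> x) \<partial>M)"
proof (cases "integrable M (\<lambda>x. f x * \<rho> x)")
  case True
  have "ennreal ((\<integral>x. f x * \<rho> x \<partial>M)\<^sup>2) = (ennreal \<bar>\<integral>x. f x * \<rho> x \<partial>M\<bar>)\<^sup>2"
    by (simp add: ennreal_power)
  also have "\<dots> \<le> (\<integral>\<^sup>+x. ennreal \<bar>f x * \<rho> x\<bar> \<partial>M)\<^sup>2"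
    using integral_norm_bound_ennreal[OF True] by (intro power_mono) auto
  also have "(\<integral>\<^sup>+x. ennreal \<bar>f x * \<rho> x\<bar> \<partial>M)
      = (\<integral>\<^sup>+x. ennreal (\<bar>f x\<bar> * sqrt (\<rho> x)) * ennreal (sqrt (\<rho> x)) \<partial>M)"
    using nn by (intro nn_integral_cong)
      (simp add: ennreal_mult[symmetric] abs_mult mult.assoc real_sqrt_mult_self)
  also have "(\<dots>)\<^sup>2 \<le> (\<integral>\<^sup>+x. (ennreal (\<bar>f x\<bar> * sqrt (\<rho> x)))\<^sup>2 \<partial>M)
      * (\<integral>\<^sup>+x. (ennreal (sqrt (\<rho> x)))\<^sup>2 \<partial>M)"
    by (rule Cauchy_Schwarz_nn_integral) measurable
  also have "(\<integral>\<^sup>+x. (ennreal (sqrt (\<rho> x)))\<^sup>2 \<partial>M) = (\<integral>\<^sup>+x. ennreal (\<rho> x) \<partial>M)"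
    using nn by (intro nn_integral_cong) (simp add: ennreal_power)
  also have "(\<integral>\<^sup>+x. (ennreal (\<bar>f x\<bar> * sqrt (\<rho> x)))\<^sup>2 \<partial>M)
      = (\<integral>\<^sup>+x. ennreal ((f x)\<^sup>2) * ennreal (\<rho> x) \<partial>M)"
    using nn by (intro nn_integral_cong) (simp add: ennreal_power ennreal_mult[symmetric] power_mult_distrib)
  also have "\<dots> * (\<integral>\<^sup>+x. ennreal (\<rho> x) \<partial>M) \<le> \<dots> * 1"
    by (intro mult_left_mono one) simp
  finally show ?thesis by simp
qed (simp add: not_integrable_integral_eq)

definition kern :: "'i set \<Rightarrow> ('i \<Rightarrow> real \<Rightarrow> real) \<Rightarrow> ('i \<Rightarrow> real) \<Rightarrow> ('i \<Rightarrow> real) \<Rightarrow> real" where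
  "kern I F x z = (\<Prod>i\<in>I. F i (z i - x i))"

definition mollify :: "'i set \<Rightarrow> ('i \<Rightarrow> real \<Rightarrow> real) \<Rightarrow> (('i \<Rightarrow> real) \<Rightarrow> real) \<Rightarrow> ('i \<Rightarrow> real) \<Rightarrow> real" where
  "mollify I F v x = (\<integral>z. v z * kern I F x z \<partial>leb I)"

lemma kern_eq_tens: "kern I F x = tens I (\<lambda>i s. F i (s - x i))"
  by (simp add: kern_def tens_def fun_eq_iff)

lemma DERIV_shift_minus:
  fixes f :: "real \<Rightarrow> real"
  assumes "(f has_real_derivative D) (at (s - c))"
  shows "((\<lambda>s. f (s - c)) has_real_derivative D) (at s)"
  using DERIV_shift[of f D "s" "- c"] assms by simp

lemma deriv_pow_shift:
  assumes "smooth1 b"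
  shows "(deriv ^^ a) (\<lambda>s. b (s - c)) = (\<lambda>s. (deriv ^^ a) b (s - c))"
proof (induction a)
  case (Suc a)
  have "((\<lambda>s. (deriv ^^ a) b (s - c)) has_real_derivative (deriv ^^ Suc a) b (s - c)) (at s)" for s
    by (rule DERIV_shift_minus[OF smooth1D[OF assms]])
  then have "deriv (\<lambda>s. (deriv ^^ a) b (s - c)) = (\<lambda>s. (deriv ^^ Suc a) b (s - c))"
    by (intro ext DERIV_imp_deriv)
  then show ?case using Suc by simp
qed simp

lemma smooth1_shift: "smooth1 b \<Longrightarrow> smooth1 (\<lambda>s. b (s - c))"
  unfolding smooth1_def[of "\<lambda>s. b (s - c)"]
proof (intro allI)
  fix a s assume b: "smooth1 b"
  show "((deriv ^^ a) (\<lambda>s. b (s - c)) has_real_derivative (deriv ^^ Suc a) (\<lambda>s. b (s - c)) s) (at s)"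
    unfolding deriv_pow_shift[OF b] by (rule DERIV_shift_minus[OF smooth1D[OF b]])
qed

lemma dtens_shift:
  assumes "\<And>i. i \<in> I \<Longrightarrow> smooth1 (F i)"
  shows "dtens I (\<lambda>i s. F i (s - x i)) is z = dtens I F is (\<lambda>i. z i - x i)"
  unfolding dtens_def tens_def using assms by (intro prod.cong) (simp_all add: deriv_pow_shift)

text \<open>
  Every component of the kernel is a bump around \<open>c i\<close> of radius \<open>d\<close>. The kernel need not be
  centred at \<open>0\<close>, so that it can be pushed into an interior cone of the domain.
\<close>

locale mollifier =
  fixes I :: "'i set" and c :: "'i \<Rightarrow> real" and d :: real and F :: "'i \<Rightarrow> real \<Rightarrow> real"
  assumes finI: "finite I" and bumpF: "\<And>i. i \<in> I \<Longrightarrow> bump (c i) d (F i)"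
begin

lemma smoothF: "i \<in> I \<Longrightarrow> smooth1 (F i)"
  using bumpF by (auto simp: bump_def)

lemma measF: "i \<in> I \<Longrightarrow> (deriv ^^ a) (F i) \<in> borel_measurable borel"
  by (intro smooth1_measurable smoothF)

lemma measF0: "i \<in> I \<Longrightarrow> F i \<in> borel_measurable borel"
  using measF[of i 0] by simp

lemma kern_nonneg: "0 \<le> kern I F x z"
  unfolding kern_def using bumpF by (intro prod_nonneg) (auto simp: bump_def)

lemma kern_support: "kern I F x z \<noteq> 0 \<Longrightarrow> i \<in> I \<Longrightarrow> \<bar>z i - x i - c i\<bar> \<le> d"
  using bumpF[of i] finI by (force simp: kern_def bump_def prod_zero_iff)

lemma kern_measurable2: "(\<lambda>(x, z). kern I F x z) \<in> borel_measurable (leb I \<Otimes>\<^sub>M leb I)"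
  unfolding kern_def case_prod_beta
proof (intro borel_measurable_prod)
  fix i assume i: "i \<in> I"
  have "(\<lambda>p. snd p i - fst p i) \<in> borel_measurable (leb I \<Otimes>\<^sub>M leb I)" using i by measurable
  from measurable_compose[OF this measF0[OF i]]
  show "(\<lambda>p. F i (snd p i - fst p i)) \<in> borel_measurable (leb I \<Otimes>\<^sub>M leb I)" .
qed

lemma dtens_measurable:
  assumes "\<And>i. i \<in> I \<Longrightarrow> (\<lambda>p. f p i) \<in> borel_measurable N"
  shows "(\<lambda>p. dtens I F is (f p)) \<in> borel_measurable N"
  unfolding dtens_def tens_def
  by (intro borel_measurable_prod) (rule measurable_compose[OF assms measF], auto)

lemma kern_measurable: "kern I F x \<in> borel_measurable (leb I)"
proof -
  have "(\<lambda>z. dtens I F [] (\<lambda>i. z i - x i)) \<in> borel_measurable (leb I)"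
    by (rule dtens_measurable) measurable
  then show ?thesis by (simp add: dtens_def tens_def kern_def [abs_def])
qed

lemma kern_integral: "(\<integral>\<^sup>+z. ennreal (kern I F x z) \<partial>leb I) = 1"
proof -
  interpret product_sigma_finite "\<lambda>_. lborel :: real measure" by standard
  have "(\<integral>\<^sup>+z. ennreal (kern I F x z) \<partial>leb I) = (\<integral>\<^sup>+z. (\<Prod>i\<in>I. ennreal (F i (z i - x i))) \<partial>leb I)"
    unfolding kern_def using bumpF
    by (intro nn_integral_cong prod_ennreal[symmetric]) (auto simp: bump_def)
  also have "\<dots> = (\<Prod>i\<in>I. \<integral>\<^sup>+s. ennreal (F i (s - x i)) \<partial>lborel)"
    by (rule product_nn_integral_prod[OF finI]) (use measF0 in measurable)
  also have "\<dots> = (\<Prod>i\<in>I. 1)"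
  proof (rule prod.cong[OF refl])
    fix i assume i: "i \<in> I"
    then show "(\<integral>\<^sup>+s. ennreal (F i (s - x i)) \<partial>lborel) = 1"
      using nn_integral_real_affine[of "\<lambda>s. ennreal (F i s)" 1 "- x i"] measF0[OF i] bumpF[OF i]
      by (simp add: bump_def)
  qed
  finally show ?thesis by simp
qed

lemma kern_integral_fst: "(\<integral>\<^sup>+x. ennreal (kern I F x z) \<partial>leb I) = 1"
proof -
  interpret product_sigma_finite "\<lambda>_. lborel :: real measure" by standard
  have "(\<integral>\<^sup>+x. ennreal (kern I F x z) \<partial>leb I) = (\<integral>\<^sup>+x. (\<Prod>i\<in>I. ennreal (F i (z i - x i))) \<partial>leb I)"
    unfolding kern_def using bumpF
    by (intro nn_integral_cong prod_ennreal[symmetric]) (auto simp: bump_def)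
  also have "\<dots> = (\<Prod>i\<in>I. \<integral>\<^sup>+s. ennreal (F i (z i - s)) \<partial>lborel)"
    by (rule product_nn_integral_prod[OF finI]) (use measF0 in measurable)
  also have "\<dots> = (\<Prod>i\<in>I. 1)"
  proof (rule prod.cong[OF refl])
    fix i assume i: "i \<in> I"
    then show "(\<integral>\<^sup>+s. ennreal (F i (z i - s)) \<partial>lborel) = 1"
      using nn_integral_real_affine[of "\<lambda>s. ennreal (F i s)" "-1" "z i"] measF0[OF i] bumpF[OF i]
      by (simp add: bump_def)
  qed
  finally show ?thesis by simp
qed

lemma dtens_bounded: "\<exists>B. \<forall>y. \<bar>dtens I F is y\<bar> \<le> B"
proof -
  have "\<forall>i\<in>I. \<exists>B. \<forall>s. \<bar>(deriv ^^ count_list is i) (F i) s\<bar> \<le> B"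
    using bump_deriv_bounded[OF bumpF] by blast
  then obtain B where B: "\<And>i s. i \<in> I \<Longrightarrow> \<bar>(deriv ^^ count_list is i) (F i) s\<bar> \<le> B i"
    by metis
  have "\<bar>dtens I F is y\<bar> \<le> (\<Prod>i\<in>I. B i)" for y
    unfolding dtens_def tens_def abs_prod by (intro prod_mono) (use B in auto)
  then show ?thesis by blast
qed

lemma kern_bounded: "\<exists>B. \<forall>x z. \<bar>kern I F x z\<bar> \<le> B"
proof -
  obtain B where "\<forall>y. \<bar>dtens I F [] y\<bar> \<le> B" using dtens_bounded by blast
  then have "\<bar>kern I F x z\<bar> \<le> B" for x z
    by (auto simp: dtens_def tens_def kern_def dest: spec[of _ "\<lambda>i. z i - x i"])
  then show ?thesis by blast
qed

lemma kern_mult_integrable: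
  assumes "integrable (leb I) v"
  shows "integrable (leb I) (\<lambda>z. v z * kern I F x z)"
proof -
  obtain B where B: "\<And>x z. \<bar>kern I F x z\<bar> \<le> B" using kern_bounded by blast
  have [measurable]: "kern I F x \<in> borel_measurable (leb I)" by (rule kern_measurable)
  show ?thesis
    by (rule Bochner_Integration.integrable_bound[where f = "\<lambda>z. v z * B"])
       (use assms B order.trans[OF abs_ge_self B] in
         \<open>auto simp: abs_mult intro!: mult_left_mono AE_I2 order.trans[OF B abs_ge_self]\<close>)
qed

lemma mollify_measurable:
  assumes [measurable]: "v \<in> borel_measurable (leb I)"
  shows "mollify I F v \<in> borel_measurable (leb I)"
proof -
  interpret sigma_finite_measure "leb I" by (rule leb_sigma_finite[OF finI])
  note kern_measurable2[measurable]
  show ?thesis unfolding mollify_def [abs_def]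
    by (rule borel_measurable_lebesgue_integral) measurable
qed

lemma mollify_bounded:
  assumes v: "integrable (leb I) v"
  shows "\<exists>B. \<forall>x. \<bar>mollify I F v x\<bar> \<le> B"
proof -
  obtain B where B: "\<And>x z. \<bar>kern I F x z\<bar> \<le> B" using kern_bounded by blast
  have "\<bar>mollify I F v x\<bar> \<le> (\<integral>z. \<bar>v z\<bar> * B \<partial>leb I)" for x
    unfolding mollify_def
    by (rule order.trans[OF integral_abs_bound integral_mono])
       (use v B integrable_abs[OF kern_mult_integrable[OF v]] in \<open>auto simp: abs_mult intro!: mult_left_mono\<close>)
  then show ?thesis by blast
qed

text \<open>Mollification is a convex combination of translations, hence a contraction of \<open>L\<^sup>2\<close>.\<close>

lemma mollify_contraction:
  assumes [measurable]: "v \<in> borel_measurable (leb I)"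
  shows "(\<integral>\<^sup>+x. ennreal ((mollify I F v x)\<^sup>2) \<partial>leb I) \<le> (\<integral>\<^sup>+x. ennreal ((v x)\<^sup>2) \<partial>leb I)"
proof -
  interpret S: sigma_finite_measure "leb I" by (rule leb_sigma_finite[OF finI])
  interpret pair_sigma_finite "leb I" "leb I" by standard
  note kern_measurable2[measurable] kern_measurable[measurable]
  have "(\<integral>\<^sup>+x. ennreal ((mollify I F v x)\<^sup>2) \<partial>leb I)
      \<le> (\<integral>\<^sup>+x. (\<integral>\<^sup>+z. ennreal ((v z)\<^sup>2) * ennreal (kern I F x z) \<partial>leb I) \<partial>leb I)"
    unfolding mollify_def
    by (intro nn_integral_mono jensen_weighted) (auto simp: kern_nonneg kern_integral)
  also have "\<dots> = (\<integral>\<^sup>+z. (\<integral>\<^sup>+x. ennreal ((v z)\<^sup>2) * ennreal (kern I F x z) \<partial>leb I) \<partial>leb I)"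
    by (rule Fubini') measurable
  also have "\<dots> = (\<integral>\<^sup>+z. ennreal ((v z)\<^sup>2) * (\<integral>\<^sup>+x. ennreal (kern I F x z) \<partial>leb I) \<partial>leb I)"
    by (intro nn_integral_cong nn_integral_cmult) measurable
  finally show ?thesis by (simp add: kern_integral_fst)
qed

end

section \<open>Weak derivatives and Taylor expansion of mollified functions\<close>

abbreviation words :: "'i set \<Rightarrow> nat \<Rightarrow> 'i list set" where
  "words I a \<equiv> {is. set is \<subseteq> I \<and> length is = a}"

text \<open>
  Monomials and derivatives of order \<open>a\<close> are indexed by words of length \<open>a\<close>. Each multi-index thus
  occurs with its multinomial multiplicity, and \<open>1 / fact a\<close> is the coefficient of every term of
  order \<open>a\<close> in Taylor's formula.
\<close>

definition monom_at :: "('i \<Rightarrow> real) \<Rightarrow> 'i list \<Rightarrow> real" where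
  "monom_at w is = prod_list (map w is)"

lemma finite_words: "finite I \<Longrightarrow> finite (words I a)"
  by (rule finite_lists_length_eq)

lemma sum_words_Suc:
  assumes "finite I"
  shows "(\<Sum>is\<in>words I (Suc a). f is) = (\<Sum>is\<in>words I a. \<Sum>j\<in>I. f (j # is))"
proof -
  have "(\<Sum>is\<in>words I (Suc a). f is) = (\<Sum>(is, j)\<in>words I a \<times> I. f (j # is))"
    unfolding lists_length_Suc_eq
    by (subst sum.reindex) (auto simp: inj_on_def case_prod_beta)
  then show ?thesis by (simp add: sum.cartesian_product)
qed

text \<open>\<open>W\<close> consists of \<open>u = W []\<close> and its weak derivatives on \<open>U\<close>, all extended by zero.\<close>

definition weak_derivs ::
    "'i set \<Rightarrow> ('i \<Rightarrow> real) set \<Rightarrow> nat \<Rightarrow> ('i list \<Rightarrow> ('i \<Rightarrow> real) \<Rightarrow> real) \<Rightarrow> bool" where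
  "weak_derivs I U p W \<longleftrightarrow> (\<forall>is. set is \<subseteq> I \<and> length is \<le> p \<longrightarrow>
     integrable (leb I) (W is) \<and> (\<integral>\<^sup>+x. ennreal ((W is x)\<^sup>2) \<partial>leb I) < \<infinity> \<and>
     (\<forall>\<eta>. test_function I U \<eta> \<longrightarrow>
        (\<integral>x. W [] x * partials is \<eta> x \<partial>leb I) = (-1) ^ length is * (\<integral>x. W is x * \<eta> x \<partial>leb I)))"

context mollifier
begin

text \<open>The derivative falls on the kernel, which is a test function as long as its support stays in \<open>U\<close>.\<close>

lemma integral_dtens_eq_mollify:
  assumes W: "weak_derivs I U p W" and "is": "set is \<subseteq> I" "length is \<le> p"
    and supp: "PiE I (\<lambda>i. {x i + c i - d..x i + c i + d}) \<subseteq> U"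
  shows "(\<integral>z. W [] z * dtens I F is (\<lambda>i. z i - x i) \<partial>leb I)
    = (-1) ^ length is * mollify I F (W is) x"
proof -
  let ?F = "\<lambda>i s. F i (s - x i)"
  have sm: "smooth1 (?F i)" if "i \<in> I" for i by (rule smooth1_shift[OF smoothF[OF that]])
  have "test_function I U (tens I ?F)"
  proof (rule tens_test_function[OF finI sm _ supp])
    fix i s assume "i \<in> I" "s \<notin> {x i + c i - d..x i + c i + d}"
    then show "F i (s - x i) = 0"
      using bumpF[of i] by (auto simp: bump_def)
  qed
  moreover have "partials is (tens I ?F) z = dtens I F is (\<lambda>i. z i - x i)" for z
    using "is" by (subst partials_tens[OF finI sm]) (auto simp: dtens_shift smoothF)
  ultimately show ?thesis
    using W "is" unfolding weak_derivs_def mollify_def kern_eq_tens by fastforce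
qed

text \<open>The derivative of order \<open>a\<close>, at time \<open>t\<close>, of the kernel centred at \<open>x + t * w\<close>, evaluated at \<open>z\<close>.\<close>

definition line_deriv :: "('i \<Rightarrow> real) \<Rightarrow> ('i \<Rightarrow> real) \<Rightarrow> nat \<Rightarrow> ('i \<Rightarrow> real) \<Rightarrow> real \<Rightarrow> real" where
  "line_deriv x w a z t =
     (\<Sum>is\<in>words I a. (-1) ^ a * monom_at w is * dtens I F is (\<lambda>i. z i - (x i + t * w i)))"

lemma line_deriv_has_derivative:
  "(line_deriv x w a z has_real_derivative line_deriv x w (Suc a) z t) (at t)"
proof -
  have "((\<lambda>t. \<Sum>is\<in>words I a. (-1) ^ a * monom_at w is * dtens I F is (\<lambda>i. z i - (x i + t * w i)))
      has_real_derivative (\<Sum>is\<in>words I a. (-1) ^ a * monom_at w is *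
        (\<Sum>j\<in>I. - w j * dtens I F (j # is) (\<lambda>i. z i - (x i + t * w i))))) (at t)"
  proof (intro DERIV_sum DERIV_cmult)
    fix "is" assume "is \<in> words I a"
    show "((\<lambda>t. dtens I F is (\<lambda>i. z i - (x i + t * w i))) has_real_derivative
        (\<Sum>j\<in>I. - w j * dtens I F (j # is) (\<lambda>i. z i - (x i + t * w i)))) (at t)"
      by (rule tens_has_derivative[OF finI smoothF]) (auto intro!: derivative_eq_intros)
  qed
  also have "(\<Sum>is\<in>words I a. (-1) ^ a * monom_at w is *
        (\<Sum>j\<in>I. - w j * dtens I F (j # is) (\<lambda>i. z i - (x i + t * w i)))) = line_deriv x w (Suc a) z t"
    unfolding line_deriv_def sum_words_Suc[OF finI] sum_distrib_left
    by (intro sum.cong) (auto simp: monom_at_def algebra_simps)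
  finally show ?thesis by (simp add: line_deriv_def [abs_def])
qed

lemma line_deriv_measurable:
  "(\<lambda>p. line_deriv x w a (snd p) (fst p)) \<in> borel_measurable (lborel \<Otimes>\<^sub>M leb I)"
  unfolding line_deriv_def
  by (intro borel_measurable_sum borel_measurable_times borel_measurable_const dtens_measurable) measurable

lemma line_deriv_bounded: "\<exists>B. \<forall>z t. \<bar>line_deriv x w a z t\<bar> \<le> B"
proof -
  have "\<forall>is. \<exists>B. \<forall>y. \<bar>dtens I F is y\<bar> \<le> B" using dtens_bounded by blast
  then obtain B where B: "\<And>is y. \<bar>dtens I F is y\<bar> \<le> B is" by metis
  have "\<bar>line_deriv x w a z t\<bar> \<le> (\<Sum>is\<in>words I a. \<bar>monom_at w is\<bar> * B is)" for z t
    unfolding line_deriv_def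
    by (rule order.trans[OF sum_abs sum_mono]) (auto simp: abs_mult intro!: mult_left_mono B)
  then show ?thesis by blast
qed

lemma line_deriv_integrable:
  assumes v: "integrable (leb I) v"
  shows "integrable (leb I) (\<lambda>z. v z * dtens I F is (\<lambda>i. z i - y i))"
proof -
  obtain B where B: "\<And>y. \<bar>dtens I F is y\<bar> \<le> B" using dtens_bounded by blast
  have [measurable]: "(\<lambda>z. dtens I F is (\<lambda>i. z i - y i)) \<in> borel_measurable (leb I)"
    by (rule dtens_measurable) measurable
  show ?thesis
    by (rule Bochner_Integration.integrable_bound[where f = "\<lambda>z. v z * B"])
       (use v in \<open>auto simp: abs_mult intro!: mult_left_mono AE_I2 order.trans[OF B abs_ge_self]\<close>)
qed

lemma integral_line_deriv:
  assumes W: "weak_derivs I U p W" and a: "a \<le> p"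
    and supp: "PiE I (\<lambda>i. {x i + t * w i + c i - d..x i + t * w i + c i + d}) \<subseteq> U"
  shows "(\<integral>z. W [] z * line_deriv x w a z t \<partial>leb I)
    = (\<Sum>is\<in>words I a. monom_at w is * mollify I F (W is) (\<lambda>i. x i + t * w i))"
proof -
  have int: "integrable (leb I) (W [])" using W by (auto simp: weak_derivs_def)
  have "(\<integral>z. W [] z * line_deriv x w a z t \<partial>leb I) = (\<integral>z. (\<Sum>is\<in>words I a. (-1) ^ a * monom_at w is *
      (W [] z * dtens I F is (\<lambda>i. z i - (x i + t * w i)))) \<partial>leb I)"
    unfolding line_deriv_def sum_distrib_left by (simp add: mult_ac)
  also have "\<dots> = (\<Sum>is\<in>words I a. (-1) ^ a * monom_at w is *
      (\<integral>z. W [] z * dtens I F is (\<lambda>i. z i - (x i + t * w i)) \<partial>leb I))"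
    by (subst Bochner_Integration.integral_sum)
       (auto intro!: integrable_mult_right line_deriv_integrable[OF int])
  also have "\<dots> = (\<Sum>is\<in>words I a. monom_at w is * mollify I F (W is) (\<lambda>i. x i + t * w i))"
  proof (rule sum.cong[OF refl])
    fix "is" assume isw: "is \<in> words I a"
    have "(\<integral>z. W [] z * dtens I F is (\<lambda>i. z i - (x i + t * w i)) \<partial>leb I)
        = (-1) ^ a * mollify I F (W is) (\<lambda>i. x i + t * w i)"
      using integral_dtens_eq_mollify[OF W _ _ supp, of "is"] isw a by auto
    then show "(-1) ^ a * monom_at w is * (\<integral>z. W [] z * dtens I F is (\<lambda>i. z i - (x i + t * w i)) \<partial>leb I)
        = monom_at w is * mollify I F (W is) (\<lambda>i. x i + t * w i)"
      by (simp add: power_mult_distrib[symmetric] mult.assoc flip: power_add)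
  qed
  finally show ?thesis .
qed

text \<open>
  Taylor's formula in \<open>t\<close> with integral remainder holds for the kernel, pointwise in \<open>z\<close>. It is
  integrated against \<open>W []\<close>, and the definition of weak derivatives moves the derivatives from the
  kernel to \<open>W\<close>. It applies because the supports of the
  kernels along the segment lie in \<open>U\<close>.
\<close>

lemma mollify_Taylor:
  assumes W: "weak_derivs I U p W" and p: "p > 0"
    and supp: "\<And>t. t \<in> {0..1} \<Longrightarrow>
      PiE I (\<lambda>i. {x i + t * w i + c i - d..x i + t * w i + c i + d}) \<subseteq> U"
  defines "S t \<equiv> \<Sum>is\<in>words I p. monom_at w is * mollify I F (W is) (\<lambda>i. x i + t * w i)"
  shows "mollify I F (W []) (\<lambda>i. x i + w i) =
      (\<Sum>a<p. \<Sum>is\<in>words I a. monom_at w is * mollify I F (W is) x / fact a) +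
      (\<integral>t. ((1 - t) ^ (p - 1) / fact (p - 1) * S t) * indicator {0..1} t \<partial>lborel)"
proof -
  interpret S: sigma_finite_measure "leb I" by (rule leb_sigma_finite[OF finI])
  interpret pair_sigma_finite "lborel :: real measure" "leb I" by standard
  have int: "integrable (leb I) (W [])" using W by (auto simp: weak_derivs_def)
  then have [measurable]: "W [] \<in> borel_measurable (leb I)" by simp
  define k where "k t = (1 - t) ^ (p - 1) / fact (p - 1) * indicator {0..1} t" for t :: real
  have kb: "\<bar>k t\<bar> \<le> indicator {0..1} t" for t
    unfolding k_def using power_le_one[of "1 - t" "p - 1"] fact_ge_1[of "p - 1"]
    by (auto simp: abs_mult divide_le_eq split: split_indicator intro: order.trans)
  have [measurable]: "k \<in> borel_measurable borel" unfolding k_def by measurable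
  obtain B where B: "\<And>z t. \<bar>line_deriv x w p z t\<bar> \<le> B" using line_deriv_bounded by blast
  define G where "G t z = k t * (W [] z * line_deriv x w p z t)" for t z
  have pt: "line_deriv x w 0 z 1 = (\<Sum>a<p. line_deriv x w a z 0 / fact a)
      + (\<integral>t. k t * line_deriv x w p z t \<partial>lborel)" for z
  proof -
    let ?i = "\<lambda>t. ((1 - t) ^ (p - 1) / fact (p - 1)) *\<^sub>R line_deriv x w p z t"
    have "(line_deriv x w a z has_vector_derivative line_deriv x w (Suc a) z t) (at t within {0..1})" for a t
      using line_deriv_has_derivative has_real_derivative_iff_has_vector_derivative has_field_derivative_at_within
      by blast
    from Taylor_integral[of p "\<lambda>a. line_deriv x w a z" "line_deriv x w 0 z" 0 1, OF p refl this]
    have "line_deriv x w 0 z 1 = (\<Sum>a<p. line_deriv x w a z 0 / fact a) + integral {0..1} ?i"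
      by simp
    moreover have "set_integrable lborel {0..1} ?i"
      unfolding set_integrable_def
    proof (rule borel_integrable_compact[OF compact_Icc])
      have "continuous_on {0..1} (line_deriv x w p z)"
        by (meson DERIV_isCont continuous_at_imp_continuous_on line_deriv_has_derivative)
      then show "continuous_on {0..1} ?i" by (intro continuous_intros) auto
    qed
    then have "integral {0..1} ?i = (\<integral>t. k t * line_deriv x w p z t \<partial>lborel)"
      by (simp add: set_borel_integral_eq_integral(2)[symmetric] set_lebesgue_integral_def k_def mult_ac)
    ultimately show ?thesis by simp
  qed
  have k1: "integrable lborel (indicat_real {0..1::real})" by simp
  have Gint: "integrable (lborel \<Otimes>\<^sub>M leb I) (case_prod G)"
  proof (rule Bochner_Integration.integrable_bound)
    show "integrable (lborel \<Otimes>\<^sub>M leb I) (\<lambda>(t::real, z). indicator {0..1} t * (\<bar>W [] z\<bar> * B))"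
    proof (rule Fubini_integrable)
      show "integrable lborel (\<lambda>t. \<integral>z. norm (case (t::real, z) of (t, z) \<Rightarrow> indicator {0..1} t * (\<bar>W [] z\<bar> * B)) \<partial>leb I)"
        using k1 by (simp add: abs_mult)
    qed (use int in \<open>auto intro!: AE_I2 integrable_mult_right integrable_mult_left\<close>)
    show "case_prod G \<in> borel_measurable (lborel \<Otimes>\<^sub>M leb I)"
      using line_deriv_measurable[of x w p] unfolding G_def case_prod_beta by measurable
    show "AE q in lborel \<Otimes>\<^sub>M leb I. norm (case_prod G q)
        \<le> norm (case q of (t, z) \<Rightarrow> indicator {0..1} t * (\<bar>W [] z\<bar> * B))"
      using kb by (auto simp: G_def abs_mult intro!: AE_I2 mult_mono order.trans[OF B abs_ge_self]
          order.trans[OF kb abs_ge_self])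
  qed
  have "mollify I F (W []) (\<lambda>i. x i + w i) = (\<integral>z. W [] z * line_deriv x w 0 z 1 \<partial>leb I)"
    by (simp add: mollify_def kern_def line_deriv_def monom_at_def dtens_def tens_def Collect_conv_if)
  also have "\<dots> = (\<integral>z. (\<Sum>a<p. W [] z * line_deriv x w a z 0 / fact a) + (\<integral>t. G t z \<partial>lborel) \<partial>leb I)"
    unfolding pt G_def by (simp add: distrib_left sum_distrib_left mult.left_commute[of _ "W [] _"])
  also have "\<dots> = (\<integral>z. (\<Sum>a<p. W [] z * line_deriv x w a z 0 / fact a) \<partial>leb I)
      + (\<integral>z. (\<integral>t. G t z \<partial>lborel) \<partial>leb I)"
  proof (rule Bochner_Integration.integral_add)
    show "integrable (leb I) (\<lambda>z. \<Sum>a<p. W [] z * line_deriv x w a z 0 / fact a)"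
      unfolding line_deriv_def sum_distrib_left sum_divide_distrib
      using line_deriv_integrable[OF int]
      by (intro Bochner_Integration.integrable_sum) (simp add: mult.left_commute[of "W [] _"])
  qed (rule integrable_snd[OF Gint])
  also have "(\<integral>z. (\<integral>t. G t z \<partial>lborel) \<partial>leb I) = (\<integral>t. (\<integral>z. G t z \<partial>leb I) \<partial>lborel)"
    by (rule Fubini_integral[OF Gint])
  also have "\<dots> = (\<integral>t. ((1 - t) ^ (p - 1) / fact (p - 1) * S t) * indicator {0..1} t \<partial>lborel)"
  proof (rule Bochner_Integration.integral_cong[OF refl])
    fix t :: real
    show "(\<integral>z. G t z \<partial>leb I) = (1 - t) ^ (p - 1) / fact (p - 1) * S t * indicator {0..1} t"
      using integral_line_deriv[OF W order.refl supp[of t]]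
      by (cases "t \<in> {0..1}") (simp_all add: G_def k_def S_def)
  qed
  also have "(\<integral>z. (\<Sum>a<p. W [] z * line_deriv x w a z 0 / fact a) \<partial>leb I)
      = (\<Sum>a<p. (\<integral>z. W [] z * line_deriv x w a z 0 \<partial>leb I) / fact a)"
    by (subst Bochner_Integration.integral_sum)
       (auto simp: line_deriv_def sum_distrib_left mult.left_commute[of "W [] _"]
         intro!: Bochner_Integration.integrable_sum integrable_mult_right integrable_divide line_deriv_integrable[OF int])
  also have "\<dots> = (\<Sum>a<p. \<Sum>is\<in>words I a. monom_at w is * mollify I F (W is) x / fact a)"
    using integral_line_deriv[OF W _ supp[of 0]] by (intro sum.cong) (auto simp: sum_divide_distrib)
  finally show ?thesis .
qed

end

section \<open>Continuity of translations\<close>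

definition shift_dist :: "'i set \<Rightarrow> (('i \<Rightarrow> real) \<Rightarrow> real) \<Rightarrow> ('i \<Rightarrow> real) \<Rightarrow> ennreal" where
  "shift_dist I u y = (\<integral>\<^sup>+x. ennreal ((u (\<lambda>i\<in>I. x i + y i) - u x)\<^sup>2) \<partial>leb I)"

text \<open>
  Formulated with sequences, which suffices for the uniform version below and allows dominated
  convergence to be applied.
\<close>

definition shift_continuous :: "'i set \<Rightarrow> (('i \<Rightarrow> real) \<Rightarrow> real) \<Rightarrow> bool" where
  "shift_continuous I u \<longleftrightarrow>
     (\<forall>y. (\<forall>i\<in>I. (\<lambda>n. y n i) \<longlonglongrightarrow> 0) \<longrightarrow> (\<lambda>n::nat. shift_dist I u (y n)) \<longlonglongrightarrow> 0)"

lemma shift_measurable: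
  assumes "u \<in> borel_measurable (leb I)"
  shows "(\<lambda>x. u (\<lambda>i\<in>I. x i + y i)) \<in> borel_measurable (leb I)"
  by (rule measurable_compose[OF _ assms]) measurable

lemma square_add_le: "((a::real) + b)\<^sup>2 \<le> 2 * a\<^sup>2 + 2 * b\<^sup>2"
  using zero_le_power2[of "a - b"] by (simp add: power2_eq_square algebra_simps)

lemma nn_integral_square_add_le:
  fixes f g :: "'a \<Rightarrow> real"
  assumes [measurable]: "f \<in> borel_measurable M" "g \<in> borel_measurable M"
  shows "(\<integral>\<^sup>+x. ennreal ((f x + g x)\<^sup>2) \<partial>M)
    \<le> 2 * (\<integral>\<^sup>+x. ennreal ((f x)\<^sup>2) \<partial>M) + 2 * (\<integral>\<^sup>+x. ennreal ((g x)\<^sup>2) \<partial>M)"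
proof -
  have "(\<integral>\<^sup>+x. ennreal ((f x + g x)\<^sup>2) \<partial>M)
      \<le> (\<integral>\<^sup>+x. 2 * ennreal ((f x)\<^sup>2) + 2 * ennreal ((g x)\<^sup>2) \<partial>M)"
  proof (intro nn_integral_mono)
    fix x
    have "ennreal ((f x + g x)\<^sup>2) \<le> ennreal (2 * (f x)\<^sup>2 + 2 * (g x)\<^sup>2)"
      by (intro ennreal_leI square_add_le)
    then show "ennreal ((f x + g x)\<^sup>2) \<le> 2 * ennreal ((f x)\<^sup>2) + 2 * ennreal ((g x)\<^sup>2)"
      by (simp add: ennreal_mult'')
  qed
  then show ?thesis by (simp add: nn_integral_add nn_integral_cmult)
qed

lemma ennreal_tendsto_0_squeeze:
  fixes a b :: "nat \<Rightarrow> ennreal"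
  assumes "\<And>n. a n \<le> b n" "b \<longlonglongrightarrow> 0" shows "a \<longlonglongrightarrow> 0"
  by (rule tendsto_sandwich[OF _ _ tendsto_const assms(2)]) (use assms(1) in auto)

lemma shift_continuous_add:
  assumes u: "shift_continuous I u" "u \<in> borel_measurable (leb I)"
    and v: "shift_continuous I v" "v \<in> borel_measurable (leb I)"
  shows "shift_continuous I (\<lambda>x. u x + v x)"
  unfolding shift_continuous_def
proof (intro allI impI)
  fix y :: "nat \<Rightarrow> 'a \<Rightarrow> real" assume y: "\<forall>i\<in>I. (\<lambda>n. y n i) \<longlonglongrightarrow> 0"
  note [measurable] = u(2) v(2) shift_measurable[OF u(2)] shift_measurable[OF v(2)]
  show "(\<lambda>n. shift_dist I (\<lambda>x. u x + v x) (y n)) \<longlonglongrightarrow> 0"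
  proof (rule ennreal_tendsto_0_squeeze)
    fix n
    have "shift_dist I (\<lambda>x. u x + v x) (y n) = (\<integral>\<^sup>+x. ennreal (((u (\<lambda>i\<in>I. x i + y n i) - u x)
        + (v (\<lambda>i\<in>I. x i + y n i) - v x))\<^sup>2) \<partial>leb I)"
      unfolding shift_dist_def by (simp add: algebra_simps)
    also have "\<dots> \<le> 2 * shift_dist I u (y n) + 2 * shift_dist I v (y n)"
      unfolding shift_dist_def by (rule nn_integral_square_add_le) measurable
    finally show "shift_dist I (\<lambda>x. u x + v x) (y n) \<le> 2 * shift_dist I u (y n) + 2 * shift_dist I v (y n)" .
  next
    have "(\<lambda>n. 2 * shift_dist I u (y n) + 2 * shift_dist I v (y n)) \<longlonglongrightarrow> 2 * 0 + 2 * 0"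
      using u v y unfolding shift_continuous_def by (intro tendsto_intros tendsto_mult_ennreal) auto
    then show "(\<lambda>n. 2 * shift_dist I u (y n) + 2 * shift_dist I v (y n)) \<longlonglongrightarrow> 0" by simp
  qed
qed

lemma shift_continuous_cmult:
  assumes u: "shift_continuous I u" "u \<in> borel_measurable (leb I)"
  shows "shift_continuous I (\<lambda>x. c * u x)"
  unfolding shift_continuous_def
proof (intro allI impI)
  fix y :: "nat \<Rightarrow> 'a \<Rightarrow> real" assume y: "\<forall>i\<in>I. (\<lambda>n. y n i) \<longlonglongrightarrow> 0"
  note [measurable] = u(2) shift_measurable[OF u(2)]
  have "shift_dist I (\<lambda>x. c * u x) (y n) = ennreal (c\<^sup>2) * shift_dist I u (y n)" for n
    unfolding shift_dist_def
    by (subst nn_integral_cmult[symmetric])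
       (auto simp: ennreal_mult[symmetric] power_mult_distrib[symmetric] right_diff_distrib)
  moreover have "(\<lambda>n. ennreal (c\<^sup>2) * shift_dist I u (y n)) \<longlonglongrightarrow> ennreal (c\<^sup>2) * 0"
    using u y unfolding shift_continuous_def by (intro tendsto_mult_ennreal) auto
  ultimately show "(\<lambda>n. shift_dist I (\<lambda>x. c * u x) (y n)) \<longlonglongrightarrow> 0" by simp
qed

lemma shift_continuous_sum:
  assumes "finite A" "\<And>a. a \<in> A \<Longrightarrow> shift_continuous I (u a)" "\<And>a. a \<in> A \<Longrightarrow> u a \<in> borel_measurable (leb I)"
  shows "shift_continuous I (\<lambda>x. \<Sum>a\<in>A. u a x)"
  using assms
proof (induction A rule: finite_induct)
  case empty
  then show ?case by (simp add: shift_continuous_def shift_dist_def)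
next
  case (insert a A)
  then show ?case by (auto intro!: shift_continuous_add borel_measurable_sum)
qed

text \<open>
  Translations are isometries of \<open>L\<^sup>2\<close>, so the distance of \<open>v\<close> to its translates is bounded by
  multiples of that of \<open>u k\<close> and of the distance between \<open>u k\<close> and \<open>v\<close>.
\<close>

lemma shift_continuous_limit:
  assumes I: "finite I" and u: "\<And>k::nat. shift_continuous I (u k)" "\<And>k. u k \<in> borel_measurable (leb I)"
    and v: "v \<in> borel_measurable (leb I)"
    and lim: "(\<lambda>k. \<integral>\<^sup>+x. ennreal ((u k x - v x)\<^sup>2) \<partial>leb I) \<longlonglongrightarrow> 0"
  shows "shift_continuous I v"
  unfolding shift_continuous_def
proof (intro allI impI)
  fix y :: "nat \<Rightarrow> 'a \<Rightarrow> real" assume y: "\<forall>i\<in>I. (\<lambda>n. y n i) \<longlonglongrightarrow> 0"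
  note [measurable] = u(2) v shift_measurable[OF u(2)] shift_measurable[OF v]
  define E where "E k = (\<integral>\<^sup>+x. ennreal ((u k x - v x)\<^sup>2) \<partial>leb I)" for k
  have bound: "shift_dist I v (y n) \<le> 6 * E k + 4 * shift_dist I (u k) (y n)" for n k
  proof -
    have "(\<integral>\<^sup>+x. ennreal ((u k (\<lambda>i\<in>I. x i + y n i) - v (\<lambda>i\<in>I. x i + y n i))\<^sup>2) \<partial>leb I) = E k"
      unfolding E_def
      by (rule nn_integral_leb_translate[OF I, of "\<lambda>x. ennreal ((u k x - v x)\<^sup>2)"]) measurable
    then have E': "(\<integral>\<^sup>+x. ennreal ((v (\<lambda>i\<in>I. x i + y n i) - u k (\<lambda>i\<in>I. x i + y n i))\<^sup>2) \<partial>leb I) = E k"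
      by (simp add: power2_commute)
    have "shift_dist I v (y n) = (\<integral>\<^sup>+x. ennreal (((v (\<lambda>i\<in>I. x i + y n i) - u k (\<lambda>i\<in>I. x i + y n i))
        + ((u k (\<lambda>i\<in>I. x i + y n i) - u k x) + (u k x - v x)))\<^sup>2) \<partial>leb I)"
      unfolding shift_dist_def by simp
    also have "\<dots> \<le> 2 * E k + 2 * (\<integral>\<^sup>+x. ennreal (((u k (\<lambda>i\<in>I. x i + y n i) - u k x) + (u k x - v x))\<^sup>2) \<partial>leb I)"
      unfolding E'[symmetric] by (rule nn_integral_square_add_le) measurable
    also have "\<dots> \<le> 2 * E k + 2 * (2 * shift_dist I (u k) (y n) + 2 * E k)"
      unfolding E_def shift_dist_def by (intro add_mono mult_left_mono nn_integral_square_add_le) auto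
    also have "\<dots> = 6 * E k + 4 * shift_dist I (u k) (y n)"
      by (simp add: distrib_left mult.assoc[symmetric] add.assoc[symmetric])
         (simp add: ring_distribs[symmetric] add.commute add.left_commute flip: numeral_add)
    finally show ?thesis .
  qed
  show "(\<lambda>n. shift_dist I v (y n)) \<longlonglongrightarrow> 0"
  proof (rule order_tendstoI)
    fix e :: ennreal assume e: "0 < e"
    have "(\<lambda>k. 6 * E k) \<longlonglongrightarrow> 6 * 0" using lim unfolding E_def by (intro tendsto_mult_ennreal) auto
    then have "\<forall>\<^sub>F k in sequentially. 6 * E k < e / 2" using e
      by (intro order_tendstoD(2)) (auto simp: ennreal_zero_less_divide)
    then obtain k where k: "6 * E k < e / 2" by (auto simp: eventually_sequentially)
    have "(\<lambda>n. 4 * shift_dist I (u k) (y n)) \<longlonglongrightarrow> 4 * 0"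
      using u(1)[of k] y unfolding shift_continuous_def by (intro tendsto_mult_ennreal) auto
    then have "\<forall>\<^sub>F n in sequentially. 4 * shift_dist I (u k) (y n) < e / 2" using e
      by (intro order_tendstoD(2)) (auto simp: ennreal_zero_less_divide)
    then show "\<forall>\<^sub>F n in sequentially. shift_dist I v (y n) < e"
    proof eventually_elim
      case (elim n)
      have "shift_dist I v (y n) \<le> 6 * E k + 4 * shift_dist I (u k) (y n)" by (rule bound)
      also have "\<dots> < e / 2 + e / 2" using k elim by (rule add_strict_mono)
      finally show ?case by (simp add: mult_2[symmetric] ennreal_times_divide mult.commute[of 2 e] mult_divide_eq_ennreal)
    qed
  qed simp
qed

lemma AE_leb_component_neq:
  assumes I: "finite I" "i \<in> I"
  shows "AE x in leb I. x i \<noteq> a"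
proof -
  interpret product_sigma_finite "\<lambda>_. lborel :: real measure" by standard
  have "emeasure (leb I) (PiE I (\<lambda>j. if j = i then {a} else UNIV)) = 0"
    using I by (subst emeasure_PiM) (auto intro!: prod_zero bexI[of _ i])
  then have "PiE I (\<lambda>j. if j = i then {a} else UNIV) \<in> null_sets (leb I)"
    using I by (intro null_setsI sets_PiM_I_finite) auto
  then show ?thesis
    by (rule AE_I') (auto simp: space_leb PiE_iff extensional_def)
qed

definition open_box :: "'i set \<Rightarrow> ('i \<Rightarrow> real) \<Rightarrow> ('i \<Rightarrow> real) \<Rightarrow> ('i \<Rightarrow> real) set" where
  "open_box I a b = PiE I (\<lambda>i. {a i<..<b i})"

lemma open_box_sets: "finite I \<Longrightarrow> open_box I a b \<in> sets (leb I)"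
  unfolding open_box_def by (intro sets_PiM_I_finite) auto

lemma emeasure_open_box_finite: "finite I \<Longrightarrow> emeasure (leb I) (open_box I a b) < \<infinity>"
proof -
  interpret product_sigma_finite "\<lambda>_. lborel :: real measure" by standard
  assume I: "finite I"
  have "emeasure lborel {a i<..<b i} \<noteq> \<infinity>" for i
    by (cases "a i \<le> b i") auto
  then show ?thesis unfolding open_box_def
    using I by (subst emeasure_PiM) (auto simp: ennreal_prod_eq_top less_top[symmetric])
qed

text \<open>The indicator functions converge pointwise off the faces of the box, which form a null set.\<close>

lemma shift_continuous_open_box:
  assumes I: "finite I"
  shows "shift_continuous I (indicator (open_box I a b))"
  unfolding shift_continuous_def
proof (intro allI impI)
  fix y :: "nat \<Rightarrow> 'a \<Rightarrow> real" assume y: "\<forall>i\<in>I. (\<lambda>n. y n i) \<longlonglongrightarrow> 0"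
  let ?B = "open_box I a b"
  have "\<exists>K. \<forall>n. \<bar>y n i\<bar> \<le> K" if "i \<in> I" for i
  proof -
    have "Bseq (\<lambda>n. y n i)"
      using y that by (intro convergent_imp_Bseq) (auto intro: convergentI)
    then show ?thesis by (auto simp: Bseq_def)
  qed
  then obtain K where K: "\<And>i n. i \<in> I \<Longrightarrow> \<bar>y n i\<bar> \<le> K i" by metis
  let ?D = "open_box I (\<lambda>i. a i - K i) (\<lambda>i. b i + K i)"
  note [measurable] = open_box_sets[OF I]
  have [measurable]: "(\<lambda>x. indicat_real ?B (\<lambda>i\<in>I. x i + y n i)) \<in> borel_measurable (leb I)" for n
    by (rule shift_measurable) measurable
  have "(\<lambda>n. shift_dist I (indicator ?B) (y n)) \<longlonglongrightarrow> (\<integral>\<^sup>+x. 0 \<partial>leb I)"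
    unfolding shift_dist_def
  proof (rule nn_integral_dominated_convergence)
    show "(\<integral>\<^sup>+x. indicator (?D \<union> ?B) x \<partial>leb I) < \<infinity>"
      using emeasure_open_box_finite[OF I]
      by (simp add: order.strict_trans1[OF emeasure_subadditive])
    show "AE x in leb I. ennreal ((indicat_real ?B (\<lambda>i\<in>I. x i + y n i) - indicat_real ?B x)\<^sup>2)
        \<le> indicator (?D \<union> ?B) x" for n
    proof (rule AE_I2)
      fix x assume x: "x \<in> space (leb I)"
      have "x \<in> ?D" if m: "(\<lambda>i\<in>I. x i + y n i) \<in> ?B"
        unfolding open_box_def
      proof (rule PiE_I)
        fix i assume i: "i \<in> I"
        then have "a i < x i + y n i \<and> x i + y n i < b i"
          using m by (auto simp: open_box_def PiE_iff dest: bspec[of I _ i])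
        then show "x i \<in> {a i - K i<..<b i + K i}" using K[OF i, of n] by (auto simp: abs_le_iff)
      qed (use x in \<open>auto simp: space_leb\<close>)
      then show "ennreal ((indicat_real ?B (\<lambda>i\<in>I. x i + y n i) - indicat_real ?B x)\<^sup>2)
        \<le> indicator (?D \<union> ?B) x"
        by (auto split: split_indicator)
    qed
    have "AE x in leb I. \<forall>i\<in>I. x i \<noteq> a i \<and> x i \<noteq> b i"
      using AE_leb_component_neq[OF I] by (intro AE_finite_allI[OF I]) auto
    then show "AE x in leb I. (\<lambda>n. ennreal ((indicat_real ?B (\<lambda>i\<in>I. x i + y n i) - indicat_real ?B x)\<^sup>2))
        \<longlonglongrightarrow> 0"
    proof (rule AE_mp, intro AE_I2 impI)
      fix x assume x: "x \<in> space (leb I)" and ne: "\<forall>i\<in>I. x i \<noteq> a i \<and> x i \<noteq> b i"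
      have lim: "(\<lambda>n. x i + y n i) \<longlonglongrightarrow> x i" if "i \<in> I" for i
        using tendsto_add[OF tendsto_const y[rule_format, OF that], of "x i"] by simp
      have "\<forall>\<^sub>F n in sequentially. ((\<lambda>i\<in>I. x i + y n i) \<in> ?B \<longleftrightarrow> x \<in> ?B)"
      proof (cases "x \<in> ?B")
        case True
        then have "\<forall>i\<in>I. \<forall>\<^sub>F n in sequentially. a i < x i + y n i \<and> x i + y n i < b i"
          using lim by (auto simp: open_box_def PiE_iff intro!: eventually_conj order_tendstoD)
        then have "\<forall>\<^sub>F n in sequentially. \<forall>i\<in>I. a i < x i + y n i \<and> x i + y n i < b i"
          using I by (simp add: eventually_ball_finite)
        then show ?thesis by eventually_elim (use True in \<open>auto simp: open_box_def\<close>)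
      next
        case False
        then obtain i where i: "i \<in> I" "x i < a i \<or> x i > b i"
          using x ne by (fastforce simp: open_box_def space_leb PiE_iff)
        then have "\<forall>\<^sub>F n in sequentially. x i + y n i < a i \<or> x i + y n i > b i"
          using order_tendstoD(1)[OF lim[OF i(1)], of "b i"] order_tendstoD(2)[OF lim[OF i(1)], of "a i"] i(2)
          by (auto elim: eventually_mono)
        then show ?thesis
        proof eventually_elim
          case (elim n)
          have "(\<lambda>i\<in>I. x i + y n i) i \<in> {a i<..<b i}" if "(\<lambda>i\<in>I. x i + y n i) \<in> ?B"
            using that i(1) unfolding open_box_def by (rule PiE_mem)
          then show ?case using False i(1) elim by auto
        qed
      qed
      then show "(\<lambda>n. ennreal ((indicat_real ?B (\<lambda>i\<in>I. x i + y n i) - indicat_real ?B x)\<^sup>2)) \<longlonglongrightarrow> 0"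
        by (rule tendsto_eventually[OF eventually_mono]) (auto split: split_indicator)
    qed
  qed measurable
  then show "(\<lambda>n. shift_dist I (indicator ?B) (y n)) \<longlonglongrightarrow> 0" by simp
qed


lemma sets_leb_eq_open_boxes:
  assumes I: "finite I"
  shows "sets (leb I) = sigma_sets (PiE I (\<lambda>_. UNIV)) {open_box I a b | a b. True}" (is "_ = sigma_sets ?\<Omega> ?G")
proof
  have G: "?G \<subseteq> Pow ?\<Omega>" by (auto simp: open_box_def PiE_iff)
  let ?S = "sigma ?\<Omega> ?G"
  have sp: "space ?S = ?\<Omega>" and st: "sets ?S = sigma_sets ?\<Omega> ?G" using G by auto
  have comp: "(\<lambda>f. f i) \<in> borel_measurable ?S" if i: "i \<in> I" for i
  proof (rule borel_measurableI_less)
    fix s :: real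
    have "{f \<in> space ?S. f i < s}
        = (\<Union>n::nat. open_box I (\<lambda>_. - real n) (\<lambda>j. if j = i then s else real n))"
    proof (intro equalityI subsetI)
      fix f assume f: "f \<in> {f \<in> space ?S. f i < s}"
      obtain n :: nat where n: "(\<Sum>j\<in>I. \<bar>f j\<bar>) < real n" using reals_Archimedean2 by blast
      have "\<bar>f j\<bar> < real n" if "j \<in> I" for j
        using member_le_sum[OF that, of "\<lambda>j. \<bar>f j\<bar>"] I n by simp
      then have "f \<in> open_box I (\<lambda>_. - real n) (\<lambda>j. if j = i then s else real n)"
        using f[unfolded sp] by (auto simp: open_box_def PiE_iff abs_less_iff minus_less_iff)
      then show "f \<in> (\<Union>n::nat. open_box I (\<lambda>_. - real n) (\<lambda>j. if j = i then s else real n))" by blast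
    next
      fix f assume "f \<in> (\<Union>n::nat. open_box I (\<lambda>_. - real n) (\<lambda>j. if j = i then s else real n))"
      then obtain n :: nat where f: "f \<in> open_box I (\<lambda>_. - real n) (\<lambda>j. if j = i then s else real n)" by blast
      then have "f i < s" using i by (force simp: open_box_def PiE_iff)
      with f show "f \<in> {f \<in> space ?S. f i < s}" unfolding sp by (auto simp: open_box_def PiE_iff)
    qed
    also have "\<dots> \<in> sets ?S" unfolding st by (intro sigma_sets.Union sigma_sets.Basic) blast
    finally show "{f \<in> space ?S. f i < s} \<in> sets ?S" .
  qed
  show "sets (leb I) \<subseteq> sigma_sets ?\<Omega> ?G"
    unfolding sets_PiM_single space_lborel space_borel
  proof (rule sigma_sets_mono, safe)
    fix i and A :: "real set" assume i: "i \<in> I" and A: "A \<in> sets lborel"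
    have "(\<lambda>f. f i) -` A \<inter> space ?S \<in> sets ?S"
      using comp[OF i] A by (intro measurable_sets) auto
    also have "(\<lambda>f. f i) -` A \<inter> space ?S = {f \<in> I \<rightarrow>\<^sub>E UNIV. f i \<in> A}" unfolding sp by auto
    finally show "{f \<in> I \<rightarrow>\<^sub>E UNIV. f i \<in> A} \<in> sigma_sets ?\<Omega> ?G" unfolding st .
  qed
  show "sigma_sets ?\<Omega> ?G \<subseteq> sets (leb I)"
    using sets.sigma_sets_subset[of ?G "leb I"] open_box_sets[OF I] by (auto simp: space_leb)
qed

lemma open_box_Int: "open_box I a b \<inter> open_box I a' b'
    = open_box I (\<lambda>i. max (a i) (a' i)) (\<lambda>i. min (b i) (b' i))"
  by (auto simp: open_box_def PiE_iff)

text \<open>By Dynkin's lemma it is enough to consider open boxes.\<close>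

lemma shift_continuous_indicator:
  assumes I: "finite I" and S: "S \<in> sets (leb I)"
  shows "shift_continuous I (indicator (S \<inter> open_box I a b))"
proof -
  let ?\<Omega> = "PiE I (\<lambda>_. UNIV) :: ('a \<Rightarrow> real) set" and ?G = "{open_box I a b | a b. True}"
  let ?B = "open_box I a b"
  note [measurable] = open_box_sets[OF I]
  have stable: "Int_stable ?G" by (auto simp: Int_stable_def open_box_Int) blast
  have sub: "?G \<subseteq> Pow ?\<Omega>" by (auto simp: open_box_def PiE_iff)
  have Bsub: "?B \<subseteq> ?\<Omega>" by (auto simp: open_box_def PiE_iff)
  have mem: "S \<in> sigma_sets ?\<Omega> ?G" using S sets_leb_eq_open_boxes[OF I] by simp
  have meas: "A \<in> sets (leb I)" if "A \<in> sigma_sets ?\<Omega> ?G" for A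
    using that sets_leb_eq_open_boxes[OF I] by simp
  from stable sub mem show ?thesis
  proof (induction rule: sigma_sets_induct_disjoint)
    case (basic A)
    then show ?case by (auto simp: open_box_Int intro!: shift_continuous_open_box[OF I])
  next
    case empty
    show ?case by (simp add: shift_continuous_def shift_dist_def)
  next
    case (compl A)
    note [measurable] = meas[OF compl(1)]
    have "indicat_real ((?\<Omega> - A) \<inter> ?B) = (\<lambda>x. indicator ?B x + (-1) * indicator (A \<inter> ?B) x)"
      using Bsub by (auto simp: fun_eq_iff split: split_indicator)
    moreover have "shift_continuous I (\<lambda>x. indicator ?B x + (-1) * indicator (A \<inter> ?B) x)"
      by (intro shift_continuous_add shift_continuous_cmult shift_continuous_open_box I compl) measurable
    ultimately show ?case by simp
  next
    case (union A)
    have A[measurable]: "A i \<in> sets (leb I)" for i using union(2) by (intro meas) blast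
    let ?u = "\<lambda>k x. \<Sum>i<k. indicat_real (A i \<inter> ?B) x"
    have u_eq: "?u k x = indicator ((\<Union>i<k. A i) \<inter> ?B) x" for k x
    proof -
      have "disjoint_family_on (\<lambda>i. A i \<inter> ?B) {..<k}"
        using union(1) by (auto simp: disjoint_family_on_def)
      then have "indicat_real (\<Union>i<k. A i \<inter> ?B) x = ?u k x"
        by (intro indicator_UN_disjoint) auto
      then show ?thesis by simp
    qed
    show ?case
    proof (rule shift_continuous_limit[OF I])
      show "shift_continuous I (?u k)" for k by (intro shift_continuous_sum union) auto
      have "(\<lambda>k. \<integral>\<^sup>+x. ennreal ((?u k x - indicat_real ((\<Union>i. A i) \<inter> ?B) x)\<^sup>2) \<partial>leb I)
          \<longlonglongrightarrow> (\<integral>\<^sup>+x. 0 \<partial>leb I)"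
      proof (rule nn_integral_dominated_convergence)
        show "(\<integral>\<^sup>+x. indicator ?B x \<partial>leb I) < \<infinity>"
          using emeasure_open_box_finite[OF I] by simp
        show "AE x in leb I. ennreal ((?u k x - indicat_real ((\<Union>i. A i) \<inter> ?B) x)\<^sup>2) \<le> indicator ?B x" for k
          unfolding u_eq by (auto split: split_indicator)
        show "AE x in leb I. (\<lambda>k. ennreal ((?u k x - indicat_real ((\<Union>i. A i) \<inter> ?B) x)\<^sup>2)) \<longlonglongrightarrow> 0"
        proof (rule AE_I2)
          fix x
          have "\<forall>\<^sub>F k in sequentially. ((\<exists>i<k. x \<in> A i) \<longleftrightarrow> (\<exists>i. x \<in> A i))"
          proof (cases "\<exists>i. x \<in> A i")
            case True
            then obtain i where "x \<in> A i" by blast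
            then show ?thesis by (intro eventually_mono[OF eventually_gt_at_top[of i]]) blast
          qed auto
          then show "(\<lambda>k. ennreal ((?u k x - indicat_real ((\<Union>i. A i) \<inter> ?B) x)\<^sup>2)) \<longlonglongrightarrow> 0"
            unfolding u_eq by (rule tendsto_eventually[OF eventually_mono]) (auto split: split_indicator)
        qed
      qed measurable
      then show "(\<lambda>k. \<integral>\<^sup>+x. ennreal ((?u k x - indicat_real ((\<Union>i. A i) \<inter> ?B) x)\<^sup>2) \<partial>leb I) \<longlonglongrightarrow> 0"
        by simp
    qed measurable
  qed
qed

text \<open>Simple functions are dense in \<open>L\<^sup>2\<close>.\<close>

lemma shift_continuous_L2:
  assumes I: "finite I" and u[measurable]: "u \<in> borel_measurable (leb I)"
    and fin: "(\<integral>\<^sup>+x. ennreal ((u x)\<^sup>2) \<partial>leb I) < \<infinity>"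
    and supp: "\<And>x. x \<in> space (leb I) \<Longrightarrow> x \<notin> open_box I a b \<Longrightarrow> u x = 0"
  shows "shift_continuous I u"
proof -
  note [measurable] = open_box_sets[OF I]
  obtain s where "(\<forall>k. simple_function (leb I) (s k)) \<and> (\<forall>x\<in>space (leb I). (\<lambda>k. s k x) \<longlonglongrightarrow> u x)
      \<and> (\<forall>k. \<forall>x\<in>space (leb I). dist (s k x) 0 \<le> 2 * dist (u x) 0)"
    using borel_measurable_implies_sequence_metric[OF u, of 0] ..
  then have s: "\<And>k. simple_function (leb I) (s k)"
    and lim: "\<And>x. x \<in> space (leb I) \<Longrightarrow> (\<lambda>k. s k x) \<longlonglongrightarrow> u x"
    and bnd: "\<And>k x. x \<in> space (leb I) \<Longrightarrow> \<bar>s k x\<bar> \<le> 2 * \<bar>u x\<bar>"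
    by (simp_all add: dist_real_def)
  let ?s = "\<lambda>k x. \<Sum>c\<in>s k ` space (leb I). c * indicator ((s k -` {c} \<inter> space (leb I)) \<inter> open_box I a b) x"
  have s_eq: "?s k x = s k x" if x: "x \<in> space (leb I)" for k x
  proof (cases "x \<in> open_box I a b")
    case True
    then have "?s k x = (\<Sum>c\<in>s k ` space (leb I). if c = s k x then c else 0)"
      using x by (intro sum.cong) (auto split: split_indicator)
    then show ?thesis using x s[of k] by (simp add: simple_function_def sum.delta)
  next
    case False
    then show ?thesis using bnd[OF x, of k] supp[OF x] by simp
  qed
  have meas: "s k -` {c} \<inter> space (leb I) \<in> sets (leb I)" for k c
    by (rule simple_functionD(2)[OF s])
  show ?thesis
  proof (rule shift_continuous_limit[OF I _ _ u])
    show "shift_continuous I (?s k)" for k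
      using s[of k] meas
      by (intro shift_continuous_sum shift_continuous_cmult shift_continuous_indicator I)
         (auto simp: simple_function_def)
    show "?s k \<in> borel_measurable (leb I)" for k using meas by measurable
    have [measurable]: "s k \<in> borel_measurable (leb I)" for k
      using s by (rule borel_measurable_simple_function)
    have "(\<lambda>k. \<integral>\<^sup>+x. ennreal ((s k x - u x)\<^sup>2) \<partial>leb I) \<longlonglongrightarrow> (\<integral>\<^sup>+x. 0 \<partial>leb I)"
    proof (rule nn_integral_dominated_convergence)
      show "(\<integral>\<^sup>+x. 9 * ennreal ((u x)\<^sup>2) \<partial>leb I) < \<infinity>"
        using fin by (simp add: nn_integral_cmult ennreal_mult_less_top)
      show "AE x in leb I. ennreal ((s k x - u x)\<^sup>2) \<le> 9 * ennreal ((u x)\<^sup>2)" for k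
      proof (rule AE_I2)
        fix x assume "x \<in> space (leb I)"
        then have "\<bar>s k x - u x\<bar> \<le> 3 * \<bar>u x\<bar>" using bnd[of x k] by linarith
        then have "(s k x - u x)\<^sup>2 \<le> (3 * u x)\<^sup>2" by (intro abs_le_square_iff[THEN iffD1]) (simp add: abs_mult)
        then have "ennreal ((s k x - u x)\<^sup>2) \<le> ennreal (9 * (u x)\<^sup>2)"
          by (intro ennreal_leI) (simp add: power_mult_distrib)
        then show "ennreal ((s k x - u x)\<^sup>2) \<le> 9 * ennreal ((u x)\<^sup>2)" by (simp add: ennreal_mult'')
      qed
      show "AE x in leb I. (\<lambda>k. ennreal ((s k x - u x)\<^sup>2)) \<longlonglongrightarrow> 0"
      proof (rule AE_I2)
        fix x assume "x \<in> space (leb I)"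
        from tendsto_power[OF tendsto_diff[OF lim[OF this] tendsto_const], of "u x" 2]
        have "(\<lambda>k. (s k x - u x)\<^sup>2) \<longlonglongrightarrow> 0" by simp
        then show "(\<lambda>k. ennreal ((s k x - u x)\<^sup>2)) \<longlonglongrightarrow> 0"
          using tendsto_ennrealI by fastforce
      qed
    qed measurable
    moreover have "(\<integral>\<^sup>+x. ennreal ((?s k x - u x)\<^sup>2) \<partial>leb I) = (\<integral>\<^sup>+x. ennreal ((s k x - u x)\<^sup>2) \<partial>leb I)" for k
      by (intro nn_integral_cong) (simp only: s_eq)
    ultimately show "(\<lambda>k. \<integral>\<^sup>+x. ennreal ((?s k x - u x)\<^sup>2) \<partial>leb I) \<longlonglongrightarrow> 0" by simp
  qed
qed

lemma shift_continuous_uniform: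
  assumes u: "shift_continuous I u" and e: "e > 0"
  obtains r where "r > 0" "\<And>y. (\<And>i. i \<in> I \<Longrightarrow> \<bar>y i\<bar> \<le> r) \<Longrightarrow> shift_dist I u y \<le> e"
proof (rule ccontr)
  assume "\<not> thesis"
  then have "\<forall>n::nat. \<exists>y. (\<forall>i\<in>I. \<bar>y i\<bar> \<le> 1 / real (Suc n)) \<and> shift_dist I u y > e"
    using that by (metis not_le zero_less_divide_1_iff of_nat_0_less_iff zero_less_Suc)
  then obtain y where y: "\<And>n i. i \<in> I \<Longrightarrow> \<bar>y n i\<bar> \<le> 1 / real (Suc n)" "\<And>n. shift_dist I u (y n) > e"
    by metis
  have "(\<lambda>n. y n i) \<longlonglongrightarrow> 0" if "i \<in> I" for i
    by (rule Lim_null_comparison[OF _ LIMSEQ_Suc[OF lim_1_over_n]])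
       (use y(1)[OF that] in auto)
  then have "(\<lambda>n. shift_dist I u (y n)) \<longlonglongrightarrow> 0" using u unfolding shift_continuous_def by blast
  then have "\<forall>\<^sub>F n in sequentially. shift_dist I u (y n) < e" using e by (rule order_tendstoD)
  then show False using y(2) by (auto simp: eventually_sequentially dest: order.asym)
qed

text \<open>
  The difference is an average of differences of \<open>v\<close> and its translates over the support of the
  kernel, so Jensen's inequality applies.
\<close>

lemma (in mollifier) mollify_close:
  assumes v: "integrable (leb I) v"
    and e: "\<And>y. (\<And>i. i \<in> I \<Longrightarrow> \<bar>y i - c i\<bar> \<le> d) \<Longrightarrow> shift_dist I v y \<le> e"
  shows "(\<integral>\<^sup>+x. ennreal ((mollify I F v x - v x)\<^sup>2) \<partial>leb I) \<le> e"
proof -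
  interpret S: sigma_finite_measure "leb I" by (rule leb_sigma_finite[OF finI])
  interpret pair_sigma_finite "leb I" "leb I" by standard
  have vm[measurable]: "v \<in> borel_measurable (leb I)" using v by simp
  note kern_measurable2[measurable] kern_measurable[measurable]
  have [measurable]: "(\<lambda>p. v (\<lambda>i\<in>I. fst p i + snd p i)) \<in> borel_measurable (leb I \<Otimes>\<^sub>M leb I)"
    by (rule measurable_compose[OF _ vm]) measurable
  have kint: "integrable (leb I) (kern I F x)" for x
    by (rule integrableI_nonneg) (auto simp: kern_nonneg kern_integral)
  have k1: "(\<integral>z. kern I F x z \<partial>leb I) = 1" for x
    using kern_integral[of x] by (subst integral_eq_nn_integral) (auto simp: kern_nonneg)
  have pt: "ennreal ((mollify I F v x - v x)\<^sup>2)
      \<le> (\<integral>\<^sup>+y. ennreal ((v (\<lambda>i\<in>I. x i + y i) - v x)\<^sup>2) * ennreal (kern I F (\<lambda>_. 0) y) \<partial>leb I)"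
    if x: "x \<in> space (leb I)" for x
  proof -
    have "mollify I F v x - v x = (\<integral>z. (v z - v x) * kern I F x z \<partial>leb I)"
      unfolding mollify_def left_diff_distrib
      using kern_mult_integrable[OF v] kint k1 by (subst Bochner_Integration.integral_diff) auto
    then have "ennreal ((mollify I F v x - v x)\<^sup>2)
        \<le> (\<integral>\<^sup>+z. ennreal ((v z - v x)\<^sup>2) * ennreal (kern I F x z) \<partial>leb I)"
      by (simp only:) (rule jensen_weighted, auto simp: kern_nonneg kern_integral)
    also have "\<dots> = (\<integral>\<^sup>+y. ennreal ((v (\<lambda>i\<in>I. y i + x i) - v x)\<^sup>2)
        * ennreal (kern I F x (\<lambda>i\<in>I. y i + x i)) \<partial>leb I)"
      by (rule nn_integral_leb_translate[OF finI, symmetric]) measurable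
    also have "\<dots> = (\<integral>\<^sup>+y. ennreal ((v (\<lambda>i\<in>I. x i + y i) - v x)\<^sup>2) * ennreal (kern I F (\<lambda>_. 0) y) \<partial>leb I)"
      by (intro nn_integral_cong) (simp add: kern_def add.commute)
    finally show ?thesis .
  qed
  have "(\<integral>\<^sup>+x. ennreal ((mollify I F v x - v x)\<^sup>2) \<partial>leb I)
      \<le> (\<integral>\<^sup>+x. (\<integral>\<^sup>+y. ennreal ((v (\<lambda>i\<in>I. x i + y i) - v x)\<^sup>2) * ennreal (kern I F (\<lambda>_. 0) y) \<partial>leb I) \<partial>leb I)"
    using pt by (intro nn_integral_mono) auto
  also have "\<dots> = (\<integral>\<^sup>+y. (\<integral>\<^sup>+x. ennreal ((v (\<lambda>i\<in>I. x i + y i) - v x)\<^sup>2) * ennreal (kern I F (\<lambda>_. 0) y) \<partial>leb I) \<partial>leb I)"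
    by (rule Fubini'[symmetric]) (unfold case_prod_beta, measurable)
  also have "\<dots> = (\<integral>\<^sup>+y. shift_dist I v y * ennreal (kern I F (\<lambda>_. 0) y) \<partial>leb I)"
    unfolding shift_dist_def using shift_measurable[OF vm]
    by (intro nn_integral_cong nn_integral_multc) measurable
  also have "\<dots> \<le> (\<integral>\<^sup>+y. e * ennreal (kern I F (\<lambda>_. 0) y) \<partial>leb I)"
  proof (intro nn_integral_mono)
    fix y
    show "shift_dist I v y * ennreal (kern I F (\<lambda>_. 0) y) \<le> e * ennreal (kern I F (\<lambda>_. 0) y)"
      using kern_support[of "\<lambda>_. 0" y] e[of y]
      by (cases "kern I F (\<lambda>_. 0) y = 0") (auto intro!: mult_right_mono)
  qed
  also have "\<dots> = e" by (simp add: nn_integral_cmult kern_integral)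
  finally show ?thesis .
qed

section \<open>The Taylor remainder on a cell\<close>

lemma mollify_cong:
  "(\<And>i. i \<in> I \<Longrightarrow> x i = x' i) \<Longrightarrow> mollify I F v x = mollify I F v x'"
  unfolding mollify_def kern_def by (intro Bochner_Integration.integral_cong) auto

lemma exists_le_average:
  assumes [measurable]: "B \<in> sets M" "g \<in> borel_measurable M"
    and B: "0 < emeasure M B" "emeasure M B < \<infinity>"
    and le: "(\<integral>\<^sup>+x. g x * indicator B x \<partial>M) \<le> c * emeasure M B"
  shows "\<exists>x\<in>B. g x \<le> (c :: ennreal)"
proof (rule ccontr)
  assume "\<not> ?thesis"
  then have gt: "\<And>x. x \<in> B \<Longrightarrow> c < g x" by auto
  have "B \<noteq> {}" using B by auto
  then have c: "c < \<infinity>" using gt by (metis ex_in_conv infinity_ennreal_def less_top order_less_trans top.not_eq_extremum)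
  have "(\<integral>\<^sup>+x. c * indicator B x \<partial>M) < (\<integral>\<^sup>+x. g x * indicator B x \<partial>M)"
  proof (rule nn_integral_less)
    show "(\<integral>\<^sup>+x. c * indicator B x \<partial>M) \<noteq> \<infinity>"
      using B c by (simp add: nn_integral_cmult_indicator ennreal_mult_eq_top_iff less_top)
    show "AE x in M. c * indicator B x \<le> g x * indicator B x"
      using gt by (intro AE_I2) (auto split: split_indicator intro: less_imp_le)
    show "\<not> (AE x in M. g x * indicator B x \<le> c * indicator B x)"
    proof
      assume "AE x in M. g x * indicator B x \<le> c * indicator B x"
      then have "AE x in M. x \<notin> B"
        by eventually_elim (auto dest!: gt leD split: split_indicator_asm)
      then have "B \<in> null_sets M" by (simp add: AE_iff_null_sets)
      then show False using B by auto
    qed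
  qed measurable
  then show False using le by (simp add: nn_integral_cmult_indicator)
qed

text \<open>
  The Cauchy--Schwarz inequality for the sum over words and for the integral over \<open>t\<close>; the weight
  \<open>(1 - t) ^ (p - 1) / fact (p - 1)\<close> of the remainder is at most \<open>1\<close>.
\<close>

lemma (in mollifier) mollify_Taylor_remainder:
  assumes W: "weak_derivs I U p W" and p: "p > 0"
    and supp: "\<And>t. t \<in> {0..1} \<Longrightarrow>
      PiE I (\<lambda>i. {x i + t * w i + c i - d..x i + t * w i + c i + d}) \<subseteq> U"
    and \<omega>: "\<And>is. is \<in> words I p \<Longrightarrow> \<bar>monom_at w is\<bar> \<le> \<omega>"
  shows "ennreal ((mollify I F (W []) (\<lambda>i. x i + w i)
        - (\<Sum>a<p. \<Sum>is\<in>words I a. monom_at w is * mollify I F (W is) x / fact a))\<^sup>2)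
    \<le> ennreal (real (card (words I p)) * \<omega>\<^sup>2) * (\<integral>\<^sup>+t. (\<Sum>is\<in>words I p.
        ennreal ((mollify I F (W is) (\<lambda>i. x i + t * w i))\<^sup>2)) * indicator {0..1} t \<partial>lborel)"
proof -
  let ?m = "\<lambda>is t. mollify I F (W is) (\<lambda>i. x i + t * w i)"
  define S where "S t = (\<Sum>is\<in>words I p. monom_at w is * ?m is t)" for t
  define k where "k t = (1 - t) ^ (p - 1) / fact (p - 1)" for t :: real
  have m_meas: "?m is \<in> borel_measurable lborel" if "is \<in> words I p" for "is"
  proof -
    have [measurable]: "W is \<in> borel_measurable (leb I)" using W that by (auto simp: weak_derivs_def)
    have "(\<lambda>t. mollify I F (W is) (\<lambda>i\<in>I. x i + t * w i)) \<in> borel_measurable lborel"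
      by (rule measurable_compose[OF _ mollify_measurable]) measurable
    also have "(\<lambda>t. mollify I F (W is) (\<lambda>i\<in>I. x i + t * w i)) = ?m is"
      by (auto simp: fun_eq_iff intro!: mollify_cong)
    finally show ?thesis .
  qed
  have S_meas[measurable]: "S \<in> borel_measurable lborel"
    unfolding S_def using m_meas by measurable
  have [measurable]: "k \<in> borel_measurable lborel" unfolding k_def by measurable
  have k1: "\<bar>k t\<bar> \<le> 1" if "t \<in> {0..1}" for t
    unfolding k_def using that power_le_one[of "1 - t" "p - 1"] fact_ge_1[of "p - 1"]
    by (auto simp: abs_mult divide_le_eq intro: order.trans)
  have pt: "(k t * S t)\<^sup>2 \<le> real (card (words I p)) * \<omega>\<^sup>2 * (\<Sum>is\<in>words I p. (?m is t)\<^sup>2)"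
    if t: "t \<in> {0..1}" for t
  proof -
    have "(k t * S t)\<^sup>2 \<le> (S t)\<^sup>2"
      using k1[OF t] by (simp add: power_mult_distrib mult_left_le_one_le abs_square_le_1)
    also have "\<dots> \<le> (\<Sum>is\<in>words I p. (monom_at w is)\<^sup>2) * (\<Sum>is\<in>words I p. (?m is t)\<^sup>2)"
      unfolding S_def by (rule Cauchy_Schwarz_ineq_sum)
    also have "(\<Sum>is\<in>words I p. (monom_at w is)\<^sup>2) \<le> (\<Sum>is\<in>words I p. \<omega>\<^sup>2)"
      using \<omega> by (intro sum_mono) (simp add: abs_le_square_iff[symmetric] order.trans[OF _ abs_ge_self])
    finally show ?thesis by (simp add: mult_right_mono sum_nonneg)
  qed
  have "ennreal ((mollify I F (W []) (\<lambda>i. x i + w i)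
        - (\<Sum>a<p. \<Sum>is\<in>words I a. monom_at w is * mollify I F (W is) x / fact a))\<^sup>2)
      = ennreal ((\<integral>t. (k t * S t) * indicator {0..1} t \<partial>lborel)\<^sup>2)"
    by (subst mollify_Taylor[OF W p supp]) (auto simp: k_def S_def)
  also have "\<dots> \<le> (\<integral>\<^sup>+t. ennreal ((k t * S t)\<^sup>2) * ennreal (indicator {0..1} t) \<partial>lborel)"
    by (rule jensen_weighted) (auto simp: ennreal_indicator)
  also have "\<dots> \<le> (\<integral>\<^sup>+t. ennreal (real (card (words I p)) * \<omega>\<^sup>2) *
      ((\<Sum>is\<in>words I p. ennreal ((?m is t)\<^sup>2)) * indicator {0..1} t) \<partial>lborel)"
  proof (intro nn_integral_mono)
    fix t :: real
    show "ennreal ((k t * S t)\<^sup>2) * ennreal (indicator {0..1} t) \<le> ennreal (real (card (words I p)) * \<omega>\<^sup>2) *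
      ((\<Sum>is\<in>words I p. ennreal ((?m is t)\<^sup>2)) * indicator {0..1} t)"
      using ennreal_leI[OF pt[of t]]
      by (cases "t \<in> {0..1}") (auto simp: ennreal_mult sum_nonneg sum_ennreal)
  qed
  also have "\<dots> = ennreal (real (card (words I p)) * \<omega>\<^sup>2) *
      (\<integral>\<^sup>+t. (\<Sum>is\<in>words I p. ennreal ((?m is t)\<^sup>2)) * indicator {0..1} t \<partial>lborel)"
  proof (rule nn_integral_cmult)
    have [measurable]: "(\<lambda>t. \<Sum>is\<in>words I p. ennreal ((?m is t)\<^sup>2)) \<in> borel_measurable lborel"
      by (intro borel_measurable_sum measurable_compose[OF _ measurable_ennreal] borel_measurable_power m_meas)
    show "(\<lambda>t. (\<Sum>is\<in>words I p. ennreal ((?m is t)\<^sup>2)) * indicator {0..1} t) \<in> borel_measurable lborel"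
      by measurable
  qed
  finally show ?thesis .
qed

text \<open>
  At time \<open>t\<close> on the segment from \<open>x'\<close> to \<open>x\<close>, one substitutes in the end point whose weight
  is at least one half, at the cost of a factor of at most \<open>2 ^ card J\<close>.
\<close>

lemma nn_integral_segments_le:
  fixes H :: "('i \<Rightarrow> real) \<Rightarrow> ennreal"
  assumes J: "finite J" and [measurable]: "X \<in> sets (leb J)" "B \<in> sets (leb J)" "Rg \<in> sets (leb J)"
    and H[measurable]: "H \<in> borel_measurable (leb J)"
    and seg: "\<And>x x' t. x \<in> X \<Longrightarrow> x' \<in> B \<Longrightarrow> t \<in> {0..1} \<Longrightarrow> (\<lambda>i\<in>J. x' i + t * (x i - x' i)) \<in> Rg"
    and XB: "emeasure (leb J) X \<le> emeasure (leb J) B"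
  shows "(\<integral>\<^sup>+x'. (\<integral>\<^sup>+x. (\<integral>\<^sup>+t. H (\<lambda>i\<in>J. x' i + t * (x i - x' i)) * indicator {0..1} t \<partial>lborel)
        * indicator X x \<partial>leb J) * indicator B x' \<partial>leb J)
    \<le> 2 ^ card J * (\<integral>\<^sup>+z. H z * indicator Rg z \<partial>leb J) * emeasure (leb J) B"
proof -
  interpret S: sigma_finite_measure "leb J" by (rule leb_sigma_finite[OF J])
  interpret P: pair_sigma_finite "leb J" "leb J" by standard
  interpret Q: pair_sigma_finite "lborel :: real measure" "leb J" by standard
  define E where "E = (\<integral>\<^sup>+z. H z * indicator Rg z \<partial>leb J)"
  define f where "f x' x t = H (\<lambda>i\<in>J. x' i + t * (x i - x' i)) * indicator {0..1} t
      * indicator X x * indicator B x'" for x' x and t :: real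
  have f_meas: "(\<lambda>q. f (fst q) (fst (snd q)) (snd (snd q))) \<in> borel_measurable (leb J \<Otimes>\<^sub>M (leb J \<Otimes>\<^sub>M lborel))"
  proof -
    have [measurable]: "(\<lambda>q. H (\<lambda>i\<in>J. fst q i + snd (snd q) * (fst (snd q) i - fst q i)))
        \<in> borel_measurable (leb J \<Otimes>\<^sub>M (leb J \<Otimes>\<^sub>M (lborel :: real measure)))"
      by (rule measurable_compose[OF _ H]) measurable
    show ?thesis unfolding f_def by measurable
  qed
  have f_comp: "(\<lambda>q. f (a q) (b q) (c q)) \<in> borel_measurable N"
    if "a \<in> N \<rightarrow>\<^sub>M leb J" "b \<in> N \<rightarrow>\<^sub>M leb J" "c \<in> borel_measurable N" for N a b c
    using measurable_compose[OF _ f_meas, of "\<lambda>q. (a q, b q, c q)" N] that by simp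
  have half: "(\<integral>\<^sup>+x. H (\<lambda>i\<in>J. a i + s * x i) * indicator Rg (\<lambda>i\<in>J. a i + s * x i) \<partial>leb J) \<le> 2 ^ card J * E"
    if s: "s \<ge> 1 / 2" for s a
  proof -
    let ?Y = "\<integral>\<^sup>+x. H (\<lambda>i\<in>J. a i + s * x i) * indicator Rg (\<lambda>i\<in>J. a i + s * x i) \<partial>leb J"
    have "E = ennreal (s ^ card J) * ?Y"
      unfolding E_def using s by (intro nn_integral_leb_affine[OF J]) auto
    then have "2 ^ card J * E = ennreal ((2 * s) ^ card J) * ?Y"
      using s by (simp add: power_mult_distrib ennreal_mult mult.assoc flip: ennreal_power)
    moreover have "ennreal 1 * ?Y \<le> ennreal ((2 * s) ^ card J) * ?Y"
      using s by (intro mult_right_mono ennreal_leI one_le_power) auto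
    ultimately show ?thesis by simp
  qed
  have ft: "(\<integral>\<^sup>+x'. (\<integral>\<^sup>+x. f x' x t \<partial>leb J) \<partial>leb J) \<le> 2 ^ card J * E * emeasure (leb J) B * indicator {0..1} t" for t
  proof (cases "t \<in> {0..1}")
    case t: True
    show ?thesis
    proof (cases "t \<ge> 1 / 2")
      case True
      have "(\<integral>\<^sup>+x'. (\<integral>\<^sup>+x. f x' x t \<partial>leb J) \<partial>leb J) \<le> (\<integral>\<^sup>+x'. (2 ^ card J * E) * indicator B x' \<partial>leb J)"
      proof (intro nn_integral_mono)
        fix x'
        show "(\<integral>\<^sup>+x. f x' x t \<partial>leb J) \<le> (2 ^ card J * E) * indicator B x'"
        proof (cases "x' \<in> B")
          case x': True
          have "(\<integral>\<^sup>+x. f x' x t \<partial>leb J)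
              \<le> (\<integral>\<^sup>+x. H (\<lambda>i\<in>J. (x' i - t * x' i) + t * x i) * indicator Rg (\<lambda>i\<in>J. (x' i - t * x' i) + t * x i) \<partial>leb J)"
          proof (intro nn_integral_mono)
            fix x
            have "(\<lambda>i\<in>J. (x' i - t * x' i) + t * x i) = (\<lambda>i\<in>J. x' i + t * (x i - x' i))"
              by (auto simp: algebra_simps)
            then show "f x' x t \<le> H (\<lambda>i\<in>J. (x' i - t * x' i) + t * x i) * indicator Rg (\<lambda>i\<in>J. (x' i - t * x' i) + t * x i)"
              using seg[of x x' t] x' t by (auto simp: f_def split: split_indicator)
          qed
          also have "\<dots> \<le> 2 ^ card J * E" by (rule half[OF True])
          finally show ?thesis using x' by simp
        qed (simp add: f_def)
      qed
      then show ?thesis using t by (simp add: nn_integral_cmult_indicator)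
    next
      case False
      have "(\<integral>\<^sup>+x'. (\<integral>\<^sup>+x. f x' x t \<partial>leb J) \<partial>leb J) = (\<integral>\<^sup>+x. (\<integral>\<^sup>+x'. f x' x t \<partial>leb J) \<partial>leb J)"
        by (rule P.Fubini'[symmetric]) (unfold case_prod_beta, rule f_comp, measurable)
      also have "\<dots> \<le> (\<integral>\<^sup>+x. (2 ^ card J * E) * indicator X x \<partial>leb J)"
      proof (intro nn_integral_mono)
        fix x
        show "(\<integral>\<^sup>+x'. f x' x t \<partial>leb J) \<le> (2 ^ card J * E) * indicator X x"
        proof (cases "x \<in> X")
          case x: True
          have "(\<integral>\<^sup>+x'. f x' x t \<partial>leb J)
              \<le> (\<integral>\<^sup>+x'. H (\<lambda>i\<in>J. t * x i + (1 - t) * x' i) * indicator Rg (\<lambda>i\<in>J. t * x i + (1 - t) * x' i) \<partial>leb J)"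
          proof (intro nn_integral_mono)
            fix x'
            have "(\<lambda>i\<in>J. t * x i + (1 - t) * x' i) = (\<lambda>i\<in>J. x' i + t * (x i - x' i))"
              by (auto simp: algebra_simps)
            then show "f x' x t \<le> H (\<lambda>i\<in>J. t * x i + (1 - t) * x' i) * indicator Rg (\<lambda>i\<in>J. t * x i + (1 - t) * x' i)"
              using seg[of x x' t] x t by (auto simp: f_def split: split_indicator)
          qed
          also have "\<dots> \<le> 2 ^ card J * E" using False by (intro half) auto
          finally show ?thesis using x by simp
        qed (simp add: f_def)
      qed
      also have "\<dots> = 2 ^ card J * E * emeasure (leb J) X" by (simp add: nn_integral_cmult_indicator)
      also have "\<dots> \<le> 2 ^ card J * E * emeasure (leb J) B" by (intro mult_left_mono XB) simp
      finally show ?thesis using t by simp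
    qed
  qed (simp add: f_def)
  have "(\<integral>\<^sup>+x'. (\<integral>\<^sup>+x. (\<integral>\<^sup>+t. H (\<lambda>i\<in>J. x' i + t * (x i - x' i)) * indicator {0..1} t \<partial>lborel)
        * indicator X x \<partial>leb J) * indicator B x' \<partial>leb J)
      = (\<integral>\<^sup>+x'. (\<integral>\<^sup>+x. (\<integral>\<^sup>+t. f x' x t \<partial>lborel) \<partial>leb J) \<partial>leb J)"
    (is "?l = _")
  proof -
    have [measurable]: "(\<lambda>t. H (\<lambda>i\<in>J. x' i + t * (x i - x' i))) \<in> borel_measurable lborel" for x x'
      by (rule measurable_compose[OF _ H]) measurable
    have "(\<integral>\<^sup>+t. f x' x t \<partial>lborel) = (\<integral>\<^sup>+t. H (\<lambda>i\<in>J. x' i + t * (x i - x' i)) * indicator {0..1} t \<partial>lborel)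
        * indicator X x * indicator B x'" for x x'
      unfolding f_def by (subst nn_integral_multc[symmetric], measurable)+
    then show ?thesis
      by (intro nn_integral_cong) (auto split: split_indicator)
  qed
  also have "\<dots> = (\<integral>\<^sup>+x'. (\<integral>\<^sup>+t. (\<integral>\<^sup>+x. f x' x t \<partial>leb J) \<partial>lborel) \<partial>leb J)"
  proof (intro nn_integral_cong)
    fix x' assume "x' \<in> space (leb J)"
    then show "(\<integral>\<^sup>+x. (\<integral>\<^sup>+t. f x' x t \<partial>lborel) \<partial>leb J) = (\<integral>\<^sup>+t. (\<integral>\<^sup>+x. f x' x t \<partial>leb J) \<partial>lborel)"
      by (intro Q.Fubini') (unfold case_prod_beta, rule f_comp, auto)
  qed
  also have "\<dots> = (\<integral>\<^sup>+t. (\<integral>\<^sup>+x'. (\<integral>\<^sup>+x. f x' x t \<partial>leb J) \<partial>leb J) \<partial>lborel)"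
  proof (rule Q.Fubini')
    show "(\<lambda>(t, x'). \<integral>\<^sup>+x. f x' x t \<partial>leb J) \<in> borel_measurable (lborel \<Otimes>\<^sub>M leb J)"
      unfolding case_prod_beta
      by (rule S.borel_measurable_nn_integral, unfold case_prod_beta, rule f_comp) measurable
  qed
  also have "\<dots> \<le> (\<integral>\<^sup>+(t::real). 2 ^ card J * E * emeasure (leb J) B * indicator {0..1} t \<partial>lborel)"
    by (rule nn_integral_mono, rule ft)
  also have "\<dots> = 2 ^ card J * E * emeasure (leb J) B" by (simp add: nn_integral_cmult_indicator)
  finally show ?thesis unfolding E_def .
qed

text \<open>
  The interior cone condition, uniformly over \<open>A\<close>: the axis of the cone with vertex \<open>x\<close> points in
  the direction \<open>v\<close>, and boxes of radius \<open>t * \<sigma>\<close> around \<open>x + t * v\<close> fit into \<open>V\<close>.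
\<close>

definition has_cone ::
    "'i set \<Rightarrow> ('i \<Rightarrow> real) set \<Rightarrow> ('i \<Rightarrow> real) set \<Rightarrow> ('i \<Rightarrow> real) \<Rightarrow> real \<Rightarrow> real \<Rightarrow> bool" where
  "has_cone J V A v \<sigma> \<tau> \<longleftrightarrow> (\<forall>x\<in>A. \<forall>t. 0 < t \<and> t \<le> \<tau> \<longrightarrow> (\<forall>z\<in>PiE J (\<lambda>_. UNIV).
     (\<forall>i\<in>J. \<bar>z i - (x i + t * v i)\<bar> \<le> t * \<sigma>) \<longrightarrow> z \<in> V))"

lemma has_coneD:
  assumes "has_cone J V A v \<sigma> \<tau>" "x \<in> A" "0 < t" "t \<le> \<tau>" "z \<in> PiE J (\<lambda>_. UNIV)"
    "\<And>i. i \<in> J \<Longrightarrow> \<bar>z i - (x i + t * v i)\<bar> \<le> t * \<sigma>"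
  shows "z \<in> V"
  using assms unfolding has_cone_def by blast

lemma merge_in_I [simp]: "i \<in> I \<Longrightarrow> merge I J (x, y) i = x i"
  by (simp add: merge_def)

lemma merge_in_J [simp]: "I \<inter> J = {} \<Longrightarrow> i \<in> J \<Longrightarrow> merge I J (x, y) i = y i"
  by (auto simp: merge_def)

text \<open>
  The Taylor polynomial at \<open>x'\<close> with respect to the variables in \<open>I1\<close>. The words range over all
  variables, but the monomials that involve \<open>I2\<close> vanish, because there the increment is \<open>0\<close>.
\<close>

definition taylor_poly ::
    "'i set \<Rightarrow> 'i set \<Rightarrow> nat \<Rightarrow> ('i \<Rightarrow> real \<Rightarrow> real) \<Rightarrow> ('i list \<Rightarrow> ('i \<Rightarrow> real) \<Rightarrow> real) \<Rightarrow>
     ('i \<Rightarrow> real) \<Rightarrow> ('i \<Rightarrow> real) \<Rightarrow> ('i \<Rightarrow> real) \<Rightarrow> real" where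
  "taylor_poly I1 I2 p F W x' x y = (\<Sum>a<p. \<Sum>is\<in>words (I1 \<union> I2) a.
     monom_at (\<lambda>i. if i \<in> I1 then x i - x' i else 0) is
       * mollify (I1 \<union> I2) F (W is) (merge I1 I2 (x', y)) / fact a)"

lemma abs_monom_at_le:
  assumes "\<And>i. i \<in> set is \<Longrightarrow> \<bar>w i\<bar> \<le> V"
  shows "\<bar>monom_at w is\<bar> \<le> V ^ length is"
  using assms unfolding monom_at_def
  by (induction "is") (auto simp: abs_mult intro!: mult_mono order.trans[OF abs_ge_zero])

lemma emeasure_leb_cube:
  assumes "finite J" "r \<ge> 0"
  shows "emeasure (leb J) (PiE J (\<lambda>i. {c i - r..c i + r})) = ennreal ((2 * r) ^ card J)"
proof -
  interpret product_sigma_finite "\<lambda>_. lborel :: real measure" by standard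
  show ?thesis using assms by (subst emeasure_PiM) (auto simp: ennreal_power)
qed

lemma mem_cube_iff:
  fixes x c :: "'i \<Rightarrow> real"
  shows "x \<in> PiE J (\<lambda>i. {c i - r..c i + r}) \<longleftrightarrow> x \<in> PiE J (\<lambda>_. UNIV) \<and> (\<forall>i\<in>J. \<bar>x i - c i\<bar> \<le> r)"
proof -
  have "s \<in> {a - r..a + r} \<longleftrightarrow> \<bar>s - a\<bar> \<le> r" for s a :: real by (auto simp: abs_le_iff)
  then show ?thesis by (auto simp: PiE_iff)
qed

lemma leb_cube_sets: "finite J \<Longrightarrow> PiE J (\<lambda>i. {l i..u i}) \<in> sets (leb J)"
  by (intro sets_PiM_I_finite) auto

text \<open>
  The centre \<open>x'\<close> is looked for in a box \<open>B\<close> as large as the cell and shifted by \<open>h * v\<close> into the cone.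
  Every segment from \<open>B\<close> to the cell, further shifted by the mollification kernel, stays in \<open>U\<close>,
  and the average over \<open>B\<close> of the remainders is bounded by \<open>nn_integral_segments_le\<close>. Some centre is
  at least as good as the average.
\<close>

lemma cell_approx:
  fixes I1 I2 :: "'i set"
  defines "I \<equiv> I1 \<union> I2"
  assumes fin: "finite I1" "finite I2" and disj: "I1 \<inter> I2 = {}"
    and W: "weak_derivs I U p W" and p: "p > 0"
    and U: "\<And>z. z \<in> PiE I (\<lambda>_. UNIV) \<Longrightarrow> restrict z I1 \<in> U1 \<Longrightarrow> restrict z I2 \<in> U2 \<Longrightarrow> z \<in> U"
    and cone: "has_cone I1 U1 A1 v \<sigma> \<tau>" "has_cone I2 U2 A2 v \<sigma> \<tau>" and pos: "0 < \<sigma>" "0 < \<tau>"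
    and A2: "A2 \<in> sets (leb I2)"
    and mol: "mollifier I (\<lambda>i. \<delta> * v i) (\<delta> * \<sigma>) F"
    and h: "0 < h" "h \<le> \<tau> / 2" and \<delta>: "0 < \<delta>" "\<delta> \<le> \<tau> / 2"
    and V: "\<And>i. i \<in> I1 \<Longrightarrow> \<bar>v i\<bar> + \<sigma> \<le> V" "0 \<le> V"
    and X: "X \<in> sets (leb I1)" "X \<subseteq> A1" "\<And>x i. x \<in> X \<Longrightarrow> i \<in> I1 \<Longrightarrow> \<bar>x i - x0 i\<bar> \<le> h * \<sigma> / 2"
    and x0: "x0 \<in> PiE I1 (\<lambda>_. UNIV)"
    and Rg: "Rg \<in> sets (leb I1)"
      "\<And>z. z \<in> PiE I1 (\<lambda>_. UNIV) \<Longrightarrow> (\<And>i. i \<in> I1 \<Longrightarrow> \<bar>z i - x0 i\<bar> \<le> h * V) \<Longrightarrow> z \<in> Rg"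
  defines "H z \<equiv> \<Sum>is\<in>words I p. \<integral>\<^sup>+y. ennreal ((mollify I F (W is) (merge I1 I2 (z, y)))\<^sup>2) \<partial>leb I2"
  obtains x' where "x' \<in> PiE I1 (\<lambda>_. UNIV)"
    and "\<And>x i. x \<in> X \<Longrightarrow> i \<in> I1 \<Longrightarrow> \<bar>x i - x' i\<bar> \<le> h * V"
    and "(\<integral>\<^sup>+x. (\<integral>\<^sup>+y. ennreal ((mollify I F (W []) (merge I1 I2 (x, y)) - taylor_poly I1 I2 p F W x' x y)\<^sup>2)
            * indicator A2 y \<partial>leb I2) * indicator X x \<partial>leb I1)
        \<le> ennreal (real (card (words I p)) * ((h * V) ^ p)\<^sup>2) * (2 ^ card I1 * (\<integral>\<^sup>+z. H z * indicator Rg z \<partial>leb I1))"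
proof -
  interpret mollifier I "\<lambda>i. \<delta> * v i" "\<delta> * \<sigma>" F by (rule mol)
  interpret S1: sigma_finite_measure "leb I1" by (rule leb_sigma_finite[OF fin(1)])
  interpret S2: sigma_finite_measure "leb I2" by (rule leb_sigma_finite[OF fin(2)])
  interpret Q: pair_sigma_finite "lborel :: real measure" "leb I2" by standard
  \<comment> \<open>the possible centres: a box with the side length \<open>h * \<sigma>\<close> of the cell, inside the cone\<close>
  define B where "B = PiE I1 (\<lambda>i. {x0 i + h * v i - h * \<sigma> / 2..x0 i + h * v i + h * \<sigma> / 2})"
  have [measurable]: "B \<in> sets (leb I1)" "X \<in> sets (leb I1)" "Rg \<in> sets (leb I1)" "A2 \<in> sets (leb I2)"
    using leb_cube_sets[OF fin(1)] X Rg A2 unfolding B_def by auto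
  define \<mu> where "\<mu> is z y = ennreal ((mollify I F (W is) (merge I1 I2 (z, y)))\<^sup>2)" for "is" z y
  define seg where "seg x' x t = (\<lambda>i\<in>I1. x' i + t * (x i - x' i))" for x' x :: "'i \<Rightarrow> real" and t :: real
  have mer[measurable]: "(\<lambda>q. merge I1 I2 (fst q, snd q)) \<in> leb I1 \<Otimes>\<^sub>M leb I2 \<rightarrow>\<^sub>M leb I"
    unfolding I_def by simp
  have W_meas: "W is \<in> borel_measurable (leb I)" if "is \<in> words I a" "a \<le> p" for "is" a
    using W that by (auto simp: weak_derivs_def)
  have \<mu>_meas: "(\<lambda>q. \<mu> is (fst q) (snd q)) \<in> borel_measurable (leb I1 \<Otimes>\<^sub>M leb I2)" if "is \<in> words I p" for "is"
    unfolding \<mu>_def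
    by (rule measurable_compose[OF _ measurable_ennreal], rule borel_measurable_power,
        rule measurable_compose[OF mer mollify_measurable[OF W_meas[OF that order.refl]]])
  have H_eq: "H z = (\<Sum>is\<in>words I p. \<integral>\<^sup>+y. \<mu> is z y \<partial>leb I2)" for z
    by (simp add: H_def \<mu>_def)
  have H_meas[measurable]: "H \<in> borel_measurable (leb I1)"
    unfolding H_eq [abs_def]
    by (intro borel_measurable_sum S2.borel_measurable_nn_integral)
       (use \<mu>_meas in \<open>simp add: case_prod_beta\<close>)
  have seg_meas: "(\<lambda>q. seg (a q) (b q) (c q)) \<in> N \<rightarrow>\<^sub>M leb I1"
    if ab: "a \<in> N \<rightarrow>\<^sub>M leb I1" "b \<in> N \<rightarrow>\<^sub>M leb I1" and [measurable]: "c \<in> borel_measurable N" for N a b c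
  proof -
    have [measurable]: "(\<lambda>q. a q i) \<in> borel_measurable N" "(\<lambda>q. b q i) \<in> borel_measurable N" if "i \<in> I1" for i
      using measurable_compose[OF ab(1) measurable_component_singleton[OF that]]
        measurable_compose[OF ab(2) measurable_component_singleton[OF that]] by simp_all
    show ?thesis unfolding seg_def by measurable
  qed
  define g where "g x' = (\<integral>\<^sup>+x. (\<integral>\<^sup>+t. H (seg x' x t) * indicator {0..1} t \<partial>lborel) * indicator X x \<partial>leb I1)" for x'
  have g_meas: "g \<in> borel_measurable (leb I1)"
  proof -
    have [measurable]: "(\<lambda>q. H (seg (fst (fst q)) (snd (fst q)) (snd q)))
        \<in> borel_measurable ((leb I1 \<Otimes>\<^sub>M leb I1) \<Otimes>\<^sub>M (lborel :: real measure))"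
      by (rule measurable_compose[OF seg_meas H_meas]) measurable
    have [measurable]: "(\<lambda>q. \<integral>\<^sup>+t. H (seg (fst q) (snd q) t) * indicator {0..1} t \<partial>lborel)
        \<in> borel_measurable (leb I1 \<Otimes>\<^sub>M leb I1)"
      by (rule lborel.borel_measurable_nn_integral) (simp add: case_prod_beta)
    show ?thesis unfolding g_def [abs_def]
      by (rule S1.borel_measurable_nn_integral) (simp add: case_prod_beta)
  qed
  have emB: "emeasure (leb I1) B = ennreal ((h * \<sigma>) ^ card I1)"
    unfolding B_def using emeasure_leb_cube[OF fin(1), of "h * \<sigma> / 2" "\<lambda>i. x0 i + h * v i"] h pos by simp
  have X_sp: "X \<subseteq> PiE I1 (\<lambda>_. UNIV)" using sets.sets_into_space[OF X(1)] by (simp add: space_leb)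
  have "X \<subseteq> PiE I1 (\<lambda>i. {x0 i - h * \<sigma> / 2..x0 i + h * \<sigma> / 2})"
    using X(3) X_sp unfolding subset_iff mem_cube_iff by blast
  then have "emeasure (leb I1) X \<le> emeasure (leb I1) (PiE I1 (\<lambda>i. {x0 i - h * \<sigma> / 2..x0 i + h * \<sigma> / 2}))"
    by (rule emeasure_mono[OF _ leb_cube_sets[OF fin(1)]])
  then have XB: "emeasure (leb I1) X \<le> emeasure (leb I1) B"
    unfolding emB using emeasure_leb_cube[OF fin(1), of "h * \<sigma> / 2" x0] h pos by simp
  have hV: "h * \<sigma> / 2 + h * \<bar>v i\<bar> + h * \<sigma> / 2 \<le> h * V" if "i \<in> I1" for i
    using mult_left_mono[OF V(1)[OF that], of h] h by (simp add: distrib_left mult.commute)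
  have hv: "\<bar>h * v i\<bar> = h * \<bar>v i\<bar>" for i using h by (simp add: abs_mult)
  have near_B: "\<bar>x' i - x0 i\<bar> \<le> h * \<bar>v i\<bar> + h * \<sigma> / 2" if "x' \<in> B" "i \<in> I1" for x' i
  proof -
    have "\<bar>x' i - (x0 i + h * v i)\<bar> \<le> h * \<sigma> / 2"
      using that unfolding B_def mem_cube_iff by blast
    then show ?thesis
      using hv[of i] abs_triangle_ineq[of "x' i - (x0 i + h * v i)" "h * v i"] by simp
  qed
  have seg_Rg: "seg x' x t \<in> Rg" if "x \<in> X" "x' \<in> B" "t \<in> {0..1}" for x x' t
  proof (rule Rg(2))
    fix i assume i: "i \<in> I1"
    have a: "\<bar>x i - x0 i\<bar> \<le> h * V" "\<bar>x' i - x0 i\<bar> \<le> h * V"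
      using X(3)[OF that(1) i] near_B[OF that(2) i] hV[OF i] h pos by (smt (verit) mult_nonneg_nonneg abs_ge_zero divide_nonneg_nonneg)+
    have "seg x' x t i - x0 i = (1 - t) * (x' i - x0 i) + t * (x i - x0 i)"
      using i by (simp add: seg_def algebra_simps)
    also have "\<bar>\<dots>\<bar> \<le> (1 - t) * (h * V) + t * (h * V)"
      by (rule order.trans[OF abs_triangle_ineq add_mono])
         (use that(3) a in \<open>auto simp: abs_mult intro!: mult_left_mono\<close>)
    finally show "\<bar>seg x' x t i - x0 i\<bar> \<le> h * V" by (simp add: algebra_simps)
  qed (simp add: seg_def)
  have "\<exists>x'\<in>B. g x' \<le> 2 ^ card I1 * (\<integral>\<^sup>+z. H z * indicator Rg z \<partial>leb I1)"
  proof (rule exists_le_average[OF _ g_meas])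
    show "0 < emeasure (leb I1) B" "emeasure (leb I1) B < \<infinity>" unfolding emB using h pos by auto
    show "(\<integral>\<^sup>+x'. g x' * indicator B x' \<partial>leb I1)
        \<le> 2 ^ card I1 * (\<integral>\<^sup>+z. H z * indicator Rg z \<partial>leb I1) * emeasure (leb I1) B"
      unfolding g_def seg_def
      by (rule nn_integral_segments_le[OF fin(1) _ _ _ H_meas seg_Rg[unfolded seg_def] XB]) measurable
  qed measurable
  then obtain x' where x'B: "x' \<in> B" and gx': "g x' \<le> 2 ^ card I1 * (\<integral>\<^sup>+z. H z * indicator Rg z \<partial>leb I1)" by blast
  have x'_sp: "x' \<in> PiE I1 (\<lambda>_. UNIV)" using x'B by (auto simp: B_def PiE_iff)
  have near: "\<bar>x i - x' i\<bar> \<le> h * V" if "x \<in> X" "i \<in> I1" for x i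
    using X(3)[OF that] near_B[OF x'B that(2)] hV[OF that(2)] by linarith
  define cc where "cc = ennreal (real (card (words I p)) * ((h * V) ^ p)\<^sup>2)"
  have pt: "ennreal ((mollify I F (W []) (merge I1 I2 (x, y)) - taylor_poly I1 I2 p F W x' x y)\<^sup>2)
      \<le> cc * (\<integral>\<^sup>+t. (\<Sum>is\<in>words I p. \<mu> is (seg x' x t) y) * indicator {0..1} t \<partial>lborel)"
    if x: "x \<in> X" and y: "y \<in> A2" for x y
  proof -
    let ?w = "\<lambda>i. if i \<in> I1 then x i - x' i else 0" and ?b = "merge I1 I2 (x', y)"
    have w: "\<bar>monom_at ?w is\<bar> \<le> (h * V) ^ p" if "is \<in> words I p" for "is"
      using abs_monom_at_le[of "is" ?w "h * V"] near[OF x] that h V(2) by auto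
    have supp: "PiE I (\<lambda>i. {?b i + t * ?w i + \<delta> * v i - \<delta> * \<sigma>..?b i + t * ?w i + \<delta> * v i + \<delta> * \<sigma>}) \<subseteq> U"
      if t: "t \<in> {0..1}" for t
    proof
      fix z assume z: "z \<in> PiE I (\<lambda>i. {?b i + t * ?w i + \<delta> * v i - \<delta> * \<sigma>..?b i + t * ?w i + \<delta> * v i + \<delta> * \<sigma>})"
      then have zi: "\<bar>z i - (?b i + t * ?w i + \<delta> * v i)\<bar> \<le> \<delta> * \<sigma>" if "i \<in> I" for i
        using that unfolding mem_cube_iff by blast
      show "z \<in> U"
      proof (rule U)
        show "restrict z I1 \<in> U1"
        proof (rule has_coneD[OF cone(1), of x "(1 - t) * h + \<delta>"])
          show "0 < (1 - t) * h + \<delta>" using t h \<delta> by (simp add: add_nonneg_pos)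
          have "(1 - t) * h \<le> 1 * h" using t h by (intro mult_right_mono) auto
          then show "(1 - t) * h + \<delta> \<le> \<tau>" using h \<delta> by linarith
          fix i assume i: "i \<in> I1"
          have "\<bar>x i - x0 i\<bar> \<le> h * \<sigma> / 2" by (rule X(3)[OF x i])
          moreover have "\<bar>x' i - (x0 i + h * v i)\<bar> \<le> h * \<sigma> / 2"
            using x'B i unfolding B_def mem_cube_iff by blast
          ultimately have "\<bar>x' i - x i - h * v i\<bar> \<le> h * \<sigma>" by linarith
          then have "(1 - t) * \<bar>x' i - x i - h * v i\<bar> \<le> (1 - t) * (h * \<sigma>)"
            using t by (intro mult_left_mono) auto
          then have 1: "\<bar>(1 - t) * (x' i - x i - h * v i)\<bar> \<le> (1 - t) * (h * \<sigma>)"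
            using t by (simp add: abs_mult)
          have 2: "\<bar>z i - (x' i + t * (x i - x' i) + \<delta> * v i)\<bar> \<le> \<delta> * \<sigma>"
            using zi[of i] i by (simp add: I_def)
          have "restrict z I1 i - (x i + ((1 - t) * h + \<delta>) * v i)
              = (z i - (x' i + t * (x i - x' i) + \<delta> * v i)) + (1 - t) * (x' i - x i - h * v i)"
            using i by (simp add: algebra_simps)
          then show "\<bar>restrict z I1 i - (x i + ((1 - t) * h + \<delta>) * v i)\<bar> \<le> ((1 - t) * h + \<delta>) * \<sigma>"
            using abs_triangle_ineq[of "z i - (x' i + t * (x i - x' i) + \<delta> * v i)" "(1 - t) * (x' i - x i - h * v i)"] 1 2
            by (simp add: algebra_simps)
        qed (use x X(2) in auto)
        show "restrict z I2 \<in> U2"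
        proof (rule has_coneD[OF cone(2) y, of \<delta>])
          show "\<delta> \<le> \<tau>" using \<delta> pos by simp
          fix i assume i: "i \<in> I2"
          then have "i \<notin> I1" using disj by blast
          then show "\<bar>restrict z I2 i - (y i + \<delta> * v i)\<bar> \<le> \<delta> * \<sigma>"
            using zi[of i] i disj by (simp add: I_def)
        qed (use \<delta> in auto)
      qed (use z in \<open>auto simp: PiE_iff\<close>)
    qed
    have "ennreal ((mollify I F (W []) (\<lambda>i. ?b i + ?w i)
          - (\<Sum>a<p. \<Sum>is\<in>words I a. monom_at ?w is * mollify I F (W is) ?b / fact a))\<^sup>2)
        \<le> cc * (\<integral>\<^sup>+t. (\<Sum>is\<in>words I p.
          ennreal ((mollify I F (W is) (\<lambda>i. ?b i + t * ?w i))\<^sup>2)) * indicator {0..1} t \<partial>lborel)"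
      unfolding cc_def by (rule mollify_Taylor_remainder[OF W p supp w])
    moreover have "mollify I F (W []) (\<lambda>i. ?b i + ?w i) = mollify I F (W []) (merge I1 I2 (x, y))"
      using disj by (intro mollify_cong) (auto simp: I_def)
    moreover have "mollify I F (W is) (\<lambda>i. ?b i + t * ?w i) = mollify I F (W is) (merge I1 I2 (seg x' x t, y))" for "is" t
      using disj by (intro mollify_cong) (auto simp: I_def seg_def)
    ultimately show ?thesis by (simp add: taylor_poly_def \<mu>_def I_def)
  qed
  have inner: "(\<integral>\<^sup>+y. ennreal ((mollify I F (W []) (merge I1 I2 (x, y)) - taylor_poly I1 I2 p F W x' x y)\<^sup>2)
            * indicator A2 y \<partial>leb I2) \<le> cc * (\<integral>\<^sup>+t. H (seg x' x t) * indicator {0..1} t \<partial>lborel)" if x: "x \<in> X" for x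
  proof -
    have x_sp: "x \<in> space (leb I1)" using x X_sp by (auto simp: space_leb)
    have sm: "seg x' x \<in> lborel \<rightarrow>\<^sub>M leb I1"
      unfolding seg_def by measurable
    have m1: "(\<lambda>q. \<mu> is (seg x' x (fst q)) (snd q)) \<in> borel_measurable (lborel \<Otimes>\<^sub>M leb I2)" if "is \<in> words I p" for "is"
    proof -
      have "(\<lambda>q. (seg x' x (fst q), snd q)) \<in> lborel \<Otimes>\<^sub>M leb I2 \<rightarrow>\<^sub>M leb I1 \<Otimes>\<^sub>M leb I2"
        using sm by measurable
      from measurable_compose[OF this \<mu>_meas[OF that]] show ?thesis by simp
    qed
    have m2: "(\<lambda>q. (\<Sum>is\<in>words I p. \<mu> is (seg x' x (fst q)) (snd q)) * indicator {0..1} (fst q))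
        \<in> borel_measurable (lborel \<Otimes>\<^sub>M leb I2)"
      by (intro borel_measurable_times_ennreal borel_measurable_sum m1) measurable
    have "(\<integral>\<^sup>+y. ennreal ((mollify I F (W []) (merge I1 I2 (x, y)) - taylor_poly I1 I2 p F W x' x y)\<^sup>2)
            * indicator A2 y \<partial>leb I2)
        \<le> (\<integral>\<^sup>+y. cc * (\<integral>\<^sup>+t. (\<Sum>is\<in>words I p. \<mu> is (seg x' x t) y) * indicator {0..1} t \<partial>lborel) \<partial>leb I2)"
      using pt[OF x] by (intro nn_integral_mono) (auto split: split_indicator)
    also have "\<dots> = cc * (\<integral>\<^sup>+y. (\<integral>\<^sup>+t. (\<Sum>is\<in>words I p. \<mu> is (seg x' x t) y) * indicator {0..1} t \<partial>lborel) \<partial>leb I2)"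
    proof (rule nn_integral_cmult)
      show "(\<lambda>y. \<integral>\<^sup>+t. (\<Sum>is\<in>words I p. \<mu> is (seg x' x t) y) * indicator {0..1} t \<partial>lborel) \<in> borel_measurable (leb I2)"
        by (rule lborel.borel_measurable_nn_integral)
           (use measurable_compose[OF measurable_pair_swap' m2] in \<open>simp add: case_prod_beta\<close>)
    qed
    also have "(\<integral>\<^sup>+y. (\<integral>\<^sup>+t. (\<Sum>is\<in>words I p. \<mu> is (seg x' x t) y) * indicator {0..1} t \<partial>lborel) \<partial>leb I2)
        = (\<integral>\<^sup>+t. (\<integral>\<^sup>+y. (\<Sum>is\<in>words I p. \<mu> is (seg x' x t) y) * indicator {0..1} t \<partial>leb I2) \<partial>lborel)"
      by (rule Q.Fubini') (use m2 in \<open>simp add: case_prod_beta\<close>)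
    also have "\<dots> = (\<integral>\<^sup>+t. H (seg x' x t) * indicator {0..1} t \<partial>lborel)"
    proof (intro nn_integral_cong)
      fix t :: real
      have m3: "(\<lambda>y. \<mu> is (seg x' x t) y) \<in> borel_measurable (leb I2)" if "is \<in> words I p" for "is"
        using measurable_compose[OF measurable_Pair1' \<mu>_meas[OF that], of "seg x' x t"]
        by (simp add: space_leb seg_def)
      have "(\<integral>\<^sup>+y. (\<Sum>is\<in>words I p. \<mu> is (seg x' x t) y) * indicator {0..1} t \<partial>leb I2)
          = (\<integral>\<^sup>+y. (\<Sum>is\<in>words I p. \<mu> is (seg x' x t) y) \<partial>leb I2) * indicator {0..1} t"
        by (intro nn_integral_multc borel_measurable_sum m3)
      also have "(\<integral>\<^sup>+y. (\<Sum>is\<in>words I p. \<mu> is (seg x' x t) y) \<partial>leb I2) = H (seg x' x t)"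
        unfolding H_eq by (intro nn_integral_sum m3)
      finally show "(\<integral>\<^sup>+y. (\<Sum>is\<in>words I p. \<mu> is (seg x' x t) y) * indicator {0..1} t \<partial>leb I2)
          = H (seg x' x t) * indicator {0..1} t" .
    qed
    finally show ?thesis .
  qed
  have "(\<integral>\<^sup>+x. (\<integral>\<^sup>+y. ennreal ((mollify I F (W []) (merge I1 I2 (x, y)) - taylor_poly I1 I2 p F W x' x y)\<^sup>2)
            * indicator A2 y \<partial>leb I2) * indicator X x \<partial>leb I1)
      \<le> (\<integral>\<^sup>+x. cc * ((\<integral>\<^sup>+t. H (seg x' x t) * indicator {0..1} t \<partial>lborel) * indicator X x) \<partial>leb I1)"
    using inner by (intro nn_integral_mono) (auto split: split_indicator)
  also have "\<dots> = cc * g x'"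
    unfolding g_def
  proof (rule nn_integral_cmult)
    have "(\<lambda>q. H (seg x' (fst q) (snd q))) \<in> borel_measurable (leb I1 \<Otimes>\<^sub>M (lborel :: real measure))"
      by (rule measurable_compose[OF seg_meas H_meas]) (use x'_sp in \<open>auto simp: space_leb\<close>)
    note [measurable] = this
    have [measurable]: "(\<lambda>x. \<integral>\<^sup>+t. H (seg x' x t) * indicator {0..1} t \<partial>lborel) \<in> borel_measurable (leb I1)"
      by (rule lborel.borel_measurable_nn_integral) (simp add: case_prod_beta)
    show "(\<lambda>x. (\<integral>\<^sup>+t. H (seg x' x t) * indicator {0..1} t \<partial>lborel) * indicator X x) \<in> borel_measurable (leb I1)"
      by measurable
  qed
  also have "\<dots> \<le> cc * (2 ^ card I1 * (\<integral>\<^sup>+z. H z * indicator Rg z \<partial>leb I1))"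
    by (intro mult_left_mono gx') simp
  finally have "(\<integral>\<^sup>+x. (\<integral>\<^sup>+y. ennreal ((mollify I F (W []) (merge I1 I2 (x, y)) - taylor_poly I1 I2 p F W x' x y)\<^sup>2)
            * indicator A2 y \<partial>leb I2) * indicator X x \<partial>leb I1)
      \<le> cc * (2 ^ card I1 * (\<integral>\<^sup>+z. H z * indicator Rg z \<partial>leb I1))" .
  then show ?thesis unfolding cc_def by (intro that[of x'] x'_sp near) assumption
qed

section \<open>Low rank approximation near one pair of cones\<close>

text \<open>
  Bounded factors are square integrable on domains of finite measure and may be multiplied with
  indicator functions.
\<close>

definition low_rank :: "'a measure \<Rightarrow> 'b measure \<Rightarrow> nat \<Rightarrow> ('a \<Rightarrow> 'b \<Rightarrow> real) \<Rightarrow> bool" where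
  "low_rank M1 M2 N G \<longleftrightarrow> (\<exists>a b.
     (\<forall>k<N. a k \<in> borel_measurable M1 \<and> bounded (range (a k)) \<and>
            b k \<in> borel_measurable M2 \<and> bounded (range (b k))) \<and>
     G = (\<lambda>x y. \<Sum>k<N. a k x * b k y))"

lemma low_rank_0: "low_rank M1 M2 0 (\<lambda>_ _. 0)"
  by (auto simp: low_rank_def)

lemma low_rank_product:
  "a \<in> borel_measurable M1 \<Longrightarrow> bounded (range a) \<Longrightarrow> b \<in> borel_measurable M2 \<Longrightarrow> bounded (range b)
    \<Longrightarrow> low_rank M1 M2 1 (\<lambda>x y. a x * b y)"
  unfolding low_rank_def by (intro exI[of _ "\<lambda>_. a"] exI[of _ "\<lambda>_. b"]) auto

lemma low_rank_add:
  assumes "low_rank M1 M2 N G" "low_rank M1 M2 N' G'"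
  shows "low_rank M1 M2 (N + N') (\<lambda>x y. G x y + G' x y)"
proof -
  obtain a b where ab: "\<forall>k<N. a k \<in> borel_measurable M1 \<and> bounded (range (a k)) \<and>
      b k \<in> borel_measurable M2 \<and> bounded (range (b k))" "G = (\<lambda>x y. \<Sum>k<N. a k x * b k y)"
    using assms(1) unfolding low_rank_def by blast
  obtain a' b' where ab': "\<forall>k<N'. a' k \<in> borel_measurable M1 \<and> bounded (range (a' k)) \<and>
      b' k \<in> borel_measurable M2 \<and> bounded (range (b' k))" "G' = (\<lambda>x y. \<Sum>k<N'. a' k x * b' k y)"
    using assms(2) unfolding low_rank_def by blast
  let ?a = "\<lambda>k. if k < N then a k else a' (k - N)" and ?b = "\<lambda>k. if k < N then b k else b' (k - N)"
  have "(\<Sum>k<N + N'. ?a k x * ?b k y) = G x y + G' x y" for x y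
  proof -
    have "(\<Sum>k<N + N'. ?a k x * ?b k y) = (\<Sum>k<N. ?a k x * ?b k y) + (\<Sum>k<N'. ?a (N + k) x * ?b (N + k) y)"
      by (simp add: lessThan_atLeast0 sum.atLeastLessThan_concat[of 0 N "N + N'", symmetric]
          sum.shift_bounds_nat_ivl[of _ 0 N N', simplified add_0 add.commute[of N' N]] add.commute[of _ N])
    then show ?thesis by (simp add: ab ab')
  qed
  then show ?thesis unfolding low_rank_def using ab ab'
    by (intro exI[of _ ?a] exI[of _ ?b]) auto
qed

lemma low_rank_sum:
  assumes "finite A" "\<And>a. a \<in> A \<Longrightarrow> low_rank M1 M2 (N a) (G a)"
  shows "low_rank M1 M2 (\<Sum>a\<in>A. N a) (\<lambda>x y. \<Sum>a\<in>A. G a x y)"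
  using assms by (induction A rule: finite_induct) (auto intro!: low_rank_0 low_rank_add)

lemma bounded_range_mult:
  fixes f g :: "'a \<Rightarrow> real"
  assumes "bounded (range f)" "bounded (range g)"
  shows "bounded (range (\<lambda>x. f x * g x))"
proof -
  obtain B B' where "\<And>x. \<bar>f x\<bar> \<le> B" "\<And>x. \<bar>g x\<bar> \<le> B'" using assms by (auto simp: bounded_iff)
  then have "\<bar>f x * g x\<bar> \<le> B * B'" for x
    by (metis abs_ge_zero abs_mult mult_mono order.trans)
  then show ?thesis by (auto simp: bounded_iff)
qed

lemma low_rank_mult:
  assumes "low_rank M1 M2 N G"
    and "c \<in> borel_measurable M1" "bounded (range c)" "e \<in> borel_measurable M2" "bounded (range e)"
  shows "low_rank M1 M2 N (\<lambda>x y. c x * e y * G x y)"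
proof -
  obtain a b where ab: "\<forall>k<N. a k \<in> borel_measurable M1 \<and> bounded (range (a k)) \<and>
      b k \<in> borel_measurable M2 \<and> bounded (range (b k))" "G = (\<lambda>x y. \<Sum>k<N. a k x * b k y)"
    using assms(1) unfolding low_rank_def by blast
  show ?thesis unfolding low_rank_def
    using ab assms
    by (intro exI[of _ "\<lambda>k x. c x * a k x"] exI[of _ "\<lambda>k y. e y * b k y"])
       (auto simp: fun_eq_iff sum_distrib_left mult_ac intro!: bounded_range_mult)
qed

lemma low_rank_measurable:
  assumes "low_rank M1 M2 N G"
  shows "(\<lambda>q. G (fst q) (snd q)) \<in> borel_measurable (M1 \<Otimes>\<^sub>M M2)"
proof -
  obtain a b where ab: "\<And>k. k < N \<Longrightarrow> a k \<in> borel_measurable M1" "\<And>k. k < N \<Longrightarrow> b k \<in> borel_measurable M2"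
    "G = (\<lambda>x y. \<Sum>k<N. a k x * b k y)"
    using assms unfolding low_rank_def by blast
  show ?thesis unfolding ab(3)
    by (intro borel_measurable_sum borel_measurable_times measurable_compose[OF measurable_fst ab(1)]
        measurable_compose[OF measurable_snd ab(2)]) auto
qed

lemma monom_at_measurable:
  assumes "\<And>i. i \<in> set is \<Longrightarrow> (\<lambda>x. w x i) \<in> borel_measurable M"
  shows "(\<lambda>x. monom_at (w x) is) \<in> borel_measurable M"
  using assms unfolding monom_at_def by (induction "is") auto

lemma taylor_poly_low_rank:
  fixes I1 I2 :: "'i set"
  defines "I \<equiv> I1 \<union> I2"
  assumes fin: "finite I1" "finite I2" and W: "weak_derivs I U p W" and mol: "mollifier I c d F"
    and X: "X \<in> sets (leb I1)" and x': "x' \<in> PiE I1 (\<lambda>_. UNIV)"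
    and near: "\<And>x i. x \<in> X \<Longrightarrow> i \<in> I1 \<Longrightarrow> \<bar>x i - x' i\<bar> \<le> V" and V: "0 \<le> V"
  shows "low_rank (leb I1) (leb I2) (\<Sum>a<p. card (words I a))
    (\<lambda>x y. indicator X x * taylor_poly I1 I2 p F W x' x y)"
proof -
  interpret mollifier I c d F by (rule mol)
  let ?w = "\<lambda>x i. if i \<in> I1 then x i - x' i else 0"
  have 1: "low_rank (leb I1) (leb I2) 1 (\<lambda>x y. (indicator X x * (monom_at (?w x) is / fact a))
      * mollify I F (W is) (merge I1 I2 (x', y)))" if a: "a < p" and isw: "is \<in> words I a" for a "is"
  proof (rule low_rank_product)
    have Wis: "W is \<in> borel_measurable (leb I)" "integrable (leb I) (W is)"
      using W a isw by (auto simp: weak_derivs_def)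
    have "(\<lambda>x. ?w x i) \<in> borel_measurable (leb I1)" for i
    proof (cases "i \<in> I1")
      case True
      then have "(\<lambda>x. x i - x' i) \<in> borel_measurable (leb I1)" by measurable
      then show ?thesis using True by simp
    qed simp
    then have [measurable]: "(\<lambda>x. monom_at (?w x) is) \<in> borel_measurable (leb I1)"
      by (intro monom_at_measurable)
    show "(\<lambda>x. indicator X x * (monom_at (?w x) is / fact a)) \<in> borel_measurable (leb I1)"
      using X by measurable
    have "\<bar>indicator X x * (monom_at (?w x) is / fact a)\<bar> \<le> V ^ a" for x
    proof (cases "x \<in> X")
      case True
      have "\<bar>monom_at (?w x) is\<bar> \<le> V ^ a"
        using abs_monom_at_le[of "is" "?w x" V] near[OF True] V isw by auto
      moreover have "\<bar>monom_at (?w x) is / fact a\<bar> \<le> \<bar>monom_at (?w x) is\<bar>"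
        using mult_left_mono[OF fact_ge_1[of a, where 'a = real], of "\<bar>monom_at (?w x) is\<bar>"]
        by (simp add: divide_le_eq)
      ultimately show ?thesis using True by simp
    qed (use V in simp)
    then show "bounded (range (\<lambda>x. indicator X x * (monom_at (?w x) is / fact a)))"
      by (auto simp: bounded_iff)
    have "(\<lambda>y. merge I1 I2 (x', y)) \<in> leb I2 \<rightarrow>\<^sub>M leb I"
      using measurable_compose[OF measurable_Pair1' measurable_merge[of I1 I2 "\<lambda>_. lborel"], of x'] x'
      by (simp add: space_leb I_def)
    from measurable_compose[OF this mollify_measurable[OF Wis(1)]]
    show "(\<lambda>y. mollify I F (W is) (merge I1 I2 (x', y))) \<in> borel_measurable (leb I2)" .
    show "bounded (range (\<lambda>y. mollify I F (W is) (merge I1 I2 (x', y))))"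
      using mollify_bounded[OF Wis(2)] by (auto simp: bounded_iff)
  qed
  have finI: "finite I" using fin by (simp add: I_def)
  have "low_rank (leb I1) (leb I2) (\<Sum>a<p. \<Sum>is\<in>words I a. 1) (\<lambda>x y. \<Sum>a<p. \<Sum>is\<in>words I a.
      (indicator X x * (monom_at (?w x) is / fact a)) * mollify I F (W is) (merge I1 I2 (x', y)))"
    by (intro low_rank_sum finite_words finI finite_lessThan 1) auto
  then show ?thesis
    unfolding taylor_poly_def I_def[symmetric] by (simp add: sum_distrib_left mult_ac)
qed

text \<open>
  In every coordinate, the integers \<open>q i\<close> with \<open>\<bar>z i / l - q i\<bar> \<le> K\<close> form an interval of length at
  most \<open>2 * K\<close>.
\<close>

lemma grid_overlap:
  fixes z :: "'i \<Rightarrow> real"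
  assumes J: "finite J" and l: "l > 0" and m: "2 * K + 1 \<le> real m" and Q: "finite Q" "Q \<subseteq> PiE J (\<lambda>_. UNIV :: int set)"
  shows "card {q \<in> Q. \<forall>i\<in>J. \<bar>z i - l * of_int (q i)\<bar> \<le> l * K} \<le> m ^ card J"
proof -
  let ?S = "\<lambda>i. {\<lceil>z i / l - K\<rceil>..\<lfloor>z i / l + K\<rfloor>}"
  have "{q \<in> Q. \<forall>i\<in>J. \<bar>z i - l * of_int (q i)\<bar> \<le> l * K} \<subseteq> PiE J ?S"
  proof
    fix q assume q: "q \<in> {q \<in> Q. \<forall>i\<in>J. \<bar>z i - l * of_int (q i)\<bar> \<le> l * K}"
    have "q i \<in> ?S i" if i: "i \<in> J" for i
    proof -
      have "\<bar>z i / l - of_int (q i)\<bar> = \<bar>z i - l * of_int (q i)\<bar> / l"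
      proof -
        have "z i / l - of_int (q i) = (z i - l * of_int (q i)) / l" using l by (simp add: field_simps)
        then show ?thesis using l by (simp add: abs_divide)
      qed
      also have "\<dots> \<le> K" using q i l by (simp add: divide_le_eq mult.commute)
      finally show ?thesis by (auto simp: ceiling_le_iff le_floor_iff abs_le_iff)
    qed
    then show "q \<in> PiE J ?S" using q Q by (auto simp: PiE_iff)
  qed
  then have "card {q \<in> Q. \<forall>i\<in>J. \<bar>z i - l * of_int (q i)\<bar> \<le> l * K} \<le> card (PiE J ?S)"
    by (rule card_mono[rotated]) (auto intro: finite_PiE J)
  also have "\<dots> = (\<Prod>i\<in>J. card (?S i))" by (rule card_PiE[OF J])
  also have "\<dots> \<le> (\<Prod>i\<in>J. m)"
  proof (rule prod_mono, safe)
    fix i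
    have "real_of_int (\<lfloor>z i / l + K\<rfloor> - \<lceil>z i / l - K\<rceil> + 1) \<le> real m"
      using m of_int_floor_le[of "z i / l + K"] le_of_int_ceiling[of "z i / l - K"]
      unfolding of_int_diff of_int_add of_int_1 by linarith
    then show "card (?S i) \<le> m" by simp
  qed
  finally show ?thesis by simp
qed

text \<open>
  One Taylor polynomial is used per cell of a grid, and the rank does not depend on the mollification.
  The remainder on a cell is controlled by the derivatives of order \<open>p\<close> on an enlarged cell. Since
  the enlarged cells overlap boundedly and mollification is a contraction, the sum of all remainders
  is at most a constant times \<open>h ^ (2 * p)\<close> times the mean square of the derivatives of order \<open>p\<close>.
\<close>

lemma local_low_rank:
  fixes I1 I2 :: "'i set"
  defines "I \<equiv> I1 \<union> I2"
  assumes fin: "finite I1" "finite I2" and disj: "I1 \<inter> I2 = {}"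
    and W: "weak_derivs I U p W" and p: "p > 0"
    and U: "\<And>z. z \<in> PiE I (\<lambda>_. UNIV) \<Longrightarrow> restrict z I1 \<in> U1 \<Longrightarrow> restrict z I2 \<in> U2 \<Longrightarrow> z \<in> U"
    and cone: "has_cone I1 U1 A1 v \<sigma> \<tau>" "has_cone I2 U2 A2 v \<sigma> \<tau>" and pos: "0 < \<sigma>" "0 < \<tau>"
    and A1: "A1 \<in> sets (leb I1)" and A2: "A2 \<in> sets (leb I2)"
    and R: "\<And>x i. x \<in> A1 \<Longrightarrow> i \<in> I1 \<Longrightarrow> \<bar>x i\<bar> \<le> R" "0 \<le> R"
    and supp: "\<And>x. x \<in> space (leb I) \<Longrightarrow> x \<notin> open_box I lo hi \<Longrightarrow> W [] x = 0"
  shows "\<exists>C K. 0 \<le> C \<and> 0 \<le> K \<and> (\<forall>h. 0 < h \<and> h \<le> \<tau> / 2 \<longrightarrow> (\<exists>N G.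
    real N \<le> K * (1 / h) ^ card I1 \<and> low_rank (leb I1) (leb I2) N G \<and>
    (\<integral>\<^sup>+z. ennreal ((W [] z - G (restrict z I1) (restrict z I2))\<^sup>2)
       * (indicator A1 (restrict z I1) * indicator A2 (restrict z I2)) \<partial>leb I) \<le> ennreal (C * h ^ (2 * p))))"
proof -
  interpret PS: product_sigma_finite "\<lambda>_. lborel :: real measure" by standard
  interpret S2: sigma_finite_measure "leb I2" by (rule leb_sigma_finite[OF fin(2)])
  have finI: "finite I" using fin by (simp add: I_def)
  define V where "V = (\<Sum>i\<in>I. \<bar>v i\<bar>) + \<sigma>"
  have V: "\<bar>v i\<bar> + \<sigma> \<le> V" if "i \<in> I" for i
    unfolding V_def using member_le_sum[OF that, of "\<lambda>i. \<bar>v i\<bar>"] finI by simp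
  have V0: "0 < V" unfolding V_def using pos by (simp add: add_nonneg_pos sum_nonneg)
  have V1: "\<bar>v i\<bar> + \<sigma> \<le> V" if "i \<in> I1" for i using V that by (simp add: I_def)
  have V0': "0 \<le> V" using V0 by simp
  have W_int: "integrable (leb I) (W is)" "(\<integral>\<^sup>+x. ennreal ((W is x)\<^sup>2) \<partial>leb I) < \<infinity>" if "is \<in> words I a" "a \<le> p" for "is" a
    using W that by (auto simp: weak_derivs_def)
  have W0_int: "integrable (leb I) (W [])" using W_int[of "[]" 0] by simp
  have W0[measurable]: "W [] \<in> borel_measurable (leb I)" using W0_int by simp
  have W0_shift: "shift_continuous I (W [])"
    by (rule shift_continuous_L2[OF finI W0 _ supp]) (use W_int[of "[]" 0] in auto)
  define E where "E = (\<Sum>is\<in>words I p. \<integral>\<^sup>+x. ennreal ((W is x)\<^sup>2) \<partial>leb I)"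
  have E: "E < \<infinity>" 
    unfolding E_def infinity_ennreal_def ennreal_sum_less_top[OF finite_words[OF finI]]
    using W_int(2)[of _ p] by auto
  \<comment> \<open>In units of the mesh size \<open>h * \<sigma> / 2\<close>, the enlarged cells have the radius \<open>1 + 2 * V / \<sigma>\<close>.\<close>
  define m where "m = nat \<lceil>2 * (1 + 2 * V / \<sigma>) + 1\<rceil>"
  have m: "2 * (1 + 2 * V / \<sigma>) + 1 \<le> real m" unfolding m_def by linarith
  define M0 where "M0 = (\<Sum>a<p. card (words I a))"
  define c0 where "c0 = real (card (words I p)) * V ^ (2 * p) * 2 ^ card I1 * real m ^ card I1 * enn2real E"
  define K where "K = (4 * R / \<sigma> + 5 * \<tau> / 2) ^ card I1 * real M0"
  have c0: "c0 \<ge> 0" unfolding c0_def using V0 by simp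
  have K: "K \<ge> 0" unfolding K_def using R pos by simp
  have main: "\<exists>N G. real N \<le> K * (1 / h) ^ card I1 \<and> low_rank (leb I1) (leb I2) N G \<and>
    (\<integral>\<^sup>+z. ennreal ((W [] z - G (restrict z I1) (restrict z I2))\<^sup>2)
       * (indicator A1 (restrict z I1) * indicator A2 (restrict z I2)) \<partial>leb I) \<le> ennreal ((2 + 2 * c0) * h ^ (2 * p))"
    if h: "0 < h" "h \<le> \<tau> / 2" for h
  proof -
    \<comment> \<open>The mollification parameter is so small that its error is negligible at scale \<open>h\<close>.\<close>
    have "ennreal (h ^ (2 * p)) > 0" using h by simp
    from shift_continuous_uniform[OF W0_shift this]
    obtain r where r: "r > 0" "\<And>y. (\<And>i. i \<in> I \<Longrightarrow> \<bar>y i\<bar> \<le> r) \<Longrightarrow> shift_dist I (W []) y \<le> ennreal (h ^ (2 * p))"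
      by blast
    define \<delta> where "\<delta> = min (\<tau> / 2) (r / V)"
    have \<delta>: "0 < \<delta>" "\<delta> \<le> \<tau> / 2" "\<delta> * V \<le> r"
      unfolding \<delta>_def using pos r V0 by (auto simp: min_def field_simps)
    have "\<exists>b. bump (\<delta> * v i) (\<delta> * \<sigma>) b" for i using \<delta> pos by (intro bump_exists) simp
    then obtain F where F: "\<And>i. bump (\<delta> * v i) (\<delta> * \<sigma>) (F i)" by metis
    have mol: "mollifier I (\<lambda>i. \<delta> * v i) (\<delta> * \<sigma>) F" by standard (auto simp: finI F)
    interpret mollifier I "\<lambda>i. \<delta> * v i" "\<delta> * \<sigma>" F by (rule mol)
    define u where "u = mollify I F (W [])"
    have [measurable]: "u \<in> borel_measurable (leb I)" unfolding u_def by (rule mollify_measurable[OF W0])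
    have u_close: "(\<integral>\<^sup>+x. ennreal ((u x - W [] x)\<^sup>2) \<partial>leb I) \<le> ennreal (h ^ (2 * p))"
      unfolding u_def
    proof (rule mollify_close[OF W0_int r(2)])
      fix y i assume y: "\<And>i. i \<in> I \<Longrightarrow> \<bar>y i - \<delta> * v i\<bar> \<le> \<delta> * \<sigma>" and i: "i \<in> I"
      have "\<bar>\<delta> * v i\<bar> = \<delta> * \<bar>v i\<bar>" using \<delta> by (simp add: abs_mult)
      then have "\<bar>y i\<bar> \<le> \<delta> * (\<bar>v i\<bar> + \<sigma>)" using y[OF i] by (simp add: distrib_left)
      also have "\<dots> \<le> \<delta> * V" using V[OF i] \<delta> by (intro mult_left_mono) auto
      finally show "\<bar>y i\<bar> \<le> r" using \<delta> by simp
    qed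
    \<comment> \<open>With this mesh size, a cell lies within the distance \<open>h * \<sigma> / 2\<close> of its corner.\<close>
    define l where "l = h * \<sigma> / 2"
    have l: "l > 0" using h pos by (simp add: l_def)
    define L where "L = \<lceil>R / l\<rceil> + 1"
    define Q where "Q = PiE I1 (\<lambda>_. {-L..L})"
    have finQ: "finite Q" unfolding Q_def using fin by (intro finite_PiE) auto
    define cell where "cell q = {x \<in> A1. \<forall>i\<in>I1. \<lfloor>x i / l\<rfloor> = q i}" for q
    have cell_sets: "cell q \<in> sets (leb I1)" for q
    proof -
      have "{x \<in> space (leb I1). \<forall>i\<in>I1. \<lfloor>x i / l\<rfloor> = q i} \<in> sets (leb I1)"
        using fin by measurable
      then have "A1 \<inter> {x \<in> space (leb I1). \<forall>i\<in>I1. \<lfloor>x i / l\<rfloor> = q i} \<in> sets (leb I1)" using A1 by blast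
      also have "A1 \<inter> {x \<in> space (leb I1). \<forall>i\<in>I1. \<lfloor>x i / l\<rfloor> = q i} = cell q"
        using sets.sets_into_space[OF A1] by (auto simp: cell_def)
      finally show ?thesis .
    qed
    have cell_ex: "\<exists>q\<in>Q. x \<in> cell q" if x: "x \<in> A1" for x
    proof
      let ?q = "\<lambda>i\<in>I1. \<lfloor>x i / l\<rfloor>"
      have "\<lfloor>x i / l\<rfloor> \<in> {-L..L}" if i: "i \<in> I1" for i
      proof -
        have "\<bar>x i / l\<bar> \<le> R / l" using R(1)[OF x i] l by (simp add: divide_right_mono)
        then have "x i / l \<le> R / l \<and> - (x i / l) \<le> R / l" by (simp only: abs_le_iff)
        then show ?thesis unfolding L_def atLeastAtMost_iff by linarith
      qed
      then show "?q \<in> Q" by (auto simp: Q_def)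
      show "x \<in> cell ?q" using x by (auto simp: cell_def)
    qed
    have cell_unique: "q = q'" if "q \<in> Q" "q' \<in> Q" "x \<in> cell q" "x \<in> cell q'" for q q' x
    proof (rule PiE_ext)
      show "q \<in> PiE I1 (\<lambda>_. {-L..L})" "q' \<in> PiE I1 (\<lambda>_. {-L..L})" using that by (simp_all add: Q_def)
      show "q i = q' i" if "i \<in> I1" for i
        using \<open>x \<in> cell q\<close> \<open>x \<in> cell q'\<close> that unfolding cell_def by simp
    qed
    define Rg where "Rg q = PiE I1 (\<lambda>i. {l * of_int (q i) - l * (1 + 2 * V / \<sigma>)..l * of_int (q i) + l * (1 + 2 * V / \<sigma>)})" for q :: "'i \<Rightarrow> int"
    have Rg_sets[measurable]: "Rg q \<in> sets (leb I1)" for q unfolding Rg_def by (rule leb_cube_sets[OF fin(1)])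
    define H where "H z = (\<Sum>is\<in>words I p. \<integral>\<^sup>+y. ennreal ((mollify I F (W is) (merge I1 I2 (z, y)))\<^sup>2) \<partial>leb I2)" for z
    have mm: "(\<lambda>z. ennreal ((mollify I F (W is) z)\<^sup>2)) \<in> borel_measurable (leb I)" if "is \<in> words I p" for "is"
      by (rule measurable_compose[OF _ measurable_ennreal], rule borel_measurable_power, rule mollify_measurable)
         (use W_int(1)[OF that order.refl] in simp)
    have mH: "(\<lambda>z. \<integral>\<^sup>+y. ennreal ((mollify I F (W is) (merge I1 I2 (z, y)))\<^sup>2) \<partial>leb I2) \<in> borel_measurable (leb I1)"
      if "is \<in> words I p" for "is"
    proof (rule S2.borel_measurable_nn_integral)
      have "(\<lambda>q. ennreal ((mollify I F (W is) (merge I1 I2 q))\<^sup>2)) \<in> borel_measurable (leb I1 \<Otimes>\<^sub>M leb I2)"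
        by (rule measurable_compose[OF _ mm[OF that]]) (simp add: I_def)
      then show "(\<lambda>(z, y). ennreal ((mollify I F (W is) (merge I1 I2 (z, y)))\<^sup>2)) \<in> borel_measurable (leb I1 \<Otimes>\<^sub>M leb I2)"
        by (simp add: case_prod_beta)
    qed
    have [measurable]: "H \<in> borel_measurable (leb I1)"
      unfolding H_def [abs_def] by (intro borel_measurable_sum mH)
    have H_le: "(\<integral>\<^sup>+z. H z \<partial>leb I1) \<le> E"
    proof -
      have "(\<integral>\<^sup>+z. H z \<partial>leb I1) = (\<Sum>is\<in>words I p. \<integral>\<^sup>+z. (\<integral>\<^sup>+y. ennreal ((mollify I F (W is) (merge I1 I2 (z, y)))\<^sup>2) \<partial>leb I2) \<partial>leb I1)"
        unfolding H_def by (intro nn_integral_sum mH)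
      also have "\<dots> = (\<Sum>is\<in>words I p. \<integral>\<^sup>+z. ennreal ((mollify I F (W is) z)\<^sup>2) \<partial>leb I)"
        unfolding I_def using mm[unfolded I_def]
        by (intro sum.cong refl PS.product_nn_integral_fold[symmetric] disj fin) auto
      also have "\<dots> \<le> E"
        unfolding E_def by (intro sum_mono mollify_contraction) (use W_int(1)[of _ p] in auto)
      finally show ?thesis .
    qed
    define cc where "cc = ennreal (real (card (words I p)) * ((h * V) ^ p)\<^sup>2)"
    define err where "err q x' = (\<integral>\<^sup>+x. (\<integral>\<^sup>+y. ennreal ((u (merge I1 I2 (x, y)) - taylor_poly I1 I2 p F W x' x y)\<^sup>2)
            * indicator A2 y \<partial>leb I2) * indicator (cell q) x \<partial>leb I1)" for q x'
    have "\<exists>x'. x' \<in> PiE I1 (\<lambda>_. UNIV) \<and> (\<forall>x\<in>cell q. \<forall>i\<in>I1. \<bar>x i - x' i\<bar> \<le> h * V) \<and>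
        err q x' \<le> cc * (2 ^ card I1 * (\<integral>\<^sup>+z. H z * indicator (Rg q) z \<partial>leb I1))" for q
    proof (cases "cell q = {}")
      case True
      then show ?thesis by (intro exI[of _ "\<lambda>i\<in>I1. 0"]) (simp add: err_def)
    next
      case False
      then obtain x0 where x0: "x0 \<in> cell q" by blast
      have grid: "l * of_int (q i) \<le> x i \<and> x i < l * of_int (q i) + l" if "x \<in> cell q" "i \<in> I1" for x i
      proof -
        have "\<lfloor>x i / l\<rfloor> = q i" using that by (simp add: cell_def)
        then have "of_int (q i) \<le> x i / l \<and> x i / l < of_int (q i) + 1" by (simp add: floor_eq_iff)
        then show ?thesis using l by (simp add: field_simps)
      qed
      have cell_A1: "cell q \<subseteq> A1" by (auto simp: cell_def)
      have x0_sp: "x0 \<in> PiE I1 (\<lambda>_. UNIV)" using x0 sets.sets_into_space[OF cell_sets[of q]] by (auto simp: space_leb)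
      have dist: "\<bar>x i - x0 i\<bar> \<le> h * \<sigma> / 2" if "x \<in> cell q" "i \<in> I1" for x i
        using grid[OF that] grid[OF x0 that(2)] unfolding l_def[symmetric] by linarith
      have Rg2: "z \<in> Rg q" if z: "z \<in> PiE I1 (\<lambda>_. UNIV)" and near: "\<And>i. i \<in> I1 \<Longrightarrow> \<bar>z i - x0 i\<bar> \<le> h * V" for z
      proof -
        have "\<bar>z i - l * of_int (q i)\<bar> \<le> l * (1 + 2 * V / \<sigma>)" if "i \<in> I1" for i
        proof -
          have "l * (1 + 2 * V / \<sigma>) = l + h * V" using pos by (simp add: l_def field_simps)
          then show ?thesis using near[OF that] grid[OF x0 that] by linarith
        qed
        then show ?thesis using z unfolding Rg_def mem_cube_iff by blast
      qed
      show ?thesis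
        unfolding err_def u_def cc_def H_def I_def
        by (rule cell_approx[of I1 I2 U p W U1 U2 A1 v \<sigma> \<tau> A2 \<delta> F h V "cell q" x0 "Rg q"])
           ((fact fin disj W[unfolded I_def] p U[unfolded I_def] cone pos A2 mol[unfolded I_def] h \<delta> V1 V0'
              cell_sets cell_A1 dist x0_sp Rg_sets Rg2)+,
             rule exI, intro conjI ballI, assumption, assumption, assumption)
    qed
    from choice[OF allI[OF this]]
    obtain x' where x'_all: "\<forall>q. x' q \<in> PiE I1 (\<lambda>_. UNIV) \<and> (\<forall>x\<in>cell q. \<forall>i\<in>I1. \<bar>x i - x' q i\<bar> \<le> h * V) \<and>
        err q (x' q) \<le> cc * (2 ^ card I1 * (\<integral>\<^sup>+z. H z * indicator (Rg q) z \<partial>leb I1))" ..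
    have x': "x' q \<in> PiE I1 (\<lambda>_. UNIV)" "x \<in> cell q \<Longrightarrow> i \<in> I1 \<Longrightarrow> \<bar>x i - x' q i\<bar> \<le> h * V"
      "err q (x' q) \<le> cc * (2 ^ card I1 * (\<integral>\<^sup>+z. H z * indicator (Rg q) z \<partial>leb I1))" for q x i
      using x'_all by auto
    have hV: "0 \<le> h * V" using h V0 by simp
    define T where "T q x y = indicator (cell q) x * taylor_poly I1 I2 p F W (x' q) x y" for q x y
    define G where "G x y = (\<Sum>q\<in>Q. T q x y)" for x y
    have T_rank: "low_rank (leb I1) (leb I2) M0 (T q)" for q
      unfolding T_def [abs_def] M0_def I_def
      by (rule taylor_poly_low_rank[of I1 I2 U p W "\<lambda>i. \<delta> * v i" "\<delta> * \<sigma>" F "cell q" "x' q" "h * V"])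
         (fact fin W[unfolded I_def] mol[unfolded I_def] cell_sets x' hV)+
    have G_rank: "low_rank (leb I1) (leb I2) (card Q * M0) G"
      using low_rank_sum[OF finQ T_rank] by (simp add: G_def [abs_def])
    have cardQ: "real (card Q * M0) \<le> K * (1 / h) ^ card I1"
    proof -
      have "card Q = (nat (2 * L + 1)) ^ card I1"
        unfolding Q_def using fin by (simp add: card_PiE algebra_simps)
      moreover have "L \<ge> 0"
      proof -
        have "0 \<le> R / l" using R(2) l by simp
        then show ?thesis unfolding L_def by linarith
      qed
      moreover have "real_of_int (2 * L + 1) \<le> (4 * R / \<sigma> + 5 * \<tau> / 2) * (1 / h)"
      proof -
        have "real_of_int L \<le> R / l + 2" unfolding L_def by linarith
        then have "real_of_int (2 * L + 1) \<le> 2 * (R / l) + 5" by simp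
        also have "2 * (R / l) = 4 * R / \<sigma> * (1 / h)" unfolding l_def using h pos by (simp add: field_simps)
        also have "5 \<le> 5 * \<tau> / 2 * (1 / h)" using h by (simp add: field_simps)
        finally show ?thesis by (simp add: algebra_simps)
      qed
      ultimately have "real (card Q) \<le> ((4 * R / \<sigma> + 5 * \<tau> / 2) * (1 / h)) ^ card I1"
        by (simp add: power_mono)
      then show ?thesis
        unfolding K_def power_mult_distrib of_nat_mult
        using mult_right_mono[of "real (card Q)" "(4 * R / \<sigma> + 5 * \<tau> / 2) ^ card I1 * (1 / h) ^ card I1" "real M0"]
        by (simp add: power_mult_distrib mult_ac)
    qed
    have split_A1: "(\<integral>\<^sup>+y. ennreal ((u (merge I1 I2 (x, y)) - G x y)\<^sup>2) * indicator A2 y \<partial>leb I2) * indicator A1 x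
        = (\<Sum>q\<in>Q. (\<integral>\<^sup>+y. ennreal ((u (merge I1 I2 (x, y)) - taylor_poly I1 I2 p F W (x' q) x y)\<^sup>2)
            * indicator A2 y \<partial>leb I2) * indicator (cell q) x)" for x
    proof (cases "x \<in> A1")
      case True
      then obtain q where q: "q \<in> Q" "x \<in> cell q" using cell_ex by blast
      have uniq: "q' = q" if "q' \<in> Q" "x \<in> cell q'" for q'
        by (rule cell_unique[OF that(1) q(1) that(2) q(2)])
      have mem: "x \<in> cell q' \<longleftrightarrow> q' = q" if "q' \<in> Q" for q'
      proof
        show "x \<in> cell q' \<Longrightarrow> q' = q" by (rule uniq[OF that])
        show "q' = q \<Longrightarrow> x \<in> cell q'" using q(2) by (simp only:)
      qed
      have "G x y = (\<Sum>q'\<in>Q. if q' = q then taylor_poly I1 I2 p F W (x' q) x y else 0)" for y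
        unfolding G_def T_def by (intro sum.cong refl) (simp add: indicator_def mem)
      then have Gx: "G x y = taylor_poly I1 I2 p F W (x' q) x y" for y using finQ q by simp
      have "(\<Sum>q'\<in>Q. (\<integral>\<^sup>+y. ennreal ((u (merge I1 I2 (x, y)) - taylor_poly I1 I2 p F W (x' q') x y)\<^sup>2)
            * indicator A2 y \<partial>leb I2) * indicator (cell q') x)
          = (\<Sum>q'\<in>Q. if q' = q then (\<integral>\<^sup>+y. ennreal ((u (merge I1 I2 (x, y)) - taylor_poly I1 I2 p F W (x' q) x y)\<^sup>2)
            * indicator A2 y \<partial>leb I2) else 0)"
        by (intro sum.cong refl) (simp add: indicator_def mem)
      then show ?thesis using finQ q True by (simp add: Gx)
    next
      case False
      then have "x \<notin> cell q" for q by (auto simp: cell_def)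
      then show ?thesis using False by simp
    qed
    have part2: "(\<integral>\<^sup>+x. (\<integral>\<^sup>+y. ennreal ((u (merge I1 I2 (x, y)) - G x y)\<^sup>2) * indicator A2 y \<partial>leb I2) * indicator A1 x \<partial>leb I1)
        \<le> ennreal (c0 * h ^ (2 * p))"
    proof -
      have meas: "(\<lambda>x. (\<integral>\<^sup>+y. ennreal ((u (merge I1 I2 (x, y)) - taylor_poly I1 I2 p F W (x' q) x y)\<^sup>2)
            * indicator A2 y \<partial>leb I2) * indicator (cell q) x) \<in> borel_measurable (leb I1)" for q
      proof -
        have [measurable]: "cell q \<in> sets (leb I1)" "A2 \<in> sets (leb I2)" by (rule cell_sets, rule A2)
        have [measurable]: "(\<lambda>s. T q (fst s) (snd s)) \<in> borel_measurable (leb I1 \<Otimes>\<^sub>M leb I2)"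
          by (rule low_rank_measurable[OF T_rank])
        have [measurable]: "(\<lambda>s. u (merge I1 I2 s)) \<in> borel_measurable (leb I1 \<Otimes>\<^sub>M leb I2)"
        proof -
          have "merge I1 I2 \<in> leb I1 \<Otimes>\<^sub>M leb I2 \<rightarrow>\<^sub>M leb I" by (simp add: I_def)
          from measurable_compose[OF this, of u borel] show ?thesis by simp
        qed
        have "(\<lambda>x. (\<integral>\<^sup>+y. ennreal ((u (merge I1 I2 (x, y)) - T q x y)\<^sup>2)
            * indicator A2 y \<partial>leb I2)) \<in> borel_measurable (leb I1)"
          by (rule S2.borel_measurable_nn_integral) (simp add: case_prod_beta)
        then have "(\<lambda>x. (\<integral>\<^sup>+y. ennreal ((u (merge I1 I2 (x, y)) - T q x y)\<^sup>2)
            * indicator A2 y \<partial>leb I2) * indicator (cell q) x) \<in> borel_measurable (leb I1)" by measurable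
        also have "(\<lambda>x. (\<integral>\<^sup>+y. ennreal ((u (merge I1 I2 (x, y)) - T q x y)\<^sup>2)
            * indicator A2 y \<partial>leb I2) * indicator (cell q) x)
          = (\<lambda>x. (\<integral>\<^sup>+y. ennreal ((u (merge I1 I2 (x, y)) - taylor_poly I1 I2 p F W (x' q) x y)\<^sup>2)
            * indicator A2 y \<partial>leb I2) * indicator (cell q) x)"
          by (auto simp: T_def fun_eq_iff split: split_indicator)
        finally show ?thesis .
      qed
      have "(\<integral>\<^sup>+x. (\<integral>\<^sup>+y. ennreal ((u (merge I1 I2 (x, y)) - G x y)\<^sup>2) * indicator A2 y \<partial>leb I2) * indicator A1 x \<partial>leb I1)
          = (\<Sum>q\<in>Q. err q (x' q))"
        unfolding split_A1 err_def by (intro nn_integral_sum meas)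
      also have "\<dots> \<le> (\<Sum>q\<in>Q. cc * (2 ^ card I1 * (\<integral>\<^sup>+z. H z * indicator (Rg q) z \<partial>leb I1)))"
        by (intro sum_mono x'(3))
      also have "\<dots> = cc * 2 ^ card I1 * (\<integral>\<^sup>+z. (\<Sum>q\<in>Q. H z * indicator (Rg q) z) \<partial>leb I1)"
        by (subst nn_integral_sum) (auto simp: sum_distrib_left mult.assoc)
      also have "(\<integral>\<^sup>+z. (\<Sum>q\<in>Q. H z * indicator (Rg q) z) \<partial>leb I1) \<le> (\<integral>\<^sup>+z. ennreal (real m ^ card I1) * H z \<partial>leb I1)"
      proof (intro nn_integral_mono)
        fix z assume z: "z \<in> space (leb I1)"
        have "{q \<in> Q. z \<in> Rg q} = {q \<in> Q. \<forall>i\<in>I1. \<bar>z i - l * of_int (q i)\<bar> \<le> l * (1 + 2 * V / \<sigma>)}"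
          using z by (auto simp only: Rg_def mem_cube_iff space_leb mem_Collect_eq)
        then have "card {q \<in> Q. z \<in> Rg q} \<le> m ^ card I1"
          using grid_overlap[OF fin(1) l m finQ, of z] by (auto simp: Q_def)
        then have "(of_nat (card {q \<in> Q. z \<in> Rg q}) :: ennreal) \<le> of_nat (m ^ card I1)"
          by (simp only: of_nat_le_iff)
        moreover have "(\<Sum>q\<in>Q. indicator (Rg q) z) = (of_nat (card {q \<in> Q. z \<in> Rg q}) :: ennreal)"
          using finQ by (simp add: indicator_def sum.If_cases Int_def)
        ultimately show "(\<Sum>q\<in>Q. H z * indicator (Rg q) z) \<le> ennreal (real m ^ card I1) * H z"
          unfolding sum_distrib_left[symmetric]
          by (subst mult.commute, intro mult_right_mono) (auto simp: ennreal_of_nat_eq_real_of_nat)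
      qed
      also have "\<dots> = ennreal (real m ^ card I1) * (\<integral>\<^sup>+z. H z \<partial>leb I1)"
        by (rule nn_integral_cmult) measurable
      also have "(\<integral>\<^sup>+z. H z \<partial>leb I1) \<le> ennreal (enn2real E)"
        using H_le E by (simp add: less_top)
      finally have "(\<integral>\<^sup>+x. (\<integral>\<^sup>+y. ennreal ((u (merge I1 I2 (x, y)) - G x y)\<^sup>2) * indicator A2 y \<partial>leb I2) * indicator A1 x \<partial>leb I1)
          \<le> cc * 2 ^ card I1 * (ennreal (real m ^ card I1) * ennreal (enn2real E))"
        by (simp add: mult_left_mono)
      also have "\<dots> = ennreal (c0 * h ^ (2 * p))"
      proof -
        have two: "(2 :: ennreal) ^ card I1 = ennreal (2 ^ card I1)" by (simp add: ennreal_power[symmetric])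
        have "cc * 2 ^ card I1 * (ennreal (real m ^ card I1) * ennreal (enn2real E))
            = ennreal (real (card (words I p)) * ((h * V) ^ p)\<^sup>2 * 2 ^ card I1 * (real m ^ card I1 * enn2real E))"
          unfolding cc_def two by (simp only: ennreal_mult[symmetric] mult_nonneg_nonneg zero_le_power2
              of_nat_0_le_iff zero_le_power zero_le_numeral enn2real_nonneg)
        also have "real (card (words I p)) * ((h * V) ^ p)\<^sup>2 * 2 ^ card I1 * (real m ^ card I1 * enn2real E) = c0 * h ^ (2 * p)"
          unfolding c0_def by (simp add: power_mult_distrib power_mult[symmetric] mult_ac)
        finally show ?thesis .
      qed
      finally show ?thesis .
    qed
    let ?ind = "\<lambda>z. indicator A1 (restrict z I1) * indicator A2 (restrict z I2)"
    have r1[measurable]: "(\<lambda>z. restrict z I1) \<in> leb I \<rightarrow>\<^sub>M leb I1" and r2[measurable]: "(\<lambda>z. restrict z I2) \<in> leb I \<rightarrow>\<^sub>M leb I2"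
      unfolding I_def by (auto intro: measurable_restrict_subset)
    have [measurable]: "(\<lambda>z. G (restrict z I1) (restrict z I2)) \<in> borel_measurable (leb I)"
      using measurable_compose[OF measurable_Pair[OF r1 r2] low_rank_measurable[OF G_rank]] by simp
    have [measurable]: "(\<lambda>z. indicat_real A1 (restrict z I1)) \<in> borel_measurable (leb I)"
      "(\<lambda>z. indicat_real A2 (restrict z I2)) \<in> borel_measurable (leb I)"
      using measurable_compose[OF r1, of "indicat_real A1"] measurable_compose[OF r2, of "indicat_real A2"] A1 A2 by auto
    have eq: "ennreal ((W [] z - G (restrict z I1) (restrict z I2))\<^sup>2) * ?ind z
        = ennreal (((W [] z - u z) * ?ind z + (u z - G (restrict z I1) (restrict z I2)) * ?ind z)\<^sup>2)" for z
      by (auto simp: algebra_simps split: split_indicator)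
    have total: "(\<integral>\<^sup>+z. ennreal ((W [] z - G (restrict z I1) (restrict z I2))\<^sup>2) * ?ind z \<partial>leb I)
        \<le> 2 * (\<integral>\<^sup>+z. ennreal (((W [] z - u z) * ?ind z)\<^sup>2) \<partial>leb I)
          + 2 * (\<integral>\<^sup>+z. ennreal (((u z - G (restrict z I1) (restrict z I2)) * ?ind z)\<^sup>2) \<partial>leb I)"
      unfolding eq by (rule nn_integral_square_add_le) measurable
    have "(\<integral>\<^sup>+z. ennreal (((W [] z - u z) * ?ind z)\<^sup>2) \<partial>leb I) \<le> (\<integral>\<^sup>+z. ennreal ((u z - W [] z)\<^sup>2) \<partial>leb I)"
      by (intro nn_integral_mono) (auto simp: power2_commute split: split_indicator)
    also have "\<dots> \<le> ennreal (h ^ (2 * p))" by (rule u_close)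
    finally have first: "(\<integral>\<^sup>+z. ennreal (((W [] z - u z) * ?ind z)\<^sup>2) \<partial>leb I) \<le> ennreal (h ^ (2 * p))" .
    have "(\<integral>\<^sup>+z. ennreal (((u z - G (restrict z I1) (restrict z I2)) * ?ind z)\<^sup>2) \<partial>leb I)
        = (\<integral>\<^sup>+x. (\<integral>\<^sup>+y. ennreal ((u (merge I1 I2 (x, y)) - G x y)\<^sup>2) * indicator A2 y \<partial>leb I2) * indicator A1 x \<partial>leb I1)"
    proof -
      have "(\<integral>\<^sup>+z. ennreal (((u z - G (restrict z I1) (restrict z I2)) * ?ind z)\<^sup>2) \<partial>leb I)
          = (\<integral>\<^sup>+x. (\<integral>\<^sup>+y. ennreal (((u (merge I1 I2 (x, y)) - G (restrict (merge I1 I2 (x, y)) I1) (restrict (merge I1 I2 (x, y)) I2))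
              * ?ind (merge I1 I2 (x, y)))\<^sup>2) \<partial>leb I2) \<partial>leb I1)"
        unfolding I_def
        by (rule PS.product_nn_integral_fold[OF disj fin]) (simp only: I_def[symmetric], measurable)
      also have "\<dots> = (\<integral>\<^sup>+x. (\<integral>\<^sup>+y. ennreal ((u (merge I1 I2 (x, y)) - G x y)\<^sup>2) * indicator A2 y \<partial>leb I2) * indicator A1 x \<partial>leb I1)"
      proof (rule nn_integral_cong)
        fix x assume x: "x \<in> space (leb I1)"
        have "ennreal (((u (merge I1 I2 (x, y)) - G (restrict (merge I1 I2 (x, y)) I1) (restrict (merge I1 I2 (x, y)) I2))
              * ?ind (merge I1 I2 (x, y)))\<^sup>2) = ennreal ((u (merge I1 I2 (x, y)) - G x y)\<^sup>2) * indicator A2 y * indicator A1 x"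
          if y: "y \<in> space (leb I2)" for y
        proof -
          have "restrict (merge I1 I2 (x, y)) I1 = x" "restrict (merge I1 I2 (x, y)) I2 = y"
            using x y disj by (auto simp: space_leb PiE_iff extensional_restrict)
          then show ?thesis by (auto split: split_indicator)
        qed
        then have "(\<integral>\<^sup>+y. ennreal (((u (merge I1 I2 (x, y)) - G (restrict (merge I1 I2 (x, y)) I1) (restrict (merge I1 I2 (x, y)) I2))
              * ?ind (merge I1 I2 (x, y)))\<^sup>2) \<partial>leb I2)
            = (\<integral>\<^sup>+y. ennreal ((u (merge I1 I2 (x, y)) - G x y)\<^sup>2) * indicator A2 y * indicator A1 x \<partial>leb I2)"
          by (rule nn_integral_cong)
        also have "\<dots> = (\<integral>\<^sup>+y. ennreal ((u (merge I1 I2 (x, y)) - G x y)\<^sup>2) * indicator A2 y \<partial>leb I2) * indicator A1 x"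
          by (cases "x \<in> A1") auto
        finally show "(\<integral>\<^sup>+y. ennreal (((u (merge I1 I2 (x, y)) - G (restrict (merge I1 I2 (x, y)) I1) (restrict (merge I1 I2 (x, y)) I2))
              * ?ind (merge I1 I2 (x, y)))\<^sup>2) \<partial>leb I2)
            = (\<integral>\<^sup>+y. ennreal ((u (merge I1 I2 (x, y)) - G x y)\<^sup>2) * indicator A2 y \<partial>leb I2) * indicator A1 x" .
      qed
      finally show ?thesis .
    qed
    also have "\<dots> \<le> ennreal (c0 * h ^ (2 * p))" by (rule part2)
    finally have second: "(\<integral>\<^sup>+z. ennreal (((u z - G (restrict z I1) (restrict z I2)) * ?ind z)\<^sup>2) \<partial>leb I)
        \<le> ennreal (c0 * h ^ (2 * p))" .
    note total
    also have "2 * (\<integral>\<^sup>+z. ennreal (((W [] z - u z) * ?ind z)\<^sup>2) \<partial>leb I)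
          + 2 * (\<integral>\<^sup>+z. ennreal (((u z - G (restrict z I1) (restrict z I2)) * ?ind z)\<^sup>2) \<partial>leb I)
        \<le> 2 * ennreal (h ^ (2 * p)) + 2 * ennreal (c0 * h ^ (2 * p))"
      by (intro add_mono mult_left_mono first second) auto
    also have "\<dots> = ennreal ((2 + 2 * c0) * h ^ (2 * p))"
    proof -
      have "2 * ennreal r = ennreal (2 * r)" if "r \<ge> 0" for r using that by (simp add: ennreal_mult)
      then show ?thesis using c0 h by (simp add: distrib_right mult.assoc flip: ennreal_plus)
    qed
    finally show ?thesis using cardQ G_rank by blast
  qed
  show ?thesis
    by (intro exI[of _ "2 + 2 * c0"] exI[of _ K]) (use main c0 K in auto)
qed

section \<open>Domains with the uniform interior cone property\<close>

text \<open>
  A cone property with finitely many axes. The patches on which the axis is constant are disjoint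
  and measurable, so that errors add up over the patches.
\<close>

definition uniform_cone :: "'i set \<Rightarrow> ('i \<Rightarrow> real) set \<Rightarrow> bool" where
  "uniform_cone J V \<longleftrightarrow> (\<exists>(K::nat) A v \<sigma> \<tau>. 0 < \<sigma> \<and> 0 < \<tau> \<and>
     (\<forall>c<K. A c \<in> sets (leb J) \<and> has_cone J V (A c) (v c) \<sigma> \<tau>) \<and>
     disjoint_family_on A {..<K} \<and> V = (\<Union>c<K. A c))"

lemma uniform_coneE:
  assumes "uniform_cone J V"
  obtains K :: nat and A v \<sigma> \<tau> where "\<And>c. c < K \<Longrightarrow> has_cone J V (A c) (v c) \<sigma> \<tau>" "0 < \<sigma>" "0 < \<tau>"
    "\<And>c. c < K \<Longrightarrow> A c \<in> sets (leb J)" "disjoint_family_on A {..<K}" "V = (\<Union>c<K. A c)"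
proof -
  from assms[unfolded uniform_cone_def] obtain K A v \<sigma> \<tau> where *: "0 < \<sigma> \<and> 0 < \<tau> \<and>
     (\<forall>c<(K::nat). A c \<in> sets (leb J) \<and> has_cone J V (A c) (v c) \<sigma> \<tau>) \<and>
     disjoint_family_on A {..<K} \<and> V = (\<Union>c<K. A c)"
    by (elim exE) (rule that)
  show thesis by (rule that[of K A v \<sigma> \<tau>]) (use * in blast)+
qed

lemma uniform_coneI:
  assumes C: "finite C" and "0 < \<sigma>" "0 < \<tau>" and A: "\<And>c. c \<in> C \<Longrightarrow> A c \<in> sets (leb J)"
    and cone: "\<And>c. c \<in> C \<Longrightarrow> has_cone J V (A c) (v c) \<sigma> \<tau>"
    and disj: "disjoint_family_on A C" and V: "V = (\<Union>c\<in>C. A c)"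
  shows "uniform_cone J V"
proof -
  obtain b where b: "bij_betw b {0..<card C} C" using ex_bij_betw_nat_finite[OF C] by blast
  then have b': "bij_betw b {..<card C} C" by (simp add: lessThan_atLeast0)
  have mem: "b k \<in> C" if "k < card C" for k using bij_betwE[OF b'] that by simp
  have "disjoint_family_on (\<lambda>k. A (b k)) {..<card C}"
    unfolding disjoint_family_on_def
  proof (intro ballI impI)
    fix k k' assume k: "k \<in> {..<card C}" "k' \<in> {..<card C}" "k \<noteq> k'"
    then have "b k \<noteq> b k'" using bij_betw_imp_inj_on[OF b'] by (auto simp: inj_on_def)
    then show "A (b k) \<inter> A (b k') = {}" using disj mem k by (auto simp: disjoint_family_on_def)
  qed
  moreover have "V = (\<Union>k<card C. A (b k))"
  proof -
    have "(\<Union>k<card C. A (b k)) = (\<Union>c\<in>b ` {..<card C}. A c)" by simp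
    then show ?thesis using V bij_betw_imp_surj_on[OF b'] by simp
  qed
  ultimately show ?thesis
    unfolding uniform_cone_def using assms(2,3) A cone mem
    by (intro exI[of _ "card C"] exI[of _ "\<lambda>k. A (b k)"] exI[of _ "\<lambda>k. v (b k)"] exI[of _ \<sigma>] exI[of _ \<tau>]) auto
qed

lemma has_cone_mono:
  assumes "has_cone J V A v \<sigma> \<tau>" "\<sigma>' \<le> \<sigma>" "\<tau>' \<le> \<tau>"
  shows "has_cone J V A v \<sigma>' \<tau>'"
  unfolding has_cone_def
proof (intro ballI allI impI)
  fix x t z assume x: "x \<in> A" "0 < t \<and> t \<le> \<tau>'" "z \<in> J \<rightarrow>\<^sub>E UNIV"
    "\<forall>i\<in>J. \<bar>z i - (x i + t * v i)\<bar> \<le> t * \<sigma>'"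
  have "t * \<sigma>' \<le> t * \<sigma>" using x assms by (intro mult_left_mono) auto
  then show "z \<in> V" using x assms by (intro has_coneD[OF assms(1), of x t]) (auto intro: order.trans)
qed

lemma has_cone_cong:
  assumes "has_cone J V A v \<sigma> \<tau>" "\<And>i. i \<in> J \<Longrightarrow> v i = v' i"
  shows "has_cone J V A v' \<sigma> \<tau>"
  using assms unfolding has_cone_def by simp

lemma uniform_cone_sets:
  assumes "uniform_cone J V" shows "V \<in> sets (leb J)"
proof -
  obtain K A where "\<And>c. c < (K :: nat) \<Longrightarrow> A c \<in> sets (leb J)" "V = (\<Union>c<K. A c)"
    by (rule uniform_coneE[OF assms], rule that, assumption+)
  then show ?thesis by auto
qed

text \<open>
  A pair of patches of the two factors has a cone in the product, whose axis is composed of the two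
  axes. The approximations on such pairs are cut off by the indicator functions of the patches,
  which does not raise their rank, and added.
\<close>

lemma global_low_rank:
  fixes I1 I2 :: "'i set"
  defines "I \<equiv> I1 \<union> I2"
  assumes fin: "finite I1" "finite I2" and disj: "I1 \<inter> I2 = {}"
    and W: "weak_derivs I U p W" and p: "p > 0"
    and U: "U = {z \<in> PiE I (\<lambda>_. UNIV). restrict z I1 \<in> U1 \<and> restrict z I2 \<in> U2}"
    and cone: "uniform_cone I1 U1" "uniform_cone I2 U2"
    and R: "\<And>x i. x \<in> U1 \<Longrightarrow> i \<in> I1 \<Longrightarrow> \<bar>x i\<bar> \<le> R" "0 \<le> R"
    and supp: "\<And>x. x \<in> space (leb I) \<Longrightarrow> x \<notin> open_box I lo hi \<Longrightarrow> W [] x = 0"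
  shows "\<exists>C K h0. 0 \<le> C \<and> 0 \<le> K \<and> 0 < h0 \<and> (\<forall>h. 0 < h \<and> h \<le> h0 \<longrightarrow> (\<exists>N G.
    real N \<le> K * (1 / h) ^ card I1 \<and> low_rank (leb I1) (leb I2) N G \<and>
    (\<integral>\<^sup>+z. ennreal ((W [] z - G (restrict z I1) (restrict z I2))\<^sup>2) * indicator U z \<partial>leb I)
      \<le> ennreal (C * h ^ (2 * p))))"
proof -
  from cone(1)[unfolded uniform_cone_def] obtain K1 A1 v1 \<sigma>1 \<tau>1 where cover1: "0 < \<sigma>1 \<and> 0 < \<tau>1 \<and>
     (\<forall>c<(K1::nat). A1 c \<in> sets (leb I1) \<and> has_cone I1 U1 (A1 c) (v1 c) \<sigma>1 \<tau>1) \<and>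
     disjoint_family_on A1 {..<K1} \<and> U1 = (\<Union>c<K1. A1 c)"
    by (elim exE) (rule that)
  have 1: "\<And>c. c < K1 \<Longrightarrow> has_cone I1 U1 (A1 c) (v1 c) \<sigma>1 \<tau>1"
    "0 < \<sigma>1" "0 < \<tau>1" "\<And>c. c < K1 \<Longrightarrow> A1 c \<in> sets (leb I1)" "disjoint_family_on A1 {..<K1}" "U1 = (\<Union>c<K1. A1 c)"
    using cover1 by blast+
  from cone(2)[unfolded uniform_cone_def] obtain K2 A2 v2 \<sigma>2 \<tau>2 where cover2: "0 < \<sigma>2 \<and> 0 < \<tau>2 \<and>
     (\<forall>c<(K2::nat). A2 c \<in> sets (leb I2) \<and> has_cone I2 U2 (A2 c) (v2 c) \<sigma>2 \<tau>2) \<and>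
     disjoint_family_on A2 {..<K2} \<and> U2 = (\<Union>c<K2. A2 c)"
    by (elim exE) (rule that)
  have 2: "\<And>c. c < K2 \<Longrightarrow> has_cone I2 U2 (A2 c) (v2 c) \<sigma>2 \<tau>2"
    "0 < \<sigma>2" "0 < \<tau>2" "\<And>c. c < K2 \<Longrightarrow> A2 c \<in> sets (leb I2)" "disjoint_family_on A2 {..<K2}" "U2 = (\<Union>c<K2. A2 c)"
    using cover2 by blast+
  define \<sigma> where "\<sigma> = min \<sigma>1 \<sigma>2"
  define \<tau> where "\<tau> = min \<tau>1 \<tau>2"
  define D where "D = {..<K1} \<times> {..<K2}"
  define ind :: "nat \<times> nat \<Rightarrow> ('i \<Rightarrow> real) \<Rightarrow> ennreal" where
    "ind d z = indicator (A1 (fst d)) (restrict z I1) * indicator (A2 (snd d)) (restrict z I2)" for d z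
  define approx where "approx d C L h N G \<longleftrightarrow> real N \<le> L * (1 / h) ^ card I1 \<and> low_rank (leb I1) (leb I2) N G \<and>
    (\<integral>\<^sup>+z. ennreal ((W [] z - G (restrict z I1) (restrict z I2))\<^sup>2) * ind d z \<partial>leb I) \<le> ennreal (C * h ^ (2 * p))"
    for d C L h N G
  have "\<exists>C L. 0 \<le> C \<and> 0 \<le> L \<and> (\<forall>h. 0 < h \<and> h \<le> \<tau> / 2 \<longrightarrow> (\<exists>N G. approx d C L h N G))"
    if d: "d \<in> D" for d
  proof -
    have d12: "fst d < K1" "snd d < K2" using d by (auto simp: D_def)
    let ?v = "\<lambda>i. if i \<in> I1 then v1 (fst d) i else v2 (snd d) i"
    have c1: "has_cone I1 U1 (A1 (fst d)) ?v \<sigma> \<tau>"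
      by (rule has_cone_cong[OF has_cone_mono[OF 1(1)[OF d12(1)]]]) (auto simp: \<sigma>_def \<tau>_def)
    have c2: "has_cone I2 U2 (A2 (snd d)) ?v \<sigma> \<tau>"
      by (rule has_cone_cong[OF has_cone_mono[OF 2(1)[OF d12(2)]]]) (use disj in \<open>auto simp: \<sigma>_def \<tau>_def\<close>)
    show ?thesis
      unfolding approx_def ind_def I_def
    proof (rule local_low_rank[OF fin disj W[unfolded I_def] p _ c1 c2])
      show "z \<in> U" if "z \<in> I1 \<union> I2 \<rightarrow>\<^sub>E UNIV" "restrict z I1 \<in> U1" "restrict z I2 \<in> U2" for z
        using that unfolding U I_def by simp
      show "0 < \<sigma>" "0 < \<tau>" using 1(2,3) 2(2,3) by (simp_all add: \<sigma>_def \<tau>_def)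
      show "A1 (fst d) \<in> sets (leb I1)" "A2 (snd d) \<in> sets (leb I2)" by (rule 1(4) 2(4), rule d12)+
      show "\<bar>x i\<bar> \<le> R" if "x \<in> A1 (fst d)" "i \<in> I1" for x i
        using that d12(1) by (intro R(1)) (auto simp: 1(6))
      show "W [] x = 0" if "x \<in> space (leb (I1 \<union> I2))" "x \<notin> open_box (I1 \<union> I2) lo hi" for x
        using that supp unfolding I_def by blast
    qed (rule R(2))
  qed
  then obtain C L where CL: "\<And>d. d \<in> D \<Longrightarrow> 0 \<le> C d" "\<And>d. d \<in> D \<Longrightarrow> 0 \<le> L d"
    "\<And>d h. d \<in> D \<Longrightarrow> 0 < h \<Longrightarrow> h \<le> \<tau> / 2 \<Longrightarrow> \<exists>N G. approx d (C d) (L d) h N G"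
    by metis
  have finD: "finite D" by (simp add: D_def)
  have "integrable (leb I) (W [])" using W by (auto simp: weak_derivs_def dest: spec[of _ "[]"])
  then have W0[measurable]: "W [] \<in> borel_measurable (leb I)" by simp
  have main: "\<exists>N G. real N \<le> (\<Sum>d\<in>D. L d) * (1 / h) ^ card I1 \<and> low_rank (leb I1) (leb I2) N G \<and>
    (\<integral>\<^sup>+z. ennreal ((W [] z - G (restrict z I1) (restrict z I2))\<^sup>2) * indicator U z \<partial>leb I)
      \<le> ennreal ((\<Sum>d\<in>D. C d) * h ^ (2 * p))" if h: "0 < h" "h \<le> \<tau> / 2" for h
  proof -
    obtain N H where "\<And>d. d \<in> D \<Longrightarrow> approx d (C d) (L d) h (N d) (H d)"
      using CL(3)[OF _ h] by metis
    then have NG: "\<And>d. d \<in> D \<Longrightarrow> real (N d) \<le> L d * (1 / h) ^ card I1"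
      "\<And>d. d \<in> D \<Longrightarrow> low_rank (leb I1) (leb I2) (N d) (H d)"
      "\<And>d. d \<in> D \<Longrightarrow> (\<integral>\<^sup>+z. ennreal ((W [] z - H d (restrict z I1) (restrict z I2))\<^sup>2) * ind d z \<partial>leb I) \<le> ennreal (C d * h ^ (2 * p))"
      unfolding approx_def by blast+
    define G where "G x y = (\<Sum>d\<in>D. indicator (A1 (fst d)) x * indicator (A2 (snd d)) y * H d x y)" for x y
    have bi: "bounded (range (indicat_real S))" for S :: "('i \<Rightarrow> real) set"
      by (auto simp: bounded_iff indicator_def intro!: exI[of _ 1])
    have G_rank: "low_rank (leb I1) (leb I2) (\<Sum>d\<in>D. N d) G"
      unfolding G_def [abs_def]
    proof (intro low_rank_sum finD low_rank_mult NG bi)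
      fix d assume "d \<in> D"
      then show "indicat_real (A1 (fst d)) \<in> borel_measurable (leb I1)" "indicat_real (A2 (snd d)) \<in> borel_measurable (leb I2)"
        using 1(4) 2(4) by (auto simp: D_def)
    qed
    have rank: "real (\<Sum>d\<in>D. N d) \<le> (\<Sum>d\<in>D. L d) * (1 / h) ^ card I1"
      unfolding of_nat_sum sum_distrib_right by (intro sum_mono NG)
    have split: "ennreal ((W [] z - G (restrict z I1) (restrict z I2))\<^sup>2) * indicator U z
        = (\<Sum>d\<in>D. ennreal ((W [] z - H d (restrict z I1) (restrict z I2))\<^sup>2) * ind d z)"
      if z: "z \<in> space (leb I)" for z
    proof (cases "z \<in> U")
      case True
      then obtain c1 c2 where c: "c1 < K1" "restrict z I1 \<in> A1 c1" "c2 < K2" "restrict z I2 \<in> A2 c2"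
        unfolding U 1(6) 2(6) by blast
      have u1: "restrict z I1 \<in> A1 c \<longleftrightarrow> c = c1" if "c < K1" for c
        using 1(5) c that unfolding disjoint_family_on_def by blast
      have u2: "restrict z I2 \<in> A2 c \<longleftrightarrow> c = c2" if "c < K2" for c
        using 2(5) c that unfolding disjoint_family_on_def by blast
      have cD: "(c1, c2) \<in> D" using c by (simp add: D_def)
      have "G (restrict z I1) (restrict z I2) = (\<Sum>d\<in>D. if d = (c1, c2) then H (c1, c2) (restrict z I1) (restrict z I2) else 0)"
        unfolding G_def by (intro sum.cong refl) (auto simp: D_def indicator_def u1 u2)
      then have G_eq: "G (restrict z I1) (restrict z I2) = H (c1, c2) (restrict z I1) (restrict z I2)"
        using finD cD by simp
      have "(\<Sum>d\<in>D. ennreal ((W [] z - H d (restrict z I1) (restrict z I2))\<^sup>2) * ind d z)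
          = (\<Sum>d\<in>D. if d = (c1, c2) then ennreal ((W [] z - H (c1, c2) (restrict z I1) (restrict z I2))\<^sup>2) else 0)"
        by (intro sum.cong refl) (auto simp: D_def ind_def indicator_def u1 u2)
      then show ?thesis using finD cD True by (simp add: G_eq)
    next
      case False
      have "ind d z = 0" if "d \<in> D" for d
        using False that z unfolding U 1(6) 2(6) ind_def D_def I_def
        by (auto simp: space_leb indicator_def)
      then show ?thesis using False by simp
    qed
    have r1: "(\<lambda>z. restrict z I1) \<in> leb I \<rightarrow>\<^sub>M leb I1" and r2: "(\<lambda>z. restrict z I2) \<in> leb I \<rightarrow>\<^sub>M leb I2"
      unfolding I_def by (auto intro: measurable_restrict_subset)
    have meas: "(\<lambda>z. ennreal ((W [] z - H d (restrict z I1) (restrict z I2))\<^sup>2) * ind d z) \<in> borel_measurable (leb I)"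
      if d: "d \<in> D" for d
    proof -
      have [measurable]: "(\<lambda>z. H d (restrict z I1) (restrict z I2)) \<in> borel_measurable (leb I)"
        using measurable_compose[OF measurable_Pair[OF r1 r2] low_rank_measurable[OF NG(2)[OF d]]] by simp
      have [measurable]: "(\<lambda>z. indicator (A1 (fst d)) (restrict z I1) :: ennreal) \<in> borel_measurable (leb I)"
        "(\<lambda>z. indicator (A2 (snd d)) (restrict z I2) :: ennreal) \<in> borel_measurable (leb I)"
        using d 1(4) 2(4) by (auto simp: D_def intro!: measurable_compose[OF r1] measurable_compose[OF r2])
      show ?thesis unfolding ind_def by measurable
    qed
    have "(\<integral>\<^sup>+z. ennreal ((W [] z - G (restrict z I1) (restrict z I2))\<^sup>2) * indicator U z \<partial>leb I)
        = (\<Sum>d\<in>D. \<integral>\<^sup>+z. ennreal ((W [] z - H d (restrict z I1) (restrict z I2))\<^sup>2) * ind d z \<partial>leb I)"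
      by (subst nn_integral_sum[OF meas, symmetric]) (auto intro!: nn_integral_cong split)
    also have "\<dots> \<le> (\<Sum>d\<in>D. ennreal (C d * h ^ (2 * p)))" by (intro sum_mono NG)
    also have "\<dots> = ennreal ((\<Sum>d\<in>D. C d) * h ^ (2 * p))"
      using CL(1) h by (simp add: sum_ennreal sum_distrib_right)
    finally show ?thesis using rank G_rank by blast
  qed
  have "0 \<le> (\<Sum>d\<in>D. C d)" "0 \<le> (\<Sum>d\<in>D. L d)" using CL by (auto intro!: sum_nonneg)
  moreover have "0 < \<tau> / 2" using 1(3) 2(3) by (simp add: \<tau>_def)
  ultimately show ?thesis using main
    by (intro exI[of _ "\<Sum>d\<in>D. C d"] exI[of _ "\<Sum>d\<in>D. L d"] exI[of _ "\<tau> / 2"]) simp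
qed

text \<open>The cone property passes to products, as the cones are described coordinate by coordinate.\<close>

lemma uniform_cone_product:
  fixes S :: "nat set" and n :: "nat \<Rightarrow> nat"
  assumes S: "finite S" and cone: "\<And>j. j \<in> S \<Longrightarrow> uniform_cone {..<n j} (\<Omega> j)"
  shows "uniform_cone (SIGMA j:S. {..<n j})
    {z \<in> PiE (SIGMA j:S. {..<n j}) (\<lambda>_. UNIV). \<forall>j\<in>S. (\<lambda>i\<in>{..<n j}. z (j, i)) \<in> \<Omega> j}"
    (is "uniform_cone ?J ?V")
proof -
  have "\<forall>j\<in>S. \<exists>q. 0 < fst (snd (snd (snd q))) \<and> 0 < snd (snd (snd (snd q))) \<and>
     (\<forall>c<(fst q :: nat). fst (snd q) c \<in> sets (leb {..<n j}) \<and>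
        has_cone {..<n j} (\<Omega> j) (fst (snd q) c) (fst (snd (snd q)) c) (fst (snd (snd (snd q)))) (snd (snd (snd (snd q))))) \<and>
     disjoint_family_on (fst (snd q)) {..<fst q} \<and> \<Omega> j = (\<Union>c<fst q. fst (snd q) c)"
    using cone unfolding uniform_cone_def by (simp add: split_paired_Ex)
  from bchoice[OF this] obtain q where q: "\<forall>j\<in>S. 0 < fst (snd (snd (snd (q j)))) \<and> 0 < snd (snd (snd (snd (q j)))) \<and>
     (\<forall>c<(fst (q j) :: nat). fst (snd (q j)) c \<in> sets (leb {..<n j}) \<and>
        has_cone {..<n j} (\<Omega> j) (fst (snd (q j)) c) (fst (snd (snd (q j))) c) (fst (snd (snd (snd (q j))))) (snd (snd (snd (snd (q j)))))) \<and>
     disjoint_family_on (fst (snd (q j))) {..<fst (q j)} \<and> \<Omega> j = (\<Union>c<fst (q j). fst (snd (q j)) c)" ..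
  define K where "K j = fst (q j)" for j
  define A where "A j = fst (snd (q j))" for j
  define v where "v j = fst (snd (snd (q j)))" for j
  define \<sigma> where "\<sigma> j = fst (snd (snd (snd (q j))))" for j
  define \<tau> where "\<tau> j = snd (snd (snd (snd (q j))))" for j
  have pos: "0 < \<sigma> j" "0 < \<tau> j" and AS: "c < K j \<Longrightarrow> A j c \<in> sets (leb {..<n j})"
    and Ac: "c < K j \<Longrightarrow> has_cone {..<n j} (\<Omega> j) (A j c) (v j c) (\<sigma> j) (\<tau> j)"
    and Ad: "disjoint_family_on (A j) {..<K j}" and \<Omega>: "\<Omega> j = (\<Union>c<K j. A j c)" if "j \<in> S" for j c
    using bspec[OF q that] unfolding K_def A_def v_def \<sigma>_def \<tau>_def by auto
  define \<sigma>0 where "\<sigma>0 = Min (insert 1 (\<sigma> ` S))"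
  define \<tau>0 where "\<tau>0 = Min (insert 1 (\<tau> ` S))"
  have le: "\<sigma>0 \<le> \<sigma> j" "\<tau>0 \<le> \<tau> j" if "j \<in> S" for j using S that by (auto simp: \<sigma>0_def \<tau>0_def)
  define blk where "blk z j = (\<lambda>i\<in>{..<n j}. z (j, i))" for z :: "nat \<times> nat \<Rightarrow> real" and j
  have blk_meas: "(\<lambda>z. blk z j) \<in> leb ?J \<rightarrow>\<^sub>M leb {..<n j}" if "j \<in> S" for j
    unfolding blk_def using that by (intro measurable_restrict measurable_component_singleton) auto
  define B where "B l = {z \<in> PiE ?J (\<lambda>_. UNIV). \<forall>j\<in>S. blk z j \<in> A j (l j)}" for l
  let ?C = "PiE S (\<lambda>j. {..<K j})"
  show ?thesis
  proof (rule uniform_coneI[where C = ?C and A = B and v = "\<lambda>l (j, i). v j (l j) i" and \<sigma> = \<sigma>0 and \<tau> = \<tau>0])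
    show "finite ?C" using S by (intro finite_PiE) auto
    show "0 < \<sigma>0" "0 < \<tau>0" using S pos by (auto simp: \<sigma>0_def \<tau>0_def)
    fix l assume l: "l \<in> ?C"
    have "B l = {z \<in> space (leb ?J). \<forall>j\<in>S. z \<in> (\<lambda>z. blk z j) -` A j (l j) \<inter> space (leb ?J)}"
      by (auto simp: B_def space_leb)
    also have "\<dots> \<in> sets (leb ?J)"
    proof (rule sets.sets_Collect_finite_All[OF _ S])
      fix j assume j: "j \<in> S"
      have "(\<lambda>z. blk z j) -` A j (l j) \<inter> space (leb ?J) \<in> sets (leb ?J)"
        using l j by (intro measurable_sets[OF blk_meas AS]) auto
      then show "{z \<in> space (leb ?J). z \<in> (\<lambda>z. blk z j) -` A j (l j) \<inter> space (leb ?J)} \<in> sets (leb ?J)"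
        by (simp add: Collect_conj_eq Int_commute vimage_def)
    qed
    finally show "B l \<in> sets (leb ?J)" .
    show "has_cone ?J ?V (B l) (\<lambda>(j, i). v j (l j) i) \<sigma>0 \<tau>0"
      unfolding has_cone_def
    proof (intro ballI allI impI)
      fix x t z assume x: "x \<in> B l" and t: "0 < t \<and> t \<le> \<tau>0" and z: "z \<in> ?J \<rightarrow>\<^sub>E UNIV"
        and near: "\<forall>i\<in>?J. \<bar>z i - (x i + t * (case i of (j, i) \<Rightarrow> v j (l j) i))\<bar> \<le> t * \<sigma>0"
      have "blk z j \<in> \<Omega> j" if j: "j \<in> S" for j
      proof (rule has_coneD[OF Ac[OF j, of "l j"], of "blk x j" t])
        show "l j < K j" using l j by auto
        show "blk x j \<in> A j (l j)" using x j by (auto simp: B_def)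
        show "t \<le> \<tau> j" using t le[OF j] by simp
        fix i assume i: "i \<in> {..<n j}"
        have "\<bar>z (j, i) - (x (j, i) + t * v j (l j) i)\<bar> \<le> t * \<sigma>0" using near i j by force
        also have "\<dots> \<le> t * \<sigma> j" using t le[OF j] by (intro mult_left_mono) auto
        finally show "\<bar>blk z j i - (blk x j i + t * v j (l j) i)\<bar> \<le> t * \<sigma> j" using i by (simp add: blk_def)
      qed (use t in \<open>auto simp: blk_def\<close>)
      then show "z \<in> ?V" using z by (simp add: blk_def)
    qed
  next
    show "disjoint_family_on B ?C"
      unfolding disjoint_family_on_def
    proof (intro ballI impI)
      fix l l' assume l: "l \<in> ?C" "l' \<in> ?C" "l \<noteq> l'"
      then obtain j where j: "j \<in> S" "l j \<noteq> l' j" by (meson PiE_ext)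
      then have "A j (l j) \<inter> A j (l' j) = {}" using Ad[OF j(1)] l by (auto simp: disjoint_family_on_def PiE_iff)
      then show "B l \<inter> B l' = {}" using j by (auto simp: B_def)
    qed
    show "?V = (\<Union>l\<in>?C. B l)"
    proof (intro equalityI subsetI)
      fix z assume z: "z \<in> ?V"
      then have "\<forall>j\<in>S. \<exists>c. c < K j \<and> blk z j \<in> A j c" using \<Omega> by (auto simp: blk_def)
      from bchoice[OF this] obtain c where c: "\<forall>j\<in>S. c j < K j \<and> blk z j \<in> A j (c j)" ..
      then have "restrict c S \<in> ?C" "z \<in> B (restrict c S)" using z by (auto simp: B_def)
      then show "z \<in> (\<Union>l\<in>?C. B l)" by blast
    next
      fix z assume "z \<in> (\<Union>l\<in>?C. B l)"
      then obtain l where l: "l \<in> ?C" "z \<in> B l" by blast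
      then have "\<forall>j\<in>S. blk z j \<in> \<Omega> j" using \<Omega> by (fastforce simp: B_def PiE_iff)
      then show "z \<in> ?V" using l by (auto simp: B_def blk_def)
    qed
  qed
qed

section \<open>Bounded Lipschitz domains have the uniform interior cone property\<close>

lemma topspace_powertop: "topspace (powertop_real I) = PiE I (\<lambda>_. UNIV)"
  by (simp add: topspace_product_topology)

lemma openin_powertop_cube:
  assumes I: "finite I" and U: "openin (powertop_real I) U" and x: "x \<in> U"
  obtains r where "r > 0" "\<And>z. z \<in> PiE I (\<lambda>_. UNIV) \<Longrightarrow> (\<And>i. i \<in> I \<Longrightarrow> \<bar>z i - x i\<bar> < r) \<Longrightarrow> z \<in> U"
proof -
  from bspec[OF U[unfolded openin_product_topology_alt] x]
  obtain V where "finite {i \<in> I. V i \<noteq> topspace euclideanreal} \<and> (\<forall>i\<in>I. openin euclideanreal (V i)) \<and>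
      x \<in> PiE I V \<and> PiE I V \<subseteq> U" ..
  then have V: "\<And>i. i \<in> I \<Longrightarrow> open (V i)" "x \<in> PiE I V" "PiE I V \<subseteq> U" by (simp_all add: open_openin[symmetric])
  have "\<exists>e>0. \<forall>s. \<bar>s - x i\<bar> < e \<longrightarrow> s \<in> V i" if "i \<in> I" for i
    using V(1)[OF that] PiE_mem[OF V(2) that] unfolding open_dist dist_real_def by blast
  then obtain e where e: "\<And>i. i \<in> I \<Longrightarrow> e i > 0" "\<And>i s. i \<in> I \<Longrightarrow> \<bar>s - x i\<bar> < e i \<Longrightarrow> s \<in> V i"
    by metis
  define r where "r = Min (insert 1 (e ` I))"
  have r: "r > 0" "r \<le> e i" if "i \<in> I" for i using I e that by (auto simp: r_def)
  show thesis
  proof (rule that[of r])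
    show "r > 0" using I e by (auto simp: r_def)
    fix z assume z: "z \<in> PiE I (\<lambda>_. UNIV)" "\<And>i. i \<in> I \<Longrightarrow> \<bar>z i - x i\<bar> < r"
    have "z i \<in> V i" if "i \<in> I" for i using z(2)[OF that] r(2)[OF that] e(2)[OF that] by auto
    then have "z \<in> PiE I V" using z(1) by (auto simp: PiE_iff)
    then show "z \<in> U" using V(3) by blast
  qed
qed

lemma openin_powertop_sets:
  assumes I: "finite I" and U: "openin (powertop_real I) U"
  shows "U \<in> sets (leb I)"
proof -
  define D where "D = {(a, b). a \<in> PiE I (\<lambda>_. \<rat>) \<and> b \<in> PiE I (\<lambda>_. \<rat>) \<and> open_box I a b \<subseteq> U}"
  have "countable (PiE I (\<lambda>_. \<rat>) :: ('a \<Rightarrow> real) set)"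
    using I by (intro countable_PiE) (auto simp: countable_rat)
  then have "countable (PiE I (\<lambda>_. \<rat>) \<times> PiE I (\<lambda>_. \<rat>) :: (('a \<Rightarrow> real) \<times> ('a \<Rightarrow> real)) set)" by simp
  then have D: "countable D" by (rule countable_subset[rotated]) (auto simp: D_def)
  have "U = (\<Union>(a, b)\<in>D. open_box I a b)"
  proof (intro equalityI subsetI)
    fix x assume x: "x \<in> U"
    then have x_sp: "x \<in> PiE I (\<lambda>_. UNIV)" using openin_subset[OF U] by (auto simp: topspace_powertop)
    obtain r where r: "r > 0" "\<And>z. z \<in> PiE I (\<lambda>_. UNIV) \<Longrightarrow> (\<And>i. i \<in> I \<Longrightarrow> \<bar>z i - x i\<bar> < r) \<Longrightarrow> z \<in> U"
      by (rule openin_powertop_cube[OF I U x]) blast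
    have "\<exists>a\<in>\<rat>. x i - r < a \<and> a < x i" for i using Rats_dense_in_real[of "x i - r" "x i"] r by auto
    then obtain a where a: "\<And>i. a i \<in> \<rat>" "\<And>i. x i - r < a i" "\<And>i. a i < x i" by metis
    have "\<exists>b\<in>\<rat>. x i < b \<and> b < x i + r" for i using Rats_dense_in_real[of "x i" "x i + r"] r by auto
    then obtain b where b: "\<And>i. b i \<in> \<rat>" "\<And>i. x i < b i" "\<And>i. b i < x i + r" by metis
    have box: "open_box I (restrict a I) (restrict b I) \<subseteq> U"
    proof
      fix z assume z: "z \<in> open_box I (restrict a I) (restrict b I)"
      show "z \<in> U"
      proof (rule r(2))
        show "\<bar>z i - x i\<bar> < r" if "i \<in> I" for i
        proof -
          have "a i < z i" "z i < b i" using PiE_mem[OF z[unfolded open_box_def] that] that by auto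
          then show ?thesis using a(2)[of i] b(3)[of i] by linarith
        qed
      qed (use z in \<open>auto simp: open_box_def PiE_iff\<close>)
    qed
    have "(restrict a I, restrict b I) \<in> D" using box a b by (auto simp: D_def)
    moreover have "x \<in> open_box I (restrict a I) (restrict b I)"
      using x_sp a b by (auto simp: open_box_def PiE_iff)
    ultimately show "x \<in> (\<Union>(a, b)\<in>D. open_box I a b)" by blast
  next
    fix x assume "x \<in> (\<Union>(a, b)\<in>D. open_box I a b)"
    then obtain a b where "(a, b) \<in> D" "x \<in> open_box I a b" by blast
    then show "x \<in> U" unfolding D_def by blast
  qed
  also have "\<dots> \<in> sets (leb I)" using D open_box_sets[OF I] by (intro sets.countable_UN') auto
  finally show ?thesis .
qed

text \<open>
  Cones with axis \<open>v\<close> that are narrow in terms of the Lipschitz constant of \<open>\<gamma>\<close> do not leave the strict epigraph of \<open>\<gamma>\<close>.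
\<close>

lemma lipschitz_epigraph_cone:
  fixes I :: "'i set"
  assumes I: "finite I" and v: "v \<in> PiE I (\<lambda>_. UNIV)" "L2_set v I = 1" and L: "0 \<le> L" and t: "0 < t"
    and lip: "\<And>a b. a \<in> orth_hyperplane I v \<Longrightarrow> b \<in> orth_hyperplane I v \<Longrightarrow> \<bar>\<gamma> a - \<gamma> b\<bar> \<le> L * euclid_dist I a b"
    and x: "\<gamma> (orth_proj I v x) < dot_on I x v"
    and z: "\<And>i. i \<in> I \<Longrightarrow> \<bar>z i - (x i + t * v i)\<bar> \<le> t * \<sigma>"
    and \<sigma>: "\<sigma> = 1 / (1 + real (card I) + L * (real (card I) * (1 + real (card I))))"
  shows "\<gamma> (orth_proj I v z) < dot_on I z v"
proof -
  define N where "N = real (card I)"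
  define e where "e i = z i - (x i + t * v i)" for i
  have N: "N \<ge> 0" by (simp add: N_def)
  have "1 + N + L * (N * (1 + N)) > 0" using N L by (simp add: add_pos_nonneg)
  then have \<sigma>0: "\<sigma> > 0" "\<sigma> * (1 + N + L * (N * (1 + N))) = 1" unfolding \<sigma> N_def by auto
  have ts: "0 \<le> t * \<sigma>" using t \<sigma>0 by simp
  have vv: "(\<Sum>i\<in>I. (v i)\<^sup>2) = 1" using v(2) by (simp add: L2_set_def)
  have v1: "\<bar>v i\<bar> \<le> 1" if "i \<in> I" for i
    using member_le_L2_set[OF I that, of "\<lambda>i. \<bar>v i\<bar>"] v(2) by (simp add: L2_set_def)
  have e1: "\<bar>e i\<bar> \<le> t * \<sigma>" if "i \<in> I" for i using z[OF that] by (simp add: e_def)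
  have zi: "z i = x i + t * v i + e i" for i by (simp add: e_def)
  define d where "d = dot_on I e v"
  have dz: "dot_on I z v = dot_on I x v + t + d"
    unfolding d_def dot_on_def zi using vv
    by (simp add: distrib_right sum.distrib power2_eq_square mult.assoc flip: sum_distrib_left)
  have d1: "\<bar>d\<bar> \<le> N * (t * \<sigma>)"
  proof -
    have "\<bar>d\<bar> \<le> (\<Sum>i\<in>I. \<bar>e i * v i\<bar>)" unfolding d_def dot_on_def by (rule sum_abs)
    also have "\<dots> \<le> (\<Sum>i\<in>I. t * \<sigma>)"
    proof (rule sum_mono)
      fix i assume i: "i \<in> I"
      have "\<bar>e i\<bar> * \<bar>v i\<bar> \<le> (t * \<sigma>) * 1" by (intro mult_mono e1 v1 i) (use ts in auto)
      then show "\<bar>e i * v i\<bar> \<le> t * \<sigma>" by (simp add: abs_mult)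
    qed
    finally show ?thesis by (simp add: N_def)
  qed
  have dotp: "dot_on I (orth_proj I v y) v = 0" for y
  proof -
    have "dot_on I (orth_proj I v y) v = (\<Sum>i\<in>I. y i * v i - dot_on I y v * (v i)\<^sup>2)"
      unfolding dot_on_def orth_proj_def by (intro sum.cong) (auto simp: power2_eq_square algebra_simps)
    also have "\<dots> = dot_on I y v - dot_on I y v * (\<Sum>i\<in>I. (v i)\<^sup>2)"
      by (simp add: sum_subtractf sum_distrib_left dot_on_def)
    finally show ?thesis using vv by simp
  qed
  then have hyp: "orth_proj I v y \<in> orth_hyperplane I v" for y
    by (auto simp: orth_hyperplane_def orth_proj_def)
  have "euclid_dist I (orth_proj I v z) (orth_proj I v x) \<le> (\<Sum>i\<in>I. \<bar>orth_proj I v z i - orth_proj I v x i\<bar>)"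
    unfolding euclid_dist_def by (rule L2_set_le_sum_abs)
  also have "\<dots> \<le> (\<Sum>i\<in>I. t * \<sigma> * (1 + N))"
  proof (rule sum_mono)
    fix i assume i: "i \<in> I"
    have "orth_proj I v z i - orth_proj I v x i = e i - d * v i"
      using i by (simp add: orth_proj_def dz zi algebra_simps)
    also have "\<bar>\<dots>\<bar> \<le> \<bar>e i\<bar> + \<bar>d\<bar> * \<bar>v i\<bar>" using abs_triangle_ineq4[of "e i" "d * v i"] by (simp add: abs_mult)
    also have "\<dots> \<le> t * \<sigma> + N * (t * \<sigma>) * 1"
      by (intro add_mono mult_mono e1 v1 d1 i) (use N ts in auto)
    finally show "\<bar>orth_proj I v z i - orth_proj I v x i\<bar> \<le> t * \<sigma> * (1 + N)" by (simp add: algebra_simps)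
  qed
  finally have dist: "euclid_dist I (orth_proj I v z) (orth_proj I v x) \<le> N * (t * \<sigma> * (1 + N))"
    by (simp add: N_def)
  have "\<gamma> (orth_proj I v z) \<le> \<gamma> (orth_proj I v x) + L * euclid_dist I (orth_proj I v z) (orth_proj I v x)"
    using lip[OF hyp[of z] hyp[of x]] by linarith
  also have "\<dots> \<le> \<gamma> (orth_proj I v x) + L * (N * (t * \<sigma> * (1 + N)))"
    using mult_left_mono[OF dist L] by simp
  also have "\<dots> < dot_on I x v + L * (N * (t * \<sigma> * (1 + N)))" using x by simp
  also have "\<dots> \<le> dot_on I z v"
  proof -
    have "t * (\<sigma> * (1 + N + L * (N * (1 + N)))) = t" using \<sigma>0 by simp
    then have "t * \<sigma> + N * (t * \<sigma>) + L * (N * (t * \<sigma> * (1 + N))) = t" by (simp add: algebra_simps)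
    then show ?thesis using dz d1 ts by linarith
  qed
  finally show ?thesis .
qed

definition cube_nbhd :: "'i set \<Rightarrow> ('i \<Rightarrow> real) \<Rightarrow> real \<Rightarrow> ('i \<Rightarrow> real) set" where
  "cube_nbhd I p r = {z \<in> PiE I (\<lambda>_. UNIV). \<forall>i\<in>I. \<bar>z i - p i\<bar> < r}"

lemma cube_nbhd_openin:
  assumes "finite I" shows "openin (powertop_real I) (cube_nbhd I p r)"
proof -
  have "cube_nbhd I p r = PiE I (\<lambda>i. {p i - r<..<p i + r})"
  proof -
    have "s \<in> {a - r<..<a + r} \<longleftrightarrow> \<bar>s - a\<bar> < r" for s a :: real by auto
    then show ?thesis by (auto simp: cube_nbhd_def PiE_iff extensional_def)
  qed
  then show ?thesis using assms by (simp add: openin_PiE)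
qed

lemma bounded_lipschitz_chart:
  assumes \<Omega>: "bounded_lipschitz_domain I \<Omega>" and front: "p \<in> powertop_real I frontier_of \<Omega>"
  shows "\<exists>v\<in>PiE I (\<lambda>_. UNIV). \<exists>\<gamma> L \<delta>. L2_set v I = 1 \<and> 0 \<le> L \<and> 0 < \<delta> \<and>
          (\<forall>a\<in>orth_hyperplane I v. \<forall>b\<in>orth_hyperplane I v. \<bar>\<gamma> a - \<gamma> b\<bar> \<le> L * euclid_dist I a b) \<and>
          (\<forall>x\<in>PiE I (\<lambda>_. UNIV). euclid_dist I x p < \<delta> \<longrightarrow> (x \<in> \<Omega> \<longleftrightarrow> \<gamma> (orth_proj I v x) < dot_on I x v))"
  using bspec[OF conjunct2[OF conjunct2[OF conjunct2[OF conjunct2[OF \<Omega>[unfolded bounded_lipschitz_domain_def]]]]] front] .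

text \<open>
  Near an interior point the cone may be a cube. Near a boundary point its axis is that of the
  epigraph.
\<close>

lemma lipschitz_local_cone:
  fixes I :: "'i set"
  assumes I: "finite I" and \<Omega>: "bounded_lipschitz_domain I \<Omega>"
    and p: "p \<in> powertop_real I closure_of \<Omega>"
  obtains r v \<sigma> \<tau> where "0 < r" "0 < \<sigma>" "0 < \<tau>" "has_cone I \<Omega> (\<Omega> \<inter> cube_nbhd I p r) v \<sigma> \<tau>"
proof (cases "p \<in> \<Omega>")
  case True
  have "openin (powertop_real I) \<Omega>" using \<Omega> by (simp add: bounded_lipschitz_domain_def)
  from openin_powertop_cube[OF I this True] obtain r where
    r: "r > 0" "\<And>z. z \<in> PiE I (\<lambda>_. UNIV) \<Longrightarrow> (\<And>i. i \<in> I \<Longrightarrow> \<bar>z i - p i\<bar> < r) \<Longrightarrow> z \<in> \<Omega>"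
    by blast
  show thesis
  proof (rule that[of "r / 2" 1 "r / 2" "\<lambda>_. 0"])
    show "has_cone I \<Omega> (\<Omega> \<inter> cube_nbhd I p (r / 2)) (\<lambda>_. 0) 1 (r / 2)"
      unfolding has_cone_def
    proof (intro ballI allI impI)
      fix x t z assume x: "x \<in> \<Omega> \<inter> cube_nbhd I p (r / 2)" and t: "0 < t \<and> t \<le> r / 2"
        and z: "z \<in> I \<rightarrow>\<^sub>E UNIV" "\<forall>i\<in>I. \<bar>z i - (x i + t * 0)\<bar> \<le> t * 1"
      show "z \<in> \<Omega>"
      proof (rule r(2)[OF z(1)])
        fix i assume i: "i \<in> I"
        have "\<bar>x i - p i\<bar> < r / 2" "\<bar>z i - x i\<bar> \<le> r / 2" using x z(2) i t by (auto simp: cube_nbhd_def)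
        then show "\<bar>z i - p i\<bar> < r" by linarith
      qed
    qed
  qed (use r in auto)
next
  case False
  have op: "openin (powertop_real I) \<Omega>" using \<Omega> by (simp add: bounded_lipschitz_domain_def)
  have front: "p \<in> powertop_real I frontier_of \<Omega>"
    using p False interior_of_subset[of "powertop_real I" \<Omega>] unfolding frontier_of_def by blast
  from bounded_lipschitz_chart[OF \<Omega> front]
  obtain v where v: "v \<in> PiE I (\<lambda>_. UNIV)" and "\<exists>\<gamma> L \<delta>. L2_set v I = 1 \<and> 0 \<le> L \<and> 0 < \<delta> \<and>
          (\<forall>a\<in>orth_hyperplane I v. \<forall>b\<in>orth_hyperplane I v. \<bar>\<gamma> a - \<gamma> b\<bar> \<le> L * euclid_dist I a b) \<and>
          (\<forall>x\<in>PiE I (\<lambda>_. UNIV). euclid_dist I x p < \<delta> \<longrightarrow> (x \<in> \<Omega> \<longleftrightarrow> \<gamma> (orth_proj I v x) < dot_on I x v))" ..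
  then obtain \<gamma> L \<delta> where *: "L2_set v I = 1 \<and> 0 \<le> L \<and> 0 < \<delta> \<and>
          (\<forall>a\<in>orth_hyperplane I v. \<forall>b\<in>orth_hyperplane I v. \<bar>\<gamma> a - \<gamma> b\<bar> \<le> L * euclid_dist I a b) \<and>
          (\<forall>x\<in>PiE I (\<lambda>_. UNIV). euclid_dist I x p < \<delta> \<longrightarrow> (x \<in> \<Omega> \<longleftrightarrow> \<gamma> (orth_proj I v x) < dot_on I x v))"
    by (elim exE) (rule that)
  have v2: "L2_set v I = 1" and L: "0 \<le> L" and \<delta>: "0 < \<delta>"
    and lip: "\<forall>a\<in>orth_hyperplane I v. \<forall>b\<in>orth_hyperplane I v. \<bar>\<gamma> a - \<gamma> b\<bar> \<le> L * euclid_dist I a b"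
    and epi: "\<And>x. x \<in> PiE I (\<lambda>_. UNIV) \<Longrightarrow> euclid_dist I x p < \<delta> \<Longrightarrow> x \<in> \<Omega> \<longleftrightarrow> \<gamma> (orth_proj I v x) < dot_on I x v"
    using * by simp_all
  define N where "N = real (card I)"
  \<comment> \<open>the opening required by \<open>lipschitz_epigraph_cone\<close>\<close>
  define \<sigma> where "\<sigma> = 1 / (1 + real (card I) + L * (real (card I) * (1 + real (card I))))"
  have \<sigma>: "0 < \<sigma>" "\<sigma> \<le> 1"
  proof -
    have "1 \<le> 1 + real (card I) + L * (real (card I) * (1 + real (card I)))" using L by simp
    then show "0 < \<sigma>" "\<sigma> \<le> 1" unfolding \<sigma>_def by auto
  qed
  \<comment> \<open>Points at distance at most \<open>2 * r\<close> in every coordinate lie in the chart.\<close>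
  define r where "r = \<delta> / (2 * N + 2)"
  have N: "N \<ge> 0" by (simp add: N_def)
  have r: "r > 0" "N * (2 * r) < \<delta>" using \<delta> N unfolding r_def by (auto simp: field_simps)
  have near: "euclid_dist I z p < \<delta>" if "\<And>i. i \<in> I \<Longrightarrow> \<bar>z i - p i\<bar> \<le> 2 * r" for z
  proof -
    have "euclid_dist I z p \<le> (\<Sum>i\<in>I. \<bar>z i - p i\<bar>)" unfolding euclid_dist_def by (rule L2_set_le_sum_abs)
    also have "\<dots> \<le> (\<Sum>i\<in>I. 2 * r)" by (intro sum_mono that)
    also have "\<dots> = N * (2 * r)" by (simp add: N_def)
    finally show ?thesis using r by simp
  qed
  have v1: "\<bar>v i\<bar> \<le> 1" if "i \<in> I" for i
    using member_le_L2_set[OF I that, of "\<lambda>i. \<bar>v i\<bar>"] v2 by (simp add: L2_set_def)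
  show thesis
  proof (rule that[of r \<sigma> "r / 2" v])
    show "has_cone I \<Omega> (\<Omega> \<inter> cube_nbhd I p r) v \<sigma> (r / 2)"
      unfolding has_cone_def
    proof (intro ballI allI impI)
      fix x t z assume x: "x \<in> \<Omega> \<inter> cube_nbhd I p r" and t: "0 < t \<and> t \<le> r / 2"
        and z: "z \<in> I \<rightarrow>\<^sub>E UNIV" "\<forall>i\<in>I. \<bar>z i - (x i + t * v i)\<bar> \<le> t * \<sigma>"
      have xp: "\<bar>x i - p i\<bar> < r" if "i \<in> I" for i using x that by (auto simp: cube_nbhd_def)
      have zp: "\<bar>z i - p i\<bar> \<le> 2 * r" if i: "i \<in> I" for i
      proof -
        have "\<bar>t * v i\<bar> \<le> t * 1" unfolding abs_mult using t v1[OF i] by (intro mult_mono) auto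
        moreover have "t * \<sigma> \<le> t * 1" using t \<sigma> by (intro mult_left_mono) auto
        moreover have "\<bar>z i - (x i + t * v i)\<bar> \<le> t * \<sigma>" using z(2) i by blast
        ultimately show ?thesis using xp[OF i] t by linarith
      qed
      have xO: "x \<in> \<Omega>" "x \<in> PiE I (\<lambda>_. UNIV)" using x by (auto simp: cube_nbhd_def)
      have "euclid_dist I x p < \<delta>"
      proof (rule near)
        show "\<bar>x i - p i\<bar> \<le> 2 * r" if "i \<in> I" for i using xp[OF that] r by linarith
      qed
      then have x_epi: "\<gamma> (orth_proj I v x) < dot_on I x v" using epi[OF xO(2)] xO(1) by simp
      have "\<gamma> (orth_proj I v z) < dot_on I z v"
      proof (rule lipschitz_epigraph_cone[of I v L t \<gamma> x z \<sigma>])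
        show "\<bar>\<gamma> a - \<gamma> b\<bar> \<le> L * euclid_dist I a b" if "a \<in> orth_hyperplane I v" "b \<in> orth_hyperplane I v" for a b
          using lip that by blast
        show "\<bar>z i - (x i + t * v i)\<bar> \<le> t * \<sigma>" if "i \<in> I" for i using z(2) that by blast
        show "\<sigma> = 1 / (1 + real (card I) + L * (real (card I) * (1 + real (card I))))" by (rule \<sigma>_def)
      qed (use I v v2 L t x_epi in simp_all)
      then show "z \<in> \<Omega>" using epi[OF z(1) near[OF zp]] by simp
    qed
  qed (use r \<sigma> in auto)
qed

lemma bounded_lipschitz_domain_bounded:
  assumes I: "finite I" and \<Omega>: "bounded_lipschitz_domain I \<Omega>"
  obtains B where "B \<ge> 0" "\<And>x i. x \<in> \<Omega> \<Longrightarrow> i \<in> I \<Longrightarrow> \<bar>x i\<bar> \<le> B"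
proof -
  have "\<exists>B. \<forall>x\<in>\<Omega>. L2_set x I \<le> B"
    using \<Omega> unfolding bounded_lipschitz_domain_def by (elim conjE)
  then obtain B where B: "\<And>x. x \<in> \<Omega> \<Longrightarrow> L2_set x I \<le> B" by blast
  have "\<bar>x i\<bar> \<le> max B 0" if "x \<in> \<Omega>" "i \<in> I" for x i
    using member_le_L2_set[OF I that(2), of "\<lambda>i. \<bar>x i\<bar>"] B[OF that(1)] by (simp add: L2_set_def)
  then show thesis by (intro that[of "max B 0"]) auto
qed

text \<open>
  By compactness of the closure, finitely many of the local patches suffice. Removing from each
  patch its predecessors makes them disjoint.
\<close>

lemma bounded_lipschitz_domain_uniform_cone:
  fixes I :: "'i set"
  assumes I: "finite I" and \<Omega>: "bounded_lipschitz_domain I \<Omega>"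
  shows "uniform_cone I \<Omega>"
proof -
  let ?T = "powertop_real I"
  have op: "openin ?T \<Omega>" using \<Omega> by (simp add: bounded_lipschitz_domain_def)
  have sub: "\<Omega> \<subseteq> PiE I (\<lambda>_. UNIV)" using openin_subset[OF op] by (simp add: topspace_powertop)
  obtain B where B: "\<And>x i. x \<in> \<Omega> \<Longrightarrow> i \<in> I \<Longrightarrow> \<bar>x i\<bar> \<le> B"
    by (rule bounded_lipschitz_domain_bounded[OF I \<Omega>]) blast
  let ?Q = "PiE I (\<lambda>_. {- B..B})"
  have "compactin ?T ?Q" by (simp add: compactin_PiE)
  moreover have "closedin ?T ?Q" by (simp add: closedin_product_topology)
  moreover have "\<Omega> \<subseteq> ?Q"
  proof
    fix x assume x: "x \<in> \<Omega>"
    have "x i \<in> {- B..B}" if "i \<in> I" for i using B[OF x that] by (simp add: abs_le_iff)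
    then show "x \<in> ?Q" using x sub by (auto simp: PiE_iff)
  qed
  ultimately have K: "compactin ?T (?T closure_of \<Omega>)"
    by (intro closed_compactin[OF _ closure_of_minimal closedin_closure_of])
  have "\<forall>p\<in>?T closure_of \<Omega>. \<exists>r v \<sigma> \<tau>. 0 < r \<and> 0 < \<sigma> \<and> 0 < \<tau> \<and> has_cone I \<Omega> (\<Omega> \<inter> cube_nbhd I p r) v \<sigma> \<tau>"
  proof
    fix p assume "p \<in> ?T closure_of \<Omega>"
    then show "\<exists>r v \<sigma> \<tau>. 0 < r \<and> 0 < \<sigma> \<and> 0 < \<tau> \<and> has_cone I \<Omega> (\<Omega> \<inter> cube_nbhd I p r) v \<sigma> \<tau>"
      by (rule lipschitz_local_cone[OF I \<Omega>]) blast
  qed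
  then obtain r v \<sigma> \<tau> where loc: "\<And>p. p \<in> ?T closure_of \<Omega> \<Longrightarrow> 0 < r p"
    "\<And>p. p \<in> ?T closure_of \<Omega> \<Longrightarrow> 0 < (\<sigma> p :: real)" "\<And>p. p \<in> ?T closure_of \<Omega> \<Longrightarrow> 0 < (\<tau> p :: real)"
    "\<And>p. p \<in> ?T closure_of \<Omega> \<Longrightarrow> has_cone I \<Omega> (\<Omega> \<inter> cube_nbhd I p (r p)) (v p) (\<sigma> p) (\<tau> p)"
    by metis
  have cl_sub: "?T closure_of \<Omega> \<subseteq> PiE I (\<lambda>_. UNIV)" using closure_of_subset_topspace[of ?T \<Omega>] by (simp add: topspace_powertop)
  have cov: "?T closure_of \<Omega> \<subseteq> \<Union>((\<lambda>p. cube_nbhd I p (r p)) ` (?T closure_of \<Omega>))"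
    using loc(1) cl_sub by (force simp: cube_nbhd_def)
  from compactinD[OF K _ cov] cube_nbhd_openin[OF I]
  obtain F where F: "finite F" "F \<subseteq> (\<lambda>p. cube_nbhd I p (r p)) ` (?T closure_of \<Omega>)" "?T closure_of \<Omega> \<subseteq> \<Union>F"
    by blast
  then obtain P where P: "finite P" "P \<subseteq> ?T closure_of \<Omega>" "F = (\<lambda>p. cube_nbhd I p (r p)) ` P"
    by (meson finite_subset_image)
  obtain b where b: "bij_betw b {0..<card P} P" using ex_bij_betw_nat_finite[OF P(1)] by blast
  define N where "N c = \<Omega> \<inter> cube_nbhd I (b c) (r (b c))" for c
  define A where "A c = N c - (\<Union>c'<c. N c')" for c
  have bP: "b c \<in> ?T closure_of \<Omega>" "b c \<in> P" if "c < card P" for c using bij_betwE[OF b] that P(2) by auto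
  show ?thesis
  proof (rule uniform_coneI[where C = "{..<card P}" and A = A and v = "\<lambda>c. v (b c)"
        and \<sigma> = "Min (insert 1 (\<sigma> ` P))" and \<tau> = "Min (insert 1 (\<tau> ` P))"])
    show "0 < Min (insert 1 (\<sigma> ` P))" "0 < Min (insert 1 (\<tau> ` P))" using P loc by auto
    fix c assume c: "c \<in> {..<card P}"
    have N_sets: "N c' \<in> sets (leb I)" for c'
      unfolding N_def by (intro openin_powertop_sets[OF I] openin_Int op cube_nbhd_openin[OF I])
    show "A c \<in> sets (leb I)" unfolding A_def using N_sets by auto
    have "has_cone I \<Omega> (\<Omega> \<inter> cube_nbhd I (b c) (r (b c))) (v (b c)) (Min (insert 1 (\<sigma> ` P))) (Min (insert 1 (\<tau> ` P)))"
      using c bP P(1) by (intro has_cone_mono[OF loc(4)]) auto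
    then show "has_cone I \<Omega> (A c) (v (b c)) (Min (insert 1 (\<sigma> ` P))) (Min (insert 1 (\<tau> ` P)))"
      unfolding has_cone_def A_def N_def by blast
  next
    show "disjoint_family_on A {..<card P}"
      unfolding disjoint_family_on_def
    proof (intro ballI impI)
      fix c c' :: nat assume "c \<noteq> c'"
      then consider "c < c'" | "c' < c" by linarith
      then show "A c \<inter> A c' = {}" by cases (auto simp: A_def)
    qed
    have "\<Omega> \<subseteq> (\<Union>c<card P. N c)"
    proof
      fix x assume x: "x \<in> \<Omega>"
      then have "x \<in> ?T closure_of \<Omega>" using closure_of_subset[of \<Omega> ?T] sub by (auto simp: topspace_powertop)
      then obtain p where p: "p \<in> P" "x \<in> cube_nbhd I p (r p)" using F(3) P(3) by auto
      then have "p \<in> b ` {0..<card P}" using bij_betw_imp_surj_on[OF b] by simp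
      then obtain c where "c < card P" "b c = p" by auto
      then show "x \<in> (\<Union>c<card P. N c)" using p x by (auto simp: N_def)
    qed
    moreover have "(\<Union>c<card P. A c) = (\<Union>c<card P. N c)"
    proof (intro equalityI subsetI)
      fix x assume "x \<in> (\<Union>c<card P. N c)"
      then obtain c0 where c0: "c0 < card P" "x \<in> N c0" by blast
      define c where "c = (LEAST c. x \<in> N c)"
      have c: "x \<in> N c" "c \<le> c0" unfolding c_def using LeastI Least_le c0 by metis+
      have "x \<notin> N c'" if "c' < c" for c' using not_less_Least that unfolding c_def by blast
      then have "x \<in> A c" "c < card P" using c c0 by (auto simp: A_def)
      then show "x \<in> (\<Union>c<card P. A c)" by blast
    qed (auto simp: A_def)
    ultimately show "\<Omega> = (\<Union>c<card P. A c)" by (auto simp: N_def)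
  qed simp
qed

section \<open>Finite rank approximation in Frobenius norm\<close>

definition inner_on :: "nat \<Rightarrow> (nat \<Rightarrow> real) \<Rightarrow> (nat \<Rightarrow> real) \<Rightarrow> real" where
  "inner_on N x y = (\<Sum>i<N. x i * y i)"

definition orthonormal_on :: "nat \<Rightarrow> nat \<Rightarrow> (nat \<Rightarrow> nat \<Rightarrow> real) \<Rightarrow> bool" where
  "orthonormal_on N m q \<longleftrightarrow> (\<forall>k<m. \<forall>l<m. inner_on N (q k) (q l) = (if k = l then 1 else 0))"

lemma inner_on_sum_right: "inner_on N x (\<lambda>i. \<Sum>k\<in>A. y k i) = (\<Sum>k\<in>A. inner_on N x (y k))"
  unfolding inner_on_def by (simp add: sum_distrib_left sum.swap[of _ A])

lemma inner_on_scale_right: "inner_on N x (\<lambda>i. c * y i) = c * inner_on N x y"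
  unfolding inner_on_def by (simp add: sum_distrib_left mult_ac)

lemma inner_on_diff_right: "inner_on N x (\<lambda>i. y i - z i) = inner_on N x y - inner_on N x z"
  unfolding inner_on_def by (simp add: sum_subtractf right_diff_distrib)

lemma inner_on_add_right: "inner_on N x (\<lambda>i. y i + z i) = inner_on N x y + inner_on N x z"
  unfolding inner_on_def by (simp add: sum.distrib distrib_left)

lemma inner_on_commute: "inner_on N x y = inner_on N y x"
  unfolding inner_on_def by (simp add: mult.commute)

lemma inner_on_diff_self: "inner_on N (\<lambda>i. x i - y i) (\<lambda>i. x i - y i)
    = inner_on N x x - 2 * inner_on N x y + inner_on N y y"
  unfolding inner_on_def
  by (simp add: left_diff_distrib right_diff_distrib sum_subtractf sum.distrib sum_distrib_left mult.commute[of "y _" "x _"])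

lemma inner_on_self_nonneg: "0 \<le> inner_on N x x"
  unfolding inner_on_def by (simp add: sum_nonneg)

lemma inner_on_self_eq_0: "inner_on N x x = 0 \<Longrightarrow> i < N \<Longrightarrow> x i = 0"
  unfolding inner_on_def by (subst (asm) sum_nonneg_eq_0_iff) auto

text \<open>Gram--Schmidt; vectors that depend on their predecessors are dropped.\<close>

lemma orthonormal_span:
  fixes b :: "nat \<Rightarrow> nat \<Rightarrow> real"
  shows "\<exists>m\<le>r. \<exists>q. orthonormal_on N m q \<and>
    (\<forall>k<r. \<forall>i<N. b k i = (\<Sum>l<m. inner_on N (b k) (q l) * q l i))"
proof (induction r)
  case 0
  then show ?case by (auto simp: orthonormal_on_def)
next
  case (Suc r)
  then obtain m q where m: "m \<le> r" and q: "orthonormal_on N m q"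
    and span: "\<And>k i. k < r \<Longrightarrow> i < N \<Longrightarrow> b k i = (\<Sum>l<m. inner_on N (b k) (q l) * q l i)" by blast
  define e where "e i = b r i - (\<Sum>l<m. inner_on N (b r) (q l) * q l i)" for i
  have eq: "inner_on N (q k) e = 0" if k: "k < m" for k
  proof -
    have "inner_on N (q k) e = inner_on N (q k) (b r) - (\<Sum>l<m. inner_on N (b r) (q l) * inner_on N (q k) (q l))"
      unfolding e_def inner_on_diff_right inner_on_sum_right inner_on_scale_right by simp
    also have "(\<Sum>l<m. inner_on N (b r) (q l) * inner_on N (q k) (q l)) = (\<Sum>l<m. if l = k then inner_on N (b r) (q k) else 0)"
      using q k by (intro sum.cong) (auto simp: orthonormal_on_def)
    finally show ?thesis using k by (simp add: inner_on_commute)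
  qed
  show ?case
  proof (cases "inner_on N e e = 0")
    case True
    then have "b r i = (\<Sum>l<m. inner_on N (b r) (q l) * q l i)" if "i < N" for i
      using inner_on_self_eq_0[OF True that] by (simp add: e_def)
    then show ?thesis using m q span by (intro exI[of _ m] exI[of _ q] conjI) (auto simp: less_Suc_eq)
  next
    case False
    define s where "s = sqrt (inner_on N e e)"
    have s: "s > 0" "s * s = inner_on N e e" using False inner_on_self_nonneg[of N e] by (auto simp: s_def order.strict_iff_order)
    define q' where "q' l = (if l < m then q l else (\<lambda>i. (1 / s) * e i))" for l
    have q'm: "q' m = (\<lambda>i. (1 / s) * e i)" by (simp add: q'_def)
    have q'l: "q' l = q l" if "l < m" for l using that by (simp add: q'_def)
    have qe: "inner_on N (q k) (q' m) = 0" if "k < m" for k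
      unfolding q'm inner_on_scale_right using eq[OF that] by simp
    have mm: "inner_on N (q' m) (q' m) = 1"
    proof -
      have "inner_on N (\<lambda>i. (1 / s) * e i) e = (1 / s) * (s * s)"
        by (subst inner_on_commute) (simp only: inner_on_scale_right s(2))
      then show ?thesis unfolding q'm inner_on_scale_right using s(1) by simp
    qed
    have on: "orthonormal_on N (Suc m) q'"
      unfolding orthonormal_on_def
    proof (intro allI impI)
      fix k l assume "k < Suc m" "l < Suc m"
      then consider "k < m" "l < m" | "k < m" "l = m" | "k = m" "l < m" | "k = m" "l = m"
        by (auto simp: less_Suc_eq)
      then show "inner_on N (q' k) (q' l) = (if k = l then 1 else 0)"
      proof cases
        case 1
        then show ?thesis using q by (simp add: q'l orthonormal_on_def)
      next
        case 2
        then show ?thesis using qe[of k] by (simp add: q'l)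
      next
        case 3
        then show ?thesis using qe[of l] by (simp add: q'l inner_on_commute[of N "q' m"])
      next
        case 4
        then show ?thesis using mm by simp
      qed
    qed
    have be: "inner_on N (b r) e = inner_on N e e"
    proof -
      have "inner_on N e (b r) = inner_on N e (\<lambda>i. e i + (\<Sum>l<m. inner_on N (b r) (q l) * q l i))"
        by (simp add: e_def)
      also have "\<dots> = inner_on N e e + (\<Sum>l<m. inner_on N (b r) (q l) * inner_on N e (q l))"
        unfolding inner_on_add_right inner_on_sum_right inner_on_scale_right ..
      finally show ?thesis using eq by (simp add: inner_on_commute)
    qed
    have new: "b k i = (\<Sum>l<Suc m. inner_on N (b k) (q' l) * q' l i)" if k: "k < Suc r" and i: "i < N" for k i
    proof (cases "k = r")
      case True
      have "inner_on N (b r) (q' m) * q' m i = e i"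
        unfolding q'm inner_on_scale_right be s(2)[symmetric] using s(1) by simp
      then show ?thesis using True by (simp add: q'l e_def)
    next
      case False
      then have kr: "k < r" using k by simp
      have "inner_on N (q' m) (b k) = inner_on N (q' m) (\<lambda>i. \<Sum>l<m. inner_on N (b k) (q l) * q l i)"
        unfolding inner_on_def by (intro sum.cong) (auto simp: span[OF kr, unfolded inner_on_def])
      also have "\<dots> = 0" unfolding inner_on_sum_right inner_on_scale_right using qe by (simp add: inner_on_commute)
      finally have "inner_on N (b k) (q' m) = 0" by (simp add: inner_on_commute)
      then show ?thesis using span[OF kr i] by (simp add: q'l)
    qed
    show ?thesis using m on new by (intro exI[of _ "Suc m"] exI[of _ q'] conjI) auto
  qed
qed

text \<open>
  Pythagoras: the distance of \<open>x\<close> to the span, plus the distance of the projection of \<open>x\<close> to the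
  given element of the span.
\<close>

lemma dist_orthonormal_span:
  assumes q: "orthonormal_on N m q"
  shows "inner_on N (\<lambda>i. x i - (\<Sum>l<m. c l * q l i)) (\<lambda>i. x i - (\<Sum>l<m. c l * q l i))
    = inner_on N x x - (\<Sum>l<m. (inner_on N x (q l))\<^sup>2) + (\<Sum>l<m. (c l - inner_on N x (q l))\<^sup>2)"
proof -
  have qq: "inner_on N (\<lambda>i. \<Sum>l<m. c l * q l i) (\<lambda>i. \<Sum>l<m. c l * q l i) = (\<Sum>l<m. (c l)\<^sup>2)"
  proof -
    have "inner_on N (\<lambda>i. \<Sum>l<m. c l * q l i) (\<lambda>i. \<Sum>l<m. c l * q l i)
        = (\<Sum>l<m. c l * (\<Sum>k<m. c k * inner_on N (q l) (q k)))"
      unfolding inner_on_sum_right inner_on_scale_right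
      unfolding inner_on_commute[of N "\<lambda>i. \<Sum>l<m. c l * q l i"] inner_on_sum_right inner_on_scale_right ..
    also have "\<dots> = (\<Sum>l<m. c l * (\<Sum>k<m. if k = l then c l else 0))"
      using q by (intro sum.cong arg_cong2[of _ _ _ _ "(*)"]) (auto simp: orthonormal_on_def)
    finally show ?thesis by (simp add: power2_eq_square)
  qed
  have xq: "inner_on N x (\<lambda>i. \<Sum>l<m. c l * q l i) = (\<Sum>l<m. c l * inner_on N x (q l))"
    unfolding inner_on_sum_right inner_on_scale_right ..
  have "inner_on N (\<lambda>i. x i - (\<Sum>l<m. c l * q l i)) (\<lambda>i. x i - (\<Sum>l<m. c l * q l i))
      = inner_on N x x - 2 * inner_on N x (\<lambda>i. \<Sum>l<m. c l * q l i)
        + inner_on N (\<lambda>i. \<Sum>l<m. c l * q l i) (\<lambda>i. \<Sum>l<m. c l * q l i)"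
    by (rule inner_on_diff_self)
  also have "\<dots> = inner_on N x x + (\<Sum>l<m. (c l - inner_on N x (q l))\<^sup>2 - (inner_on N x (q l))\<^sup>2)"
    unfolding qq xq by (simp add: power2_diff sum_subtractf sum.distrib sum_distrib_left mult_ac)
  finally show ?thesis by (simp add: sum_subtractf)
qed

text \<open>
  The Eckart--Young theorem for a diagonal matrix: an orthonormal basis of the row space of the
  approximation captures the weight \<open>w \<beta> \<le> 1\<close> of the \<open>\<beta>\<close>-th row, and the total weight is at most \<open>r\<close>.
\<close>

lemma eckart_young_diagonal:
  fixes s :: "nat \<Rightarrow> real"
  assumes dec: "\<And>\<beta> \<beta>'. \<beta> \<le> \<beta>' \<Longrightarrow> \<beta>' < N \<Longrightarrow> (s \<beta>')\<^sup>2 \<le> (s \<beta>)\<^sup>2"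
  shows "(\<Sum>\<beta>\<in>{r..<N}. (s \<beta>)\<^sup>2)
    \<le> (\<Sum>\<beta><N. \<Sum>\<gamma><N. ((if \<beta> = \<gamma> then s \<beta> else 0) - (\<Sum>k<r. a k \<beta> * b k \<gamma>))\<^sup>2)"
proof (cases "r < N")
  case False
  then show ?thesis by (simp add: sum_nonneg)
next
  case True
  obtain m q where m: "m \<le> r" and q: "orthonormal_on N m q"
    and span: "\<And>k i. k < r \<Longrightarrow> i < N \<Longrightarrow> b k i = (\<Sum>l<m. inner_on N (b k) (q l) * q l i)"
    using orthonormal_span[of r N b] by blast
  define w where "w \<beta> = (\<Sum>l<m. (q l \<beta>)\<^sup>2)" for \<beta>
  have row: "(s \<beta>)\<^sup>2 * (1 - w \<beta>) \<le> (\<Sum>\<gamma><N. ((if \<beta> = \<gamma> then s \<beta> else 0) - (\<Sum>k<r. a k \<beta> * b k \<gamma>))\<^sup>2)"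
    if \<beta>: "\<beta> < N" for \<beta>
  proof -
    let ?x = "\<lambda>\<gamma>. if \<beta> = \<gamma> then s \<beta> else 0"
    define c where "c l = (\<Sum>k<r. a k \<beta> * inner_on N (b k) (q l))" for l
    have F: "(\<Sum>k<r. a k \<beta> * b k \<gamma>) = (\<Sum>l<m. c l * q l \<gamma>)" if "\<gamma> < N" for \<gamma>
    proof -
      have "(\<Sum>k<r. a k \<beta> * b k \<gamma>) = (\<Sum>k<r. \<Sum>l<m. a k \<beta> * inner_on N (b k) (q l) * q l \<gamma>)"
        by (intro sum.cong refl, subst span[OF _ that]) (auto simp: sum_distrib_left mult.assoc)
      also have "\<dots> = (\<Sum>l<m. \<Sum>k<r. a k \<beta> * inner_on N (b k) (q l) * q l \<gamma>)" by (rule sum.swap)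
      finally show ?thesis by (simp add: c_def sum_distrib_right)
    qed
    have xq: "inner_on N ?x (q l) = s \<beta> * q l \<beta>" for l
      using \<beta> by (simp add: inner_on_def if_distrib[of "\<lambda>t. t * _"] sum.delta' cong: if_cong)
    have xx: "inner_on N ?x ?x = (s \<beta>)\<^sup>2"
      using \<beta> by (simp add: inner_on_def if_distrib[of "\<lambda>t. t * _"] power2_eq_square cong: if_cong)
    have "(s \<beta>)\<^sup>2 * (1 - w \<beta>) = inner_on N ?x ?x - (\<Sum>l<m. (inner_on N ?x (q l))\<^sup>2)"
      unfolding xx xq w_def by (simp add: right_diff_distrib power_mult_distrib sum_distrib_left)
    also have "\<dots> \<le> inner_on N (\<lambda>i. ?x i - (\<Sum>l<m. c l * q l i)) (\<lambda>i. ?x i - (\<Sum>l<m. c l * q l i))"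
      unfolding dist_orthonormal_span[OF q] by (simp add: sum_nonneg)
    also have "\<dots> = (\<Sum>\<gamma><N. (?x \<gamma> - (\<Sum>k<r. a k \<beta> * b k \<gamma>))\<^sup>2)"
      unfolding inner_on_def by (intro sum.cong) (auto simp: F power2_eq_square)
    finally show ?thesis .
  qed
  have w1: "w \<beta> \<le> 1" if \<beta>: "\<beta> < N" for \<beta>
  proof -
    let ?x = "\<lambda>\<gamma>. if \<beta> = \<gamma> then 1 else 0 :: real"
    have "inner_on N ?x (q l) = q l \<beta>" for l
      using \<beta> by (simp add: inner_on_def if_distrib[of "\<lambda>t. t * _"] sum.delta' cong: if_cong)
    moreover have "inner_on N ?x ?x = 1"
      using \<beta> by (simp add: inner_on_def if_distrib[of "\<lambda>t. t * _"] cong: if_cong)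
    ultimately have *: "1 - w \<beta> = inner_on N ?x ?x - (\<Sum>l<m. (inner_on N ?x (q l))\<^sup>2)" by (simp add: w_def)
    let ?y = "\<lambda>i. ?x i - (\<Sum>l<m. inner_on N ?x (q l) * q l i)"
    have "1 - w \<beta> = inner_on N ?y ?y"
      unfolding dist_orthonormal_span[OF q] * by simp
    then show ?thesis using inner_on_self_nonneg[of N ?y] by linarith
  qed
  have w0: "0 \<le> w \<beta>" for \<beta> by (simp add: w_def sum_nonneg)
  have sum_w: "(\<Sum>\<beta><N. w \<beta>) = real m"
  proof -
    have "(\<Sum>\<beta><N. w \<beta>) = (\<Sum>l<m. inner_on N (q l) (q l))"
      unfolding w_def inner_on_def by (subst sum.swap) (simp add: power2_eq_square)
    then show ?thesis using q by (simp add: orthonormal_on_def)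
  qed
  \<comment> \<open>Moving weight towards the small entries only decreases the weighted sum.\<close>
  have split: "(\<Sum>\<beta><N. f \<beta>) = (\<Sum>\<beta><r. f \<beta>) + (\<Sum>\<beta>\<in>{r..<N}. f \<beta>)" for f :: "nat \<Rightarrow> real"
    using True by (simp add: lessThan_atLeast0 sum.atLeastLessThan_concat)
  let ?t = "(s r)\<^sup>2"
  have low: "?t * (1 - w \<beta>) \<le> (s \<beta>)\<^sup>2 * (1 - w \<beta>)" if "\<beta> < r" for \<beta>
    using dec[of \<beta> r] w1[of \<beta>] that True by (intro mult_right_mono) auto
  have high: "(s \<beta>)\<^sup>2 * w \<beta> \<le> ?t * w \<beta>" if "\<beta> \<in> {r..<N}" for \<beta>
    using dec[of r \<beta>] w0 that by (intro mult_right_mono) auto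
  have "(\<Sum>\<beta>\<in>{r..<N}. (s \<beta>)\<^sup>2) = (\<Sum>\<beta>\<in>{r..<N}. (s \<beta>)\<^sup>2 * (1 - w \<beta>)) + (\<Sum>\<beta>\<in>{r..<N}. (s \<beta>)\<^sup>2 * w \<beta>)"
    by (simp add: sum.distrib[symmetric] algebra_simps)
  also have "(\<Sum>\<beta>\<in>{r..<N}. (s \<beta>)\<^sup>2 * w \<beta>) \<le> (\<Sum>\<beta>\<in>{r..<N}. ?t * w \<beta>)"
    by (intro sum_mono high)
  also have "\<dots> = ?t * (real m - (\<Sum>\<beta><r. w \<beta>))"
    using split[of w] sum_w by (simp add: sum_distrib_left[symmetric])
  also have "\<dots> \<le> ?t * (real r - (\<Sum>\<beta><r. w \<beta>))" using m by (intro mult_left_mono) auto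
  also have "\<dots> = (\<Sum>\<beta><r. ?t * (1 - w \<beta>))" by (simp add: sum_distrib_left[symmetric] sum_subtractf)
  also have "\<dots> \<le> (\<Sum>\<beta><r. (s \<beta>)\<^sup>2 * (1 - w \<beta>))" by (intro sum_mono low) auto
  also have "(\<Sum>\<beta>\<in>{r..<N}. (s \<beta>)\<^sup>2 * (1 - w \<beta>)) + (\<Sum>\<beta><r. (s \<beta>)\<^sup>2 * (1 - w \<beta>)) = (\<Sum>\<beta><N. (s \<beta>)\<^sup>2 * (1 - w \<beta>))"
    using split[of "\<lambda>\<beta>. (s \<beta>)\<^sup>2 * (1 - w \<beta>)"] by simp
  also have "\<dots> \<le> (\<Sum>\<beta><N. \<Sum>\<gamma><N. ((if \<beta> = \<gamma> then s \<beta> else 0) - (\<Sum>k<r. a k \<beta> * b k \<gamma>))\<^sup>2)"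
    by (intro sum_mono row) auto
  finally show ?thesis by simp
qed

section \<open>Square integrable functions\<close>

lemma L2_measurable: "u \<in> L2 M \<Longrightarrow> u \<in> borel_measurable M"
  by (simp add: L2_def)

lemma L2_integrable_square: "u \<in> L2 M \<Longrightarrow> integrable M (\<lambda>x. (u x)\<^sup>2)"
  by (simp add: L2_def)

lemma L2_integrable_mult:
  assumes "u \<in> L2 M" "v \<in> L2 M" shows "integrable M (\<lambda>x. u x * v x)"
proof (rule Bochner_Integration.integrable_bound)
  show "integrable M (\<lambda>x. (u x)\<^sup>2 + (v x)\<^sup>2)" using assms by (simp add: L2_def)
  show "(\<lambda>x. u x * v x) \<in> borel_measurable M"
    using assms[THEN L2_measurable] by measurable
  have "\<bar>a * b\<bar> \<le> a\<^sup>2 + b\<^sup>2" for a b :: real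
  proof -
    have "2 * (\<bar>a\<bar> * \<bar>b\<bar>) \<le> a\<^sup>2 + b\<^sup>2" using sum_squares_bound[of "\<bar>a\<bar>" "\<bar>b\<bar>"] by simp
    moreover have "0 \<le> \<bar>a\<bar> * \<bar>b\<bar>" by simp
    ultimately show ?thesis unfolding abs_mult by linarith
  qed
  then show "AE x in M. norm (u x * v x) \<le> norm ((u x)\<^sup>2 + (v x)\<^sup>2)" by simp
qed

lemma L2_zero: "(\<lambda>_. 0) \<in> L2 M"
  by (simp add: L2_def)

lemma L2_add:
  assumes "u \<in> L2 M" "v \<in> L2 M" shows "(\<lambda>x. u x + v x) \<in> L2 M"
proof -
  have "(\<lambda>x. u x + v x) \<in> borel_measurable M"
    using assms[THEN L2_measurable] by measurable
  moreover have "integrable M (\<lambda>x. (u x)\<^sup>2 + (v x)\<^sup>2 + 2 * (u x * v x))"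
    using L2_integrable_mult[OF assms] L2_integrable_square[OF assms(1)] L2_integrable_square[OF assms(2)] by simp
  ultimately show ?thesis by (simp add: L2_def power2_sum mult.assoc)
qed

lemma L2_cmult:
  assumes u: "u \<in> L2 M" shows "(\<lambda>x. c * u x) \<in> L2 M"
proof -
  have "(\<lambda>x. c * u x) \<in> borel_measurable M" using L2_measurable[OF u] by measurable
  then show ?thesis using u by (simp add: L2_def power_mult_distrib)
qed

lemma L2_diff:
  assumes "u \<in> L2 M" "v \<in> L2 M" shows "(\<lambda>x. u x - v x) \<in> L2 M"
  using L2_add[OF assms(1) L2_cmult[OF assms(2), of "-1"]] by simp

lemma L2_sum: "(\<And>a. a \<in> A \<Longrightarrow> u a \<in> L2 M) \<Longrightarrow> (\<lambda>x. \<Sum>a\<in>A. u a x) \<in> L2 M"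
  by (induction A rule: infinite_finite_induct) (auto intro: L2_zero L2_add)

lemma L2_norm_nonneg: "0 \<le> L2_norm M u"
  by (simp add: L2_norm_def)

lemma L2_norm_power2: "(L2_norm M u)\<^sup>2 = (\<integral>x. (u x)\<^sup>2 \<partial>M)"
  by (simp add: L2_norm_def)

lemma L2_norm_cong: "(\<And>x. x \<in> space M \<Longrightarrow> u x = v x) \<Longrightarrow> L2_norm M u = L2_norm M v"
  unfolding L2_norm_def by (intro arg_cong[where f = sqrt] Bochner_Integration.integral_cong) auto

definition orthonormal_L2 :: "'a measure \<Rightarrow> 'k set \<Rightarrow> ('k \<Rightarrow> 'a \<Rightarrow> real) \<Rightarrow> bool" where
  "orthonormal_L2 M K e \<longleftrightarrow> (\<forall>k\<in>K. e k \<in> L2 M) \<and>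
     (\<forall>k\<in>K. \<forall>l\<in>K. (\<integral>x. e k x * e l x \<partial>M) = (if k = l then 1 else 0))"

lemma orthonormal_L2_subset: "orthonormal_L2 M K e \<Longrightarrow> K' \<subseteq> K \<Longrightarrow> orthonormal_L2 M K' e"
  unfolding orthonormal_L2_def by blast

lemma integral_square_orthonormal_sum:
  assumes K: "finite K" and e: "orthonormal_L2 M K e"
  shows "(\<integral>x. (\<Sum>k\<in>K. c k * e k x)\<^sup>2 \<partial>M) = (\<Sum>k\<in>K. (c k)\<^sup>2)"
proof -
  have eL: "\<And>k. k \<in> K \<Longrightarrow> e k \<in> L2 M" using e by (simp add: orthonormal_L2_def)
  have "(\<integral>x. (\<Sum>k\<in>K. c k * e k x)\<^sup>2 \<partial>M) = (\<integral>x. (\<Sum>k\<in>K. \<Sum>l\<in>K. c k * c l * (e k x * e l x)) \<partial>M)"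
    by (simp add: power2_eq_square sum_product mult_ac)
  also have "\<dots> = (\<Sum>k\<in>K. \<Sum>l\<in>K. c k * c l * (\<integral>x. e k x * e l x \<partial>M))"
    using eL by (simp add: Bochner_Integration.integral_sum L2_integrable_mult)
  also have "\<dots> = (\<Sum>k\<in>K. \<Sum>l\<in>K. if l = k then (c k)\<^sup>2 else 0)"
    using e by (intro sum.cong refl) (auto simp: orthonormal_L2_def power2_eq_square)
  finally show ?thesis using K by simp
qed

lemma bessel_L2:
  assumes K: "finite K" and e: "orthonormal_L2 M K e" and u: "u \<in> L2 M"
  shows "(\<Sum>k\<in>K. (\<integral>x. u x * e k x \<partial>M)\<^sup>2) \<le> (\<integral>x. (u x)\<^sup>2 \<partial>M)"
proof -
  have eL: "\<And>k. k \<in> K \<Longrightarrow> e k \<in> L2 M" using e by (simp add: orthonormal_L2_def)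
  define c where "c k = (\<integral>x. u x * e k x \<partial>M)" for k
  define s where "s x = (\<Sum>k\<in>K. c k * e k x)" for x
  have sL: "s \<in> L2 M" unfolding s_def using eL by (intro L2_sum L2_cmult)
  have us: "(\<integral>x. u x * s x \<partial>M) = (\<Sum>k\<in>K. (c k)\<^sup>2)"
  proof -
    have "(\<integral>x. u x * s x \<partial>M) = (\<integral>x. (\<Sum>k\<in>K. c k * (u x * e k x)) \<partial>M)"
      by (simp add: s_def sum_distrib_left mult_ac)
    also have "\<dots> = (\<Sum>k\<in>K. c k * (\<integral>x. u x * e k x \<partial>M))"
      using u eL by (simp add: Bochner_Integration.integral_sum L2_integrable_mult)
    finally show ?thesis by (simp add: c_def power2_eq_square)
  qed
  have "0 \<le> (\<integral>x. (u x - s x)\<^sup>2 \<partial>M)" by simp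
  also have "\<dots> = (\<integral>x. (u x)\<^sup>2 - 2 * (u x * s x) + (s x)\<^sup>2 \<partial>M)" by (simp add: power2_diff algebra_simps)
  also have "\<dots> = (\<integral>x. (u x)\<^sup>2 \<partial>M) - 2 * (\<integral>x. u x * s x \<partial>M) + (\<integral>x. (s x)\<^sup>2 \<partial>M)"
    using u sL L2_integrable_mult[OF u sL] by (simp add: L2_integrable_square)
  also have "(\<integral>x. (s x)\<^sup>2 \<partial>M) = (\<Sum>k\<in>K. (c k)\<^sup>2)"
    unfolding s_def by (rule integral_square_orthonormal_sum[OF K e])
  finally show ?thesis unfolding us c_def by simp
qed

lemma cauchy_schwarz_L2:
  assumes u: "u \<in> L2 M" and v: "v \<in> L2 M"
  shows "(\<integral>x. u x * v x \<partial>M) \<le> L2_norm M u * L2_norm M v"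
proof (cases "L2_norm M v = 0")
  case True
  then have "(\<integral>x. (v x)\<^sup>2 \<partial>M) = 0" by (simp add: L2_norm_def)
  then have "AE x in M. (v x)\<^sup>2 = 0"
    using integral_nonneg_eq_0_iff_AE[OF L2_integrable_square[OF v]] by simp
  then have "AE x in M. u x * v x = 0" by eventually_elim simp
  then have "(\<integral>x. u x * v x \<partial>M) = 0" by (rule integral_eq_zero_AE)
  then show ?thesis using True by simp
next
  case False
  then have pos: "L2_norm M v > 0" using L2_norm_nonneg[of M v] by simp
  define e where "e k x = (1 / L2_norm M v) * v x" for k :: unit and x
  have "orthonormal_L2 M {()} e"
  proof -
    have "(\<integral>x. e () x * e () x \<partial>M) = (1 / (L2_norm M v)\<^sup>2) * (\<integral>x. (v x)\<^sup>2 \<partial>M)"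
      by (simp add: e_def power2_eq_square mult_ac)
    also have "\<dots> = 1" unfolding L2_norm_power2[symmetric] using pos by simp
    finally have "(\<integral>x. e () x * e () x \<partial>M) = 1" .
    moreover have "e () \<in> L2 M" unfolding e_def by (rule L2_cmult[OF v])
    ultimately show ?thesis by (simp add: orthonormal_L2_def)
  qed
  from bessel_L2[OF _ this u] have "(\<integral>x. u x * e () x \<partial>M)\<^sup>2 \<le> (L2_norm M u)\<^sup>2"
    by (simp add: L2_norm_power2)
  then have "(\<integral>x. u x * e () x \<partial>M) \<le> L2_norm M u"
    using L2_norm_nonneg power2_le_imp_le by blast
  also have "(\<integral>x. u x * e () x \<partial>M) = (\<integral>x. u x * v x \<partial>M) / L2_norm M v"
    by (simp add: e_def)
  finally show ?thesis using pos by (simp add: divide_le_eq)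
qed

lemma L2_norm_triangle:
  assumes u: "u \<in> L2 M" and v: "v \<in> L2 M"
  shows "L2_norm M (\<lambda>x. u x + v x) \<le> L2_norm M u + L2_norm M v"
proof (rule power2_le_imp_le)
  have "(L2_norm M (\<lambda>x. u x + v x))\<^sup>2 = (\<integral>x. (u x)\<^sup>2 + (v x)\<^sup>2 + 2 * (u x * v x) \<partial>M)"
    unfolding L2_norm_power2 by (simp add: power2_sum mult_ac)
  also have "\<dots> = (\<integral>x. (u x)\<^sup>2 \<partial>M) + (\<integral>x. (v x)\<^sup>2 \<partial>M) + 2 * (\<integral>x. u x * v x \<partial>M)"
    using u v L2_integrable_mult[OF u v] by (simp add: L2_integrable_square)
  also have "\<dots> \<le> (L2_norm M u)\<^sup>2 + (L2_norm M v)\<^sup>2 + 2 * (L2_norm M u * L2_norm M v)"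
    using cauchy_schwarz_L2[OF u v] by (simp add: L2_norm_power2)
  also have "\<dots> = (L2_norm M u + L2_norm M v)\<^sup>2" by (simp add: power2_sum)
  finally show "(L2_norm M (\<lambda>x. u x + v x))\<^sup>2 \<le> (L2_norm M u + L2_norm M v)\<^sup>2" .
qed (simp add: L2_norm_nonneg)

lemma L2_norm_triangle_diff:
  assumes "u \<in> L2 M" "v \<in> L2 M" "w \<in> L2 M"
  shows "L2_norm M (\<lambda>x. u x - w x) \<le> L2_norm M (\<lambda>x. u x - v x) + L2_norm M (\<lambda>x. v x - w x)"
  using L2_norm_triangle[OF L2_diff[OF assms(1,2)] L2_diff[OF assms(2,3)]] by simp

lemma L2_norm_minus_commute: "L2_norm M (\<lambda>x. u x - v x) = L2_norm M (\<lambda>x. v x - u x)"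
  by (simp add: L2_norm_def power2_commute)

section \<open>Tensor products of square integrable functions\<close>

text \<open>Through \<open>p1\<close> and \<open>p2\<close>, the measure \<open>P\<close> is the product of \<open>X\<close> and \<open>Y\<close>. A product over a set of
  indices is split in this way into the products over two subsets, or one index is split off.\<close>

definition product_via :: "'w measure \<Rightarrow> 'x measure \<Rightarrow> ('w \<Rightarrow> 'x) \<Rightarrow> 'y measure \<Rightarrow> ('w \<Rightarrow> 'y) \<Rightarrow> bool" where
  "product_via P X p1 Y p2 \<longleftrightarrow> sigma_finite_measure X \<and> sigma_finite_measure Y \<and>
     p1 \<in> P \<rightarrow>\<^sub>M X \<and> p2 \<in> P \<rightarrow>\<^sub>M Y \<and> distr P (X \<Otimes>\<^sub>M Y) (\<lambda>w. (p1 w, p2 w)) = X \<Otimes>\<^sub>M Y"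

lemma product_viaI:
  assumes X: "sigma_finite_measure X" and Y: "sigma_finite_measure Y"
    and p: "p1 \<in> P \<rightarrow>\<^sub>M X" "p2 \<in> P \<rightarrow>\<^sub>M Y"
    and eq: "\<And>A B. A \<in> sets X \<Longrightarrow> B \<in> sets Y \<Longrightarrow>
      (\<integral>\<^sup>+w. indicator A (p1 w) * indicator B (p2 w) \<partial>P) = emeasure X A * emeasure Y B"
  shows "product_via P X p1 Y p2"
proof -
  have [measurable]: "(\<lambda>w. (p1 w, p2 w)) \<in> P \<rightarrow>\<^sub>M X \<Otimes>\<^sub>M Y" using p by measurable
  have "X \<Otimes>\<^sub>M Y = distr P (X \<Otimes>\<^sub>M Y) (\<lambda>w. (p1 w, p2 w))"
  proof (rule pair_measure_eqI[OF X Y])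
    fix A B assume AB: "A \<in> sets X" "B \<in> sets Y"
    have "emeasure (distr P (X \<Otimes>\<^sub>M Y) (\<lambda>w. (p1 w, p2 w))) (A \<times> B)
        = (\<integral>\<^sup>+q. indicator (A \<times> B) q \<partial>distr P (X \<Otimes>\<^sub>M Y) (\<lambda>w. (p1 w, p2 w)))"
      using AB by simp
    also have "\<dots> = (\<integral>\<^sup>+w. indicator (A \<times> B) (p1 w, p2 w) \<partial>P)"
      using AB by (intro nn_integral_distr) auto
    also have "\<dots> = (\<integral>\<^sup>+w. indicator A (p1 w) * indicator B (p2 w) \<partial>P)"
      by (simp add: indicator_times)
    finally show "emeasure X A * emeasure Y B = emeasure (distr P (X \<Otimes>\<^sub>M Y) (\<lambda>w. (p1 w, p2 w))) (A \<times> B)"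
      using eq[OF AB] by simp
  qed simp
  then show ?thesis using X Y p unfolding product_via_def by simp
qed

lemma product_via_integral:
  fixes a :: "'x \<Rightarrow> real" and b :: "'y \<Rightarrow> real"
  assumes P: "product_via P X p1 Y p2" and a: "integrable X a" and b: "integrable Y b"
  shows "integrable P (\<lambda>w. a (p1 w) * b (p2 w))"
    and "(\<integral>w. a (p1 w) * b (p2 w) \<partial>P) = (\<integral>x. a x \<partial>X) * (\<integral>y. b y \<partial>Y)"
proof -
  interpret X: sigma_finite_measure X using P by (simp add: product_via_def)
  interpret Y: sigma_finite_measure Y using P by (simp add: product_via_def)
  interpret pair_sigma_finite X Y ..
  have p: "(\<lambda>w. (p1 w, p2 w)) \<in> P \<rightarrow>\<^sub>M X \<Otimes>\<^sub>M Y"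
    and eq: "distr P (X \<Otimes>\<^sub>M Y) (\<lambda>w. (p1 w, p2 w)) = X \<Otimes>\<^sub>M Y"
    using P by (auto simp: product_via_def)
  have [measurable]: "a \<in> borel_measurable X" "b \<in> borel_measurable Y" using a b by auto
  let ?f = "\<lambda>q. a (fst q) * b (snd q)"
  have m: "?f \<in> borel_measurable (X \<Otimes>\<^sub>M Y)" by measurable
  have int: "integrable (X \<Otimes>\<^sub>M Y) ?f"
  proof (rule Fubini_integrable[OF m])
    show "integrable X (\<lambda>x. \<integral>y. norm (a (fst (x, y)) * b (snd (x, y))) \<partial>Y)"
      using a by (simp add: abs_mult)
  qed (use b in simp)
  then show "integrable P (\<lambda>w. a (p1 w) * b (p2 w))"
    using integrable_distr_eq[OF p m] eq by simp
  have "(\<integral>w. a (p1 w) * b (p2 w) \<partial>P) = (\<integral>q. ?f q \<partial>(X \<Otimes>\<^sub>M Y))"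
    using integral_distr[OF p m] eq by simp
  also have "\<dots> = (\<integral>x. (\<integral>y. a x * b y \<partial>Y) \<partial>X)" using integral_fst'[OF int] by simp
  finally show "(\<integral>w. a (p1 w) * b (p2 w) \<partial>P) = (\<integral>x. a x \<partial>X) * (\<integral>y. b y \<partial>Y)" by simp
qed

lemma L2_tensor:
  assumes P: "product_via P X p1 Y p2" and a: "a \<in> L2 X" and b: "b \<in> L2 Y"
  shows "(\<lambda>w. a (p1 w) * b (p2 w)) \<in> L2 P"
proof -
  have "p1 \<in> P \<rightarrow>\<^sub>M X" "p2 \<in> P \<rightarrow>\<^sub>M Y" using P by (auto simp: product_via_def)
  then have "(\<lambda>w. a (p1 w) * b (p2 w)) \<in> borel_measurable P"
    using measurable_compose[OF _ L2_measurable[OF a]] measurable_compose[OF _ L2_measurable[OF b]] by measurable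
  then show ?thesis
    using product_via_integral(1)[OF P L2_integrable_square[OF a] L2_integrable_square[OF b]]
    by (simp add: L2_def power_mult_distrib)
qed

lemma integral_tensor_mult:
  assumes P: "product_via P X p1 Y p2" and "a \<in> L2 X" "b \<in> L2 Y" "a' \<in> L2 X" "b' \<in> L2 Y"
  shows "(\<integral>w. (a (p1 w) * b (p2 w)) * (a' (p1 w) * b' (p2 w)) \<partial>P) = (\<integral>x. a x * a' x \<partial>X) * (\<integral>y. b y * b' y \<partial>Y)"
  using product_via_integral(2)[OF P L2_integrable_mult L2_integrable_mult, of a a' b b'] assms
  by (simp add: mult_ac)

lemma orthonormal_tensor:
  assumes P: "product_via P X p1 Y p2" and \<Phi>: "orthonormal_L2 X K \<Phi>" and \<psi>: "orthonormal_L2 Y L \<psi>"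
  shows "orthonormal_L2 P (K \<times> L) (\<lambda>(k, l) w. \<Phi> k (p1 w) * \<psi> l (p2 w))"
  using \<Phi> \<psi> unfolding orthonormal_L2_def
  by (auto simp: L2_tensor[OF P] integral_tensor_mult[OF P])

text \<open>Contraction with an orthonormal system is an isometry from the vector-valued \<open>L\<^sup>2\<close> space.\<close>

lemma L2_norm_orthonormal_tensor:
  assumes P: "product_via P X p1 Y p2" and K: "finite K" and \<Phi>: "orthonormal_L2 X K \<Phi>"
    and g: "\<And>k. k \<in> K \<Longrightarrow> g k \<in> L2 Y"
  shows "(L2_norm P (\<lambda>w. \<Sum>k\<in>K. \<Phi> k (p1 w) * g k (p2 w)))\<^sup>2 = (\<Sum>k\<in>K. (L2_norm Y (g k))\<^sup>2)"
proof -
  have \<Phi>L: "\<And>k. k \<in> K \<Longrightarrow> \<Phi> k \<in> L2 X" using \<Phi> by (simp add: orthonormal_L2_def)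
  have t: "(\<lambda>w. \<Phi> k (p1 w) * g k (p2 w)) \<in> L2 P" if "k \<in> K" for k
    by (rule L2_tensor[OF P \<Phi>L[OF that] g[OF that]])
  have "(L2_norm P (\<lambda>w. \<Sum>k\<in>K. \<Phi> k (p1 w) * g k (p2 w)))\<^sup>2
      = (\<integral>w. (\<Sum>k\<in>K. \<Sum>l\<in>K. (\<Phi> k (p1 w) * g k (p2 w)) * (\<Phi> l (p1 w) * g l (p2 w))) \<partial>P)"
    unfolding L2_norm_power2 by (simp add: power2_eq_square sum_product)
  also have "\<dots> = (\<Sum>k\<in>K. \<Sum>l\<in>K. \<integral>w. (\<Phi> k (p1 w) * g k (p2 w)) * (\<Phi> l (p1 w) * g l (p2 w)) \<partial>P)"
    using L2_integrable_mult[OF t t] by (simp add: Bochner_Integration.integral_sum)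
  also have "\<dots> = (\<Sum>k\<in>K. \<Sum>l\<in>K. if l = k then (\<integral>y. g k y * g k y \<partial>Y) else 0)"
  proof (intro sum.cong refl)
    fix k l assume kl: "k \<in> K" "l \<in> K"
    show "(\<integral>w. (\<Phi> k (p1 w) * g k (p2 w)) * (\<Phi> l (p1 w) * g l (p2 w)) \<partial>P)
        = (if l = k then (\<integral>y. g k y * g k y \<partial>Y) else 0)"
      unfolding integral_tensor_mult[OF P \<Phi>L[OF kl(1)] g[OF kl(1)] \<Phi>L[OF kl(2)] g[OF kl(2)]]
      using \<Phi> kl by (auto simp: orthonormal_L2_def)
  qed
  finally show ?thesis unfolding L2_norm_power2[of Y] using K by (simp add: power2_eq_square)
qed

text \<open>Bessel's inequality for the system \<open>\<Phi> \<beta> \<otimes> \<psi> \<gamma>\<close> reduces the claim to a diagonal matrix.\<close>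

lemma eckart_young_finite:
  fixes r N :: nat
  assumes P: "product_via P X p1 Y p2"
    and \<Phi>: "orthonormal_L2 X {1..N} \<Phi>" and \<psi>: "orthonormal_L2 Y {1..N} \<psi>"
    and dec: "\<And>\<beta> \<beta>'. 1 \<le> \<beta> \<Longrightarrow> \<beta> \<le> \<beta>' \<Longrightarrow> \<beta>' \<le> N \<Longrightarrow> (s \<beta>')\<^sup>2 \<le> (s \<beta>)\<^sup>2"
    and ab: "\<And>k. k < r \<Longrightarrow> a k \<in> L2 X" "\<And>k. k < r \<Longrightarrow> b k \<in> L2 Y"
  shows "L2_norm P (\<lambda>w. (\<Sum>\<beta>=1..N. s \<beta> * \<Phi> \<beta> (p1 w) * \<psi> \<beta> (p2 w)) - (\<Sum>\<beta>\<in>{1..N} \<inter> {1..r}. s \<beta> * \<Phi> \<beta> (p1 w) * \<psi> \<beta> (p2 w)))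
    \<le> L2_norm P (\<lambda>w. (\<Sum>\<beta>=1..N. s \<beta> * \<Phi> \<beta> (p1 w) * \<psi> \<beta> (p2 w)) - (\<Sum>k<r. a k (p1 w) * b k (p2 w)))"
    (is "L2_norm P (\<lambda>w. ?h w - ?t w) \<le> L2_norm P (\<lambda>w. ?h w - ?F w)")
proof (rule power2_le_imp_le)
  let ?e = "\<lambda>(\<beta>, \<gamma>) w. \<Phi> \<beta> (p1 w) * \<psi> \<gamma> (p2 w)"
  have \<Phi>L: "\<And>k. k \<in> {1..N} \<Longrightarrow> \<Phi> k \<in> L2 X" and \<psi>L: "\<And>k. k \<in> {1..N} \<Longrightarrow> \<psi> k \<in> L2 Y"
    using \<Phi> \<psi> by (auto simp: orthonormal_L2_def)
  have on: "orthonormal_L2 P ({1..N} \<times> {1..N}) ?e" by (rule orthonormal_tensor[OF P \<Phi> \<psi>])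
  have diag: "orthonormal_L2 P {1..N} (\<lambda>\<beta> w. \<Phi> \<beta> (p1 w) * \<psi> \<beta> (p2 w))"
  proof -
    have "e \<in> L2 P" if "e = ?e (\<beta>, \<beta>)" "\<beta> \<in> {1..N}" for e \<beta>
      using on that unfolding orthonormal_L2_def by blast
    moreover have "(\<integral>w. ?e (\<beta>, \<beta>) w * ?e (\<gamma>, \<gamma>) w \<partial>P) = (if \<beta> = \<gamma> then 1 else 0)"
      if "\<beta> \<in> {1..N}" "\<gamma> \<in> {1..N}" for \<beta> \<gamma>
    proof -
      have "(\<beta>, \<beta>) \<in> {1..N} \<times> {1..N}" "(\<gamma>, \<gamma>) \<in> {1..N} \<times> {1..N}" using that by auto
      with on have "(\<integral>w. ?e (\<beta>, \<beta>) w * ?e (\<gamma>, \<gamma>) w \<partial>P) = (if (\<beta>, \<beta>) = (\<gamma>, \<gamma>) then 1 else 0)"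
        unfolding orthonormal_L2_def by blast
      then show ?thesis by simp
    qed
    ultimately show ?thesis unfolding orthonormal_L2_def by simp
  qed
  have tL: "(\<lambda>w. \<Phi> \<beta> (p1 w) * \<psi> \<gamma> (p2 w)) \<in> L2 P" if "\<beta> \<in> {1..N}" "\<gamma> \<in> {1..N}" for \<beta> \<gamma>
    by (rule L2_tensor[OF P \<Phi>L[OF that(1)] \<psi>L[OF that(2)]])
  have hL: "?h \<in> L2 P" unfolding mult.assoc by (rule L2_sum, rule L2_cmult, rule tL)
  have abL: "(\<lambda>w. a k (p1 w) * b k (p2 w)) \<in> L2 P" if "k < r" for k
    by (rule L2_tensor[OF P ab(1)[OF that] ab(2)[OF that]])
  have FL: "?F \<in> L2 P" by (rule L2_sum, rule abL) simp
  have "?h w - ?t w = (\<Sum>\<beta>\<in>{Suc r..N}. s \<beta> * (\<Phi> \<beta> (p1 w) * \<psi> \<beta> (p2 w)))" for w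
  proof -
    have "?h w = ?t w + (\<Sum>\<beta>\<in>{1..N} - {1..r}. s \<beta> * \<Phi> \<beta> (p1 w) * \<psi> \<beta> (p2 w))"
      by (rule sum.Int_Diff) simp
    moreover have "{1..N} - {1..r} = {Suc r..N}" by auto
    ultimately show ?thesis by (simp add: mult.assoc)
  qed
  then have "(L2_norm P (\<lambda>w. ?h w - ?t w))\<^sup>2 = (\<integral>w. (\<Sum>\<beta>\<in>{Suc r..N}. s \<beta> * (\<Phi> \<beta> (p1 w) * \<psi> \<beta> (p2 w)))\<^sup>2 \<partial>P)"
    unfolding L2_norm_power2 by simp
  also have "\<dots> = (\<Sum>\<beta>\<in>{Suc r..N}. (s \<beta>)\<^sup>2)"
    by (rule integral_square_orthonormal_sum[OF _ orthonormal_L2_subset[OF diag]]) auto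
  also have "\<dots> = (\<Sum>\<beta>\<in>{r..<N}. (s (Suc \<beta>))\<^sup>2)"
    using sum.shift_bounds_Suc_ivl[of "\<lambda>\<beta>. (s \<beta>)\<^sup>2" r N] by (simp only: atLeastLessThanSuc_atLeastAtMost)
  also have "\<dots> \<le> (\<Sum>\<beta><N. \<Sum>\<gamma><N. ((if \<beta> = \<gamma> then s (Suc \<beta>) else 0)
      - (\<Sum>k<r. (\<integral>x. a k x * \<Phi> (Suc \<beta>) x \<partial>X) * (\<integral>y. b k y * \<psi> (Suc \<gamma>) y \<partial>Y)))\<^sup>2)"
    by (rule eckart_young_diagonal) (use dec in auto)
  also have "\<dots> = (\<Sum>\<beta>\<in>{1..N}. \<Sum>\<gamma>\<in>{1..N}. ((if \<beta> = \<gamma> then s \<beta> else 0)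
      - (\<Sum>k<r. (\<integral>x. a k x * \<Phi> \<beta> x \<partial>X) * (\<integral>y. b k y * \<psi> \<gamma> y \<partial>Y)))\<^sup>2)"
    by (simp add: sum.atLeast1_atMost_eq)
  also have "\<dots> = (\<Sum>\<beta>\<in>{1..N}. \<Sum>\<gamma>\<in>{1..N}. (\<integral>w. (?h w - ?F w) * ?e (\<beta>, \<gamma>) w \<partial>P)\<^sup>2)"
  proof (rule sum.cong[OF refl], rule sum.cong[OF refl])
    fix \<beta> \<gamma> assume b: "\<beta> \<in> {1..N}" and g: "\<gamma> \<in> {1..N}"
    have eL: "(\<lambda>w. \<Phi> \<beta> (p1 w) * \<psi> \<gamma> (p2 w)) \<in> L2 P" by (rule L2_tensor[OF P \<Phi>L[OF b] \<psi>L[OF g]])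
    have "(\<integral>w. ?h w * (\<Phi> \<beta> (p1 w) * \<psi> \<gamma> (p2 w)) \<partial>P)
        = (\<integral>w. (\<Sum>\<beta>'=1..N. s \<beta>' * ((\<Phi> \<beta>' (p1 w) * \<psi> \<beta>' (p2 w)) * (\<Phi> \<beta> (p1 w) * \<psi> \<gamma> (p2 w)))) \<partial>P)"
      by (simp only: sum_distrib_right mult.assoc)
    also have "\<dots> = (\<Sum>\<beta>'=1..N. s \<beta>' * (\<integral>w. (\<Phi> \<beta>' (p1 w) * \<psi> \<beta>' (p2 w)) * (\<Phi> \<beta> (p1 w) * \<psi> \<gamma> (p2 w)) \<partial>P))"
      using L2_integrable_mult[OF tL eL] by (subst Bochner_Integration.integral_sum) auto
    also have "\<dots> = (\<Sum>\<beta>'=1..N. if \<beta>' = \<beta> then (if \<beta> = \<gamma> then s \<beta> else 0) else 0)"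
    proof (intro sum.cong refl)
      fix \<beta>' assume b': "\<beta>' \<in> {1..N}"
      show "s \<beta>' * (\<integral>w. (\<Phi> \<beta>' (p1 w) * \<psi> \<beta>' (p2 w)) * (\<Phi> \<beta> (p1 w) * \<psi> \<gamma> (p2 w)) \<partial>P)
          = (if \<beta>' = \<beta> then (if \<beta> = \<gamma> then s \<beta> else 0) else 0)"
        unfolding integral_tensor_mult[OF P \<Phi>L[OF b'] \<psi>L[OF b'] \<Phi>L[OF b] \<psi>L[OF g]]
        using \<Phi> \<psi> b b' g by (auto simp: orthonormal_L2_def)
    qed
    finally have 1: "(\<integral>w. ?h w * (\<Phi> \<beta> (p1 w) * \<psi> \<gamma> (p2 w)) \<partial>P) = (if \<beta> = \<gamma> then s \<beta> else 0)"
      using b by simp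
    have "(\<integral>w. ?F w * (\<Phi> \<beta> (p1 w) * \<psi> \<gamma> (p2 w)) \<partial>P)
        = (\<Sum>k<r. \<integral>w. (a k (p1 w) * b k (p2 w)) * (\<Phi> \<beta> (p1 w) * \<psi> \<gamma> (p2 w)) \<partial>P)"
      unfolding sum_distrib_right
      using L2_integrable_mult[OF abL eL] by (subst Bochner_Integration.integral_sum) auto
    also have "\<dots> = (\<Sum>k<r. (\<integral>x. a k x * \<Phi> \<beta> x \<partial>X) * (\<integral>y. b k y * \<psi> \<gamma> y \<partial>Y))"
    proof (intro sum.cong refl)
      fix k assume "k \<in> {..<r}"
      then have k: "k < r" by simp
      show "(\<integral>w. (a k (p1 w) * b k (p2 w)) * (\<Phi> \<beta> (p1 w) * \<psi> \<gamma> (p2 w)) \<partial>P)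
          = (\<integral>x. a k x * \<Phi> \<beta> x \<partial>X) * (\<integral>y. b k y * \<psi> \<gamma> y \<partial>Y)"
        by (rule integral_tensor_mult[OF P ab(1)[OF k] ab(2)[OF k] \<Phi>L[OF b] \<psi>L[OF g]])
    qed
    finally have 2: "(\<integral>w. ?F w * (\<Phi> \<beta> (p1 w) * \<psi> \<gamma> (p2 w)) \<partial>P)
        = (\<Sum>k<r. (\<integral>x. a k x * \<Phi> \<beta> x \<partial>X) * (\<integral>y. b k y * \<psi> \<gamma> y \<partial>Y))" .
    have "(\<integral>w. (?h w - ?F w) * (\<Phi> \<beta> (p1 w) * \<psi> \<gamma> (p2 w)) \<partial>P)
        = (if \<beta> = \<gamma> then s \<beta> else 0) - (\<Sum>k<r. (\<integral>x. a k x * \<Phi> \<beta> x \<partial>X) * (\<integral>y. b k y * \<psi> \<gamma> y \<partial>Y))"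
      unfolding left_diff_distrib 1[symmetric] 2[symmetric]
      by (rule Bochner_Integration.integral_diff[OF L2_integrable_mult[OF hL eL] L2_integrable_mult[OF FL eL]])
    then show "((if \<beta> = \<gamma> then s \<beta> else 0) - (\<Sum>k<r. (\<integral>x. a k x * \<Phi> \<beta> x \<partial>X) * (\<integral>y. b k y * \<psi> \<gamma> y \<partial>Y)))\<^sup>2
        = (\<integral>w. (?h w - ?F w) * ?e (\<beta>, \<gamma>) w \<partial>P)\<^sup>2" by simp
  qed
  also have "\<dots> = (\<Sum>d\<in>{1..N} \<times> {1..N}. (\<integral>w. (?h w - ?F w) * ?e d w \<partial>P)\<^sup>2)"
    by (rule sum.cartesian_product'[symmetric])
  also have "\<dots> \<le> (L2_norm P (\<lambda>w. ?h w - ?F w))\<^sup>2"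
    unfolding L2_norm_power2 by (rule bessel_L2[OF _ on L2_diff[OF hL FL]]) simp
  finally show "(L2_norm P (\<lambda>w. ?h w - ?t w))\<^sup>2 \<le> (L2_norm P (\<lambda>w. ?h w - ?F w))\<^sup>2" .
qed (rule L2_norm_nonneg)

text \<open>
  The finite case applies to the partial sums of the series, from which \<open>h\<close> differs arbitrarily
  little.
\<close>

lemma eckart_young:
  fixes r :: nat
  assumes P: "product_via P X p1 Y p2" and h: "h \<in> L2 P"
    and \<Phi>: "orthonormal_L2 X {1..} \<Phi>" and \<psi>: "orthonormal_L2 Y {1..} \<psi>"
    and dec: "\<And>\<beta> \<beta>'. 1 \<le> \<beta> \<Longrightarrow> \<beta> \<le> \<beta>' \<Longrightarrow> (s \<beta>')\<^sup>2 \<le> (s \<beta>)\<^sup>2"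
    and ab: "\<And>k. k < r \<Longrightarrow> a k \<in> L2 X" "\<And>k. k < r \<Longrightarrow> b k \<in> L2 Y"
    and lim: "(\<lambda>N. L2_norm P (\<lambda>w. h w - (\<Sum>\<beta>=1..N. s \<beta> * \<Phi> \<beta> (p1 w) * \<psi> \<beta> (p2 w)))) \<longlonglongrightarrow> 0"
  shows "L2_norm P (\<lambda>w. h w - (\<Sum>\<beta>=1..r. s \<beta> * \<Phi> \<beta> (p1 w) * \<psi> \<beta> (p2 w)))
    \<le> L2_norm P (\<lambda>w. h w - (\<Sum>k<r. a k (p1 w) * b k (p2 w)))"
proof -
  define S where "S N w = (\<Sum>\<beta>=1..N. s \<beta> * \<Phi> \<beta> (p1 w) * \<psi> \<beta> (p2 w))" for N w
  define F where "F w = (\<Sum>k<r. a k (p1 w) * b k (p2 w))" for w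
  have L: "\<And>k. 1 \<le> k \<Longrightarrow> \<Phi> k \<in> L2 X" "\<And>k. 1 \<le> k \<Longrightarrow> \<psi> k \<in> L2 Y"
    using \<Phi> \<psi> by (auto simp: orthonormal_L2_def)
  have SL: "S N \<in> L2 P" for N
    unfolding S_def mult.assoc
  proof (rule L2_sum, rule L2_cmult)
    fix \<beta> assume "\<beta> \<in> {1..N}"
    then have "1 \<le> \<beta>" by simp
    then show "(\<lambda>w. \<Phi> \<beta> (p1 w) * \<psi> \<beta> (p2 w)) \<in> L2 P" by (intro L2_tensor[OF P L(1) L(2)])
  qed
  have FL: "F \<in> L2 P" unfolding F_def
  proof (rule L2_sum)
    fix k assume "k \<in> {..<r}"
    then have k: "k < r" by simp
    show "(\<lambda>w. a k (p1 w) * b k (p2 w)) \<in> L2 P" by (rule L2_tensor[OF P ab(1)[OF k] ab(2)[OF k]])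
  qed
  have bound: "L2_norm P (\<lambda>w. h w - S r w) \<le> 2 * L2_norm P (\<lambda>w. h w - S N w) + L2_norm P (\<lambda>w. h w - F w)"
    if N: "N \<ge> r" for N
  proof -
    have "{1..N} \<inter> {1..r} = {1..r}" using N by auto
    moreover have "L2_norm P (\<lambda>w. S N w - (\<Sum>\<beta>\<in>{1..N} \<inter> {1..r}. s \<beta> * \<Phi> \<beta> (p1 w) * \<psi> \<beta> (p2 w)))
        \<le> L2_norm P (\<lambda>w. S N w - F w)"
      unfolding S_def F_def
    proof (rule eckart_young_finite[OF P])
      show "orthonormal_L2 X {1..N} \<Phi>" "orthonormal_L2 Y {1..N} \<psi>"
        by (rule orthonormal_L2_subset[OF \<Phi>], auto) (rule orthonormal_L2_subset[OF \<psi>], auto)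
    qed (use dec ab in auto)
    ultimately have "L2_norm P (\<lambda>w. S N w - S r w) \<le> L2_norm P (\<lambda>w. S N w - F w)"
      by (simp only: S_def[of r])
    also have "\<dots> \<le> L2_norm P (\<lambda>w. S N w - h w) + L2_norm P (\<lambda>w. h w - F w)"
      by (rule L2_norm_triangle_diff[OF SL h FL])
    finally show ?thesis
      using L2_norm_triangle_diff[OF h SL[of N] SL[of r]] L2_norm_minus_commute[of P "S N" h] by simp
  qed
  have "(\<lambda>N. 2 * L2_norm P (\<lambda>w. h w - S N w) + L2_norm P (\<lambda>w. h w - F w)) \<longlonglongrightarrow> 2 * 0 + L2_norm P (\<lambda>w. h w - F w)"
    using lim unfolding S_def by (intro tendsto_intros)
  then have "L2_norm P (\<lambda>w. h w - S r w) \<le> 2 * 0 + L2_norm P (\<lambda>w. h w - F w)"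
    by (rule LIMSEQ_le_const) (intro exI[of _ r] allI impI bound)
  then show ?thesis by (simp add: S_def F_def)
qed

section \<open>Quasi-optimality of the successive decomposition\<close>

context product_sigma_finite
begin

lemma product_via_restrict:
  assumes IJ: "I \<inter> J = {}" and fin: "finite I" "finite J"
  shows "product_via (PiM (I \<union> J) M) (PiM I M) (\<lambda>x. restrict x I) (PiM J M) (\<lambda>x. restrict x J)"
proof (rule product_viaI)
  show "sigma_finite_measure (PiM I M)" "sigma_finite_measure (PiM J M)" using fin by (auto intro: sigma_finite)
  have rI: "(\<lambda>x. restrict x I) \<in> PiM (I \<union> J) M \<rightarrow>\<^sub>M PiM I M" and rJ: "(\<lambda>x. restrict x J) \<in> PiM (I \<union> J) M \<rightarrow>\<^sub>M PiM J M"
    by (auto intro: measurable_restrict_subset)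
  then show "(\<lambda>x. restrict x I) \<in> PiM (I \<union> J) M \<rightarrow>\<^sub>M PiM I M" "(\<lambda>x. restrict x J) \<in> PiM (I \<union> J) M \<rightarrow>\<^sub>M PiM J M" .
  fix A B assume A: "A \<in> sets (PiM I M)" and B: "B \<in> sets (PiM J M)"
  have "(\<lambda>x. indicator A (restrict x I) * indicator B (restrict x J) :: ennreal) \<in> borel_measurable (PiM (I \<union> J) M)"
    using measurable_compose[OF rI borel_measurable_indicator[OF A]] measurable_compose[OF rJ borel_measurable_indicator[OF B]]
    by measurable
  then have "(\<integral>\<^sup>+x. indicator A (restrict x I) * indicator B (restrict x J) \<partial>PiM (I \<union> J) M)
      = (\<integral>\<^sup>+x. (\<integral>\<^sup>+y. indicator A (restrict (merge I J (x, y)) I) * indicator B (restrict (merge I J (x, y)) J) \<partial>PiM J M) \<partial>PiM I M)"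
    by (rule product_nn_integral_fold[OF IJ fin])
  also have "\<dots> = (\<integral>\<^sup>+x. (\<integral>\<^sup>+y. indicator A x * indicator B y \<partial>PiM J M) \<partial>PiM I M)"
  proof (intro nn_integral_cong)
    fix x y assume "x \<in> space (PiM I M)" "y \<in> space (PiM J M)"
    then have "restrict (merge I J (x, y)) I = x" "restrict (merge I J (x, y)) J = y"
      using IJ by (auto simp: space_PiM PiE_def)
    then show "indicator A (restrict (merge I J (x, y)) I) * indicator B (restrict (merge I J (x, y)) J)
        = (indicator A x * indicator B y :: ennreal)" by simp
  qed
  also have "\<dots> = emeasure (PiM I M) A * emeasure (PiM J M) B"
    using A B by (simp add: nn_integral_cmult nn_integral_multc)
  finally show "(\<integral>\<^sup>+x. indicator A (restrict x I) * indicator B (restrict x J) \<partial>PiM (I \<union> J) M)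
      = emeasure (PiM I M) A * emeasure (PiM J M) B" .
qed

lemma product_via_insert:
  assumes I: "finite I" "i \<notin> I"
  shows "product_via (PiM (insert i I) M) (PiM I M) (\<lambda>x. restrict x I) (M i) (\<lambda>x. x i)"
proof (rule product_viaI)
  show "sigma_finite_measure (PiM I M)" using I by (auto intro: sigma_finite)
  show "sigma_finite_measure (M i)" by standard
  have rI: "(\<lambda>x. restrict x I) \<in> PiM (insert i I) M \<rightarrow>\<^sub>M PiM I M" by (auto intro: measurable_restrict_subset)
  have ri: "(\<lambda>x. x i) \<in> PiM (insert i I) M \<rightarrow>\<^sub>M M i" by simp
  show "(\<lambda>x. restrict x I) \<in> PiM (insert i I) M \<rightarrow>\<^sub>M PiM I M" "(\<lambda>x. x i) \<in> PiM (insert i I) M \<rightarrow>\<^sub>M M i" by fact+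
  fix A B assume A: "A \<in> sets (PiM I M)" and B: "B \<in> sets (M i)"
  have "(\<lambda>x. indicator A (restrict x I) * indicator B (x i) :: ennreal) \<in> borel_measurable (PiM (insert i I) M)"
    using measurable_compose[OF rI borel_measurable_indicator[OF A]] measurable_compose[OF ri borel_measurable_indicator[OF B]]
    by measurable
  then have "(\<integral>\<^sup>+x. indicator A (restrict x I) * indicator B (x i) \<partial>PiM (insert i I) M)
      = (\<integral>\<^sup>+x. (\<integral>\<^sup>+y. indicator A (restrict (x(i := y)) I) * indicator B ((x(i := y)) i) \<partial>M i) \<partial>PiM I M)"
    by (rule product_nn_integral_insert[OF I])
  also have "\<dots> = (\<integral>\<^sup>+x. (\<integral>\<^sup>+y. indicator A x * indicator B y \<partial>M i) \<partial>PiM I M)"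
  proof (intro nn_integral_cong)
    fix x y assume "x \<in> space (PiM I M)"
    then have "restrict (x(i := y)) I = x" using I by (auto simp: space_PiM PiE_def extensional_def fun_eq_iff)
    then show "indicator A (restrict (x(i := y)) I) * indicator B ((x(i := y)) i)
        = (indicator A x * indicator B y :: ennreal)" by simp
  qed
  also have "\<dots> = emeasure (PiM I M) A * emeasure (M i) B"
    using A B by (simp add: nn_integral_cmult nn_integral_multc)
  finally show "(\<integral>\<^sup>+x. indicator A (restrict x I) * indicator B (x i) \<partial>PiM (insert i I) M)
      = emeasure (PiM I M) A * emeasure (M i) B" .
qed

end

text \<open>The contraction of the first \<open>j\<close> cores, with open index \<open>\<beta>\<close>.\<close>

primrec cores ::
    "(nat \<Rightarrow> nat) \<Rightarrow> (nat \<Rightarrow> nat \<Rightarrow> 'a \<Rightarrow> nat \<Rightarrow> real) \<Rightarrow> nat \<Rightarrow> nat \<Rightarrow> (nat \<Rightarrow> 'a) \<Rightarrow> real" where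
  "cores r \<phi> 0 \<beta> x = 1"
| "cores r \<phi> (Suc j) \<beta> x = (\<Sum>\<alpha>=1..r j. cores r \<phi> j \<alpha> x * \<phi> (Suc j) \<alpha> (x (Suc j)) \<beta>)"

lemma cores_cong:
  "(\<And>i. i \<in> {1..j} \<Longrightarrow> x i = y i) \<Longrightarrow> cores r \<phi> j \<beta> x = cores r \<phi> j \<beta> y"
proof (induction j arbitrary: \<beta>)
  case (Suc j)
  then have "cores r \<phi> j \<alpha> x = cores r \<phi> j \<alpha> y" for \<alpha> by (intro Suc.IH) auto
  moreover have "x (Suc j) = y (Suc j)" by (rule Suc.prems) simp
  ultimately show ?case by simp
qed simp

lemma cores_restrict: "{1..j} \<subseteq> A \<Longrightarrow> cores r \<phi> j \<beta> (restrict x A) = cores r \<phi> j \<beta> x"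
  by (rule cores_cong) auto

text \<open>The open index takes the place of \<open>\<alpha> j\<close>, which the multi-index \<open>\<alpha>\<close> does not contain.\<close>

lemma cores_eq_sum:
  assumes "j \<ge> 1"
  shows "cores r \<phi> j \<beta> x = (\<Sum>\<alpha>\<in>PiE {1..j-1} (\<lambda>i. {1..r i}).
    (\<Sum>\<alpha>0=1..r 0. \<phi> 1 \<alpha>0 (x 1) (if j = 1 then \<beta> else \<alpha> 1)) *
    (\<Prod>i=2..j. \<phi> i (\<alpha> (i - 1)) (x i) (if i = j then \<beta> else \<alpha> i)))"
  using assms
proof (induction j arbitrary: \<beta> rule: nat_induct_at_least)
  case base
  show ?case by simp
next
  case (Suc j)
  let ?P = "PiE {1..j-1} (\<lambda>i. {1..r i})"
  let ?f = "\<lambda>\<gamma> \<alpha>. (\<Sum>\<alpha>0=1..r 0. \<phi> 1 \<alpha>0 (x 1) (if j = 1 then \<gamma> else \<alpha> 1)) *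
    (\<Prod>i=2..j. \<phi> i (\<alpha> (i - 1)) (x i) (if i = j then \<gamma> else \<alpha> i))"
  let ?g = "\<lambda>\<alpha>. (\<Sum>\<alpha>0=1..r 0. \<phi> 1 \<alpha>0 (x 1) (\<alpha> 1)) *
    (\<Prod>i=2..Suc j. \<phi> i (\<alpha> (i - 1)) (x i) (if i = Suc j then \<beta> else \<alpha> i))"
  have j: "{1..j} = insert j {1..j-1}" "j \<notin> {1..j-1}" using Suc by auto
  have "(\<Sum>\<alpha>\<in>PiE {1..j} (\<lambda>i. {1..r i}). ?g \<alpha>)
      = (\<Sum>(\<gamma>, \<alpha>)\<in>{1..r j} \<times> ?P. ?g (\<alpha>(j := \<gamma>)))"
    unfolding j(1) PiE_insert_eq
    by (subst sum.reindex[OF inj_combinator[OF j(2)]]) (simp only: comp_def split_def)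
  also have "\<dots> = (\<Sum>\<gamma>=1..r j. \<Sum>\<alpha>\<in>?P. ?f \<gamma> \<alpha> * \<phi> (Suc j) \<gamma> (x (Suc j)) \<beta>)"
    unfolding sum.cartesian_product[symmetric]
  proof (intro sum.cong refl)
    fix \<gamma> \<alpha>
    have "{2..Suc j} = insert (Suc j) {2..j}" using Suc by auto
    then have "?g (\<alpha>(j := \<gamma>)) = (\<Sum>\<alpha>0=1..r 0. \<phi> 1 \<alpha>0 (x 1) ((\<alpha>(j := \<gamma>)) 1)) * (\<phi> (Suc j) \<gamma> (x (Suc j)) \<beta> *
        (\<Prod>i=2..j. \<phi> i ((\<alpha>(j := \<gamma>)) (i - 1)) (x i) (if i = Suc j then \<beta> else (\<alpha>(j := \<gamma>)) i)))" by simp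
    also have "(\<Prod>i=2..j. \<phi> i ((\<alpha>(j := \<gamma>)) (i - 1)) (x i) (if i = Suc j then \<beta> else (\<alpha>(j := \<gamma>)) i))
        = (\<Prod>i=2..j. \<phi> i (\<alpha> (i - 1)) (x i) (if i = j then \<gamma> else \<alpha> i))"
      by (intro prod.cong) auto
    moreover have "(\<alpha>(j := \<gamma>)) 1 = (if j = 1 then \<gamma> else \<alpha> 1)" by auto
    ultimately show "?g (\<alpha>(j := \<gamma>)) = ?f \<gamma> \<alpha> * \<phi> (Suc j) \<gamma> (x (Suc j)) \<beta>"
      by (simp only: mult.commute mult.left_commute mult.assoc)
  qed
  also have "\<dots> = cores r \<phi> (Suc j) \<beta> x"
    by (simp add: Suc.IH sum_distrib_right)
  finally show ?case using Suc by simp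
qed

locale tt_run = product_sigma_finite M for M :: "nat \<Rightarrow> 'a measure" +
  fixes m :: nat and r :: "nat \<Rightarrow> nat" and f :: "(nat \<Rightarrow> 'a) \<Rightarrow> real"
    and g :: "nat \<Rightarrow> nat \<Rightarrow> (nat \<Rightarrow> 'a) \<Rightarrow> real" and lam :: "nat \<Rightarrow> nat \<Rightarrow> real"
    and \<phi> :: "nat \<Rightarrow> nat \<Rightarrow> 'a \<Rightarrow> nat \<Rightarrow> real" and \<psi> :: "nat \<Rightarrow> nat \<Rightarrow> (nat \<Rightarrow> 'a) \<Rightarrow> real"
  assumes m: "m \<ge> 2" and run: "tt_svd M m r f g lam \<phi> \<psi>" and f: "f \<in> L2 (PiM {1..m} M)"
begin

lemma r0: "r 0 = 1" using run by (simp add: tt_svd_def)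

lemma svd: "j \<in> {1..m-1} \<Longrightarrow> is_svd M m j (r (j - 1)) (g j) (lam j) (\<phi> j) (\<psi> j)"
  using run by (simp add: tt_svd_def)

lemma g_Suc: "j \<in> {1..m-1} \<Longrightarrow> \<alpha> \<in> {1..r j} \<Longrightarrow> g (Suc j) \<alpha> = (\<lambda>z. sqrt (lam j \<alpha>) * \<psi> j \<alpha> z)"
  using run by (simp add: tt_svd_def)

lemma \<phi>_L2: "j \<in> {1..m-1} \<Longrightarrow> 1 \<le> \<beta> \<Longrightarrow> \<alpha> \<in> {1..r (j - 1)} \<Longrightarrow> (\<lambda>y. \<phi> j \<alpha> y \<beta>) \<in> L2 (M j)"
  using svd[of j] by (simp add: is_svd_def)

lemma \<phi>_orth: "j \<in> {1..m-1} \<Longrightarrow> 1 \<le> \<beta> \<Longrightarrow> 1 \<le> \<beta>' \<Longrightarrow>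
    (\<Sum>\<alpha>=1..r (j - 1). \<integral>y. \<phi> j \<alpha> y \<beta> * \<phi> j \<alpha> y \<beta>' \<partial>M j) = (if \<beta> = \<beta>' then 1 else 0)"
  using svd[of j] by (simp add: is_svd_def)

lemma \<psi>_orthonormal: "j \<in> {1..m-1} \<Longrightarrow> orthonormal_L2 (PiM {Suc j..m} M) {1..} (\<psi> j)"
  using svd[of j] by (auto simp: is_svd_def orthonormal_L2_def)

lemma lam_nonneg: "j \<in> {1..m-1} \<Longrightarrow> 1 \<le> \<beta> \<Longrightarrow> 0 \<le> lam j \<beta>"
  using svd[of j] by (simp add: is_svd_def)

lemma lam_antimono: "j \<in> {1..m-1} \<Longrightarrow> 1 \<le> \<beta> \<Longrightarrow> \<beta> \<le> \<beta>' \<Longrightarrow> lam j \<beta>' \<le> lam j \<beta>"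
proof -
  assume j: "j \<in> {1..m-1}" and b: "1 \<le> \<beta>" and "\<beta> \<le> \<beta>'"
  from \<open>\<beta> \<le> \<beta>'\<close> show ?thesis
  proof (induction \<beta>' rule: dec_induct)
    case (step k)
    then have "lam j (Suc k) \<le> lam j k" using svd[OF j] b by (simp add: is_svd_def)
    then show ?case using step by linarith
  qed simp
qed

lemma g_L2: "j \<in> {1..m} \<Longrightarrow> \<alpha> \<in> {1..r (j - 1)} \<Longrightarrow> g j \<alpha> \<in> L2 (PiM {j..m} M)"
proof -
  assume j: "j \<in> {1..m}" and \<alpha>: "\<alpha> \<in> {1..r (j - 1)}"
  show "g j \<alpha> \<in> L2 (PiM {j..m} M)"
  proof (cases "j = 1")
    case True
    then have "g j \<alpha> = f" using \<alpha> r0 run by (simp add: tt_svd_def)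
    then show ?thesis using f True by simp
  next
    case False
    then have j': "j - 1 \<in> {1..m-1}" "Suc (j - 1) = j" using j by auto
    have "\<psi> (j - 1) \<alpha> \<in> L2 (PiM {Suc (j - 1)..m} M)"
      using \<psi>_orthonormal[OF j'(1)] \<alpha> by (simp add: orthonormal_L2_def)
    then show ?thesis using g_Suc[OF j'(1) \<alpha>] j'(2) by (simp add: L2_cmult)
  qed
qed

text \<open>
  Integrating out the first \<open>j\<close> variables leaves only the terms with equal inner indices, and these
  add up to the inner product of the vector-valued singular functions.
\<close>

lemma cores_orthonormal_Suc:
  assumes j: "Suc j \<in> {1..m-1}" and on: "orthonormal_L2 (PiM {1..j} M) {1..r j} (cores r \<phi> j)"
  shows "orthonormal_L2 (PiM {1..Suc j} M) {1..} (cores r \<phi> (Suc j))"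
proof -
  have "product_via (PiM (insert (Suc j) {1..j}) M) (PiM {1..j} M) (\<lambda>x. restrict x {1..j}) (M (Suc j)) (\<lambda>x. x (Suc j))"
    by (rule product_via_insert) auto
  moreover have "insert (Suc j) {1..j} = {1..Suc j}" by auto
  ultimately have P: "product_via (PiM {1..Suc j} M) (PiM {1..j} M) (\<lambda>x. restrict x {1..j}) (M (Suc j)) (\<lambda>x. x (Suc j))"
    by simp
  have cL: "cores r \<phi> j \<alpha> \<in> L2 (PiM {1..j} M)" if "\<alpha> \<in> {1..r j}" for \<alpha>
    using on that by (simp add: orthonormal_L2_def)
  have pL: "(\<lambda>y. \<phi> (Suc j) \<alpha> y \<beta>) \<in> L2 (M (Suc j))" if "\<alpha> \<in> {1..r j}" "1 \<le> \<beta>" for \<alpha> \<beta>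
    using \<phi>_L2[OF j, of \<beta> \<alpha>] that by simp
  let ?t = "\<lambda>\<alpha> \<beta> x. cores r \<phi> j \<alpha> (restrict x {1..j}) * \<phi> (Suc j) \<alpha> (x (Suc j)) \<beta>"
  have tL: "?t \<alpha> \<beta> \<in> L2 (PiM {1..Suc j} M)" if "\<alpha> \<in> {1..r j}" "1 \<le> \<beta>" for \<alpha> \<beta>
    by (rule L2_tensor[OF P cL[OF that(1)] pL[OF that]])
  have eq: "cores r \<phi> (Suc j) \<beta> = (\<lambda>x. \<Sum>\<alpha>=1..r j. ?t \<alpha> \<beta> x)" for \<beta>
    by (auto simp: cores_restrict)
  show ?thesis
    unfolding orthonormal_L2_def
  proof (intro conjI ballI)
    fix \<beta> :: nat assume "\<beta> \<in> {1..}"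
    then have b: "1 \<le> \<beta>" by simp
    show "cores r \<phi> (Suc j) \<beta> \<in> L2 (PiM {1..Suc j} M)"
      unfolding eq by (rule L2_sum, rule tL[OF _ b])
    fix \<beta>' :: nat assume "\<beta>' \<in> {1..}"
    then have b': "1 \<le> \<beta>'" by simp
    have "(\<integral>x. cores r \<phi> (Suc j) \<beta> x * cores r \<phi> (Suc j) \<beta>' x \<partial>PiM {1..Suc j} M)
        = (\<integral>x. (\<Sum>\<alpha>=1..r j. \<Sum>\<alpha>'=1..r j. ?t \<alpha> \<beta> x * ?t \<alpha>' \<beta>' x) \<partial>PiM {1..Suc j} M)"
      unfolding eq sum_product ..
    also have "\<dots> = (\<Sum>\<alpha>=1..r j. \<Sum>\<alpha>'=1..r j. \<integral>x. ?t \<alpha> \<beta> x * ?t \<alpha>' \<beta>' x \<partial>PiM {1..Suc j} M)"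
    proof -
      have int: "integrable (PiM {1..Suc j} M) (\<lambda>x. ?t \<alpha> \<beta> x * ?t \<alpha>' \<beta>' x)"
        if "\<alpha> \<in> {1..r j}" "\<alpha>' \<in> {1..r j}" for \<alpha> \<alpha>'
        by (rule L2_integrable_mult[OF tL[OF that(1) b] tL[OF that(2) b']])
      have "(\<integral>x. (\<Sum>\<alpha>=1..r j. \<Sum>\<alpha>'=1..r j. ?t \<alpha> \<beta> x * ?t \<alpha>' \<beta>' x) \<partial>PiM {1..Suc j} M)
          = (\<Sum>\<alpha>=1..r j. \<integral>x. (\<Sum>\<alpha>'=1..r j. ?t \<alpha> \<beta> x * ?t \<alpha>' \<beta>' x) \<partial>PiM {1..Suc j} M)"
        by (rule Bochner_Integration.integral_sum, rule Bochner_Integration.integrable_sum, rule int)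
      also have "\<dots> = (\<Sum>\<alpha>=1..r j. \<Sum>\<alpha>'=1..r j. \<integral>x. ?t \<alpha> \<beta> x * ?t \<alpha>' \<beta>' x \<partial>PiM {1..Suc j} M)"
        by (intro sum.cong refl Bochner_Integration.integral_sum int)
      finally show ?thesis .
    qed
    also have "\<dots> = (\<Sum>\<alpha>=1..r j. \<Sum>\<alpha>'=1..r j. if \<alpha>' = \<alpha> then (\<integral>y. \<phi> (Suc j) \<alpha> y \<beta> * \<phi> (Suc j) \<alpha> y \<beta>' \<partial>M (Suc j)) else 0)"
    proof (intro sum.cong refl)
      fix \<alpha> \<alpha>' assume a: "\<alpha> \<in> {1..r j}" "\<alpha>' \<in> {1..r j}"
      show "(\<integral>x. ?t \<alpha> \<beta> x * ?t \<alpha>' \<beta>' x \<partial>PiM {1..Suc j} M)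
          = (if \<alpha>' = \<alpha> then (\<integral>y. \<phi> (Suc j) \<alpha> y \<beta> * \<phi> (Suc j) \<alpha> y \<beta>' \<partial>M (Suc j)) else 0)"
        unfolding integral_tensor_mult[OF P cL[OF a(1)] pL[OF a(1) b] cL[OF a(2)] pL[OF a(2) b']]
        using on a by (auto simp: orthonormal_L2_def)
    qed
    also have "\<dots> = (\<Sum>\<alpha>=1..r j. \<integral>y. \<phi> (Suc j) \<alpha> y \<beta> * \<phi> (Suc j) \<alpha> y \<beta>' \<partial>M (Suc j))" by simp
    also have "\<dots> = (if \<beta> = \<beta>' then 1 else 0)" using \<phi>_orth[OF j b b'] by simp
    finally show "(\<integral>x. cores r \<phi> (Suc j) \<beta> x * cores r \<phi> (Suc j) \<beta>' x \<partial>PiM {1..Suc j} M) = (if \<beta> = \<beta>' then 1 else 0)" .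
  qed
qed

lemma cores_orthonormal:
  assumes "j \<le> m - 1" shows "orthonormal_L2 (PiM {1..j} M) {1..r j} (cores r \<phi> j)"
  using assms
proof (induction j)
  case 0
  have "(\<integral>x. (1::real) \<partial>PiM {} M) = 1" "integrable (PiM {} M) (\<lambda>_. 1::real)"
    by (simp_all add: PiM_empty lebesgue_integral_count_space_finite integrable_count_space)
  then show ?case using r0 by (simp add: orthonormal_L2_def L2_def)
next
  case (Suc j)
  then have "orthonormal_L2 (PiM {1..Suc j} M) {1..} (cores r \<phi> (Suc j))"
    by (intro cores_orthonormal_Suc) auto
  then show ?case by (rule orthonormal_L2_subset) auto
qed

lemma cores_orthonormal_all:
  assumes "j \<in> {1..m-1}" shows "orthonormal_L2 (PiM {1..j} M) {1..} (cores r \<phi> j)"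
proof -
  obtain i where "j = Suc i" "i \<le> m - 1" using assms by (cases j) auto
  then show ?thesis using cores_orthonormal_Suc[of i] cores_orthonormal[of i] assms by simp
qed

text \<open>
  The approximation of \<open>f\<close> after \<open>j\<close> truncations; the coefficient functions \<open>g (Suc j)\<close> carry the
  remaining variables.
\<close>

definition partial_approx :: "nat \<Rightarrow> (nat \<Rightarrow> 'a) \<Rightarrow> real" where
  "partial_approx j x = (\<Sum>\<alpha>=1..r j. cores r \<phi> j \<alpha> x * g (Suc j) \<alpha> (restrict x {Suc j..m}))"

lemma split_at: "j \<le> m \<Longrightarrow> product_via (PiM {1..m} M) (PiM {1..j} M) (\<lambda>x. restrict x {1..j})
    (PiM {Suc j..m} M) (\<lambda>x. restrict x {Suc j..m})"
proof -
  assume "j \<le> m"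
  then have "{1..m} = {1..j} \<union> {Suc j..m}" by auto
  then show ?thesis using product_via_restrict[of "{1..j}" "{Suc j..m}"] by simp
qed

lemma partial_approx_L2:
  assumes j: "j \<le> m - 1" shows "partial_approx j \<in> L2 (PiM {1..m} M)"
proof -
  have jm: "j \<le> m" using j by simp
  have "(\<lambda>x. cores r \<phi> j \<alpha> (restrict x {1..j}) * g (Suc j) \<alpha> (restrict x {Suc j..m})) \<in> L2 (PiM {1..m} M)"
    if a: "\<alpha> \<in> {1..r j}" for \<alpha>
  proof (rule L2_tensor[OF split_at[OF jm]])
    show "cores r \<phi> j \<alpha> \<in> L2 (PiM {1..j} M)" using cores_orthonormal[OF j] a by (simp add: orthonormal_L2_def)
    show "g (Suc j) \<alpha> \<in> L2 (PiM {Suc j..m} M)" using g_L2[of "Suc j" \<alpha>] j m a by simp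
  qed
  then have "(\<lambda>x. \<Sum>\<alpha>=1..r j. cores r \<phi> j \<alpha> (restrict x {1..j}) * g (Suc j) \<alpha> (restrict x {Suc j..m})) \<in> L2 (PiM {1..m} M)"
    by (rule L2_sum)
  then show ?thesis by (simp add: partial_approx_def [abs_def] cores_restrict)
qed

text \<open>
  Composing with the orthonormal contracted cores is an isometry, so each step is a truncated
  singular value decomposition of the current approximation, seen as a function on all of the
  product. The theorem of Eckart and Young applies to it.
\<close>

lemma partial_approx_step:
  assumes j: "j \<in> {1..m-1}"
    and ab: "\<And>k. k < r j \<Longrightarrow> a k \<in> L2 (PiM {1..j} M)" "\<And>k. k < r j \<Longrightarrow> b k \<in> L2 (PiM {Suc j..m} M)"
  shows "L2_norm (PiM {1..m} M) (\<lambda>x. partial_approx (j - 1) x - partial_approx j x)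
    \<le> L2_norm (PiM {1..m} M) (\<lambda>x. partial_approx (j - 1) x - (\<Sum>k<r j. a k (restrict x {1..j}) * b k (restrict x {Suc j..m})))"
proof -
  let ?P = "PiM {1..m} M"
  let ?S = "\<lambda>N x. \<Sum>\<beta>=1..N. sqrt (lam j \<beta>) * cores r \<phi> j \<beta> (restrict x {1..j}) * \<psi> j \<beta> (restrict x {Suc j..m})"
  obtain i where i: "j = Suc i" using j by (cases j) auto
  have jm: "j \<le> m" "i \<le> m" "i \<le> m - 1" "j - 1 = i" using j i by auto
  have trunc: "partial_approx j x = ?S (r j) x" for x
  proof -
    have "partial_approx j x = (\<Sum>\<beta>=1..r j. cores r \<phi> j \<beta> x * (sqrt (lam j \<beta>) * \<psi> j \<beta> (restrict x {Suc j..m})))"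
      unfolding partial_approx_def by (intro sum.cong refl) (simp add: g_Suc[OF j])
    then show ?thesis by (simp add: cores_restrict mult_ac)
  qed
  define G where "G N \<alpha> y = g j \<alpha> y - (\<Sum>\<beta>=1..N. sqrt (lam j \<beta>) * \<phi> j \<alpha> (y j) \<beta> * \<psi> j \<beta> (restrict y {Suc j..m}))" for N \<alpha> y
  have GL: "G N \<alpha> \<in> L2 (PiM {Suc i..m} M)" if a: "\<alpha> \<in> {1..r i}" for N \<alpha>
  proof -
    have "product_via (PiM (insert j {Suc j..m}) M) (PiM {Suc j..m} M) (\<lambda>x. restrict x {Suc j..m}) (M j) (\<lambda>x. x j)"
      by (rule product_via_insert) auto
    moreover have "insert j {Suc j..m} = {Suc i..m}" using jm i by auto
    ultimately have P: "product_via (PiM {Suc i..m} M) (PiM {Suc j..m} M) (\<lambda>x. restrict x {Suc j..m}) (M j) (\<lambda>x. x j)" by simp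
    have "(\<lambda>y. \<Sum>\<beta>=1..N. sqrt (lam j \<beta>) * (\<psi> j \<beta> (restrict y {Suc j..m}) * \<phi> j \<alpha> (y j) \<beta>)) \<in> L2 (PiM {Suc i..m} M)"
    proof (rule L2_sum, rule L2_cmult)
      fix \<beta> assume "\<beta> \<in> {1..N}"
      then have b: "1 \<le> \<beta>" by simp
      have 1: "\<psi> j \<beta> \<in> L2 (PiM {Suc j..m} M)" using \<psi>_orthonormal[OF j] b by (simp add: orthonormal_L2_def)
      have 2: "(\<lambda>y. \<phi> j \<alpha> y \<beta>) \<in> L2 (M j)" using \<phi>_L2[OF j b, of \<alpha>] a jm by simp
      show "(\<lambda>y. \<psi> j \<beta> (restrict y {Suc j..m}) * \<phi> j \<alpha> (y j) \<beta>) \<in> L2 (PiM {Suc i..m} M)"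
        by (rule L2_tensor[OF P 1 2])
    qed
    moreover have "g j \<alpha> \<in> L2 (PiM {Suc i..m} M)" using g_L2[of j \<alpha>] j jm i a by simp
    ultimately have "(\<lambda>y. g j \<alpha> y - (\<Sum>\<beta>=1..N. sqrt (lam j \<beta>) * (\<psi> j \<beta> (restrict y {Suc j..m}) * \<phi> j \<alpha> (y j) \<beta>))) \<in> L2 (PiM {Suc i..m} M)"
      by (intro L2_diff)
    then show ?thesis by (simp add: G_def [abs_def] mult_ac)
  qed
  have diff: "partial_approx i x - ?S N x = (\<Sum>\<alpha>=1..r i. cores r \<phi> i \<alpha> (restrict x {1..i}) * G N \<alpha> (restrict x {Suc i..m}))" for N x
  proof -
    have "?S N x = (\<Sum>\<beta>=1..N. \<Sum>\<alpha>=1..r i. cores r \<phi> i \<alpha> x * (sqrt (lam j \<beta>) * \<phi> j \<alpha> (x j) \<beta> * \<psi> j \<beta> (restrict x {Suc j..m})))"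
      by (intro sum.cong refl) (simp add: i cores_restrict sum_distrib_left sum_distrib_right mult_ac)
    also have "\<dots> = (\<Sum>\<alpha>=1..r i. cores r \<phi> i \<alpha> x * (\<Sum>\<beta>=1..N. sqrt (lam j \<beta>) * \<phi> j \<alpha> (x j) \<beta> * \<psi> j \<beta> (restrict x {Suc j..m})))"
      by (subst sum.swap) (simp add: sum_distrib_left)
    moreover have "restrict (restrict x {Suc i..m}) {Suc j..m} = restrict x {Suc j..m}" "restrict x {Suc i..m} j = x j"
      using i jm by (auto simp: restrict_def fun_eq_iff)
    ultimately show ?thesis
      unfolding partial_approx_def G_def
      by (simp add: cores_restrict right_diff_distrib sum_subtractf i)
  qed
  have "(\<lambda>N. L2_norm ?P (\<lambda>x. partial_approx i x - ?S N x)) \<longlonglongrightarrow> 0"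
  proof -
    have sq: "(L2_norm ?P (\<lambda>x. partial_approx i x - ?S N x))\<^sup>2 = (\<Sum>\<alpha>=1..r i. (L2_norm (PiM {Suc i..m} M) (G N \<alpha>))\<^sup>2)" for N
      unfolding diff
      by (rule L2_norm_orthonormal_tensor[OF split_at[OF jm(2)] _ cores_orthonormal[OF jm(3)] GL]) auto
    have "(\<lambda>N. \<Sum>\<alpha>=1..r i. (L2_norm (PiM {j..m} M) (G N \<alpha>))\<^sup>2) \<longlonglongrightarrow> 0"
      using svd[OF j] unfolding is_svd_def G_def jm(4) by blast
    then have "(\<lambda>N. sqrt ((L2_norm ?P (\<lambda>x. partial_approx i x - ?S N x))\<^sup>2)) \<longlonglongrightarrow> sqrt 0"
      unfolding sq i[symmetric] by (rule tendsto_real_sqrt)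
    then show ?thesis by (simp add: L2_norm_nonneg)
  qed
  then have "L2_norm ?P (\<lambda>x. partial_approx i x - ?S (r j) x)
      \<le> L2_norm ?P (\<lambda>x. partial_approx i x - (\<Sum>k<r j. a k (restrict x {1..j}) * b k (restrict x {Suc j..m})))"
    by (intro eckart_young[OF split_at[OF jm(1)] partial_approx_L2[OF jm(3)] cores_orthonormal_all[OF j] \<psi>_orthonormal[OF j]] ab)
       (auto simp: lam_nonneg[OF j] lam_antimono[OF j])
  then show ?thesis unfolding trunc jm(4) .
qed

lemma partial_approx_0: "x \<in> space (PiM {1..m} M) \<Longrightarrow> partial_approx 0 x = f x"
  using run r0 by (simp add: partial_approx_def tt_svd_def space_PiM PiE_def extensional_restrict)

lemma partial_approx_last: "partial_approx (m - 1) x = tt_approx m r lam \<phi> \<psi> x"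
proof -
  let ?j = "m - 1"
  have j: "?j \<in> {1..m-1}" "?j \<ge> 1" "Suc ?j = m" using m by auto
  have jj: "{1..?j} = insert ?j {1..?j-1}" "?j \<notin> {1..?j-1}" using j by auto
  let ?P = "PiE {1..?j-1} (\<lambda>i. {1..r i})"
  let ?l = "\<lambda>\<gamma>. sqrt (lam ?j \<gamma>) * \<psi> ?j \<gamma> (restrict x {m})"
  have "tt_approx m r lam \<phi> \<psi> x = (\<Sum>(\<gamma>, \<alpha>)\<in>{1..r ?j} \<times> ?P.
      \<phi> 1 1 (x 1) ((\<alpha>(?j := \<gamma>)) 1) * (\<Prod>i=2..?j. \<phi> i ((\<alpha>(?j := \<gamma>)) (i - 1)) (x i) ((\<alpha>(?j := \<gamma>)) i)) * ?l ((\<alpha>(?j := \<gamma>)) ?j))"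
    unfolding tt_approx_def jj(1) PiE_insert_eq
    by (subst sum.reindex[OF inj_combinator[OF jj(2)]]) (simp add: case_prod_beta)
  also have "\<dots> = (\<Sum>\<gamma>=1..r ?j. \<Sum>\<alpha>\<in>?P. (\<Sum>\<alpha>0=1..r 0. \<phi> 1 \<alpha>0 (x 1) (if ?j = 1 then \<gamma> else \<alpha> 1)) *
      (\<Prod>i=2..?j. \<phi> i (\<alpha> (i - 1)) (x i) (if i = ?j then \<gamma> else \<alpha> i)) * ?l \<gamma>)"
    unfolding sum.cartesian_product[symmetric]
  proof (intro sum.cong refl)
    fix \<gamma> \<alpha>
    have "(\<Prod>i=2..?j. \<phi> i ((\<alpha>(?j := \<gamma>)) (i - 1)) (x i) ((\<alpha>(?j := \<gamma>)) i))
        = (\<Prod>i=2..?j. \<phi> i (\<alpha> (i - 1)) (x i) (if i = ?j then \<gamma> else \<alpha> i))"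
      by (intro prod.cong) auto
    then show "\<phi> 1 1 (x 1) ((\<alpha>(?j := \<gamma>)) 1) * (\<Prod>i=2..?j. \<phi> i ((\<alpha>(?j := \<gamma>)) (i - 1)) (x i) ((\<alpha>(?j := \<gamma>)) i)) * ?l ((\<alpha>(?j := \<gamma>)) ?j)
        = (\<Sum>\<alpha>0=1..r 0. \<phi> 1 \<alpha>0 (x 1) (if ?j = 1 then \<gamma> else \<alpha> 1)) *
          (\<Prod>i=2..?j. \<phi> i (\<alpha> (i - 1)) (x i) (if i = ?j then \<gamma> else \<alpha> i)) * ?l \<gamma>"
      by (simp add: r0)
  qed
  also have "\<dots> = (\<Sum>\<gamma>=1..r ?j. cores r \<phi> ?j \<gamma> x * ?l \<gamma>)"
    unfolding cores_eq_sum[OF j(2)] sum_distrib_right ..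
  also have "\<dots> = partial_approx ?j x"
    unfolding partial_approx_def using g_Suc[OF j(1)] j(3) by (intro sum.cong) auto
  finally show ?thesis ..
qed

text \<open>
  A function of rank \<open>r j\<close> at distance \<open>e\<close> from \<open>f\<close> is at distance at most \<open>E + e\<close> from an
  approximation of \<open>f\<close> with error \<open>E\<close>. The \<open>j\<close>-th step thus adds at most \<open>E + e\<close> to the error \<open>E\<close>, and
  the errors obey \<open>E\<^sub>j \<le> 2 * E\<^bsub>j-1\<^esub> + e\<close>.
\<close>

lemma tt_quasi_optimal:
  assumes e: "\<And>j. j \<in> {1..m-1} \<Longrightarrow> \<exists>a b. (\<forall>k<r j. a k \<in> L2 (PiM {1..j} M) \<and> b k \<in> L2 (PiM {Suc j..m} M)) \<and>
     L2_norm (PiM {1..m} M) (\<lambda>x. f x - (\<Sum>k<r j. a k (restrict x {1..j}) * b k (restrict x {Suc j..m}))) \<le> e"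
    and e0: "0 \<le> e"
  shows "L2_norm (PiM {1..m} M) (\<lambda>x. f x - tt_approx m r lam \<phi> \<psi> x) \<le> 2 ^ m * e"
proof -
  let ?P = "PiM {1..m} M"
  have "L2_norm ?P (\<lambda>x. f x - partial_approx j x) \<le> (2 ^ j - 1) * e" if "j \<le> m - 1" for j
    using that
  proof (induction j)
    case 0
    have "L2_norm ?P (\<lambda>x. f x - partial_approx 0 x) = L2_norm ?P (\<lambda>x. 0)"
      by (rule L2_norm_cong) (simp add: partial_approx_0)
    then show ?case by (simp add: L2_norm_def)
  next
    case (Suc j)
    then have j: "Suc j \<in> {1..m-1}" "j \<le> m - 1" by auto
    obtain a b where ab: "\<forall>k<r (Suc j). a k \<in> L2 (PiM {1..Suc j} M) \<and> b k \<in> L2 (PiM {Suc (Suc j)..m} M)"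
      and ab_e: "L2_norm ?P (\<lambda>x. f x - (\<Sum>k<r (Suc j). a k (restrict x {1..Suc j}) * b k (restrict x {Suc (Suc j)..m}))) \<le> e"
      using e[OF j(1)] by blast
    define A where "A x = (\<Sum>k<r (Suc j). a k (restrict x {1..Suc j}) * b k (restrict x {Suc (Suc j)..m}))" for x
    have AL: "A \<in> L2 ?P"
      unfolding A_def
    proof (rule L2_sum)
      fix k assume "k \<in> {..<r (Suc j)}"
      then have k: "a k \<in> L2 (PiM {1..Suc j} M)" "b k \<in> L2 (PiM {Suc (Suc j)..m} M)" using ab by auto
      have "Suc j \<le> m" using j by auto
      then show "(\<lambda>x. a k (restrict x {1..Suc j}) * b k (restrict x {Suc (Suc j)..m})) \<in> L2 ?P"
        by (intro L2_tensor[OF split_at k])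
    qed
    note hL = partial_approx_L2[OF j(2)] and hL' = partial_approx_L2[of "Suc j"]
    have "L2_norm ?P (\<lambda>x. partial_approx j x - partial_approx (Suc j) x) \<le> L2_norm ?P (\<lambda>x. partial_approx j x - A x)"
      using partial_approx_step[OF j(1), of a b] ab by (simp add: A_def)
    also have "\<dots> \<le> L2_norm ?P (\<lambda>x. partial_approx j x - f x) + L2_norm ?P (\<lambda>x. f x - A x)"
      by (rule L2_norm_triangle_diff[OF hL f AL])
    also have "\<dots> \<le> (2 ^ j - 1) * e + e"
      using Suc.IH j ab_e L2_norm_minus_commute[of ?P "partial_approx j" f] by (simp add: A_def)
    finally have "L2_norm ?P (\<lambda>x. partial_approx j x - partial_approx (Suc j) x) \<le> (2 ^ j - 1) * e + e" .
    moreover have "L2_norm ?P (\<lambda>x. f x - partial_approx (Suc j) x)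
        \<le> L2_norm ?P (\<lambda>x. f x - partial_approx j x) + L2_norm ?P (\<lambda>x. partial_approx j x - partial_approx (Suc j) x)"
      using Suc.prems by (intro L2_norm_triangle_diff[OF f hL hL'])
    ultimately have "L2_norm ?P (\<lambda>x. f x - partial_approx (Suc j) x) \<le> (2 ^ j - 1) * e + ((2 ^ j - 1) * e + e)"
      using Suc.IH[OF j(2)] by linarith
    then show ?case by (simp add: algebra_simps)
  qed
  from this[OF order_refl] have "L2_norm ?P (\<lambda>x. f x - tt_approx m r lam \<phi> \<psi> x) \<le> (2 ^ (m - 1) - 1) * e"
    unfolding partial_approx_last .
  also have "\<dots> \<le> 2 ^ m * e"
  proof -
    have "(2::real) ^ (m - 1) \<le> 2 ^ m" by (intro power_increasing) auto
    then have "(2::real) ^ (m - 1) - 1 \<le> 2 ^ m" by linarith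
    then show ?thesis by (rule mult_right_mono[OF _ e0])
  qed
  finally show ?thesis .
qed

end

section \<open>The storage cost\<close>

lemma ceiling_rank_bounds:
  assumes "1 \<le> (x::real)" shows "x \<le> real (nat \<lceil>x\<rceil>)" "real (nat \<lceil>x\<rceil>) \<le> 2 * x"
proof -
  have "real (nat \<lceil>x\<rceil>) = of_int \<lceil>x\<rceil>" using assms by (simp add: of_nat_nat)
  then show "x \<le> real (nat \<lceil>x\<rceil>)" "real (nat \<lceil>x\<rceil>) \<le> 2 * x"
    using assms le_of_int_ceiling[of x] of_int_ceiling_le_add_one[of x] by linarith+
qed

lemma tt_rank_bounds:
  assumes \<epsilon>: "0 < \<epsilon>" "\<epsilon> < 1" and k: "k > 0"
  shows "\<epsilon> powr (- real (\<Sum>i=1..j. n i) / k) \<le> real (tt_rank n k \<epsilon> j)"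
    and "real (tt_rank n k \<epsilon> j) \<le> 2 * \<epsilon> powr (- real (\<Sum>i=1..j. n i) / k)"
proof -
  have "\<epsilon> powr 0 \<le> \<epsilon> powr (- real (\<Sum>i=1..j. n i) / k)"
    using \<epsilon> k by (intro powr_mono' divide_nonpos_pos) (simp_all add: sum_nonneg)
  then have "1 \<le> \<epsilon> powr (- real (\<Sum>i=1..j. n i) / k)" using \<epsilon> by simp
  then show "\<epsilon> powr (- real (\<Sum>i=1..j. n i) / k) \<le> real (tt_rank n k \<epsilon> j)"
    "real (tt_rank n k \<epsilon> j) \<le> 2 * \<epsilon> powr (- real (\<Sum>i=1..j. n i) / k)"
    unfolding tt_rank_def by (rule ceiling_rank_bounds)+
qed

text \<open>
  Rounding up a number that is at least \<open>1\<close> at most doubles it, and the storage cost consists of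
  products of at most two ranks.
\<close>

lemma tt_storage_bounds:
  fixes \<epsilon> k :: real and n :: "nat \<Rightarrow> nat"
  assumes \<epsilon>: "0 < \<epsilon>" "\<epsilon> < 1" and k: "k > 0" and m: "m \<ge> 2"
  defines "S \<equiv> \<Sum>j=1..m-1. \<epsilon> powr (- real (2 * (\<Sum>i=1..j-1. n i) + n j) / k)"
  shows "S \<le> real (tt_storage m (tt_rank n k \<epsilon>))" and "real (tt_storage m (tt_rank n k \<epsilon>)) \<le> 4 * S"
proof -
  let ?r = "tt_rank n k \<epsilon>"
  let ?x = "\<lambda>j. \<epsilon> powr (- real (\<Sum>i=1..j. n i) / k)"
  let ?t = "\<lambda>j. \<epsilon> powr (- real (2 * (\<Sum>i=1..j-1. n i) + n j) / k)"
  have t: "?t j = ?x (j - 1) * ?x j" if "1 \<le> j" for j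
  proof -
    have "(\<Sum>i=1..j. n i) = (\<Sum>i=1..j-1. n i) + n j"
      using that by (cases j) auto
    then have "- real (2 * (\<Sum>i=1..j-1. n i) + n j) / k
        = - real (\<Sum>i=1..j-1. n i) / k + - real (\<Sum>i=1..j. n i) / k"
      by (simp only: add_divide_distrib[symmetric]) (simp del: of_nat_sum)
    then show ?thesis by (simp only: powr_add)
  qed
  have "1 \<le> m - 1" using m by simp
  then have split: "(\<Sum>j=1..m-1. g j) = g 1 + (\<Sum>j=2..m-1. g j)" for g :: "nat \<Rightarrow> real"
    by (subst sum.atLeast_Suc_atMost) (auto simp: numeral_2_eq_2)
  have x0: "?x 0 = 1" using \<epsilon> by simp
  have r0: "?x j \<le> real (?r j)" "real (?r j) \<le> 2 * ?x j" for j by (rule tt_rank_bounds[OF \<epsilon> k])+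
  have xn: "0 \<le> ?x j" for j by simp
  have st: "real (tt_storage m ?r) = real (?r 1) + (\<Sum>j=2..m-1. real (?r (j - 1)) * real (?r j))"
    by (simp add: tt_storage_def)
  have S_eq: "S = ?x 1 + (\<Sum>j=2..m-1. ?x (j - 1) * ?x j)"
  proof -
    have "S = ?t 1 + (\<Sum>j=2..m-1. ?t j)" unfolding S_def by (rule split)
    also have "?t 1 = ?x 1" using t[of 1] x0 by simp
    also have "(\<Sum>j=2..m-1. ?t j) = (\<Sum>j=2..m-1. ?x (j - 1) * ?x j)" by (intro sum.cong refl t) auto
    finally show ?thesis .
  qed
  have "(\<Sum>j=2..m-1. ?x (j - 1) * ?x j) \<le> (\<Sum>j=2..m-1. real (?r (j - 1)) * real (?r j))"
    by (intro sum_mono mult_mono r0 xn) auto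
  then show "S \<le> real (tt_storage m ?r)" unfolding st S_eq using r0(1)[of 1] by linarith
  have "(\<Sum>j=2..m-1. real (?r (j - 1)) * real (?r j)) \<le> (\<Sum>j=2..m-1. (2 * ?x (j - 1)) * (2 * ?x j))"
    by (intro sum_mono mult_mono r0) auto
  also have "\<dots> = 4 * (\<Sum>j=2..m-1. ?x (j - 1) * ?x j)" by (simp add: sum_distrib_left mult.assoc mult.left_commute)
  finally have rest: "(\<Sum>j=2..m-1. real (?r (j - 1)) * real (?r j)) \<le> 4 * (\<Sum>j=2..m-1. ?x (j - 1) * ?x j)" .
  have "real (?r 1) \<le> 4 * ?x 1" using r0(2)[of 1] xn[of 1] by linarith
  then show "real (tt_storage m ?r) \<le> 4 * S" unfolding st S_eq distrib_left using rest by (rule add_mono)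
qed

text \<open>Every exponent is a sum of at most \<open>2 * m - 1\<close> of the dimensions.\<close>

lemma tt_storage_bound_max:
  fixes \<epsilon> k :: real and n :: "nat \<Rightarrow> nat"
  assumes \<epsilon>: "0 < \<epsilon>" "\<epsilon> < 1" and k: "k > 0" and m: "m \<ge> 2"
  shows "real (tt_storage m (tt_rank n k \<epsilon>))
    \<le> 4 * real (m - 1) * \<epsilon> powr (- ((2 * real m - 1) * real (Max (n ` {1..m-1}))) / k)"
proof -
  let ?M = "Max (n ` {1..m-1})"
  have M: "n i \<le> ?M" if "i \<in> {1..m-1}" for i using that by (intro Max_ge) auto
  have "(\<Sum>j=1..m-1. \<epsilon> powr (- real (2 * (\<Sum>i=1..j-1. n i) + n j) / k))
      \<le> (\<Sum>j=1..m-1. \<epsilon> powr (- ((2 * real m - 1) * real ?M) / k))"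
  proof (rule sum_mono)
    fix j assume j: "j \<in> {1..m-1}"
    have "(\<Sum>i=1..j-1. n i) \<le> (\<Sum>i=1..j-1. ?M)" using j by (intro sum_mono M) auto
    then have "real (2 * (\<Sum>i=1..j-1. n i) + n j) \<le> real (2 * ((j - 1) * ?M) + ?M)"
      using M[OF j] by (intro of_nat_mono add_mono mult_left_mono) auto
    also have "\<dots> = (2 * real (j - 1) + 1) * real ?M" 
      by (simp only: of_nat_add of_nat_mult distrib_right mult_1 mult.assoc of_nat_numeral)
    also have "\<dots> \<le> (2 * real m - 1) * real ?M" using j m by (intro mult_right_mono) (auto simp: of_nat_diff)
    finally have "- ((2 * real m - 1) * real ?M) / k \<le> - real (2 * (\<Sum>i=1..j-1. n i) + n j) / k"
      using k by (intro divide_right_mono) auto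
    then show "\<epsilon> powr (- real (2 * (\<Sum>i=1..j-1. n i) + n j) / k) \<le> \<epsilon> powr (- ((2 * real m - 1) * real ?M) / k)"
      using \<epsilon> by (intro powr_mono') auto
  qed
  also have "\<dots> = real (m - 1) * \<epsilon> powr (- ((2 * real m - 1) * real ?M) / k)" by simp
  finally show ?thesis using tt_storage_bounds(2)[OF \<epsilon> k m, of n] by simp
qed

section \<open>Points of a product domain and their coordinates\<close>

definition block_coords :: "nat set \<Rightarrow> (nat \<Rightarrow> nat) \<Rightarrow> (nat \<times> nat) set" where
  "block_coords S n = (SIGMA j:S. {..<n j})"

definition split_blocks :: "nat set \<Rightarrow> (nat \<Rightarrow> nat) \<Rightarrow> (nat \<times> nat \<Rightarrow> real) \<Rightarrow> nat \<Rightarrow> nat \<Rightarrow> real" where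
  "split_blocks S n z = (\<lambda>j\<in>S. \<lambda>i\<in>{..<n j}. z (j, i))"

definition join_blocks :: "nat set \<Rightarrow> (nat \<Rightarrow> nat) \<Rightarrow> (nat \<Rightarrow> nat \<Rightarrow> real) \<Rightarrow> nat \<times> nat \<Rightarrow> real" where
  "join_blocks S n x = (\<lambda>q\<in>block_coords S n. x (fst q) (snd q))"

definition block_domain :: "nat set \<Rightarrow> (nat \<Rightarrow> nat) \<Rightarrow> (nat \<Rightarrow> (nat \<Rightarrow> real) set) \<Rightarrow> (nat \<times> nat \<Rightarrow> real) set" where
  "block_domain S n \<Omega> = {z \<in> PiE (block_coords S n) (\<lambda>_. UNIV). \<forall>j\<in>S. (\<lambda>i\<in>{..<n j}. z (j, i)) \<in> \<Omega> j}"

lemma coords_eq: "coords m n = block_coords {1..m} n"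
  by (simp add: coords_def block_coords_def)

lemma blocks_eq: "blocks m n = split_blocks {1..m} n"
  by (simp add: blocks_def split_blocks_def fun_eq_iff)

lemma flat_product_eq: "flat_product m n \<Omega> = block_domain {1..m} n \<Omega>"
  by (auto simp: flat_product_def block_domain_def coords_eq blocks_def PiE_iff)

lemma finite_block_coords: "finite S \<Longrightarrow> finite (block_coords S n)"
  by (simp add: block_coords_def)

lemma card_block_coords: "finite S \<Longrightarrow> card (block_coords S n) = (\<Sum>j\<in>S. n j)"
  by (simp add: block_coords_def card_SigmaI)

lemma split_join_blocks:
  "x \<in> PiE S (\<lambda>j. PiE {..<n j} (\<lambda>_. UNIV)) \<Longrightarrow> split_blocks S n (join_blocks S n x) = x"
  by (auto simp: join_blocks_def split_blocks_def block_coords_def fun_eq_iff PiE_iff extensional_def)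

lemma join_blocks_restrict:
  "J \<subseteq> S \<Longrightarrow> join_blocks J n (restrict (split_blocks S n z) J) = restrict z (block_coords J n)"
  by (auto simp: join_blocks_def split_blocks_def block_coords_def fun_eq_iff)

lemma split_blocks_measurable:
  "split_blocks S n \<in> leb (block_coords S n) \<rightarrow>\<^sub>M PiM S (\<lambda>j. leb {..<n j})"
proof -
  have "(\<lambda>z. \<lambda>j\<in>S. \<lambda>i\<in>{..<n j}. z (j, i)) \<in> leb (block_coords S n) \<rightarrow>\<^sub>M PiM S (\<lambda>j. leb {..<n j})"
  proof (rule measurable_restrict, rule measurable_restrict)
    fix j i assume "j \<in> S" "i \<in> {..<n j}"
    then show "(\<lambda>z. z (j, i)) \<in> leb (block_coords S n) \<rightarrow>\<^sub>M lborel"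
      by (intro measurable_component_singleton) (simp add: block_coords_def)
  qed
  then show ?thesis by (simp add: split_blocks_def [abs_def])
qed

lemma join_blocks_measurable:
  assumes "\<And>j i. j \<in> S \<Longrightarrow> i < n j \<Longrightarrow> (\<lambda>y. y i) \<in> M j \<rightarrow>\<^sub>M lborel"
  shows "join_blocks S n \<in> PiM S M \<rightarrow>\<^sub>M leb (block_coords S n)"
proof -
  have "(\<lambda>x. \<lambda>q\<in>block_coords S n. x (fst q) (snd q)) \<in> PiM S M \<rightarrow>\<^sub>M leb (block_coords S n)"
  proof (rule measurable_restrict)
    fix q assume "q \<in> block_coords S n"
    then have q: "fst q \<in> S" "snd q < n (fst q)" by (auto simp: block_coords_def)
    show "(\<lambda>x. x (fst q) (snd q)) \<in> PiM S M \<rightarrow>\<^sub>M lborel"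
      by (rule measurable_compose[OF measurable_component_singleton[OF q(1), where M = M] assms[OF q]])
  qed
  then show ?thesis by (simp add: join_blocks_def [abs_def])
qed

text \<open>The preimage of a box is a product of boxes.\<close>

lemma distr_join_blocks:
  assumes S: "finite S"
  shows "distr (PiM S (\<lambda>j. leb {..<n j})) (leb (block_coords S n)) (join_blocks S n) = leb (block_coords S n)"
proof -
  let ?C = "block_coords S n" and ?P = "PiM S (\<lambda>j. leb {..<n j})"
  interpret R: product_sigma_finite "\<lambda>_. lborel :: real measure" by standard
  interpret B: product_sigma_finite "\<lambda>j. leb {..<n j}"
    by (simp add: product_sigma_finite_def leb_sigma_finite)
  have meas: "join_blocks S n \<in> ?P \<rightarrow>\<^sub>M leb ?C"
    by (rule join_blocks_measurable) (simp add: measurable_component_singleton)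
  show ?thesis
  proof (rule R.PiM_eqI[OF finite_block_coords[OF S]])
    fix A :: "nat \<times> nat \<Rightarrow> real set" assume A: "\<And>q. q \<in> ?C \<Longrightarrow> A q \<in> sets lborel"
    have "PiE ?C A \<in> sets (leb ?C)" using A finite_block_coords[OF S] by (intro sets_PiM_I_finite) auto
    then have "emeasure (distr ?P (leb ?C) (join_blocks S n)) (PiE ?C A)
        = emeasure ?P (join_blocks S n -` PiE ?C A \<inter> space ?P)"
      by (rule emeasure_distr[OF meas])
    also have "join_blocks S n -` PiE ?C A \<inter> space ?P = PiE S (\<lambda>j. PiE {..<n j} (\<lambda>i. A (j, i)))"
      by (auto simp: space_PiM join_blocks_def block_coords_def PiE_iff extensional_def)
    also have "emeasure ?P \<dots> = (\<Prod>j\<in>S. emeasure (leb {..<n j}) (PiE {..<n j} (\<lambda>i. A (j, i))))"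
      using A by (intro B.emeasure_PiM S sets_PiM_I_finite) (auto simp: block_coords_def)
    also have "\<dots> = (\<Prod>j\<in>S. \<Prod>i<n j. emeasure lborel (A (j, i)))"
      using A by (intro prod.cong refl R.emeasure_PiM) (auto simp: block_coords_def)
    also have "\<dots> = (\<Prod>q\<in>?C. emeasure lborel (A q))"
      unfolding block_coords_def using S by (subst prod.Sigma) auto
    finally show "emeasure (distr ?P (leb ?C) (join_blocks S n)) (PiE ?C A) = (\<Prod>q\<in>?C. emeasure lborel (A q))" .
  qed simp
qed

lemma distr_split_blocks:
  assumes S: "finite S"
  shows "distr (leb (block_coords S n)) (PiM S (\<lambda>j. leb {..<n j})) (split_blocks S n) = PiM S (\<lambda>j. leb {..<n j})"
proof -
  let ?C = "block_coords S n" and ?P = "PiM S (\<lambda>j. leb {..<n j})"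
  have meas: "join_blocks S n \<in> ?P \<rightarrow>\<^sub>M leb ?C"
    by (rule join_blocks_measurable) (simp add: measurable_component_singleton)
  have "distr (leb ?C) ?P (split_blocks S n) = distr (distr ?P (leb ?C) (join_blocks S n)) ?P (split_blocks S n)"
    unfolding distr_join_blocks[OF S] ..
  also have "\<dots> = distr ?P ?P (split_blocks S n \<circ> join_blocks S n)"
    by (rule distr_distr[OF split_blocks_measurable meas])
  also have "\<dots> = distr ?P ?P (\<lambda>x. x)"
    by (rule distr_cong[OF refl refl]) (simp add: split_join_blocks space_PiM)
  finally show ?thesis by (simp add: distr_id)
qed

text \<open>
  All \<open>M j\<close> have to be \<open>\<sigma>\<close>-finite, because products of measures are developed for families that
  are so throughout; hence the conditions on all natural numbers \<open>j\<close>.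
\<close>

locale block_domains =
  fixes n :: "nat \<Rightarrow> nat" and \<Omega> :: "nat \<Rightarrow> (nat \<Rightarrow> real) set" and M :: "nat \<Rightarrow> (nat \<Rightarrow> real) measure"
  assumes \<Omega>_sets: "\<And>j. \<Omega> j \<in> sets (leb {..<n j})"
    and M_eq: "\<And>j. M j = dom_measure {..<n j} (\<Omega> j)"
begin

lemma M_sigma_finite: "sigma_finite_measure (M j)"
  unfolding M_eq dom_measure_def by (intro sigma_finite_measure_restrict_space leb_sigma_finite \<Omega>_sets) simp

sublocale product_sigma_finite M
  by (simp add: product_sigma_finite_def M_sigma_finite)

lemma \<Omega>_sub: "\<Omega> j \<subseteq> PiE {..<n j} (\<lambda>_. UNIV)"
  using sets.sets_into_space[OF \<Omega>_sets[of j]] by (simp add: space_leb)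

lemma PiE_\<Omega>_sub: "PiE S \<Omega> \<subseteq> PiE S (\<lambda>j. PiE {..<n j} (\<lambda>_. UNIV))"
  by (rule PiE_mono) (rule \<Omega>_sub)

lemma space_M: "space (M j) = \<Omega> j"
  using \<Omega>_sub[of j] by (auto simp: M_eq dom_measure_def space_restrict_space space_leb)

lemma \<Omega>_Int: "\<Omega> j \<inter> space (leb {..<n j}) \<in> sets (leb {..<n j})"
  using \<Omega>_sets by auto

lemma sets_M: "A \<in> sets (M j) \<longleftrightarrow> A \<subseteq> \<Omega> j \<and> A \<in> sets (leb {..<n j})"
  unfolding M_eq dom_measure_def by (rule sets_restrict_space_iff[OF \<Omega>_Int])

lemma emeasure_M: "A \<subseteq> \<Omega> j \<Longrightarrow> emeasure (M j) A = emeasure (leb {..<n j}) A"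
  unfolding M_eq dom_measure_def by (rule emeasure_restrict_space[OF \<Omega>_Int])

lemma join_measurable: "join_blocks S n \<in> PiM S M \<rightarrow>\<^sub>M leb (block_coords S n)"
proof (rule join_blocks_measurable)
  fix j i assume "i < n j"
  then show "(\<lambda>y. y i) \<in> M j \<rightarrow>\<^sub>M lborel"
    unfolding M_eq dom_measure_def
    by (intro measurable_restrict_space1 measurable_component_singleton) simp
qed

lemma join_domain: "x \<in> space (PiM S M) \<Longrightarrow> join_blocks S n x \<in> block_domain S n \<Omega>"
proof -
  assume "x \<in> space (PiM S M)"
  then have x: "x \<in> PiE S \<Omega>" by (simp add: space_PiM space_M)
  then have "x \<in> PiE S (\<lambda>j. PiE {..<n j} (\<lambda>_. UNIV))" using PiE_\<Omega>_sub ..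
  note inv = split_join_blocks[OF this]
  have "(\<lambda>i\<in>{..<n j}. join_blocks S n x (j, i)) = x j" if "j \<in> S" for j
    using fun_cong[OF inv, of j] that by (simp add: split_blocks_def)
  then show ?thesis using x by (auto simp: block_domain_def PiE_iff join_blocks_def)
qed

lemma split_join: "x \<in> space (PiM S M) \<Longrightarrow> split_blocks S n (join_blocks S n x) = x"
  by (rule split_join_blocks, rule subsetD[OF PiE_\<Omega>_sub]) (simp add: space_PiM space_M)

lemma block_domain_sets: "finite S \<Longrightarrow> block_domain S n \<Omega> \<in> sets (leb (block_coords S n))"
proof -
  assume S: "finite S"
  have "PiE S \<Omega> \<in> sets (PiM S (\<lambda>j. leb {..<n j}))"
    using \<Omega>_sets S by (intro sets_PiM_I_finite) auto
  from measurable_sets[OF split_blocks_measurable this]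
  have "split_blocks S n -` PiE S \<Omega> \<inter> space (leb (block_coords S n)) \<in> sets (leb (block_coords S n))" .
  moreover have "split_blocks S n -` PiE S \<Omega> \<inter> space (leb (block_coords S n)) = block_domain S n \<Omega>"
    by (auto simp: block_domain_def split_blocks_def space_leb PiE_iff extensional_def)
  ultimately show ?thesis by simp
qed

lemma split_measurable:
  "split_blocks S n \<in> dom_measure (block_coords S n) (block_domain S n \<Omega>) \<rightarrow>\<^sub>M PiM S M"
proof -
  let ?D = "dom_measure (block_coords S n) (block_domain S n \<Omega>)"
  have "(\<lambda>z. \<lambda>j\<in>S. \<lambda>i\<in>{..<n j}. z (j, i)) \<in> ?D \<rightarrow>\<^sub>M PiM S M"
  proof (rule measurable_restrict)
    fix j assume j: "j \<in> S"
    show "(\<lambda>z. \<lambda>i\<in>{..<n j}. z (j, i)) \<in> ?D \<rightarrow>\<^sub>M M j"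
      unfolding M_eq dom_measure_def
    proof (rule measurable_restrict_space2)
      show "(\<lambda>z. \<lambda>i\<in>{..<n j}. z (j, i)) \<in> space (restrict_space (leb (block_coords S n)) (block_domain S n \<Omega>)) \<rightarrow> \<Omega> j"
        using j by (auto simp: space_restrict_space block_domain_def)
      show "(\<lambda>z. \<lambda>i\<in>{..<n j}. z (j, i)) \<in> restrict_space (leb (block_coords S n)) (block_domain S n \<Omega>) \<rightarrow>\<^sub>M leb {..<n j}"
        using j by (intro measurable_restrict measurable_restrict_space1 measurable_component_singleton)
          (simp add: block_coords_def)
    qed
  qed
  then show ?thesis by (simp add: split_blocks_def [abs_def])
qed

text \<open>The measures agree on boxes.\<close>

lemma distr_dom_split_blocks:
  assumes S: "finite S"
  shows "distr (dom_measure (block_coords S n) (block_domain S n \<Omega>)) (PiM S M) (split_blocks S n) = PiM S M"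
proof (rule PiM_eqI[OF S])
  let ?C = "block_coords S n" and ?U = "block_domain S n \<Omega>" and ?P = "PiM S (\<lambda>j. leb {..<n j})"
  interpret B: product_sigma_finite "\<lambda>j. leb {..<n j}"
    by (simp add: product_sigma_finite_def leb_sigma_finite)
  fix A assume A: "\<And>j. j \<in> S \<Longrightarrow> A j \<in> sets (M j)"
  have A': "\<And>j. j \<in> S \<Longrightarrow> A j \<subseteq> \<Omega> j" "\<And>j. j \<in> S \<Longrightarrow> A j \<in> sets (leb {..<n j})" using A by (auto simp: sets_M)
  have PA: "PiE S A \<in> sets (PiM S M)" "PiE S A \<in> sets ?P"
    using A A' S by (auto intro: sets_PiM_I_finite)
  have "emeasure (distr (dom_measure ?C ?U) (PiM S M) (split_blocks S n)) (PiE S A)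
      = emeasure (dom_measure ?C ?U) (split_blocks S n -` PiE S A \<inter> space (dom_measure ?C ?U))"
    by (rule emeasure_distr[OF split_measurable PA(1)])
  also have "split_blocks S n -` PiE S A \<inter> space (dom_measure ?C ?U) = split_blocks S n -` PiE S A \<inter> space (leb ?C)"
    using A'(1) by (fastforce simp: dom_measure_def space_restrict_space block_domain_def space_leb split_blocks_def PiE_iff)
  also have "emeasure (dom_measure ?C ?U) \<dots> = emeasure (leb ?C) \<dots>"
    unfolding dom_measure_def
  proof (rule emeasure_restrict_space)
    show "?U \<inter> space (leb ?C) \<in> sets (leb ?C)" using block_domain_sets[OF S] by auto
    show "split_blocks S n -` PiE S A \<inter> space (leb ?C) \<subseteq> ?U"
      using A'(1) by (fastforce simp: block_domain_def space_leb split_blocks_def PiE_iff)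
  qed
  also have "\<dots> = emeasure (distr (leb ?C) ?P (split_blocks S n)) (PiE S A)"
    by (rule emeasure_distr[OF split_blocks_measurable PA(2), symmetric])
  also have "\<dots> = (\<Prod>j\<in>S. emeasure (leb {..<n j}) (A j))"
    unfolding distr_split_blocks[OF S] using A' S by (intro B.emeasure_PiM) auto
  also have "\<dots> = (\<Prod>j\<in>S. emeasure (M j) (A j))"
    using A' by (intro prod.cong refl) (simp add: emeasure_M)
  finally show "emeasure (distr (dom_measure ?C ?U) (PiM S M) (split_blocks S n)) (PiE S A) = (\<Prod>j\<in>S. emeasure (M j) (A j))" .
qed simp

lemma nn_integral_PiM_blocks:
  assumes S: "finite S" and F: "F \<in> borel_measurable (PiM S M)"
  shows "(\<integral>\<^sup>+x. F x \<partial>PiM S M)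
    = (\<integral>\<^sup>+z. F (split_blocks S n z) * indicator (block_domain S n \<Omega>) z \<partial>leb (block_coords S n))"
proof -
  have "(\<integral>\<^sup>+x. F x \<partial>PiM S M)
      = (\<integral>\<^sup>+x. F x \<partial>distr (dom_measure (block_coords S n) (block_domain S n \<Omega>)) (PiM S M) (split_blocks S n))"
    unfolding distr_dom_split_blocks[OF S] ..
  also have "\<dots> = (\<integral>\<^sup>+z. F (split_blocks S n z) \<partial>dom_measure (block_coords S n) (block_domain S n \<Omega>))"
    using F by (intro nn_integral_distr[OF split_measurable]) simp
  also have "\<dots> = (\<integral>\<^sup>+z. F (split_blocks S n z) * indicator (block_domain S n \<Omega>) z \<partial>leb (block_coords S n))"
    unfolding dom_measure_def using block_domain_sets[OF S] by (intro nn_integral_restrict_space) auto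
  finally show ?thesis .
qed

lemma measurable_of_split:
  assumes u: "(\<lambda>z. f (split_blocks S n z)) \<in> borel_measurable (dom_measure (block_coords S n) (block_domain S n \<Omega>))"
  shows "f \<in> borel_measurable (PiM S M)"
proof -
  have "join_blocks S n \<in> PiM S M \<rightarrow>\<^sub>M dom_measure (block_coords S n) (block_domain S n \<Omega>)"
    unfolding dom_measure_def by (intro measurable_restrict_space2 join_measurable) (auto simp: join_domain)
  from measurable_compose[OF this u] have "(\<lambda>x. f (split_blocks S n (join_blocks S n x))) \<in> borel_measurable (PiM S M)" .
  then show ?thesis by (subst measurable_cong[of _ _ "\<lambda>x. f (split_blocks S n (join_blocks S n x))"]) (simp_all add: split_join)
qed

end

section \<open>Sobolev functions extended by zero\<close>

text \<open>
  On a bounded domain square integrable functions are integrable. Integrals over the domain become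
  integrals over the whole space by extending the functions by zero.
\<close>

lemma sobolev_weak_derivs:
  assumes I: "finite I" and U: "U \<in> sets (leb I)" "U \<subseteq> open_box I lo hi"
    and u: "u \<in> sobolev I s U" and p: "p \<le> nat \<lfloor>s\<rfloor>"
  shows "\<exists>W. weak_derivs I U p W \<and> (\<forall>x. W [] x = indicator U x * u x)"
proof -
  have UI: "U \<inter> space (leb I) \<in> sets (leb I)" using U(1) by auto
  obtain D where D: "\<forall>is\<in>lists I. length is \<le> nat \<lfloor>s\<rfloor> \<longrightarrow>
      D is \<in> L2 (dom_measure I U) \<and> weak_derivative I U is u (D is)"
    using u unfolding sobolev_def by blast
  have uL: "u \<in> L2 (dom_measure I U)" using u by (simp add: sobolev_def)
  have "emeasure (leb I) U \<le> emeasure (leb I) (open_box I lo hi)"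
    using U(2) by (rule emeasure_mono) (rule open_box_sets[OF I])
  also have "\<dots> < \<infinity>" by (rule emeasure_open_box_finite[OF I])
  finally have fin: "finite_measure (dom_measure I U)"
    unfolding dom_measure_def
    by (intro finite_measureI) (use UI sets.sets_into_space[OF U(1)] in
      \<open>auto simp: space_restrict_space emeasure_restrict_space Int_absorb2\<close>)
  have ext: "integrable (leb I) (\<lambda>x. indicator U x * w x)"
      "(\<integral>\<^sup>+x. ennreal ((indicator U x * w x)\<^sup>2) \<partial>leb I) < \<infinity>" if w: "w \<in> L2 (dom_measure I U)" for w
  proof -
    have "integrable (dom_measure I U) w"
      using L2_measurable[OF w] L2_integrable_square[OF w] finite_measure.square_integrable_imp_integrable[OF fin] by blast
    then show "integrable (leb I) (\<lambda>x. indicator U x * w x)"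
      unfolding dom_measure_def integrable_restrict_space[OF UI] by simp
    have "integrable (leb I) (\<lambda>x. indicator U x *\<^sub>R (w x)\<^sup>2)"
      using L2_integrable_square[OF w] unfolding dom_measure_def integrable_restrict_space[OF UI] .
    then have "(\<integral>\<^sup>+x. ennreal (indicator U x *\<^sub>R (w x)\<^sup>2) \<partial>leb I) < \<infinity>"
      by (subst nn_integral_eq_integral) auto
    moreover have "(indicator U x * w x)\<^sup>2 = indicator U x *\<^sub>R (w x)\<^sup>2" for x by (simp split: split_indicator)
    ultimately show "(\<integral>\<^sup>+x. ennreal ((indicator U x * w x)\<^sup>2) \<partial>leb I) < \<infinity>" by simp
  qed
  define E where "E is = (if is = [] then u else D is)" for "is"
  define W where "W is x = indicator U x * E is x" for "is" x
  have EL: "E is \<in> L2 (dom_measure I U)" and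
    Ew: "(\<integral>x. u x * partials is \<eta> x \<partial>dom_measure I U) = (-1) ^ length is * (\<integral>x. E is x * \<eta> x \<partial>dom_measure I U)"
    if "set is \<subseteq> I" "length is \<le> p" "test_function I U \<eta> \<or> is = []" for "is" \<eta>
    using bspec[OF D, of "is"] that p uL by (auto simp: E_def weak_derivative_def lists_eq_set)
  have "weak_derivs I U p W"
    unfolding weak_derivs_def
  proof (intro allI impI conjI)
    fix "is" assume i: "set is \<subseteq> I \<and> length is \<le> p"
    have L: "E is \<in> L2 (dom_measure I U)"
      using bspec[OF D, of "is"] i p uL by (auto simp: E_def lists_eq_set)
    show "integrable (leb I) (W is)" "(\<integral>\<^sup>+x. ennreal ((W is x)\<^sup>2) \<partial>leb I) < \<infinity>"
      using ext[OF L] by (auto simp: W_def [abs_def])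
    fix \<eta> assume \<eta>: "test_function I U \<eta>"
    have "(\<integral>x. W [] x * partials is \<eta> x \<partial>leb I) = (\<integral>x. u x * partials is \<eta> x \<partial>dom_measure I U)"
      unfolding dom_measure_def integral_restrict_space[OF UI] by (simp add: W_def E_def mult.assoc)
    also have "\<dots> = (-1) ^ length is * (\<integral>x. E is x * \<eta> x \<partial>dom_measure I U)" using Ew[of "is" \<eta>] i \<eta> by simp
    also have "(\<integral>x. E is x * \<eta> x \<partial>dom_measure I U) = (\<integral>x. W is x * \<eta> x \<partial>leb I)"
      unfolding dom_measure_def integral_restrict_space[OF UI] by (simp add: W_def mult.assoc)
    finally show "(\<integral>x. W [] x * partials is \<eta> x \<partial>leb I) = (-1) ^ length is * (\<integral>x. W is x * \<eta> x \<partial>leb I)" .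
  qed
  then show ?thesis by (intro exI[of _ W]) (simp add: W_def E_def)
qed

section \<open>Separable approximation of a Sobolev function\<close>

lemma L2_norm_le:
  assumes u: "u \<in> borel_measurable M" and c: "0 \<le> c" and le: "(\<integral>\<^sup>+x. ennreal ((u x)\<^sup>2) \<partial>M) \<le> ennreal c"
  shows "L2_norm M u \<le> sqrt c"
proof -
  have "(\<integral>x. (u x)\<^sup>2 \<partial>M) = enn2real (\<integral>\<^sup>+x. ennreal ((u x)\<^sup>2) \<partial>M)"
    using u by (intro integral_eq_nn_integral) auto
  also have "\<dots> \<le> c" using le c by (rule enn2real_leI[rotated])
  finally show ?thesis unfolding L2_norm_def by (rule real_sqrt_le_mono)
qed

text \<open>
  With \<open>h = c \<epsilon>\<^bsup>1/k\<^esup>\<close> the rank bound \<open>K h\<^bsup>-d\<^esup>\<close> is at most \<open>\<epsilon>\<^bsup>-d/k\<^esup>\<close> and the error \<open>h\<^sup>p\<close> at most a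
  multiple of \<open>\<epsilon>\<close>, because \<open>p \<ge> k\<close>.
\<close>

lemma mesh_size_bounds:
  fixes \<epsilon> k K :: real
  assumes \<epsilon>: "0 < \<epsilon>" "\<epsilon> < 1" and k: "0 < k" and K: "0 \<le> K" and d: "1 \<le> d" and p: "k \<le> real p"
  defines "h \<equiv> (K + 1) * \<epsilon> powr (1 / k)"
  shows "K * (1 / h) ^ d \<le> \<epsilon> powr (- real d / k)" and "h ^ p \<le> (K + 1) ^ p * \<epsilon>"
proof -
  have pw: "(\<epsilon> powr (1 / k)) ^ q = \<epsilon> powr (real q / k)" for q
    using \<epsilon> by (simp add: powr_realpow[symmetric] powr_powr)
  have "(K + 1) ^ 1 \<le> (K + 1) ^ d" using d K by (intro power_increasing) auto
  then have "K / (K + 1) ^ d \<le> 1" using K by (simp add: divide_le_eq)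
  then have "K / (K + 1) ^ d * \<epsilon> powr (- real d / k) \<le> 1 * \<epsilon> powr (- real d / k)"
    by (rule mult_right_mono) simp
  moreover have "K * (1 / h) ^ d = K / (K + 1) ^ d * \<epsilon> powr (- real d / k)"
    unfolding h_def power_divide power_mult_distrib pw by (simp add: powr_minus_divide)
  ultimately show "K * (1 / h) ^ d \<le> \<epsilon> powr (- real d / k)" by simp
  have "\<epsilon> powr (real p / k) \<le> \<epsilon> powr 1" using \<epsilon> k p by (intro powr_mono') (auto simp: le_divide_eq)
  then show "h ^ p \<le> (K + 1) ^ p * \<epsilon>"
    unfolding h_def power_mult_distrib pw using \<epsilon> K by (intro mult_left_mono) auto
qed

context block_domains
begin

lemma block_domain_subset_box:
  assumes "\<And>j x i. j \<in> S \<Longrightarrow> x \<in> \<Omega> j \<Longrightarrow> i < n j \<Longrightarrow> \<bar>x i\<bar> \<le> B"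
  shows "block_domain S n \<Omega> \<subseteq> open_box (block_coords S n) (\<lambda>_. - B - 1) (\<lambda>_. B + 1)"
proof
  fix z assume z: "z \<in> block_domain S n \<Omega>"
  have "\<bar>z (j, i)\<bar> \<le> B" if "j \<in> S" "i < n j" for j i
    using assms[of j "\<lambda>i\<in>{..<n j}. z (j, i)" i] z that by (auto simp: block_domain_def)
  then have "z q \<in> {- B - 1<..<B + 1}" if "q \<in> block_coords S n" for q
    using that by (fastforce simp: block_coords_def abs_le_iff)
  then show "z \<in> open_box (block_coords S n) (\<lambda>_. - B - 1) (\<lambda>_. B + 1)"
    using z by (auto simp: open_box_def block_domain_def PiE_iff)
qed

lemma finite_measure_PiM:
  assumes S: "finite S" and B: "\<And>j x i. j \<in> S \<Longrightarrow> x \<in> \<Omega> j \<Longrightarrow> i < n j \<Longrightarrow> \<bar>x i\<bar> \<le> B"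
  shows "finite_measure (PiM S M)"
proof (rule finite_measureI)
  let ?C = "block_coords S n" and ?U = "block_domain S n \<Omega>"
  have "emeasure (PiM S M) (space (PiM S M)) = (\<integral>\<^sup>+x. 1 \<partial>PiM S M)" by simp
  also have "\<dots> = (\<integral>\<^sup>+z. 1 * indicator ?U z \<partial>leb ?C)" by (rule nn_integral_PiM_blocks[OF S]) simp
  also have "\<dots> = emeasure (leb ?C) ?U" using block_domain_sets[OF S] by simp
  also have "\<dots> \<le> emeasure (leb ?C) (open_box ?C (\<lambda>_. - B - 1) (\<lambda>_. B + 1))"
    by (intro emeasure_mono block_domain_subset_box B open_box_sets finite_block_coords S)
  also have "\<dots> < \<infinity>" by (intro emeasure_open_box_finite finite_block_coords S)
  finally show "emeasure (PiM S M) (space (PiM S M)) \<noteq> \<infinity>" by simp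
qed

lemma bounded_join_L2:
  assumes fin: "finite_measure (PiM S M)" and a: "a \<in> borel_measurable (leb (block_coords S n))" "bounded (range a)"
  shows "(\<lambda>x. a (join_blocks S n x)) \<in> L2 (PiM S M)"
proof -
  obtain B where B: "\<And>x. \<bar>a x\<bar> \<le> B" using a(2) by (auto simp: bounded_iff)
  have m: "(\<lambda>x. a (join_blocks S n x)) \<in> borel_measurable (PiM S M)"
    by (rule measurable_compose[OF join_measurable a(1)])
  have "(a y)\<^sup>2 \<le> B\<^sup>2" for y using B[of y] abs_le_square_iff[of "a y" B] by (meson abs_ge_self order.trans)
  then have "integrable (PiM S M) (\<lambda>x. (a (join_blocks S n x))\<^sup>2)"
    using m by (intro finite_measure.integrable_const_bound[OF fin, of _ "B\<^sup>2"]) auto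
  then show ?thesis using m by (simp add: L2_def)
qed

lemma low_rank_join:
  assumes sub: "S1 \<subseteq> S" "S2 \<subseteq> S" and fin: "finite_measure (PiM S1 M)" "finite_measure (PiM S2 M)"
    and G: "low_rank (leb (block_coords S1 n)) (leb (block_coords S2 n)) N G" and N: "N \<le> r"
  shows "\<exists>a b. (\<forall>l<r. a l \<in> L2 (PiM S1 M) \<and> b l \<in> L2 (PiM S2 M)) \<and>
    (\<forall>z. (\<Sum>l<r. a l (restrict (split_blocks S n z) S1) * b l (restrict (split_blocks S n z) S2))
       = G (restrict z (block_coords S1 n)) (restrict z (block_coords S2 n)))"
proof -
  from G[unfolded low_rank_def] obtain a b where ab: "(\<forall>k<N. a k \<in> borel_measurable (leb (block_coords S1 n)) \<and> bounded (range (a k)) \<and>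
            b k \<in> borel_measurable (leb (block_coords S2 n)) \<and> bounded (range (b k))) \<and>
     G = (\<lambda>x y. \<Sum>k<N. a k x * b k y)" by (elim exE) (rule that)
  define a' where "a' l x = (if l < N then a l (join_blocks S1 n x) else 0)" for l x
  define b' where "b' l x = (if l < N then b l (join_blocks S2 n x) else 0)" for l x
  have "a' l \<in> L2 (PiM S1 M)" "b' l \<in> L2 (PiM S2 M)" for l
    using ab bounded_join_L2[OF fin(1), of "a l"] bounded_join_L2[OF fin(2), of "b l"]
    by (cases "l < N"; simp add: a'_def [abs_def] b'_def [abs_def] L2_zero)+
  moreover have "(\<Sum>l<r. a' l (restrict (split_blocks S n z) S1) * b' l (restrict (split_blocks S n z) S2))
       = G (restrict z (block_coords S1 n)) (restrict z (block_coords S2 n))" for z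
  proof -
    have "(\<Sum>l<r. a' l (restrict (split_blocks S n z) S1) * b' l (restrict (split_blocks S n z) S2))
        = (\<Sum>l<N. a' l (restrict (split_blocks S n z) S1) * b' l (restrict (split_blocks S n z) S2))"
      using N by (intro sum.mono_neutral_right) (auto simp: a'_def)
    also have "\<dots> = (\<Sum>l<N. a l (restrict z (block_coords S1 n)) * b l (restrict z (block_coords S2 n)))"
      by (intro sum.cong refl) (simp add: a'_def b'_def join_blocks_restrict sub)
    finally show ?thesis using ab by simp
  qed
  ultimately show ?thesis by (intro exI[of _ a'] exI[of _ b']) blast
qed

lemma block_domain_Un:
  "block_domain (S1 \<union> S2) n \<Omega> = {z \<in> PiE (block_coords S1 n \<union> block_coords S2 n) (\<lambda>_. UNIV).
     restrict z (block_coords S1 n) \<in> block_domain S1 n \<Omega> \<and> restrict z (block_coords S2 n) \<in> block_domain S2 n \<Omega>}"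
proof -
  have C: "block_coords S1 n \<union> block_coords S2 n = block_coords (S1 \<union> S2) n" by (auto simp: block_coords_def)
  have eq: "(\<lambda>i\<in>{..<n j}. restrict z (block_coords T n) (j, i)) = (\<lambda>i\<in>{..<n j}. z (j, i))"
    if "j \<in> T" for T j and z :: "nat \<times> nat \<Rightarrow> real"
    using that by (auto simp: block_coords_def fun_eq_iff)
  have "(\<forall>j\<in>T. (\<lambda>i\<in>{..<n j}. restrict z (block_coords T n) (j, i)) \<in> \<Omega> j)
      \<longleftrightarrow> (\<forall>j\<in>T. (\<lambda>i\<in>{..<n j}. z (j, i)) \<in> \<Omega> j)" for T and z :: "nat \<times> nat \<Rightarrow> real"
    by (rule ball_cong[OF refl]) (simp only: eq)
  moreover have "restrict z (block_coords T n) \<in> PiE (block_coords T n) (\<lambda>_. UNIV)" for T and z :: "nat \<times> nat \<Rightarrow> real"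
    by simp
  ultimately have mem: "restrict z (block_coords T n) \<in> block_domain T n \<Omega>
      \<longleftrightarrow> (\<forall>j\<in>T. (\<lambda>i\<in>{..<n j}. z (j, i)) \<in> \<Omega> j)" for T z
    by (simp only: block_domain_def mem_Collect_eq simp_thms)
  show ?thesis unfolding C mem by (simp only: block_domain_def ball_Un)
qed

text \<open>
  For small \<open>\<epsilon>\<close> this is \<open>global_low_rank\<close> with mesh size \<open>h\<close> proportional to \<open>\<epsilon>\<^bsup>1/k\<^esup>\<close>. The other \<open>\<epsilon>\<close>
  are bounded away from \<open>0\<close>, and the zero function is good enough.
\<close>

lemma separable_approximation:
  fixes S1 S2 :: "nat set" and k s :: real
  defines "S \<equiv> S1 \<union> S2"
  assumes fin: "finite S1" "finite S2" and disj: "S1 \<inter> S2 = {}" and d: "1 \<le> (\<Sum>j\<in>S1. n j)"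
    and cone: "\<And>j. j \<in> S \<Longrightarrow> uniform_cone {..<n j} (\<Omega> j)"
    and B: "\<And>j x i. j \<in> S \<Longrightarrow> x \<in> \<Omega> j \<Longrightarrow> i < n j \<Longrightarrow> \<bar>x i\<bar> \<le> B" "0 \<le> B"
    and k: "0 < k" and s: "nat \<lceil>k\<rceil> \<le> nat \<lfloor>s\<rfloor>"
    and f: "(\<lambda>z. f (split_blocks S n z)) \<in> sobolev (block_coords S n) s (block_domain S n \<Omega>)"
  shows "\<exists>C\<ge>0. \<forall>\<epsilon>. 0 < \<epsilon> \<and> \<epsilon> < 1 \<longrightarrow> (\<forall>r. \<epsilon> powr (- real (\<Sum>j\<in>S1. n j) / k) \<le> real r \<longrightarrow>
    (\<exists>a b. (\<forall>l<r. a l \<in> L2 (PiM S1 M) \<and> b l \<in> L2 (PiM S2 M)) \<and>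
       L2_norm (PiM S M) (\<lambda>x. f x - (\<Sum>l<r. a l (restrict x S1) * b l (restrict x S2))) \<le> C * \<epsilon>))"
proof -
  let ?C1 = "block_coords S1 n" and ?C2 = "block_coords S2 n" and ?U = "block_domain S n \<Omega>"
  let ?p = "nat \<lceil>k\<rceil>" and ?d = "\<Sum>j\<in>S1. n j"
  have finS: "finite S" using fin by (simp add: S_def)
  have C: "block_coords S n = ?C1 \<union> ?C2" by (auto simp: S_def block_coords_def)
  have sub: "S1 \<subseteq> S" "S2 \<subseteq> S" by (auto simp: S_def)
  have box: "?U \<subseteq> open_box (?C1 \<union> ?C2) (\<lambda>_. - B - 1) (\<lambda>_. B + 1)"
    unfolding C[symmetric] by (rule block_domain_subset_box) (rule B(1))
  have fm: "finite_measure (PiM S1 M)" "finite_measure (PiM S2 M)"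
    by (rule finite_measure_PiM[OF fin(1), of B], rule B(1), use sub in auto)
       (rule finite_measure_PiM[OF fin(2), of B], rule B(1), use sub in auto)
  obtain W where W: "weak_derivs (?C1 \<union> ?C2) ?U ?p W" "\<And>z. W [] z = indicator ?U z * f (split_blocks S n z)"
    using sobolev_weak_derivs[OF finite_block_coords[OF finS] block_domain_sets[OF finS] box[folded C] f s]
    unfolding C by blast
  have p: "0 < ?p" "k \<le> real ?p" using k by (auto simp: of_nat_nat)
  have "\<exists>C K h0. 0 \<le> C \<and> 0 \<le> K \<and> 0 < h0 \<and> (\<forall>h. 0 < h \<and> h \<le> h0 \<longrightarrow> (\<exists>N G.
    real N \<le> K * (1 / h) ^ card ?C1 \<and> low_rank (leb ?C1) (leb ?C2) N G \<and>
    (\<integral>\<^sup>+z. ennreal ((W [] z - G (restrict z ?C1) (restrict z ?C2))\<^sup>2) * indicator ?U z \<partial>leb (?C1 \<union> ?C2))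
      \<le> ennreal (C * h ^ (2 * ?p))))"
  proof (rule global_low_rank)
    show "finite ?C1" "finite ?C2" by (rule finite_block_coords[OF fin(1)], rule finite_block_coords[OF fin(2)])
    show "?C1 \<inter> ?C2 = {}" using disj by (auto simp: block_coords_def)
    show "weak_derivs (?C1 \<union> ?C2) ?U ?p W" "0 < ?p" by fact+
    show "?U = {z \<in> PiE (?C1 \<union> ?C2) (\<lambda>_. UNIV). restrict z ?C1 \<in> block_domain S1 n \<Omega> \<and> restrict z ?C2 \<in> block_domain S2 n \<Omega>}"
      unfolding S_def by (rule block_domain_Un)
    show "uniform_cone ?C1 (block_domain S1 n \<Omega>)"
      unfolding block_coords_def block_domain_def by (rule uniform_cone_product[OF fin(1) cone]) (use sub in auto)
    show "uniform_cone ?C2 (block_domain S2 n \<Omega>)"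
      unfolding block_coords_def block_domain_def by (rule uniform_cone_product[OF fin(2) cone]) (use sub in auto)
    show "\<bar>z q\<bar> \<le> B" if z: "z \<in> block_domain S1 n \<Omega>" and q: "q \<in> ?C1" for z q
    proof -
      obtain j i where "q = (j, i)" "j \<in> S1" "i < n j" using q by (auto simp: block_coords_def)
      then show ?thesis using B(1)[of j "\<lambda>i\<in>{..<n j}. z (j, i)" i] z sub by (auto simp: block_domain_def)
    qed
    show "0 \<le> B" by fact
    show "W [] z = 0" if "z \<notin> open_box (?C1 \<union> ?C2) (\<lambda>_. - B - 1) (\<lambda>_. B + 1)" for z
      using that box W(2)[of z] by (auto split: split_indicator)
  qed
  then obtain A K h0 where AKh: "0 \<le> A \<and> 0 \<le> K \<and> 0 < h0 \<and> (\<forall>h. 0 < h \<and> h \<le> h0 \<longrightarrow> (\<exists>N G.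
    real N \<le> K * (1 / h) ^ card ?C1 \<and> low_rank (leb ?C1) (leb ?C2) N G \<and>
    (\<integral>\<^sup>+z. ennreal ((W [] z - G (restrict z ?C1) (restrict z ?C2))\<^sup>2) * indicator ?U z \<partial>leb (?C1 \<union> ?C2))
      \<le> ennreal (A * h ^ (2 * ?p))))"
    by (elim exE) (rule that)
  then have A: "0 \<le> A" and K: "0 \<le> K" and h0: "0 < h0" by auto
  have card: "card ?C1 = ?d" by (rule card_block_coords[OF fin(1)])
  have fm_S: "f \<in> borel_measurable (PiM S M)"
    using f by (intro measurable_of_split L2_measurable) (simp add: sobolev_def)
  \<comment> \<open>This is the \<open>\<epsilon>\<close> for which the mesh size is \<open>h0\<close>.\<close>
  define \<epsilon>0 where "\<epsilon>0 = (h0 / (K + 1)) powr k"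
  have \<epsilon>0: "0 < \<epsilon>0" using h0 K by (simp add: \<epsilon>0_def)
  define C' where "C' = sqrt A * (K + 1) ^ ?p + L2_norm (PiM S M) f / \<epsilon>0"
  have parts: "0 \<le> sqrt A * (K + 1) ^ ?p" "0 \<le> L2_norm (PiM S M) f / \<epsilon>0"
    using A K \<epsilon>0 L2_norm_nonneg[of "PiM S M" f] by auto
  show ?thesis
  proof (intro exI[of _ C'] conjI allI impI)
    show "0 \<le> C'" using parts by (simp add: C'_def)
    fix \<epsilon> r assume \<epsilon>: "0 < \<epsilon> \<and> \<epsilon> < 1" and r: "\<epsilon> powr (- real ?d / k) \<le> real r"
    define h where "h = (K + 1) * \<epsilon> powr (1 / k)"
    have h: "0 < h" using K \<epsilon> by (simp add: h_def)
    have mesh: "K * (1 / h) ^ ?d \<le> \<epsilon> powr (- real ?d / k)" "h ^ ?p \<le> (K + 1) ^ ?p * \<epsilon>"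
      unfolding h_def using mesh_size_bounds[of \<epsilon> k K ?d ?p] \<epsilon> k K d p by auto
    show "\<exists>a b. (\<forall>l<r. a l \<in> L2 (PiM S1 M) \<and> b l \<in> L2 (PiM S2 M)) \<and>
       L2_norm (PiM S M) (\<lambda>x. f x - (\<Sum>l<r. a l (restrict x S1) * b l (restrict x S2))) \<le> C' * \<epsilon>"
    proof (cases "h \<le> h0")
      case False
      have "\<epsilon>0 \<le> (\<epsilon> powr (1 / k)) powr k"
        unfolding \<epsilon>0_def using False h0 K k by (intro powr_mono2) (auto simp: h_def divide_le_eq mult.commute)
      then have "\<epsilon>0 \<le> \<epsilon>" using \<epsilon> k by (simp add: powr_powr)
      then have "L2_norm (PiM S M) f / \<epsilon>0 * \<epsilon>0 \<le> L2_norm (PiM S M) f / \<epsilon>0 * \<epsilon>"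
        by (rule mult_left_mono[OF _ parts(2)])
      also have "\<dots> \<le> C' * \<epsilon>" unfolding C'_def using parts(1) \<epsilon> by (intro mult_right_mono) auto
      finally have "L2_norm (PiM S M) f \<le> C' * \<epsilon>" using \<epsilon>0 by simp
      then show ?thesis by (intro exI[of _ "\<lambda>_ _. 0"]) (simp add: L2_zero)
    next
      case True
      with AKh h have "\<exists>N G. real N \<le> K * (1 / h) ^ card ?C1 \<and> low_rank (leb ?C1) (leb ?C2) N G \<and>
        (\<integral>\<^sup>+z. ennreal ((W [] z - G (restrict z ?C1) (restrict z ?C2))\<^sup>2) * indicator ?U z \<partial>leb (?C1 \<union> ?C2))
          \<le> ennreal (A * h ^ (2 * ?p))" by simp
      then obtain N G where NG: "real N \<le> K * (1 / h) ^ card ?C1 \<and> low_rank (leb ?C1) (leb ?C2) N G \<and>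
        (\<integral>\<^sup>+z. ennreal ((W [] z - G (restrict z ?C1) (restrict z ?C2))\<^sup>2) * indicator ?U z \<partial>leb (?C1 \<union> ?C2))
          \<le> ennreal (A * h ^ (2 * ?p))" by (elim exE) (rule that)
      have "real N \<le> real r" using NG mesh(1) r unfolding card by linarith
      then have N: "N \<le> r" by simp
      from low_rank_join[OF sub fm conjunct1[OF conjunct2[OF NG]] N] obtain a b
        where ab: "\<forall>l<r. a l \<in> L2 (PiM S1 M) \<and> b l \<in> L2 (PiM S2 M)"
        and G: "\<And>z. (\<Sum>l<r. a l (restrict (split_blocks S n z) S1) * b l (restrict (split_blocks S n z) S2))
          = G (restrict z ?C1) (restrict z ?C2)" by blast
      let ?E = "\<lambda>x. f x - (\<Sum>l<r. a l (restrict x S1) * b l (restrict x S2))"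
      have r1: "(\<lambda>x. restrict x S1) \<in> PiM S M \<rightarrow>\<^sub>M PiM S1 M" and r2: "(\<lambda>x. restrict x S2) \<in> PiM S M \<rightarrow>\<^sub>M PiM S2 M"
        using sub by (auto intro: measurable_restrict_subset)
      have E: "?E \<in> borel_measurable (PiM S M)"
      proof (intro borel_measurable_diff fm_S borel_measurable_sum borel_measurable_times)
        fix l assume "l \<in> {..<r}"
        then have "a l \<in> borel_measurable (PiM S1 M)" "b l \<in> borel_measurable (PiM S2 M)"
          using ab by (auto intro: L2_measurable)
        then show "(\<lambda>x. a l (restrict x S1)) \<in> borel_measurable (PiM S M)" "(\<lambda>x. b l (restrict x S2)) \<in> borel_measurable (PiM S M)"
          using measurable_compose[OF r1, of "a l"] measurable_compose[OF r2, of "b l"] by auto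
      qed
      have E2: "(\<lambda>x. ennreal ((?E x)\<^sup>2)) \<in> borel_measurable (PiM S M)" using E by measurable
      have "(\<integral>\<^sup>+x. ennreal ((?E x)\<^sup>2) \<partial>PiM S M) = (\<integral>\<^sup>+z. ennreal ((?E (split_blocks S n z))\<^sup>2) * indicator ?U z \<partial>leb (block_coords S n))"
        by (rule nn_integral_PiM_blocks[OF finS E2])
      also have "\<dots> = (\<integral>\<^sup>+z. ennreal ((W [] z - G (restrict z ?C1) (restrict z ?C2))\<^sup>2) * indicator ?U z \<partial>leb (?C1 \<union> ?C2))"
        unfolding C G by (rule nn_integral_cong) (simp add: W(2) split: split_indicator)
      also have "\<dots> \<le> ennreal (A * h ^ (2 * ?p))" using NG by simp
      finally have "L2_norm (PiM S M) ?E \<le> sqrt (A * h ^ (2 * ?p))"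
        using A h by (intro L2_norm_le[OF E]) auto
      also have "\<dots> = sqrt A * h ^ ?p"
        using h by (simp add: real_sqrt_mult power_mult power2_eq_square mult.commute[of 2] power_mult_distrib real_sqrt_power[symmetric])
      also have "\<dots> \<le> sqrt A * ((K + 1) ^ ?p * \<epsilon>)" using A by (intro mult_left_mono mesh) auto
      also have "\<dots> = (sqrt A * (K + 1) ^ ?p) * \<epsilon>" by simp
      also have "\<dots> \<le> C' * \<epsilon>" unfolding C'_def using parts(2) \<epsilon> by (intro mult_right_mono) auto
      finally have le: "L2_norm (PiM S M) ?E \<le> C' * \<epsilon>" .
      show ?thesis by (rule exI[of _ a], rule exI[of _ b], rule conjI[OF ab le])
    qed
  qed
qed

end

section \<open>The error of the tensor train decomposition\<close>

lemma is_svd_cong: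
  assumes "\<And>i. i \<in> {1..m} \<Longrightarrow> M i = M' i" and "j \<in> {1..m-1}"
  shows "is_svd M m j R g lam \<phi> \<psi> = is_svd M' m j R g lam \<phi> \<psi>"
proof -
  have "M j = M' j" using assms by auto
  moreover have "PiM {Suc j..m} M = PiM {Suc j..m} M'" "PiM {j..m} M = PiM {j..m} M'"
    by (rule PiM_cong; use assms in auto)+
  ultimately show ?thesis by (simp only: is_svd_def)
qed

lemma tt_svd_cong:
  assumes "\<And>i. i \<in> {1..m} \<Longrightarrow> M i = M' i"
  shows "tt_svd M m r f g lam \<phi> \<psi> = tt_svd M' m r f g lam \<phi> \<psi>"
  unfolding tt_svd_def by (intro conj_cong ball_cong refl is_svd_cong assms)

lemma flat_product_cong:
  "(\<And>i. i \<in> {1..m} \<Longrightarrow> \<Omega> i = \<Omega>' i) \<Longrightarrow> flat_product m n \<Omega> = flat_product m n \<Omega>'"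
proof -
  assume "\<And>i. i \<in> {1..m} \<Longrightarrow> \<Omega> i = \<Omega>' i"
  then have "PiE {1..m} \<Omega> = PiE {1..m} \<Omega>'" by (rule PiE_cong)
  then show ?thesis by (simp only: flat_product_def)
qed

text \<open>
  Sobolev smoothness \<open>k + N\<close> provides weak derivatives up to the order \<open>\<lfloor>k + N\<rfloor>\<close>, whereas the Taylor
  polynomials require the order \<open>\<lceil>k\<rceil>\<close>.
\<close>

lemma nat_ceiling_le_floor_add:
  assumes "0 < (k::real)" "1 \<le> (N::nat)" shows "nat \<lceil>k\<rceil> \<le> nat \<lfloor>k + real N\<rfloor>"
proof -
  have "\<lceil>k\<rceil> \<le> \<lfloor>k\<rfloor> + 1" by linarith
  also have "\<dots> \<le> \<lfloor>k + real N\<rfloor>" using assms(2) by linarith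
  finally show ?thesis by (rule nat_mono)
qed

lemma tt_error_bound:
  fixes m :: nat and n :: "nat \<Rightarrow> nat" and \<Omega> :: "nat \<Rightarrow> (nat \<Rightarrow> real) set" and k :: real
  assumes m: "2 \<le> m" and n: "\<And>j. j \<in> {1..m} \<Longrightarrow> n j \<ge> 1"
    and \<Omega>: "\<And>j. j \<in> {1..m} \<Longrightarrow> bounded_lipschitz_domain {..<n j} (\<Omega> j)"
    and k: "k > 0" and f: "f \<in> sobolev_product m n \<Omega> (k + real (Max (n ` {1..m})))"
    and M: "\<And>j. j \<in> {1..m} \<Longrightarrow> M j = dom_measure {..<n j} (\<Omega> j)"
  shows "\<exists>C\<ge>0. \<forall>\<epsilon>. 0 < \<epsilon> \<and> \<epsilon> < 1 \<longrightarrow> (\<forall>g lam \<phi> \<psi>. tt_svd M m (tt_rank n k \<epsilon>) f g lam \<phi> \<psi> \<longrightarrow>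
    L2_norm (PiM {1..m} M) (\<lambda>x. f x - tt_approx m (tt_rank n k \<epsilon>) lam \<phi> \<psi> x) \<le> C * \<epsilon>)"
proof -
  \<comment> \<open>The theory of product measures asks for \<open>\<sigma>\<close>-finite measures at all indices; the empty domain provides them outside \<open>{1..m}\<close>.\<close>
  define \<Omega>' where "\<Omega>' j = (if j \<in> {1..m} then \<Omega> j else {})" for j
  define M' where "M' j = dom_measure {..<n j} (\<Omega>' j)" for j
  have \<Omega>'_eq: "\<Omega>' j = \<Omega> j" if "j \<in> {1..m}" for j using that by (simp add: \<Omega>'_def)
  have MM': "M j = M' j" if "j \<in> {1..m}" for j using that by (simp add: M'_def \<Omega>'_eq M)
  have cone: "uniform_cone {..<n j} (\<Omega>' j)" if "j \<in> {1..m}" for j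
    unfolding \<Omega>'_eq[OF that] by (rule bounded_lipschitz_domain_uniform_cone[OF _ \<Omega>[OF that]]) simp
  have "\<Omega>' j \<in> sets (leb {..<n j})" for j
  proof (cases "j \<in> {1..m}")
    case True
    then show ?thesis by (rule uniform_cone_sets[OF cone])
  next
    case False
    then have "\<Omega>' j = {}" unfolding \<Omega>'_def by (rule if_not_P)
    then show ?thesis by simp
  qed
  then interpret D: block_domains n \<Omega>' M' by unfold_locales (simp_all add: M'_def)
  have "\<forall>j\<in>{1..m}. \<exists>B\<ge>0. \<forall>x\<in>\<Omega> j. \<forall>i<n j. \<bar>x i\<bar> \<le> B"
  proof
    fix j assume j: "j \<in> {1..m}"
    obtain B where "B \<ge> 0" "\<And>x i. x \<in> \<Omega> j \<Longrightarrow> i \<in> {..<n j} \<Longrightarrow> \<bar>x i\<bar> \<le> B"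
      by (rule bounded_lipschitz_domain_bounded[OF _ \<Omega>[OF j]]) auto
    then show "\<exists>B\<ge>0. \<forall>x\<in>\<Omega> j. \<forall>i<n j. \<bar>x i\<bar> \<le> B" by auto
  qed
  from bchoice[OF this] obtain b where b: "\<forall>j\<in>{1..m}. 0 \<le> b j \<and> (\<forall>x\<in>\<Omega> j. \<forall>i<n j. \<bar>x i\<bar> \<le> b j)" ..
  define B where "B = (\<Sum>j=1..m. b j)"
  have B0: "0 \<le> B" unfolding B_def using b by (intro sum_nonneg) auto
  have B: "\<bar>x i\<bar> \<le> B" if "j \<in> {1..m}" "x \<in> \<Omega>' j" "i < n j" for j x i
  proof -
    have "\<bar>x i\<bar> \<le> b j" using b that by (auto simp: \<Omega>'_eq)
    also have "\<dots> \<le> B" unfolding B_def using b that(1) by (intro member_le_sum) auto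
    finally show ?thesis .
  qed
  let ?s = "k + real (Max (n ` {1..m}))"
  have "1 \<le> n 1" using n[of 1] m by simp
  also have "n 1 \<le> Max (n ` {1..m})" using m by (intro Max_ge) auto
  finally have "1 \<le> Max (n ` {1..m})" .
  from nat_ceiling_le_floor_add[OF k this] have s: "nat \<lceil>k\<rceil> \<le> nat \<lfloor>?s\<rfloor>" .
  have f': "(\<lambda>z. f (split_blocks {1..m} n z)) \<in> sobolev (block_coords {1..m} n) ?s (block_domain {1..m} n \<Omega>')"
    using f flat_product_cong[of m \<Omega> \<Omega>' n] \<Omega>'_eq
    by (simp add: sobolev_product_def blocks_eq coords_eq flat_product_eq)
  have "\<forall>j\<in>{1..m-1}. \<exists>C. C \<ge> 0 \<and> (\<forall>\<epsilon>. 0 < \<epsilon> \<and> \<epsilon> < 1 \<longrightarrow> (\<forall>r. \<epsilon> powr (- real (\<Sum>i\<in>{1..j}. n i) / k) \<le> real r \<longrightarrow>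
    (\<exists>a b. (\<forall>l<r. a l \<in> L2 (PiM {1..j} M') \<and> b l \<in> L2 (PiM {Suc j..m} M')) \<and>
       L2_norm (PiM {1..m} M') (\<lambda>x. f x - (\<Sum>l<r. a l (restrict x {1..j}) * b l (restrict x {Suc j..m}))) \<le> C * \<epsilon>)))"
  proof
    fix j assume j: "j \<in> {1..m-1}"
    then have S: "{1..j} \<union> {Suc j..m} = {1..m}" by auto
    have "1 \<le> n 1" using n[of 1] m by simp
    also have "n 1 \<le> (\<Sum>i\<in>{1..j}. n i)" using j by (intro member_le_sum) auto
    finally have d: "1 \<le> (\<Sum>i\<in>{1..j}. n i)" .
    show "\<exists>C. C \<ge> 0 \<and> (\<forall>\<epsilon>. 0 < \<epsilon> \<and> \<epsilon> < 1 \<longrightarrow> (\<forall>r. \<epsilon> powr (- real (\<Sum>i\<in>{1..j}. n i) / k) \<le> real r \<longrightarrow>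
    (\<exists>a b. (\<forall>l<r. a l \<in> L2 (PiM {1..j} M') \<and> b l \<in> L2 (PiM {Suc j..m} M')) \<and>
       L2_norm (PiM {1..m} M') (\<lambda>x. f x - (\<Sum>l<r. a l (restrict x {1..j}) * b l (restrict x {Suc j..m}))) \<le> C * \<epsilon>)))"
      by (rule D.separable_approximation[of "{1..j}" "{Suc j..m}" B k ?s f, unfolded S])
         (use d cone B B0 k s f' in auto)
  qed
  from bchoice[OF this] obtain c where c: "\<forall>j\<in>{1..m-1}. c j \<ge> 0 \<and> (\<forall>\<epsilon>. 0 < \<epsilon> \<and> \<epsilon> < 1 \<longrightarrow> (\<forall>r. \<epsilon> powr (- real (\<Sum>i\<in>{1..j}. n i) / k) \<le> real r \<longrightarrow>
    (\<exists>a b. (\<forall>l<r. a l \<in> L2 (PiM {1..j} M') \<and> b l \<in> L2 (PiM {Suc j..m} M')) \<and>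
       L2_norm (PiM {1..m} M') (\<lambda>x. f x - (\<Sum>l<r. a l (restrict x {1..j}) * b l (restrict x {Suc j..m}))) \<le> c j * \<epsilon>)))" ..
  define C where "C = (\<Sum>j=1..m-1. c j)"
  have C0: "0 \<le> C" unfolding C_def by (rule sum_nonneg) (use c in blast)
  have cC: "c j \<le> C" if "j \<in> {1..m-1}" for j
    unfolding C_def using that bspec[OF c, THEN conjunct1] by (intro member_le_sum) auto
  have PM: "PiM {1..m} M = PiM {1..m} M'" by (rule PiM_cong) (simp_all add: MM')
  show ?thesis
  proof (intro exI[of _ "2 ^ m * C"] conjI allI impI)
    show "0 \<le> 2 ^ m * C" using C0 by simp
    fix \<epsilon> g lam \<phi> \<psi>
    assume \<epsilon>: "0 < \<epsilon> \<and> \<epsilon> < (1::real)" and "tt_svd M m (tt_rank n k \<epsilon>) f g lam \<phi> \<psi>"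
    then have run: "tt_svd M' m (tt_rank n k \<epsilon>) f g lam \<phi> \<psi>" using tt_svd_cong[of m M M'] MM' by simp
    have "f \<in> L2 (PiM {1..m} M')"
    proof -
      let ?D = "dom_measure (block_coords {1..m} n) (block_domain {1..m} n \<Omega>')"
      have u: "(\<lambda>z. f (split_blocks {1..m} n z)) \<in> L2 ?D" using f' by (simp add: sobolev_def)
      have fm: "f \<in> borel_measurable (PiM {1..m} M')" by (rule D.measurable_of_split[OF L2_measurable[OF u]])
      then have f2: "(\<lambda>x. (f x)\<^sup>2) \<in> borel_measurable (PiM {1..m} M')" by measurable
      have "integrable (PiM {1..m} M') (\<lambda>x. (f x)\<^sup>2) \<longleftrightarrow> integrable ?D (\<lambda>z. (f (split_blocks {1..m} n z))\<^sup>2)"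
        using integrable_distr_eq[OF D.split_measurable f2] D.distr_dom_split_blocks[of "{1..m}"] by simp
      then show ?thesis using fm L2_integrable_square[OF u] by (simp add: L2_def)
    qed
    then interpret T: tt_run M' m "tt_rank n k \<epsilon>" f g lam \<phi> \<psi>
      using m run by unfold_locales auto
    have "L2_norm (PiM {1..m} M') (\<lambda>x. f x - tt_approx m (tt_rank n k \<epsilon>) lam \<phi> \<psi> x) \<le> 2 ^ m * (C * \<epsilon>)"
    proof (rule T.tt_quasi_optimal)
      show "0 \<le> C * \<epsilon>" using C0 \<epsilon> by simp
      fix j assume j: "j \<in> {1..m-1}"
      have "\<epsilon> powr (- real (\<Sum>i\<in>{1..j}. n i) / k) \<le> real (tt_rank n k \<epsilon> j)"
        using tt_rank_bounds(1)[of \<epsilon> k n j] \<epsilon> k by simp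
      from bspec[OF c j, THEN conjunct2, rule_format, OF \<epsilon> this] obtain a b
        where ab: "\<forall>l<tt_rank n k \<epsilon> j. a l \<in> L2 (PiM {1..j} M') \<and> b l \<in> L2 (PiM {Suc j..m} M')"
        and le: "L2_norm (PiM {1..m} M') (\<lambda>x. f x - (\<Sum>l<tt_rank n k \<epsilon> j. a l (restrict x {1..j}) * b l (restrict x {Suc j..m}))) \<le> c j * \<epsilon>"
        by (elim exE conjE) (rule that)
      note le
      also have "c j * \<epsilon> \<le> C * \<epsilon>" using cC[OF j] \<epsilon> by (intro mult_right_mono) auto
      finally show "\<exists>a b. (\<forall>l<tt_rank n k \<epsilon> j. a l \<in> L2 (PiM {1..j} M') \<and> b l \<in> L2 (PiM {Suc j..m} M')) \<and>
        L2_norm (PiM {1..m} M') (\<lambda>x. f x - (\<Sum>l<tt_rank n k \<epsilon> j. a l (restrict x {1..j}) * b l (restrict x {Suc j..m}))) \<le> C * \<epsilon>"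
        by (intro exI[of _ a] exI[of _ b] conjI ab)
    qed
    then show "L2_norm (PiM {1..m} M) (\<lambda>x. f x - tt_approx m (tt_rank n k \<epsilon>) lam \<phi> \<psi> x) \<le> 2 ^ m * C * \<epsilon>"
      unfolding PM by (simp only: mult.assoc)
  qed
qed

theorem theorem4p1:
  fixes m :: nat and n :: "nat \<Rightarrow> nat" and \<Omega> :: "nat \<Rightarrow> (nat \<Rightarrow> real) set"
    and k :: real and f :: "(nat \<Rightarrow> nat \<Rightarrow> real) \<Rightarrow> real" and M :: "nat \<Rightarrow> (nat \<Rightarrow> real) measure"
  defines "M \<equiv> \<lambda>j. dom_measure {..<n j} (\<Omega> j)"
  assumes "m \<ge> 3"
    and "\<And>j. j \<in> {1..m} \<Longrightarrow> n j \<ge> 1"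
    and "\<And>j. j \<in> {1..m} \<Longrightarrow> bounded_lipschitz_domain {..<n j} (\<Omega> j)"
    and "k > 0"
    and "f \<in> sobolev_product m n \<Omega> (k + real (Max (n ` {1..m})))"
  shows
    "(\<exists>C>0. \<forall>\<epsilon>. 0 < \<epsilon> \<and> \<epsilon> < 1 \<longrightarrow>
        (\<forall>g lam \<phi> \<psi>. tt_svd M m (tt_rank n k \<epsilon>) f g lam \<phi> \<psi> \<longrightarrow>
           L2_norm (PiM {1..m} M) (\<lambda>x. f x - tt_approx m (tt_rank n k \<epsilon>) lam \<phi> \<psi> x)
             \<le> C * sqrt (real m) * \<epsilon>)) \<and>
     (\<exists>c>0. \<exists>C>0. \<forall>\<epsilon>. 0 < \<epsilon> \<and> \<epsilon> < 1 \<longrightarrow>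
        (let S = (\<Sum>j=1..m-1. \<epsilon> powr (- real (2 * (\<Sum>i=1..j-1. n i) + n j) / k))
         in c * S \<le> real (tt_storage m (tt_rank n k \<epsilon>)) \<and>
            real (tt_storage m (tt_rank n k \<epsilon>)) \<le> C * S)) \<and>
     (\<exists>C>0. \<forall>\<epsilon>. 0 < \<epsilon> \<and> \<epsilon> < 1 \<longrightarrow>
        real (tt_storage m (tt_rank n k \<epsilon>))
          \<le> C * \<epsilon> powr (- ((2 * real m - 1) * real (Max (n ` {1..m-1}))) / k))"
proof (intro conjI)
  have m: "m \<ge> 2" using assms(2) by simp
  have "\<exists>C\<ge>0. \<forall>\<epsilon>. 0 < \<epsilon> \<and> \<epsilon> < 1 \<longrightarrow> (\<forall>g lam \<phi> \<psi>. tt_svd M m (tt_rank n k \<epsilon>) f g lam \<phi> \<psi> \<longrightarrow>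
      L2_norm (PiM {1..m} M) (\<lambda>x. f x - tt_approx m (tt_rank n k \<epsilon>) lam \<phi> \<psi> x) \<le> C * \<epsilon>)"
    by (rule tt_error_bound[of m n \<Omega> k f M]) (use m assms in auto)
  then obtain C where C: "C \<ge> 0 \<and> (\<forall>\<epsilon>. 0 < \<epsilon> \<and> \<epsilon> < 1 \<longrightarrow> (\<forall>g lam \<phi> \<psi>. tt_svd M m (tt_rank n k \<epsilon>) f g lam \<phi> \<psi> \<longrightarrow>
      L2_norm (PiM {1..m} M) (\<lambda>x. f x - tt_approx m (tt_rank n k \<epsilon>) lam \<phi> \<psi> x) \<le> C * \<epsilon>))" ..
  show "\<exists>C>0. \<forall>\<epsilon>. 0 < \<epsilon> \<and> \<epsilon> < 1 \<longrightarrow>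
        (\<forall>g lam \<phi> \<psi>. tt_svd M m (tt_rank n k \<epsilon>) f g lam \<phi> \<psi> \<longrightarrow>
           L2_norm (PiM {1..m} M) (\<lambda>x. f x - tt_approx m (tt_rank n k \<epsilon>) lam \<phi> \<psi> x)
             \<le> C * sqrt (real m) * \<epsilon>)"
  proof (intro exI[of _ "C + 1"] conjI allI impI)
    show "0 < C + 1" using C by simp
    fix \<epsilon> g lam \<phi> \<psi>
    assume \<epsilon>: "0 < \<epsilon> \<and> \<epsilon> < (1::real)" and run: "tt_svd M m (tt_rank n k \<epsilon>) f g lam \<phi> \<psi>"
    have "L2_norm (PiM {1..m} M) (\<lambda>x. f x - tt_approx m (tt_rank n k \<epsilon>) lam \<phi> \<psi> x) \<le> C * \<epsilon>"
      by (rule C[THEN conjunct2, rule_format, OF \<epsilon> run])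
    also have "\<dots> \<le> (C + 1) * sqrt (real m) * \<epsilon>"
    proof (rule mult_right_mono)
      have "C * 1 \<le> (C + 1) * sqrt (real m)" using C m by (intro mult_mono) auto
      then show "C \<le> (C + 1) * sqrt (real m)" by simp
    qed (use \<epsilon> in simp)
    finally show "L2_norm (PiM {1..m} M) (\<lambda>x. f x - tt_approx m (tt_rank n k \<epsilon>) lam \<phi> \<psi> x)
        \<le> (C + 1) * sqrt (real m) * \<epsilon>" .
  qed
  show "\<exists>c>0. \<exists>C>0. \<forall>\<epsilon>. 0 < \<epsilon> \<and> \<epsilon> < 1 \<longrightarrow>
        (let S = (\<Sum>j=1..m-1. \<epsilon> powr (- real (2 * (\<Sum>i=1..j-1. n i) + n j) / k))
         in c * S \<le> real (tt_storage m (tt_rank n k \<epsilon>)) \<and>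
            real (tt_storage m (tt_rank n k \<epsilon>)) \<le> C * S)"
    unfolding Let_def
  proof (rule exI[of _ "1::real"], rule conjI, simp, rule exI[of _ "4::real"], intro conjI allI impI)
    fix \<epsilon> :: real assume \<epsilon>: "0 < \<epsilon> \<and> \<epsilon> < 1"
    then have \<epsilon>': "0 < \<epsilon>" "\<epsilon> < 1" by auto
    show "1 * (\<Sum>j=1..m-1. \<epsilon> powr (- real (2 * (\<Sum>i=1..j-1. n i) + n j) / k)) \<le> real (tt_storage m (tt_rank n k \<epsilon>))"
      unfolding mult_1 by (rule tt_storage_bounds(1)[OF \<epsilon>' \<open>k > 0\<close> m])
    show "real (tt_storage m (tt_rank n k \<epsilon>)) \<le> 4 * (\<Sum>j=1..m-1. \<epsilon> powr (- real (2 * (\<Sum>i=1..j-1. n i) + n j) / k))"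
      by (rule tt_storage_bounds(2)[OF \<epsilon>' \<open>k > 0\<close> m])
  qed simp_all
  show "\<exists>C>0. \<forall>\<epsilon>. 0 < \<epsilon> \<and> \<epsilon> < 1 \<longrightarrow>
        real (tt_storage m (tt_rank n k \<epsilon>))
          \<le> C * \<epsilon> powr (- ((2 * real m - 1) * real (Max (n ` {1..m-1}))) / k)"
  proof (intro exI[of _ "4 * real (m - 1)"] conjI allI impI)
    show "0 < 4 * real (m - 1)" using m by simp
    fix \<epsilon> :: real assume \<epsilon>: "0 < \<epsilon> \<and> \<epsilon> < 1"
    show "real (tt_storage m (tt_rank n k \<epsilon>))
        \<le> 4 * real (m - 1) * \<epsilon> powr (- ((2 * real m - 1) * real (Max (n ` {1..m-1}))) / k)"
      by (rule tt_storage_bound_max[OF conjunct1[OF \<epsilon>] conjunct2[OF \<epsilon>] \<open>k > 0\<close> m])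
  qed
qed

end
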